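(* For any constant $\epsilon>0$, given a balanced list decodable coding scheme with constant list size that tolerates error rate $1/2 - \epsilon$, there is a (non-adaptive) one-sided unique decoding coding scheme that tolerates error rate $1/3 - 2\epsilon$ and has, up to constant factors, the same round complexity, alphabet size and computational complexity as the given list decodable scheme.
   Context: Interactive coding setting. Coding schemes simulate an $n$-round two-party protocol $\Pi$ (between Alice and Bob) by a protocol $\Pi'$ with $N$ rounds over a constant-size alphabet. In a non-adaptive scheme, which party transmits in a round is fixed in advance, exactly one party per round; an adversary may replace any transmitted symbol arbitrarily (a corruption), and error rate $\rho$ means at most $\rho N$ corruptions. A scheme is balanced if in any execution both parties transmit equally often. One-sided unique decoding: a fixed, a priori known party must, from any execution with at most a $\rho$ fraction of corruptions, output the transcript of the error-free execution of $\Pi$ (the other party need not decode). $s$-list decoding: each party outputs a list of at most $s$ transcripts containing that transcript. Computational complexity counts computation steps over the $N$ rounds, with each oracle access to $\Pi$ counted as one step. *)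

theory Defs
  imports Complex_Main
begin

datatype party = Alice | Bob

section \<open>The protocols that are simulated\<close>

text \<open>
  A deterministic protocol: the speaker of a round depends on the round number only, and
  \<open>next_symbol \<Pi> h\<close> is the symbol sent after the history \<open>h\<close> by the party whose turn it is.
  The private inputs are part of \<open>next_symbol\<close>: a party can evaluate this function only at
  histories where it has to speak (see \<open>oracle_of\<close>).
\<close>

record protocol =
  speaker :: "nat \<Rightarrow> party"
  next_symbol :: "nat list \<Rightarrow> nat"

definition protocols :: "nat \<Rightarrow> protocol set" where
  "protocols \<sigma> = {\<Pi>. \<forall>h. next_symbol \<Pi> h < \<sigma>}"

primrec transcript :: "protocol \<Rightarrow> nat \<Rightarrow> nat list" where
  "transcript \<Pi> 0 = []"
| "transcript \<Pi> (Suc k) = transcript \<Pi> k @ [next_symbol \<Pi> (transcript \<Pi> k)]"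

definition transcripts :: "nat \<Rightarrow> nat \<Rightarrow> nat list set" where
  "transcripts \<sigma> n = {t. length t = n \<and> set t \<subseteq> {..<\<sigma>}}"

text \<open>Party \<open>P\<close>'s access to the \<open>n\<close>-round protocol \<open>\<Pi>\<close>: 0 means ``listen (or finished)'',
  \<open>Suc x\<close> means ``send \<open>x\<close>''.\<close>

definition oracle_of :: "protocol \<Rightarrow> nat \<Rightarrow> party \<Rightarrow> nat list \<Rightarrow> nat" where
  "oracle_of \<Pi> n P h =
     (if length h < n \<and> speaker \<Pi> (length h) = P then Suc (next_symbol \<Pi> h) else 0)"

section \<open>The machine of one party: a random access machine with oracle and channel\<close>

text \<open>
  The operands are addresses of memory cells, except the constant of \<open>Lit\<close> and the
  jump target of \<open>Jz\<close>. \<open>Ask d a l\<close> queries the oracle at the history stored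
  in the \<open>mem l\<close> consecutive cells starting at address \<open>mem a\<close>.
\<close>

datatype instr =
    Lit nat nat
  | Add nat nat nat
  | Sub nat nat nat
  | Mul nat nat nat
  | Div nat nat nat
  | Load nat nat
  | Store nat nat
  | Jz nat nat
  | Ask nat nat nat
  | Send nat
  | Recv nat
  | Out nat
  | Halt

type_synonym program = "instr list"

text \<open>
  \<open>comm\<close> records the rounds so far: \<open>Some v\<close> if the party transmitted \<open>v\<close>,
  \<open>None\<close> if it listened.
\<close>

record config =
  pc :: nat
  mem :: "nat \<Rightarrow> nat"
  comm :: "nat option list"
  out :: "nat list"

definition halted :: "program \<Rightarrow> config \<Rightarrow> bool" where
  "halted p c \<longleftrightarrow> pc c \<ge> length p \<or> p ! pc c = Halt"

definition assign :: "nat \<Rightarrow> nat \<Rightarrow> config \<Rightarrow> config" where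
  "assign d v c = c\<lparr>pc := Suc (pc c), mem := (mem c)(d := v)\<rparr>"

text \<open>\<open>w i\<close> is the symbol that the channel delivers in round \<open>i\<close>.\<close>

fun exec :: "(nat list \<Rightarrow> nat) \<Rightarrow> (nat \<Rightarrow> nat) \<Rightarrow> instr \<Rightarrow> config \<Rightarrow> config" where
  "exec f w (Lit d k) c = assign d k c"
| "exec f w (Add d a b) c = assign d (mem c a + mem c b) c"
| "exec f w (Sub d a b) c = assign d (mem c a - mem c b) c"
| "exec f w (Mul d a b) c = assign d (mem c a * mem c b) c"
| "exec f w (Div d a b) c = assign d (mem c a div mem c b) c"
| "exec f w (Load d a) c = assign d (mem c (mem c a)) c"
| "exec f w (Store a b) c = assign (mem c a) (mem c b) c"
| "exec f w (Jz a l) c = c\<lparr>pc := (if mem c a = 0 then l else Suc (pc c))\<rparr>"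
| "exec f w (Ask d a l) c = assign d (f (map (mem c) [mem c a..<mem c a + mem c l])) c"
| "exec f w (Send a) c = c\<lparr>pc := Suc (pc c), comm := comm c @ [Some (mem c a)]\<rparr>"
| "exec f w (Recv d) c = assign d (w (length (comm c))) (c\<lparr>comm := comm c @ [None]\<rparr>)"
| "exec f w (Out a) c = c\<lparr>pc := Suc (pc c), out := out c @ [mem c a]\<rparr>"
| "exec f w Halt c = c"

definition step :: "program \<Rightarrow> (nat list \<Rightarrow> nat) \<Rightarrow> (nat \<Rightarrow> nat) \<Rightarrow> config \<Rightarrow> config" where
  "step p f w c = (if halted p c then c else exec f w (p ! pc c) c)"

definition initial :: "nat \<Rightarrow> config" where
  "initial n = \<lparr>pc = 0, mem = (\<lambda>a. if a = 0 then n else 0), comm = [], out = []\<rparr>"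

section \<open>Non-adaptive coding schemes\<close>

text \<open>
  A coding scheme is uniform: each party has one program, which is given the length \<open>n\<close> of the
  simulated protocol as its input. The alphabet is \<open>{..<alphabet S}\<close>, independently of \<open>n\<close>,
  and \<open>turn S n i\<close> is the party that transmits in round \<open>i < rounds S n\<close>.
\<close>

record scheme =
  prog :: "party \<Rightarrow> program"
  alphabet :: nat
  rounds :: "nat \<Rightarrow> nat"
  turn :: "nat \<Rightarrow> nat \<Rightarrow> party"

definition words :: "scheme \<Rightarrow> (nat \<Rightarrow> nat) set" where
  "words S = {w. \<forall>i. w i < alphabet S}"

text \<open>
  As the parties are deterministic, an execution is determined by the word \<open>w\<close> of the symbols
  that the adversary lets the listening parties receive. Quantifying over all words covers
  adversaries that choose each corruption depending on everything sent so far.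
\<close>

definition state :: "scheme \<Rightarrow> protocol \<Rightarrow> nat \<Rightarrow> (nat \<Rightarrow> nat) \<Rightarrow> party \<Rightarrow> nat \<Rightarrow> config" where
  "state S \<Pi> n w P t = (step (prog S P) (oracle_of \<Pi> n P) w ^^ t) (initial n)"

definition halts_by :: "scheme \<Rightarrow> protocol \<Rightarrow> nat \<Rightarrow> (nat \<Rightarrow> nat) \<Rightarrow> party \<Rightarrow> nat \<Rightarrow> bool" where
  "halts_by S \<Pi> n w P t \<longleftrightarrow> halted (prog S P) (state S \<Pi> n w P t)"

definition final :: "scheme \<Rightarrow> protocol \<Rightarrow> nat \<Rightarrow> (nat \<Rightarrow> nat) \<Rightarrow> party \<Rightarrow> config" where
  "final S \<Pi> n w P = state S \<Pi> n w P (LEAST t. halts_by S \<Pi> n w P t)"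

definition nonadaptive_scheme :: "nat \<Rightarrow> scheme \<Rightarrow> bool" where
  "nonadaptive_scheme \<sigma> S \<longleftrightarrow>
     (\<forall>n\<ge>1. rounds S n > 0 \<and>
       (\<forall>\<Pi>\<in>protocols \<sigma>. \<forall>w\<in>words S. \<forall>P.
          (\<exists>t. halts_by S \<Pi> n w P t) \<and>
          length (comm (final S \<Pi> n w P)) = rounds S n \<and>
          (\<forall>i<rounds S n.
             if turn S n i = P
             then \<exists>v<alphabet S. comm (final S \<Pi> n w P) ! i = Some v
             else comm (final S \<Pi> n w P) ! i = None)))"

definition balanced :: "scheme \<Rightarrow> bool" where
  "balanced S \<longleftrightarrow>
     (\<forall>n\<ge>1. card {i. i < rounds S n \<and> turn S n i = Alice} =
             card {i. i < rounds S n \<and> turn S n i = Bob})"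

definition corruptions :: "scheme \<Rightarrow> protocol \<Rightarrow> nat \<Rightarrow> (nat \<Rightarrow> nat) \<Rightarrow> nat" where
  "corruptions S \<Pi> n w =
     card {i. i < rounds S n \<and> comm (final S \<Pi> n w (turn S n i)) ! i \<noteq> Some (w i)}"

definition list_decoding :: "nat \<Rightarrow> scheme \<Rightarrow> nat \<Rightarrow> real \<Rightarrow> bool" where
  "list_decoding \<sigma> S s \<rho> \<longleftrightarrow>
     (\<forall>n\<ge>1. \<forall>\<Pi>\<in>protocols \<sigma>. \<forall>w\<in>words S.
        real (corruptions S \<Pi> n w) \<le> \<rho> * real (rounds S n) \<longrightarrow>
        (\<forall>P. \<exists>ts. out (final S \<Pi> n w P) = concat ts \<and> length ts \<le> s \<and>
                  set ts \<subseteq> transcripts \<sigma> n \<and> transcript \<Pi> n \<in> set ts))"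

definition one_sided_unique_decoding :: "nat \<Rightarrow> scheme \<Rightarrow> real \<Rightarrow> bool" where
  "one_sided_unique_decoding \<sigma> S \<rho> \<longleftrightarrow>
     (\<exists>P. \<forall>n\<ge>1. \<forall>\<Pi>\<in>protocols \<sigma>. \<forall>w\<in>words S.
        real (corruptions S \<Pi> n w) \<le> \<rho> * real (rounds S n) \<longrightarrow>
        out (final S \<Pi> n w P) = transcript \<Pi> n)"

text \<open>
  The parties together make at most \<open>T n\<close> steps. The second condition makes unit cost
  per instruction realistic: the machines work with words of \<open>O(log (n + T n))\<close> bits.
\<close>

definition runs_in :: "nat \<Rightarrow> scheme \<Rightarrow> (nat \<Rightarrow> nat) \<Rightarrow> bool" where
  "runs_in \<sigma> S T \<longleftrightarrow>
     (\<exists>c. \<forall>n\<ge>1. \<forall>\<Pi>\<in>protocols \<sigma>. \<forall>w\<in>words S.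
        (\<exists>tA tB. halts_by S \<Pi> n w Alice tA \<and> halts_by S \<Pi> n w Bob tB \<and> tA + tB \<le> T n) \<and>
        (\<forall>P t a. mem (state S \<Pi> n w P t) a \<le> (n + T n + 2) ^ c))"

definition same_up_to :: "nat \<Rightarrow> nat \<Rightarrow> nat \<Rightarrow> bool" where
  "same_up_to K x y \<longleftrightarrow> x \<le> K * y \<and> y \<le> K * x"

end

theory Submission
  imports Defs "HOL-Computational_Algebra.Primes"
begin

text \<open>
  The new scheme runs the given scheme \<open>b\<close> times and then lets Alice talk for half as many rounds. The parties never get
  a unique answer from a run, but each collects the at most \<open>s\<close> candidates of every run, makes them consistent with its own
  input, and superimposes on each symbol it transmits one symbol of an error-correcting code. The encoded message has only
  \<open>O(log n)\<close> bits: positions at which the candidates diverge, and the values of all candidates at these positions.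

  Two candidates of Alice that are consistent with her input diverge where Bob speaks, and two candidates of Bob where Alice
  speaks. Hence if a candidate \<open>x\<close> of Alice and a candidate \<open>y\<close> of Bob agree at all divergence positions of both
  parties, and the true transcript is among the candidates of both, then \<open>y\<close> is the true transcript. So after two runs
  with less than half of the transmissions corrupted, Alice's message identifies the transcript among Bob's candidates.
  Bob list decodes the messages of all pieces, credits each candidate with the agreement of the best message that
  identifies it, and outputs the candidate with the largest total credit. A run that is not list decodable costs the adversary
  about \<open>h\<close> corruptions, as much as destroying Alice's \<open>h\<close> symbols there, so with less than a third of the
  rounds corrupted the true transcript wins.

  The messages are split into base \<open>l\<close> digits, \<open>l^4 > n\<close>, and each digit is encoded by a Hadamard code over a prime
  field, evaluated at \<open>l \<le> h\<close> points and repeated; all of this takes linear time. The programs are written in a small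
  structured language and compiled to machine code.
\<close>

section \<open>Segments of machine programs\<close>

text \<open>Two usable runs are needed: the first puts the transcript into both lists, but Alice
  cannot know where Bob's candidates diverge; in the second Bob's positions reach her up to
  constantly many alternatives. A usable run may leave only a small fraction of its code symbols
  correct, so a piece can only be list decoded, and credits are added up instead of deciding in each
  piece.

  Accounting: with \<open>h\<close> transmissions per party and run there are
  \<open>3 * b * h\<close> rounds, hence fewer than \<open>b * h\<close> corruptions. A piece with
  \<open>c\<close> corruptions adds about \<open>h - 2 * c\<close> or more to the lead of the true
  transcript, which sums to more than 0 over \<open>2 * b\<close> pieces. The first two usable runs
  lose at most \<open>4 * h\<close>; \<epsilon> \<open>* b \<ge> 3\<close> absorbs this.

  A Hadamard code is exponentially long, but messages have \<open>O(log n)\<close> bits. Splitting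
  each value into four digits brings the length down to about the fourth root of \<open>n\<close>,
  so that tables and exhaustive decoding are cheap. The code fits into the rounds because list
  decoding forces linearly many of them.\<close>

definition below :: "nat => config => bool" where
  "below B c \<longleftrightarrow> (\<forall>a. mem c a <= B)"

text \<open>The memory bound is part of the relation because \<open>runs_in\<close> restricts the
  cells in every intermediate configuration and not only at the end.\<close>

definition reaches ::
  "program => (nat list => nat) => (nat => nat) => nat => config => nat => config => bool" where
  "reaches p f w B c t c' \<longleftrightarrow>
     (step p f w ^^ t) c = c' & (\<forall>j\<le>t. below B ((step p f w ^^ j) c))"

lemma reaches_refl: "below B c ==> reaches p f w B c 0 c"
  by (simp add: reaches_def)

lemma reaches_trans:
  assumes "reaches p f w B c t c'" and "reaches p f w B c' u c''"
  shows "reaches p f w B c (t + u) c''"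
proof -
  have *: "(step p f w ^^ (t + j)) c = (step p f w ^^ j) c'" for j
    using assms(1) by (simp add: reaches_def funpow_add add.commute[of t])
  have "below B ((step p f w ^^ j) c)" if "j <= t + u" for j
  proof (cases "j <= t")
    case False
    then obtain i where "j = t + i" by (metis le_iff_add nat_le_linear)
    then show ?thesis using assms(2) that * by (simp add: reaches_def)
  qed (use assms(1) in \<open>simp add: reaches_def\<close>)
  then show ?thesis using assms(2) * by (simp add: reaches_def)
qed

lemma reaches_step:
  assumes "below B c" and "below B (step p f w c)"
  shows "reaches p f w B c 1 (step p f w c)"
  using assms by (auto simp: reaches_def le_Suc_eq)

definition code_at :: "program => nat => instr list => bool" where
  "code_at p k is \<longleftrightarrow> k + length is <= length p & (\<forall>i<length is. p ! (k + i) = is ! i)"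

lemma code_at_Nil: "code_at p k [] \<longleftrightarrow> k <= length p"
  by (simp add: code_at_def)

lemma code_at_Cons:
  "code_at p k (i # is) \<longleftrightarrow> k < length p & p ! k = i & code_at p (Suc k) is"
  by (auto simp: code_at_def less_Suc_eq_0_disj nth_Cons')

lemma code_at_append:
  "code_at p k (is @ js) \<longleftrightarrow> code_at p k is & code_at p (k + length is) js"
proof (induction "is" arbitrary: k)
  case Nil
  then show ?case by (auto simp: code_at_def)
next
  case (Cons i "is")
  then show ?case by (auto simp: code_at_Cons)
qed

lemma code_at_self: "code_at (xs @ is @ ys) (length xs) is"
  by (simp add: code_at_def nth_append)

fun linear :: "instr => bool" where
  "linear (Jz a l) = False"
| "linear Halt = False"
| "linear _ = True"

primrec run :: "(nat list => nat) => (nat => nat) => instr list => config => config" where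
  "run f w [] c = c"
| "run f w (i # is) c = run f w is (exec f w i c)"

primrec run_below :: "(nat list => nat) => (nat => nat) => nat => instr list => config => bool" where
  "run_below f w B [] c \<longleftrightarrow> below B c"
| "run_below f w B (i # is) c \<longleftrightarrow> below B c & run_below f w B is (exec f w i c)"

lemma run_append: "run f w (is @ js) c = run f w js (run f w is c)"
  by (induction "is" arbitrary: c) auto

lemma run_below_below: "run_below f w B is c ==> below B c & below B (run f w is c)"
  by (induction "is" arbitrary: c) auto

lemma run_below_append:
  "run_below f w B (is @ js) c \<longleftrightarrow> run_below f w B is c & run_below f w B js (run f w is c)"
  by (induction "is" arbitrary: c) (auto dest: run_below_below)

lemma exec_linear_pc: "linear i ==> pc (exec f w i c) = Suc (pc c)"
  by (cases i) (auto simp: assign_def)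

lemma run_pc: "list_all linear is ==> pc (run f w is c) = pc c + length is"
  by (induction "is" arbitrary: c) (auto simp: exec_linear_pc)

lemma step_code_at:
  assumes "code_at p (pc c) (i # is)" "i ~= Halt"
  shows "step p f w c = exec f w i c"
  using assms by (auto simp: code_at_Cons step_def halted_def)

lemma reaches_run:
  assumes "code_at p (pc c) is" "list_all linear is" "run_below f w B is c"
  shows "reaches p f w B c (length is) (run f w is c)"
  using assms
proof (induction "is" arbitrary: c)
  case Nil
  then show ?case by (simp add: reaches_refl)
next
  case (Cons i "is")
  have "step p f w c = exec f w i c"
    using Cons.prems step_code_at by (metis linear.simps(2) list.pred_inject(2))
  moreover have "below B (exec f w i c)" "below B c"
    using Cons.prems run_below_below by auto
  moreover have "reaches p f w B (exec f w i c) (length is) (run f w is (exec f w i c))"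
    using Cons by (intro Cons.IH) (auto simp: code_at_Cons exec_linear_pc)
  ultimately show ?case
    using reaches_trans[OF reaches_step[of B c p f w]] by fastforce
qed

lemma below_assign: "below B c ==> v <= B ==> below B (assign d v c)"
  by (simp add: below_def assign_def)

lemma assign_simps [simp]:
  "mem (assign d v c) = (mem c)(d := v)" "pc (assign d v c) = Suc (pc c)"
  "comm (assign d v c) = comm c" "out (assign d v c) = out c"
  by (auto simp: assign_def)

section \<open>A structured language with arrays\<close>

text \<open>
  The store consists of unbounded arrays. \<open>Query\<close> needs the queried history in consecutive
  memory cells, but many unbounded arrays have to share the memory. So every array is cut into
  blocks of length \<open>2 * reg 1\<close>, in two ways that are shifted by \<open>reg 1\<close>: each piece of length at
  most \<open>reg 1\<close> is contiguous in one of the two copies.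
\<close>

datatype bop = Plus | Minus | Times | Divide | Modulo | Minim

datatype expr = Const nat | Reg nat | Cell nat expr | Bin bop expr expr

datatype com =
    Skip
  | Write nat expr expr
  | Query nat nat expr expr
  | Emit expr
  | Accept nat
  | Print expr
  | Seq com com
  | Cond expr com com
  | Loop nat com

record store =
  cells :: "nat => nat => nat"
  chan :: "nat option list"
  printed :: "nat list"

primrec ap :: "bop => nat => nat => nat" where
  "ap Plus a b = a + b"
| "ap Minus a b = a - b"
| "ap Times a b = a * b"
| "ap Divide a b = a div b"
| "ap Modulo a b = a mod b"
| "ap Minim a b = min a b"

primrec eval :: "(nat => nat) => (nat => nat => nat) => expr => nat" where
  "eval e g (Const k) = k"
| "eval e g (Reg j) = e j"
| "eval e g (Cell r a) = g r (eval e g a)"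
| "eval e g (Bin b x y) = ap b (eval e g x) (eval e g y)"

definition put :: "nat => nat => nat => store => store" where
  "put r a v s = s\<lparr>cells := (cells s)(r := (cells s r)(a := v))\<rparr>"

lemma put_simps [simp]:
  "cells (put r a v s) = (cells s)(r := (cells s r)(a := v))"
  "chan (put r a v s) = chan s" "printed (put r a v s) = printed s"
  by (auto simp: put_def)

text \<open>The loop at nesting level \<open>k\<close> keeps its index in register \<open>k\<close>.\<close>

primrec sem :: "(nat list => nat) => (nat => nat) => nat => com => (nat => nat) => store => store" where
  "sem f w k Skip e s = s"
| "sem f w k (Write r x y) e s = put r (eval e (cells s) x) (eval e (cells s) y) s"
| "sem f w k (Query d r x y) e s =
     put d 0 (f (map (cells s r) [eval e (cells s) x..<eval e (cells s) x
       + min (eval e (cells s) y) (e 1)])) s"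
| "sem f w k (Emit x) e s = s\<lparr>chan := chan s @ [Some (eval e (cells s) x)]\<rparr>"
| "sem f w k (Accept d) e s = put d 0 (w (length (chan s))) (s\<lparr>chan := chan s @ [None]\<rparr>)"
| "sem f w k (Print x) e s = s\<lparr>printed := printed s @ [eval e (cells s) x]\<rparr>"
| "sem f w k (Seq c1 c2) e s = sem f w k c2 e (sem f w k c1 e s)"
| "sem f w k (Cond x c1 c2) e s =
     (if eval e (cells s) x ~= 0 then sem f w k c1 e s else sem f w k c2 e s)"
| "sem f w k (Loop p c) e s =
     fold (%j. sem f w (Suc k) c (e(k := j))) [0..<e p] s"

primrec wfe :: "nat => nat => expr => bool" where
  "wfe R k (Const n) = True"
| "wfe R k (Reg j) = (j < k)"
| "wfe R k (Cell r x) = (r < R & wfe R k x)"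
| "wfe R k (Bin b x y) = (wfe R k x & wfe R k y)"

text \<open>Loop bounds are registers below 7, which no command changes. The registers 7 to 11 hold
  loop indices, so loops that start at level 7 nest at most five deep.\<close>

primrec wfc :: "nat => nat => com => bool" where
  "wfc R k Skip = True"
| "wfc R k (Write r x y) = (r < R & wfe R k x & wfe R k y)"
| "wfc R k (Query d r x y) = (d < R & r < R & wfe R k x & wfe R k y)"
| "wfc R k (Emit x) = wfe R k x"
| "wfc R k (Accept d) = (d < R)"
| "wfc R k (Print x) = wfe R k x"
| "wfc R k (Seq c1 c2) = (wfc R k c1 & wfc R k c2)"
| "wfc R k (Cond x c1 c2) = (wfe R k x & wfc R k c1 & wfc R k c2)"
| "wfc R k (Loop p c) = (p < 7 & k < 12 & wfc R (Suc k) c)"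

text \<open>The number of scratch cells that the code of an expression may touch; it is at least 3
  for an operation because \<open>Modulo\<close> uses a third cell. The minimum 5 in
  \<open>depth\<close> covers the address computations in the cells 12 to 16.\<close>

primrec depth_expr :: "expr => nat" where
  "depth_expr (Const k) = 1"
| "depth_expr (Reg j) = 1"
| "depth_expr (Cell r x) = max (depth_expr x) 2"
| "depth_expr (Bin b x y) = max (depth_expr x) (max (Suc (depth_expr y)) 3)"

primrec depth :: "com => nat" where
  "depth Skip = 5"
| "depth (Write r x y) = max (depth_expr x) (max (Suc (depth_expr y)) 5)"
| "depth (Query d r x y) = max (depth_expr x) (max (Suc (depth_expr y)) 5)"
| "depth (Emit x) = max (depth_expr x) 5"
| "depth (Accept d) = 5"
| "depth (Print x) = max (depth_expr x) 5"
| "depth (Seq c1 c2) = max (depth c1) (depth c2)"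
| "depth (Cond x c1 c2) = max (depth_expr x) (max (depth c1) (depth c2))"
| "depth (Loop p c) = depth c"

section \<open>Compilation\<close>

text \<open>
  Cells below 12 hold the registers, the cells from 12 to \<open>D - 1\<close> intermediate results, the
  cells from \<open>D\<close> on the arrays. Registers 1 to 3 hold \<open>m\<close>, \<open>2 * m\<close> and
  \<open>(2 * R - 1) * (2 * m)\<close>, where \<open>R\<close> is the number of arrays.
\<close>

primrec code_op :: "bop => nat => instr list" where
  "code_op Plus t = [Add t t (t+1)]"
| "code_op Minus t = [Sub t t (t+1)]"
| "code_op Times t = [Mul t t (t+1)]"
| "code_op Divide t = [Div t t (t+1)]"
| "code_op Modulo t = [Div (t+2) t (t+1), Mul (t+2) (t+2) (t+1), Sub t t (t+2)]"
| "code_op Minim t = [Sub (t+1) t (t+1), Sub t t (t+1)]"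

definition code_addr :: "nat => nat => nat => instr list" where
  "code_addr D k t =
     [Div (t+1) t 2, Mul (t+1) (t+1) 3, Add t t (t+1), Lit (t+1) k, Mul (t+1) (t+1) 2,
      Add t t (t+1), Lit (t+1) D, Add t t (t+1)]"

primrec code_expr :: "nat => expr => nat => instr list" where
  "code_expr D (Const k) t = [Lit t k]"
| "code_expr D (Reg j) t = [Lit t 0, Add t t j]"
| "code_expr D (Cell r x) t = code_expr D x t @ code_addr D (2 * r) t @ [Load t t]"
| "code_expr D (Bin b x y) t = code_expr D x t @ code_expr D y (t+1) @ code_op b t"

definition code_write :: "nat => nat => instr list" where
  "code_write D r =
     [Lit 14 0, Add 14 14 12] @ code_addr D (2 * r) 14 @ [Store 14 13, Add 12 12 1, Lit 14 0, Add 14 14 12]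
     @ code_addr D (2 * r + 1) 14 @ [Store 14 13]"

text \<open>Subtraction is truncated, so \<open>l - (l - m)\<close> is the minimum of
  \<open>l\<close> and \<open>m\<close>, and subtracting the overflow twice from 1 in the same way
  gives the flag that tells whether the piece leaves its block. Multiplying by the flag selects the
  copy without a jump: it adds \<open>m\<close> to the index and, through cell 16,
  \<open>2 * m\<close> to the address.\<close>

definition code_query :: "nat => nat => instr list" where
  "code_query D r =
     [Sub 14 13 1, Sub 13 13 14,
      Div 14 12 2, Mul 14 14 2, Sub 14 12 14, Add 14 14 13, Sub 14 14 2,
      Lit 15 1, Sub 16 15 14, Sub 15 15 16,
      Mul 14 15 1, Add 12 12 14, Mul 16 15 2] @
     [Lit 14 0, Add 14 14 12] @ code_addr D (2 * r) 14 @
     [Add 14 14 16, Ask 13 14 13, Lit 12 0]"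

primrec len_expr :: "expr => nat" where
  "len_expr (Const k) = 1"
| "len_expr (Reg j) = 2"
| "len_expr (Cell r x) = len_expr x + 9"
| "len_expr (Bin b x y) = len_expr x + len_expr y + length (code_op b 0)"

primrec len :: "com => nat" where
  "len Skip = 0"
| "len (Write r x y) = len_expr x + len_expr y + 23"
| "len (Query d r x y) = len_expr x + len_expr y + 49"
| "len (Emit x) = len_expr x + 1"
| "len (Accept d) = 25"
| "len (Print x) = len_expr x + 1"
| "len (Seq c1 c2) = len c1 + len c2"
| "len (Cond x c1 c2) = len_expr x + 1 + len c1 + 2 + len c2"
| "len (Loop p c) = len c + 7"

text \<open>\<open>k\<close> is the nesting level and \<open>l\<close> the absolute address of the
  segment, as jumps are absolute. The only jump instruction tests a cell for 0, so an unconditional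
  jump clears cell 12 before.\<close>

primrec code :: "nat => nat => nat => com => instr list" where
  "code D k l Skip = []"
| "code D k l (Write r x y) = code_expr D x 12 @ code_expr D y 13 @ code_write D r"
| "code D k l (Query d r x y) =
     code_expr D x 12 @ code_expr D y 13 @ code_query D r @ code_write D d"
| "code D k l (Emit x) = code_expr D x 12 @ [Send 12]"
| "code D k l (Accept d) = [Recv 13, Lit 12 0] @ code_write D d"
| "code D k l (Print x) = code_expr D x 12 @ [Out 12]"
| "code D k l (Seq c1 c2) = code D k l c1 @ code D k (l + len c1) c2"
| "code D k l (Cond x c1 c2) =
     code_expr D x 12 @ [Jz 12 (l + len_expr x + 3 + len c1)]
     @ code D k (l + len_expr x + 1) c1
     @ [Lit 12 0, Jz 12 (l + len_expr x + 3 + len c1 + len c2)]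
     @ code D k (l + len_expr x + 3 + len c1) c2"
| "code D k l (Loop p c) =
     [Lit k 0, Sub 12 p k, Jz 12 (l + len c + 7)] @ code D (Suc k) (l + 3) c
     @ [Lit 12 1, Add k k 12, Lit 12 0, Jz 12 (l + 1)]"

text \<open>Loop bounds sit in registers, so the running time is bounded by a function of the
  registers alone; adding up both branches of a conditional keeps it independent of the
  store.\<close>

primrec cost :: "(nat => nat) => com => nat" where
  "cost e Skip = 0"
| "cost e (Write r x y) = len_expr x + len_expr y + 23"
| "cost e (Query d r x y) = len_expr x + len_expr y + 49"
| "cost e (Emit x) = len_expr x + 1"
| "cost e (Accept d) = 25"
| "cost e (Print x) = len_expr x + 1"
| "cost e (Seq c1 c2) = cost e c1 + cost e c2"
| "cost e (Cond x c1 c2) = len_expr x + 1 + (cost e c1 + 2) + cost e c2"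
| "cost e (Loop p c) = e p * (cost e c + 6) + 3"

lemma length_code_addr: "length (code_addr D k t) = 8"
  by (simp add: code_addr_def)

lemma length_code_write: "length (code_write D r) = 23"
  by (simp add: code_write_def length_code_addr)

lemma length_code_query: "length (code_query D r) = 26"
  by (simp add: code_query_def length_code_addr)

lemma length_code_op: "length (code_op b t) = length (code_op b 0)"
  by (cases b) auto

lemma length_code_expr: "length (code_expr D x t) = len_expr x"
proof (induction x arbitrary: t)
  case (Bin b x y)
  then show ?case using length_code_op[of b t] by simp
qed (auto simp: length_code_addr)

lemma length_code: "length (code D k l c) = len c"
  by (induction c arbitrary: k l)
    (auto simp: length_code_expr length_code_write length_code_query)

lemma linear_code_addr: "list_all linear (code_addr D k t)"
  by (simp add: code_addr_def)

lemma linear_code_op: "list_all linear (code_op b t)"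
  by (cases b) auto

lemma linear_code_expr: "list_all linear (code_expr D x t)"
  by (induction x arbitrary: t) (auto simp: linear_code_addr linear_code_op)

lemma linear_code_write: "list_all linear (code_write D r)"
  by (simp add: code_write_def linear_code_addr)

lemma linear_code_query: "list_all linear (code_query D r)"
  by (simp add: code_query_def linear_code_addr)

section \<open>Layout of the arrays in memory\<close>

definition loc :: "nat => nat => nat => nat => nat => nat" where
  "loc D R m k a = D + (a + a div (2 * m) * ((2 * R - 1) * (2 * m)) + k * (2 * m))"

text \<open>\<open>loc\<close> adds to \<open>a\<close> a gap of \<open>2 * R - 1\<close> foreign
  blocks for each complete block before it, which takes the machine a single division. In mixed
  radix form the address consists of block number, copy number and place in the block; injectivity
  and contiguity are read off from this form.\<close>

lemma loc_eq:
  assumes "k < 2 * R"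
  shows "loc D R m k a = D + ((a div (2 * m) * (2 * R) + k) * (2 * m) + a mod (2 * m))"
proof -
  obtain R' where R': "2 * R = Suc R'" using assms by (cases "2 * R") auto
  define u v where "u = a div (2 * m)" and "v = a mod (2 * m)"
  have "a = u * (2 * m) + v" unfolding u_def v_def by (rule div_mult_mod_eq[symmetric])
  then show ?thesis unfolding loc_def R' u_def[symmetric] v_def[symmetric]
    by (simp add: algebra_simps)
qed

lemma block_div_mod:
  fixes x g i :: nat
  assumes "i < g"
  shows "(x * g + i) div g = x" "(x * g + i) mod g = i"
  using assms by auto

lemma loc_inj:
  assumes "m > 0" "k < 2 * R" "k' < 2 * R" "loc D R m k a = loc D R m k' a'"
  shows "k = k' & a = a'"
proof -
  let ?G = "2 * m"
  have eq: "(a div ?G * (2 * R) + k) * ?G + a mod ?G = (a' div ?G * (2 * R) + k') * ?G + a' mod ?G"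
    using assms by (simp add: loc_eq)
  have G: "a mod ?G < ?G" "a' mod ?G < ?G" using assms by auto
  have 1: "a div ?G * (2 * R) + k = a' div ?G * (2 * R) + k'"
    using arg_cong[OF eq, of "%x. x div ?G"] unfolding block_div_mod[OF G(1)] block_div_mod[OF G(2)] .
  have md: "a mod ?G = a' mod ?G"
    using arg_cong[OF eq, of "%x. x mod ?G"] unfolding block_div_mod[OF G(1)] block_div_mod[OF G(2)] .
  have k: "k = k'"
    using arg_cong[OF 1, of "%x. x mod (2 * R)"] unfolding block_div_mod[OF assms(2)] block_div_mod[OF assms(3)] .
  have dv: "a div ?G = a' div ?G"
    using arg_cong[OF 1, of "%x. x div (2 * R)"] unfolding block_div_mod[OF assms(2)] block_div_mod[OF assms(3)] .
  have "a = a'" using md dv div_mult_mod_eq[of a ?G] div_mult_mod_eq[of a' ?G] by metis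
  then show ?thesis using k by simp
qed

lemma loc_contiguous:
  assumes "k < 2 * R" "a mod (2 * m) + i < 2 * m"
  shows "loc D R m k a + i = loc D R m k (a + i)"
proof -
  have eq: "a + i = a div (2 * m) * (2 * m) + (a mod (2 * m) + i)"
    unfolding add.assoc[symmetric] div_mult_mod_eq ..
  have "(a + i) div (2 * m) = a div (2 * m)" "(a + i) mod (2 * m) = a mod (2 * m) + i"
    by (subst eq, rule block_div_mod[OF assms(2)])+
  then show ?thesis using assms by (simp add: loc_eq)
qed

definition regs_ok :: "nat => (nat => nat) => bool" where
  "regs_ok R e \<longleftrightarrow> e 1 > 0 & e 2 = 2 * e 1 & e 3 = (2 * R - 1) * e 2"

definition holds_regs :: "nat => (nat => nat) => (nat => nat) => bool" where
  "holds_regs k e \<mu> \<longleftrightarrow> (\<forall>j<k. \<mu> j = e j)"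

definition holds_cells :: "nat => nat => nat => (nat => nat => nat) => (nat => nat) => bool" where
  "holds_cells D R m g \<mu> \<longleftrightarrow>
     (\<forall>r<R. \<forall>a. \<mu> (loc D R m (2 * r) a) = g r a & \<mu> (loc D R m (2 * r + 1) (a + m)) = g r a)"

definition represents ::
  "nat => nat => nat => (nat => nat) => store => config => bool" where
  "represents D R k e s c \<longleftrightarrow>
     regs_ok R e & holds_regs k e (mem c) & holds_cells D R (e 1) (cells s) (mem c)
     & comm c = chan s & out c = printed s"

definition values_le :: "nat => nat => (nat => nat) => store => bool" where
  "values_le Z k e s \<longleftrightarrow> (\<forall>j<k. e j <= Z) & (\<forall>r a. cells s r a <= Z)"

text \<open>Bounds the intermediate results of an expression, addresses included, over a store with
  values up to \<open>Z\<close>. What counts is that it is a polynomial in \<open>Z\<close>: this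
  yields the exponent demanded by \<open>runs_in\<close>.\<close>

primrec peak :: "nat => expr => nat => nat" where
  "peak D (Const k) Z = k"
| "peak D (Reg j) Z = Z"
| "peak D (Cell r x) Z = peak D x Z + peak D x Z * Z + (2 * r + 1) * Z + Z + Z + D + 2 * r + 1"
| "peak D (Bin b x y) Z = peak D x Z * peak D y Z + peak D x Z + peak D y Z"

lemma ap_le: "ap b x y <= x * y + x + y"
  by (cases b) (auto simp: trans_le_add1 le_diff_conv
      intro: le_trans[OF div_le_dividend] le_trans[OF mod_less_eq_dividend])

lemma eval_le:
  assumes "wfe R k x" "values_le Z k e s"
  shows "eval e (cells s) x <= peak D x Z"
  using assms
proof (induction x)
  case (Bin b x y)
  have "ap b (eval e (cells s) x) (eval e (cells s) y)
      <= eval e (cells s) x * eval e (cells s) y + eval e (cells s) x + eval e (cells s) y"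
    by (rule ap_le)
  also have "\<dots> <= peak D x Z * peak D y Z + peak D x Z + peak D y Z"
    using Bin by (intro add_mono mult_mono) auto
  finally show ?case by simp
next
  case (Cell r x)
  then have "cells s r (eval e (cells s) x) <= Z" by (simp add: values_le_def)
  then show ?case by simp
qed (auto simp: values_le_def)

text \<open>The cells from \<open>t\<close> to \<open>D - 1\<close> are scratch space; the cells
  below them and the arrays above them survive.\<close>

definition same_below :: "nat => nat => config => config => bool" where
  "same_below t D c c' \<longleftrightarrow>
     (\<forall>a. a < t \<or> D <= a --> mem c' a = mem c a) & comm c' = comm c & out c' = out c"

lemma loc_ge: "D <= loc D R m k a"
  by (simp add: loc_def)

lemma represents_same:
  assumes "represents D R k e s c" "same_below t D c c'" "k <= t"
  shows "represents D R k e s c'"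
  using assms loc_ge unfolding represents_def same_below_def holds_regs_def holds_cells_def
  by simp

lemma run_code_addr:
  assumes r: "mem c 2 = 2 * m" "mem c 3 = (2 * R - 1) * (2 * m)" and t: "3 < t" "t + 2 <= D"
    and "below B c" and z: "mem c 2 <= Z" "mem c 3 <= Z" and a: "mem c t = a"
    and B: "a + a * Z + i * Z + D + i + Z <= B"
  shows "mem (run f w (code_addr D i t) c) t = loc D R m i a"
    and "same_below t D c (run f w (code_addr D i t) c)"
    and "run_below f w B (code_addr D i t) c"
proof -
  show "mem (run f w (code_addr D i t) c) t = loc D R m i a"
    using t a r by (simp add: code_addr_def loc_def)
  show "same_below t D c (run f w (code_addr D i t) c)"
    using t by (auto simp: code_addr_def same_below_def)
  have 1: "a div mem c 2 * mem c 3 <= a * Z" "i * mem c 2 <= i * Z" "a div mem c 2 <= a"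
    using z by (auto intro: mult_le_mono)
  have "a + a div mem c 2 * mem c 3 <= B" "a + a div mem c 2 * mem c 3 + i * mem c 2 <= B"
    "a + a div mem c 2 * mem c 3 + i * mem c 2 + D <= B" "i <= B" "D <= B" "i * mem c 2 <= B"
    "a div mem c 2 * mem c 3 <= B" "a div mem c 2 <= B"
    using 1 B by linarith+
  then show "run_below f w B (code_addr D i t) c"
    using t a \<open>below B c\<close> by (simp add: code_addr_def below_assign)
qed

lemma represents_addr_regs:
  assumes "represents D R k e s c" "3 < k" "values_le Z k e s"
  shows "mem c 2 = 2 * e 1" "mem c 3 = (2 * R - 1) * (2 * e 1)" "mem c 2 <= Z" "mem c 3 <= Z"
proof -
  have *: "mem c 2 = e 2" "mem c 3 = e 3" "e 2 <= Z" "e 3 <= Z" "regs_ok R e"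
    using assms by (auto simp: represents_def holds_regs_def values_le_def)
  then show "mem c 2 = 2 * e 1" "mem c 3 = (2 * R - 1) * (2 * e 1)" "mem c 2 <= Z" "mem c 3 <= Z"
    unfolding regs_ok_def by metis+
qed

lemma run_code_expr:
  assumes "represents D R k e s c" "wfe R k x" "3 < k" "k <= t" "t + depth_expr x <= D"
    and "below B c" "values_le Z k e s" "peak D x Z <= B"
  shows "mem (run f w (code_expr D x t) c) t = eval e (cells s) x
    & same_below t D c (run f w (code_expr D x t) c)
    & run_below f w B (code_expr D x t) c"
  using assms
proof (induction x arbitrary: t c)
  case (Const n)
  then show ?case by (auto simp: same_below_def below_assign)
next
  case (Reg j)
  then have "mem c j = e j" "e j <= B"
    by (auto simp: represents_def holds_regs_def values_le_def)
  with Reg show ?case by (auto simp: same_below_def below_assign)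
next
  case (Cell r x)
  let ?c1 = "run f w (code_expr D x t) c"
  let ?v = "eval e (cells s) x"
  have IH: "mem ?c1 t = ?v" "same_below t D c ?c1" "run_below f w B (code_expr D x t) c"
    using Cell by auto
  have rep: "represents D R k e s ?c1" using Cell.prems IH(2) represents_same by blast
  have v: "?v <= peak D x Z" using eval_le[of R k x Z e s] Cell.prems by simp
  then have "?v * Z <= peak D x Z * Z" by simp
  then have big: "?v + ?v * Z + 2 * r * Z + D + 2 * r + Z <= B"
    using v Cell.prems(8) add_mult_distrib[of "2 * r" 1 Z] unfolding peak.simps by linarith
  let ?c2 = "run f w (code_addr D (2 * r) t) ?c1"
  have b1: "below B ?c1" using IH(3) run_below_below by blast
  have td: "t + 2 <= D" using Cell.prems(5) by simp
  have t3: "3 < t" using Cell.prems by simp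
  note pr = represents_addr_regs[OF rep Cell.prems(3,7)]
  note A = run_code_addr[OF pr(1,2) t3 td b1 pr(3,4) IH(1) big, where f = f and w = w]
  have "represents D R k e s ?c2" using rep A(2) Cell.prems(4) represents_same by blast
  then have ld: "mem ?c2 (mem ?c2 t) = cells s r ?v"
    using A(1) Cell.prems(2) by (simp add: represents_def holds_cells_def)
  have "cells s r ?v <= Z" using Cell.prems(7) by (simp add: values_le_def)
  then have "cells s r ?v <= B" using Cell.prems(8) by simp
  then show ?case
    using A IH ld run_below_below[OF A(3)] Cell.prems(5)
    by (auto simp: run_append run_below_append same_below_def below_assign)
next
  case (Bin b x y)
  let ?c1 = "run f w (code_expr D x t) c"
  have l: "peak D x Z <= B" "peak D y Z <= B" using Bin.prems by auto
  have IH: "mem ?c1 t = eval e (cells s) x" "same_below t D c ?c1" "run_below f w B (code_expr D x t) c"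
    using Bin.IH(1)[OF Bin.prems(1)] Bin.prems l by auto
  have rep: "represents D R k e s ?c1" using Bin.prems IH(2) represents_same by blast
  let ?c2 = "run f w (code_expr D y (t+1)) ?c1"
  have IH2: "mem ?c2 (t+1) = eval e (cells s) y" "same_below (t+1) D ?c1 ?c2"
    "run_below f w B (code_expr D y (t+1)) ?c1"
    using Bin.IH(2)[OF rep] Bin.prems l run_below_below[OF IH(3)] by auto
  have m: "mem ?c2 t = eval e (cells s) x" "mem ?c2 (Suc t) = eval e (cells s) y"
    using IH IH2 by (auto simp: same_below_def)
  have v: "eval e (cells s) x <= peak D x Z" "eval e (cells s) y <= peak D y Z"
    using eval_le[of R k _ Z e s] Bin.prems by auto
  have v': "eval e (cells s) x * eval e (cells s) y + eval e (cells s) x + eval e (cells s) y <= B"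
    using Bin.prems(8) v mult_le_mono[OF v] by simp
  have b2: "below B ?c2" using IH2(3) run_below_below by blast
  have opb: "run_below f w B (code_op b t) ?c2"
  proof (cases b)
    case Modulo
    have "eval e (cells s) x div eval e (cells s) y * eval e (cells s) y <= B"
      using div_times_less_eq_dividend[of "eval e (cells s) x" "eval e (cells s) y"] v' by linarith
    then show ?thesis using m v' b2 Modulo
      by (auto simp: below_assign intro!: below_assign
          intro: le_trans[OF div_le_dividend] le_trans[OF diff_le_self])
  qed (use m v' b2 in \<open>auto intro!: below_assign intro: le_trans[OF div_le_dividend]\<close>)
  have opv: "mem (run f w (code_op b t) ?c2) t = ap b (eval e (cells s) x) (eval e (cells s) y)"
    using m by (cases b) (auto simp: minus_div_mult_eq_mod)
  have ops: "same_below t D ?c2 (run f w (code_op b t) ?c2)"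
    using Bin.prems(5) by (cases b) (auto simp: same_below_def)
  have "same_below t D c (run f w (code_op b t) ?c2)"
    using IH(2) IH2(2) ops by (auto simp: same_below_def)
  then show ?case using IH IH2 opb opv by (auto simp: run_append run_below_append)
qed

lemma holds_cells_write:
  assumes h: "holds_cells D R m g \<mu>" and "m > 0" "r < R"
    and new: "\<And>x. D <= x ==> \<mu>' x = (if x = loc D R m (2 * r) a \<or> x = loc D R m (2 * r + 1) (a + m) then v else \<mu> x)"
  shows "holds_cells D R m (g(r := (g r)(a := v))) \<mu>'"
  unfolding holds_cells_def
proof (intro allI impI conjI)
  fix r' a' assume r': "r' < R"
  have k: "2 * r < 2 * R" "2 * r + 1 < 2 * R" "2 * r' < 2 * R" "2 * r' + 1 < 2 * R"
    using assms(3) r' by auto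
  have ne: "2 * r' ~= 2 * r + 1" "2 * r' + 1 ~= 2 * r" by presburger+
  have 1: "loc D R m (2 * r') a' = loc D R m (2 * r) a \<longleftrightarrow> r' = r & a' = a"
    using loc_inj[OF \<open>m > 0\<close> k(3) k(1), of D a' a] by auto
  have 2: "loc D R m (2 * r') a' ~= loc D R m (2 * r + 1) (a + m)"
    using loc_inj[OF \<open>m > 0\<close> k(3) k(2), of D a' "a + m"] ne by blast
  have 3: "loc D R m (2 * r' + 1) (a' + m) ~= loc D R m (2 * r) a"
    using loc_inj[OF \<open>m > 0\<close> k(4) k(1), of D "a' + m" a] ne by blast
  have 4: "loc D R m (2 * r' + 1) (a' + m) = loc D R m (2 * r + 1) (a + m) \<longleftrightarrow> r' = r & a' = a"
    using loc_inj[OF \<open>m > 0\<close> k(4) k(2), of D "a' + m" "a + m"] by auto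
  have old: "\<mu> (loc D R m (2 * r') a') = g r' a'" "\<mu> (loc D R m (2 * r' + 1) (a' + m)) = g r' a'"
    using h r' by (auto simp: holds_cells_def)
  show "\<mu>' (loc D R m (2 * r') a') = (g(r := (g r)(a := v))) r' a'"
    using new[OF loc_ge] 1 2 old by auto
  show "\<mu>' (loc D R m (2 * r' + 1) (a' + m)) = (g(r := (g r)(a := v))) r' a'"
    using new[OF loc_ge] 3 4 old by auto
qed

lemma run_code_write:
  assumes rep: "represents D R k e s c" and k: "3 < k" "k <= 12" and D: "17 <= D" and "r < R"
    and "below B c" and Z: "values_le Z k e s" and a: "mem c 12 = a" and v: "mem c 13 = v"
    and B: "(a + Z) + (a + Z) * Z + (2 * r + 1) * Z + D + (2 * r + 1) + Z <= B" and "v <= B"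
  shows "represents D R k e (put r a v s) (run f w (code_write D r) c)"
    and "run_below f w B (code_write D r) c"
proof -
  let ?m = "e 1"
  have regs: "mem c 1 = ?m" "?m <= Z" "?m > 0"
    using rep k Z by (auto simp: represents_def regs_ok_def holds_regs_def values_le_def)
  define c1 where "c1 = run f w [Lit 14 0, Add 14 14 12] c"
  have s1: "same_below 14 D c c1" and m1: "mem c1 14 = a" "mem c1 13 = v" "mem c1 12 = a"
    and bb1: "run_below f w B [Lit 14 0, Add 14 14 12] c"
    using a v D B \<open>below B c\<close> by (auto simp: c1_def same_below_def below_assign)
  have rep1: "represents D R k e s c1" using represents_same[OF rep s1] k by simp
  have b1: "below B c1" using bb1 run_below_below unfolding c1_def by blast
  have aZ: "a * Z <= (a + Z) * Z" by simp
  have B1: "a + a * Z + 2 * r * Z + D + 2 * r + Z <= B"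
    using B aZ add_mult_distrib[of "2 * r" 1 Z] by linarith
  have D14: "14 + 2 <= D" using D by simp
  have t3: "3 < (14::nat)" by simp
  note pr = represents_addr_regs[OF rep1 k(1) Z]
  define c2 where "c2 = run f w (code_addr D (2 * r) 14) c1"
  note A = run_code_addr[OF pr(1,2) t3 D14 b1 pr(3,4) m1(1) B1, where f = f and w = w, folded c2_def]
  have m2: "mem c2 13 = v" "mem c2 12 = a" "mem c2 1 = ?m"
    using A(2) m1 regs s1 by (auto simp: same_below_def)
  have b2: "below B c2" using A(3) run_below_below unfolding c2_def by blast
  let ?L = "loc D R ?m (2 * r) a"
  have L: "?L >= D" by (rule loc_ge)
  let ?is = "[Store 14 13, Add 12 12 1, Lit 14 0, Add 14 14 12]"
  define c3 where "c3 = run f w ?is c2"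
  have ne: "?L ~= 1" "?L ~= 12" "?L ~= 13" "?L ~= 14" using L D by linarith+
  have c3: "mem c3 = (mem c2)(?L := v, 12 := a + ?m, 14 := a + ?m)"
    "comm c3 = chan s" "out c3 = printed s"
    using m2 A(1,2) ne s1 rep by (auto simp: c3_def fun_eq_iff same_below_def represents_def)
  have m3: "mem c3 14 = a + ?m" "mem c3 13 = v"
    using m2 ne by (simp_all add: c3)
  have am: "a + ?m <= B" using B regs by linarith
  have bb3: "run_below f w B ?is c2"
    using m2 A(1) ne b2 \<open>v <= B\<close> am by (auto simp: below_assign)
  have b3: "below B c3" using bb3 run_below_below unfolding c3_def by blast
  have hi2: "mem c2 x = mem c x" if "D <= x \<or> x < 12" for x
    using that A(2) s1 by (auto simp: same_below_def)
  have regs3: "holds_regs k e (mem c3)"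
    using rep k L D hi2 unfolding c3(1) holds_regs_def represents_def by auto
  define c4 where "c4 = run f w (code_addr D (2 * r + 1) 14) c3"
  have "mem c3 2 = e 2" "mem c3 3 = e 3" "e 2 <= Z" "e 3 <= Z" "regs_ok R e"
    using regs3 rep k Z unfolding holds_regs_def represents_def values_le_def by auto
  then have r3: "mem c3 2 = 2 * ?m" "mem c3 3 = (2 * R - 1) * (2 * ?m)" "mem c3 2 <= Z" "mem c3 3 <= Z"
    unfolding regs_ok_def by metis+
  have "(a + ?m) * Z <= (a + Z) * Z" using regs by simp
  then have B3: "(a + ?m) + (a + ?m) * Z + (2 * r + 1) * Z + D + (2 * r + 1) + Z <= B"
    using B regs by linarith
  note A4 = run_code_addr[OF r3(1,2) t3 D14 b3 r3(3,4) m3(1) B3, where f = f and w = w, folded c4_def]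
  let ?L' = "loc D R ?m (2 * r + 1) (a + ?m)"
  have L': "?L' >= D" by (rule loc_ge)
  define c5 where "c5 = run f w [Store 14 13] c4"
  have m4: "mem c4 13 = v" using A4(2) m3(2) by (auto simp: same_below_def)
  have m5: "mem c5 = (mem c4)(?L' := v)" "comm c5 = chan s" "out c5 = printed s"
    using m4 A4(1,2) c3 by (auto simp: c5_def same_below_def)
  have eq: "run f w (code_write D r) c = c5"
    unfolding code_write_def run_append c1_def[symmetric] c2_def[symmetric] c3_def[symmetric]
      c4_def[symmetric] c5_def[symmetric] ..
  have m4': "mem c4 x = mem c3 x" if "D <= x \<or> x < 12" for x
    using that A4(2) by (auto simp: same_below_def)
  have hi: "mem c5 x = (if x = ?L \<or> x = ?L' then v else mem c x)" if "D <= x" for x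
    using that m4' hi2 D by (auto simp: m5 c3(1))
  have "holds_cells D R ?m ((cells s)(r := (cells s r)(a := v))) (mem c5)"
    using holds_cells_write[OF _ regs(3) \<open>r < R\<close> hi] rep by (auto simp: represents_def)
  moreover have "holds_regs k e (mem c5)"
    using regs3 m4' k L' D unfolding holds_regs_def m5(1) by auto
  ultimately show "represents D R k e (put r a v s) (run f w (code_write D r) c)"
    unfolding eq represents_def using rep m5 by (auto simp: represents_def)
  have "below B c4" using A4(3) run_below_below unfolding c4_def by blast
  then have "run_below f w B [Store 14 13] c4" using m4 \<open>v <= B\<close> by (auto simp: below_assign)
  then show "run_below f w B (code_write D r) c"
    unfolding code_write_def run_below_append run_append c1_def[symmetric] c2_def[symmetric] c3_def[symmetric]
      c4_def[symmetric] c5_def[symmetric] using bb1 A(3) bb3 A4(3) by blast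
qed

text \<open>The second copy is used exactly if the queried cells do not lie in one block of the first.\<close>

lemma run_code_query:
  assumes rep: "represents D R k e s c" and k: "3 < k" "k <= 12" and D: "17 <= D" and "r < R"
    and "below B c" and Z: "values_le Z k e s" and a: "mem c 12 = a" and l: "mem c 13 = l"
    and B: "(a + Z) + (a + Z) * Z + (2 * r + 1) * Z + D + (2 * r + 1) + Z + l + Z + Z <= B"
    and v: "v = f (map (cells s r) [a..<a + min l (e 1)])" "v <= B"
  shows "mem (run f w (code_query D r) c) 12 = 0" "mem (run f w (code_query D r) c) 13 = v"
    and "same_below 12 D c (run f w (code_query D r) c)"
    and "run_below f w B (code_query D r) c"
proof -
  define m where "m = e 1"
  have ro: "regs_ok R e" using rep by (simp add: represents_def)
  have regs: "mem c 1 = m" "m <= Z" "m > 0"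
    using rep k Z by (auto simp: represents_def regs_ok_def holds_regs_def values_le_def m_def)
  note pr = represents_addr_regs[OF rep k(1) Z, folded m_def]
  define l' where "l' = min l m"
  define x where "x = (if a mod (2 * m) + l' <= 2 * m then 0 else 1 :: nat)"
  let ?is = "[Sub 14 13 1, Sub 13 13 14,
      Div 14 12 2, Mul 14 14 2, Sub 14 12 14, Add 14 14 13, Sub 14 14 2,
      Lit 15 1, Sub 16 15 14, Sub 15 15 16,
      Mul 14 15 1, Add 12 12 14, Mul 16 15 2]"
  define c1 where "c1 = run f w ?is c"
  have lm: "l - (l - m) = l'" by (auto simp: l'_def)
  have md: "a - a div (2 * m) * (2 * m) = a mod (2 * m)" by (rule minus_div_mult_eq_mod)
  have xx: "1 - (1 - (a mod (2 * m) + l' - 2 * m)) = x" by (auto simp: x_def)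
  have c1: "mem c1 12 = a + x * m" "mem c1 13 = l'" "mem c1 16 = x * (2 * m)" "same_below 12 D c c1"
    using a l regs pr D by (auto simp: c1_def lm md xx[simplified] same_below_def)
  have xm: "x * m <= Z" "x * (2 * m) <= Z" "x <= 1" using regs pr by (auto simp: x_def)
  have dz: "a div (2 * m) * (2 * m) <= a" "a mod (2 * m) <= a" "l' <= l" by (auto simp: l'_def)
  have bb1: "run_below f w B ?is c"
  proof -
    have "l - m <= B" "l' <= B" "a div (2 * m) <= B" "a div (2 * m) * (2 * m) <= B" "a mod (2 * m) <= B"
      "a mod (2 * m) + l' <= B" "a mod (2 * m) + l' - 2 * m <= B" "1 <= B"
      "1 - (a mod (2 * m) + l' - 2 * m) <= B" "x <= B" "x * m <= B" "a + x * m <= B" "x * (2 * m) <= B"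
      using B xm dz div_le_dividend[of a "2 * m"] \<open>17 <= D\<close> by linarith+
    then show ?thesis
      using \<open>below B c\<close> a l regs pr by (simp add: below_assign lm md xx[simplified])
  qed
  define c2 where "c2 = run f w [Lit 14 0, Add 14 14 12] c1"
  have c2: "mem c2 14 = a + x * m" "mem c2 13 = l'" "mem c2 16 = x * (2 * m)" "same_below 12 D c c2"
    using c1 D by (auto simp: c2_def same_below_def)
  have b1: "below B c1" using bb1 run_below_below unfolding c1_def by blast
  have am: "a + x * m <= B" using B xm by linarith
  have bb2: "run_below f w B [Lit 14 0, Add 14 14 12] c1" using b1 c1 am by (auto simp: below_assign)
  have b2: "below B c2" using bb2 run_below_below unfolding c2_def by blast
  have p2: "mem c2 2 = 2 * m" "mem c2 3 = (2 * R - 1) * (2 * m)" "mem c2 2 <= Z" "mem c2 3 <= Z"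
    using pr c2(4) by (auto simp: same_below_def)
  have D14: "14 + 2 <= D" "3 < (14::nat)" using D by auto
  have "(a + x * m) * Z <= (a + Z) * Z" using xm by simp
  then have B2: "(a + x * m) + (a + x * m) * Z + 2 * r * Z + D + 2 * r + Z <= B"
    using B xm add_mult_distrib[of "2 * r" 1 Z] by linarith
  define c3 where "c3 = run f w (code_addr D (2 * r) 14) c2"
  note A = run_code_addr[OF p2(1,2) D14(2,1) b2 p2(3,4) c2(1) B2, where f = f and w = w, folded c3_def]
  have b3: "below B c3" using A(3) run_below_below unfolding c3_def by blast
  have "mem c3 16 = x * (2 * m)"
    using c2(3) unfolding c3_def code_addr_def by simp
  then have c3: "mem c3 16 = x * (2 * m)" "mem c3 13 = l'" "same_below 12 D c c3"
    using c2 A(2) by (auto simp: same_below_def)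
  have adr: "loc D R m (2 * r) (a + x * m) + x * (2 * m) = loc D R m (2 * r + x) (a + x * m)"
    by (simp add: loc_def algebra_simps)
  have rep3: "represents D R k e s c3" using represents_same[OF rep c3(3)] k by simp
  have k2: "2 * r + x < 2 * R" using \<open>r < R\<close> xm by linarith
  \<comment> \<open>A piece of length at most \<open>m\<close> that overflows its block starts in
    the upper half of it. Shifted by \<open>m\<close> it starts in the lower half of the next block
    and fits there.\<close>
  have fits: "(a + x * m) mod (2 * m) + i < 2 * m" if "i < l'" for i
  proof (cases "x = 0")
    case True
    then show ?thesis using that by (auto simp: x_def split: if_splits)
  next
    case False
    then have x1: "x = 1" and gt: "a mod (2 * m) + l' > 2 * m" by (auto simp: x_def split: if_splits)
    have lm': "l' <= m" by (simp add: l'_def)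
    have lt: "a mod (2 * m) < 2 * m" using regs by simp
    have "a + m = (a div (2 * m) + 1) * (2 * m) + (a mod (2 * m) - m)"
      using div_mult_mod_eq[of a "2 * m"] gt lm' by (simp add: algebra_simps)
    then have "(a + m) mod (2 * m) = a mod (2 * m) - m"
      using block_div_mod(2)[of "a mod (2 * m) - m" "2 * m"] lt by (metis less_imp_diff_less)
    then have "(a + x * m) mod (2 * m) = a mod (2 * m) - m" using x1 by simp
    then show ?thesis using that lm' lt gt by linarith
  qed
  have cell: "mem c3 (loc D R m (2 * r + x) (a + x * m) + i) = cells s r (a + i)" if "i < l'" for i
  proof -
    have "loc D R m (2 * r + x) (a + x * m) + i = loc D R m (2 * r + x) (a + x * m + i)"
      using loc_contiguous[OF k2 fits[OF that]] .
    also have "\<dots> = loc D R m (2 * r + x) (a + i + x * m)" by (simp add: add_ac)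
    finally show ?thesis using rep3 \<open>r < R\<close> unfolding represents_def holds_cells_def m_def[symmetric]
      by (cases "x = 0") (auto simp: x_def split: if_splits)
  qed
  let ?js = "[Add 14 14 16, Ask 13 14 13, Lit 12 0]"
  define L where "L = loc D R m (2 * r + x) (a + x * m)"
  have mp: "map (mem c3) [L..<L + l'] = map (cells s r) [a..<a + l']"
    by (rule nth_equalityI) (use cell in \<open>auto simp: L_def\<close>)
  have "map ((mem c3)(14 := L)) [L..<L + l'] = map (mem c3) [L..<L + l']"
    using loc_ge[of D R m "2 * r + x" "a + x * m"] D by (auto simp: L_def)
  then have ask: "f (map ((mem c3)(14 := L)) [L..<L + l']) = v"
    using mp v(1) unfolding l'_def m_def by (simp only:)
  have m14: "mem c3 14 + x * (2 * m) = L" using A(1) adr by (simp add: L_def)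
  have eq: "run f w (code_query D r) c = run f w ?js c3"
    unfolding code_query_def run_append c1_def[symmetric] c2_def[symmetric] c3_def[symmetric] ..
  have c4: "mem (run f w ?js c3) = (mem c3)(14 := L, 13 := v, 12 := 0)"
    "comm (run f w ?js c3) = comm c3" "out (run f w ?js c3) = out c3"
    using m14 c3 ask by (auto simp: fun_eq_iff)
  show "mem (run f w (code_query D r) c) 12 = 0" "mem (run f w (code_query D r) c) 13 = v"
    by (auto simp: eq c4 simp del: run.simps)
  show "same_below 12 D c (run f w (code_query D r) c)"
    using c3(3) D unfolding eq same_below_def c4 by auto
  have "L <= B"
  proof -
    have 1: "(a + x * m) div (2 * m) * ((2 * R - 1) * (2 * m)) <= (a + x * m) * Z"
      using p2 by (intro mult_le_mono) auto
    have 2: "(2 * r + x) * (2 * m) <= (2 * r + 1) * Z"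
      using p2 xm by (intro mult_le_mono) auto
    have 3: "(a + x * m) * Z <= (a + Z) * Z" using xm by simp
    show ?thesis unfolding L_def loc_def using 1 2 3 B xm by linarith
  qed
  then have bb3: "run_below f w B ?js c3"
    using b3 m14 c3 ask v(2) by (auto simp: below_assign)
  show "run_below f w B (code_query D r) c"
    unfolding code_query_def run_below_append run_append c1_def[symmetric] c2_def[symmetric] c3_def[symmetric]
    using bb1 bb2 A(3) bb3 by blast
qed

primrec writes_le ::
  "(nat list => nat) => (nat => nat) => nat => nat => com => (nat => nat) => store => bool" where
  "writes_le f w Z k Skip e s = True"
| "writes_le f w Z k (Write r x y) e s = (eval e (cells s) y <= Z)"
| "writes_le f w Z k (Query d r x y) e s =
     (f (map (cells s r) [eval e (cells s) x..<eval e (cells s) x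
       + min (eval e (cells s) y) (e 1)]) <= Z)"
| "writes_le f w Z k (Emit x) e s = True"
| "writes_le f w Z k (Accept d) e s = (w (length (chan s)) <= Z)"
| "writes_le f w Z k (Print x) e s = True"
| "writes_le f w Z k (Seq c1 c2) e s =
     (writes_le f w Z k c1 e s & writes_le f w Z k c2 e (sem f w k c1 e s))"
| "writes_le f w Z k (Cond x c1 c2) e s =
     (if eval e (cells s) x ~= 0 then writes_le f w Z k c1 e s else writes_le f w Z k c2 e s)"
| "writes_le f w Z k (Loop p c) e s =
     (\<forall>j<e p. writes_le f w Z (Suc k) c (e(k := j))
        (fold (%j. sem f w (Suc k) c (e(k := j))) [0..<j] s))"

definition peak_addr :: "nat => nat => nat => nat => nat" where
  "peak_addr D r a Z = (a + Z) + (a + Z) * Z + (2 * r + 1) * Z + D + (2 * r + 1) + Z"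

primrec peak_com :: "nat => com => nat => nat" where
  "peak_com D Skip Z = 0"
| "peak_com D (Write r x y) Z = peak_addr D r (peak D x Z) Z + peak D x Z + peak D y Z"
| "peak_com D (Query d r x y) Z =
     peak_addr D r (peak D x Z) Z + peak D x Z + peak D y Z + Z + Z + peak_addr D d 0 Z"
| "peak_com D (Emit x) Z = peak D x Z"
| "peak_com D (Accept d) Z = peak_addr D d 0 Z"
| "peak_com D (Print x) Z = peak D x Z"
| "peak_com D (Seq c1 c2) Z = peak_com D c1 Z + peak_com D c2 Z"
| "peak_com D (Cond x c1 c2) Z = peak D x Z + peak_com D c1 Z + peak_com D c2 Z"
| "peak_com D (Loop p c) Z = peak_com D c Z + 1"

lemma peak_addr_mono: "a <= b ==> peak_addr D r a Z <= peak_addr D r b Z"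
  by (auto simp: peak_addr_def intro!: add_mono mult_le_mono)

lemma cost_upd: "wfc R l c ==> 7 <= k ==> cost (e(k := j)) c = cost e c"
  by (induction c arbitrary: l) auto

text \<open>Compilation is correct, within the time \<open>cost\<close> and with all cells at most
  \<open>B\<close>. Commands without control flow are single runs of linear code. Values written
  into the store stay below \<open>Z\<close> by \<open>writes_le\<close>, so that \<open>Z\<close>
  serves throughout the induction and all other cell contents are bounded through
  \<open>peak_com\<close>.\<close>

lemma reaches_code:
  assumes "code_at p (pc cf) (code D k (pc cf) c)" "represents D R k e s cf"
    and "7 <= k" "k <= 12" "wfc R k c" "12 + depth c <= D" "below B cf" "values_le Z k e s"
    and "writes_le f w Z k c e s" "peak_com D c Z <= B" "Z <= B"
  shows "\<exists>t cf'. t <= cost e c & reaches p f w B cf t cf' & pc cf' = pc cf + len c &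
    represents D R k e (sem f w k c e s) cf' & values_le Z k e (sem f w k c e s)"
  using assms
proof (induction c arbitrary: k e s cf)
  case Skip
  then show ?case by (auto intro!: exI[of _ 0] exI[of _ cf] reaches_refl)
next
  case (Write r x y)
  let ?is1 = "code_expr D x 12" let ?is2 = "code_expr D y 13" let ?is3 = "code_write D r"
  let ?a = "eval e (cells s) x" and ?v = "eval e (cells s) y"
  have k: "3 < k" "k <= 12" "k <= 13" using Write.prems by auto
  have wf: "wfe R k x" "wfe R k y" "r < R" using Write.prems by auto
  have dD: "12 + depth_expr x <= D" "13 + depth_expr y <= D" "17 <= D" using Write.prems by auto
  have pk: "peak D x Z <= B" "peak D y Z <= B" using Write.prems by auto
  note E1 = run_code_expr[OF Write.prems(2) wf(1) k(1,2) dD(1) Write.prems(7,8) pk(1), where f = f and w = w]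
  define c1 where "c1 = run f w ?is1 cf"
  have rep1: "represents D R k e s c1" using represents_same[OF Write.prems(2)] E1 k unfolding c1_def by blast
  have b1: "below B c1" using E1 run_below_below unfolding c1_def by blast
  note E2 = run_code_expr[OF rep1 wf(2) k(1,3) dD(2) b1 Write.prems(8) pk(2), where f = f and w = w]
  define c2 where "c2 = run f w ?is2 c1"
  have rep2: "represents D R k e s c2" using represents_same[OF rep1] E2 k unfolding c2_def by blast
  have b2: "below B c2" using E2 run_below_below unfolding c2_def by blast
  have m2: "mem c2 12 = ?a" "mem c2 13 = ?v"
    using E1 E2 unfolding c2_def[symmetric] c1_def[symmetric] by (auto simp: same_below_def)
  have av: "?a <= peak D x Z" "?v <= B" using eval_le[OF wf(1) Write.prems(8)] Write.prems(9,11) by auto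
  have B: "peak_addr D r ?a Z <= B" using peak_addr_mono[OF av(1), of D r Z] Write.prems(10) by simp
  note E3 = run_code_write[OF rep2 k(1,2) dD(3) wf(3) b2 Write.prems(8) m2 B[unfolded peak_addr_def] av(2), where f = f and w = w]
  define is' where "is' = ?is1 @ ?is2 @ ?is3"
  have rb: "run_below f w B is' cf"
    unfolding is'_def run_below_append c1_def[symmetric] run_append c2_def[symmetric]
    using E1 E2 E3 by (auto simp: c1_def c2_def)
  have lin: "list_all linear is'"
    unfolding is'_def by (simp add: linear_code_expr linear_code_write)
  have re: "run f w is' cf = run f w ?is3 c2" by (simp add: is'_def run_append c1_def c2_def)
  have "reaches p f w B cf (length is') (run f w is' cf)"
    using reaches_run[OF _ lin rb] Write.prems(1) by (simp add: is'_def)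
  moreover have "length is' = len (Write r x y)" by (simp add: is'_def length_code_expr length_code_write)
  moreover have "values_le Z k e (put r ?a ?v s)" using Write.prems(8,9) by (auto simp: values_le_def)
  ultimately show ?case using E3(1) re run_pc[OF lin, of f w cf]
    by (intro exI[of _ "length is'"] exI[of _ "run f w is' cf"]) auto
next
  case (Query d r x y)
  let ?is1 = "code_expr D x 12" let ?is2 = "code_expr D y 13" let ?is3 = "code_query D r"
  let ?is4 = "code_write D d"
  let ?a = "eval e (cells s) x" and ?l = "eval e (cells s) y"
  define v where "v = f (map (cells s r) [?a..<?a + min ?l (e 1)])"
  have k: "3 < k" "k <= 12" "k <= 13" using Query.prems by auto
  have wf: "wfe R k x" "wfe R k y" "r < R" "d < R" using Query.prems by auto
  have dD: "12 + depth_expr x <= D" "13 + depth_expr y <= D" "17 <= D" using Query.prems by auto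
  have pk: "peak D x Z <= B" "peak D y Z <= B" using Query.prems by auto
  note E1 = run_code_expr[OF Query.prems(2) wf(1) k(1,2) dD(1) Query.prems(7,8) pk(1), where f = f and w = w]
  define c1 where "c1 = run f w ?is1 cf"
  have rep1: "represents D R k e s c1" using represents_same[OF Query.prems(2)] E1 k unfolding c1_def by blast
  have b1: "below B c1" using E1 run_below_below unfolding c1_def by blast
  note E2 = run_code_expr[OF rep1 wf(2) k(1,3) dD(2) b1 Query.prems(8) pk(2), where f = f and w = w]
  define c2 where "c2 = run f w ?is2 c1"
  have rep2: "represents D R k e s c2" using represents_same[OF rep1] E2 k unfolding c2_def by blast
  have b2: "below B c2" using E2 run_below_below unfolding c2_def by blast
  have m2: "mem c2 12 = ?a" "mem c2 13 = ?l"
    using E1 E2 unfolding c2_def[symmetric] c1_def[symmetric] by (auto simp: same_below_def)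
  have av: "?a <= peak D x Z" "?l <= peak D y Z" "v <= Z" "v <= B"
    using eval_le[OF wf(1) Query.prems(8)] eval_le[OF wf(2) Query.prems(8)] Query.prems(9,11) by (auto simp: v_def)
  have B: "peak_addr D r ?a Z + ?l + Z + Z <= B"
    using peak_addr_mono[OF av(1), of D r Z] Query.prems(10) av(2) by simp
  note E3 = run_code_query[where f = f and w = w, OF rep2 k(1,2) dD(3) wf(3) b2 Query.prems(8) m2 B[unfolded peak_addr_def] v_def av(4)]
  define c3 where "c3 = run f w ?is3 c2"
  have rep3: "represents D R k e s c3" using represents_same[OF rep2 E3(3)] k unfolding c3_def by blast
  have b3: "below B c3" using E3 run_below_below unfolding c3_def by blast
  have m3: "mem c3 12 = 0" "mem c3 13 = v" using E3 by (auto simp: c3_def)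
  have B': "peak_addr D d 0 Z <= B" using Query.prems(10) by simp
  note E4 = run_code_write[OF rep3 k(1,2) dD(3) wf(4) b3 Query.prems(8) m3 B'[unfolded peak_addr_def] av(4), where f = f and w = w]
  define is' where "is' = ?is1 @ ?is2 @ ?is3 @ ?is4"
  have rb: "run_below f w B is' cf"
    unfolding is'_def run_below_append c1_def[symmetric] run_append c2_def[symmetric] c3_def[symmetric]
    using E1 E2 E3 E4 by (auto simp: c1_def c2_def c3_def)
  have lin: "list_all linear is'"
    unfolding is'_def by (simp add: linear_code_expr linear_code_write linear_code_query)
  have re: "run f w is' cf = run f w ?is4 c3" by (simp add: is'_def run_append c1_def c2_def c3_def)
  have "reaches p f w B cf (length is') (run f w is' cf)"
    using reaches_run[OF _ lin rb] Query.prems(1) by (simp add: is'_def)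
  moreover have "length is' = len (Query d r x y)"
    by (simp add: is'_def length_code_expr length_code_write length_code_query)
  moreover have "values_le Z k e (put d 0 v s)" using Query.prems(8) av by (auto simp: values_le_def)
  ultimately show ?case using E4(1) re run_pc[OF lin, of f w cf] unfolding sem.simps v_def[symmetric]
    by (intro exI[of _ "length is'"] exI[of _ "run f w is' cf"]) auto
next
  case (Emit x)
  have k: "3 < k" "k <= 12" and wf: "wfe R k x" and dD: "12 + depth_expr x <= D" "17 <= D"
    and pk: "peak D x Z <= B" using Emit.prems by auto
  note E1 = run_code_expr[OF Emit.prems(2) wf k dD(1) Emit.prems(7,8) pk, where f = f and w = w]
  define c1 where "c1 = run f w (code_expr D x 12) cf"
  have rep1: "represents D R k e s c1" using represents_same[OF Emit.prems(2)] E1 k unfolding c1_def by blast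
  have b1: "below B c1" using E1 run_below_below unfolding c1_def by blast
  define is' where "is' = code_expr D x 12 @ [Send 12]"
  have rb: "run_below f w B is' cf"
    using E1 b1 unfolding is'_def run_below_append c1_def[symmetric] by (auto simp: below_def)
  have lin: "list_all linear is'" unfolding is'_def by (simp add: linear_code_expr)
  have "reaches p f w B cf (length is') (run f w is' cf)"
    using reaches_run[OF _ lin rb] Emit.prems(1) by (simp add: is'_def)
  moreover have "length is' = len (Emit x)" by (simp add: is'_def length_code_expr)
  moreover have "represents D R k e (sem f w k (Emit x) e s) (run f w is' cf)"
    using rep1 E1 unfolding is'_def run_append c1_def[symmetric] by (auto simp: represents_def)
  ultimately show ?case using run_pc[OF lin, of f w cf] Emit.prems(8)
    by (intro exI[of _ "length is'"] exI[of _ "run f w is' cf"]) (auto simp: values_le_def)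
next
  case (Print x)
  have k: "3 < k" "k <= 12" and wf: "wfe R k x" and dD: "12 + depth_expr x <= D" "17 <= D"
    and pk: "peak D x Z <= B" using Print.prems by auto
  note E1 = run_code_expr[OF Print.prems(2) wf k dD(1) Print.prems(7,8) pk, where f = f and w = w]
  define c1 where "c1 = run f w (code_expr D x 12) cf"
  have rep1: "represents D R k e s c1" using represents_same[OF Print.prems(2)] E1 k unfolding c1_def by blast
  have b1: "below B c1" using E1 run_below_below unfolding c1_def by blast
  define is' where "is' = code_expr D x 12 @ [Out 12]"
  have rb: "run_below f w B is' cf"
    using E1 b1 unfolding is'_def run_below_append c1_def[symmetric] by (auto simp: below_def)
  have lin: "list_all linear is'" unfolding is'_def by (simp add: linear_code_expr)
  have "reaches p f w B cf (length is') (run f w is' cf)"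
    using reaches_run[OF _ lin rb] Print.prems(1) by (simp add: is'_def)
  moreover have "length is' = len (Print x)" by (simp add: is'_def length_code_expr)
  moreover have "represents D R k e (sem f w k (Print x) e s) (run f w is' cf)"
    using rep1 E1 unfolding is'_def run_append c1_def[symmetric] by (auto simp: represents_def)
  ultimately show ?case using run_pc[OF lin, of f w cf] Print.prems(8)
    by (intro exI[of _ "length is'"] exI[of _ "run f w is' cf"]) (auto simp: values_le_def)
next
  case (Accept d)
  have k: "3 < k" "k <= 12" and dr: "d < R" and dD: "17 <= D" using Accept.prems by auto
  define v where "v = w (length (chan s))"
  have v: "v <= Z" "v <= B" using Accept.prems(9,11) by (auto simp: v_def)
  have cm: "comm cf = chan s" using Accept.prems(2) by (simp add: represents_def)
  let ?s = "s\<lparr>chan := chan s @ [None]\<rparr>"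
  define c1 where "c1 = run f w [Recv 13, Lit 12 0] cf"
  have c1: "mem c1 = (mem cf)(13 := v, 12 := 0)" "comm c1 = chan s @ [None]" "out c1 = out cf"
    by (auto simp: c1_def v_def cm)
  have ne: "loc D R (e 1) i a ~= 12" "loc D R (e 1) i a ~= 13" for i a
    using loc_ge[of D R "e 1" i a] dD by linarith+
  have rep1: "represents D R k e ?s c1"
    using Accept.prems(2) k unfolding represents_def c1 holds_regs_def holds_cells_def
    by (simp add: ne[simplified])
  have rb1: "run_below f w B [Recv 13, Lit 12 0] cf"
    using Accept.prems(7) v cm by (auto simp: below_def v_def)
  have b1: "below B c1" using rb1 run_below_below unfolding c1_def by blast
  have Z: "values_le Z k e ?s" using Accept.prems(8) by (simp add: values_le_def)
  have m1: "mem c1 12 = 0" "mem c1 13 = v" by (auto simp: c1)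
  have B': "peak_addr D d 0 Z <= B" using Accept.prems(10) by simp
  note E4 = run_code_write[OF rep1 k dD dr b1 Z m1 B'[unfolded peak_addr_def] v(2), where f = f and w = w]
  define is' where "is' = [Recv 13, Lit 12 0] @ code_write D d"
  have rb: "run_below f w B is' cf"
    unfolding is'_def run_below_append c1_def[symmetric] using rb1 E4 by blast
  have lin: "list_all linear is'" unfolding is'_def by (simp add: linear_code_write)
  have "reaches p f w B cf (length is') (run f w is' cf)"
    using reaches_run[OF _ lin rb] Accept.prems(1) by (simp add: is'_def)
  moreover have "length is' = len (Accept d)" by (simp add: is'_def length_code_write)
  moreover have "run f w is' cf = run f w (code_write D d) c1" unfolding is'_def run_append c1_def ..
  moreover have "values_le Z k e (put d 0 v ?s)" using Z v by (auto simp: values_le_def)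
  ultimately show ?case using E4(1) run_pc[OF lin, of f w cf] unfolding sem.simps v_def[symmetric]
    by (intro exI[of _ "length is'"] exI[of _ "run f w is' cf"]) auto
next
  case (Seq c1 c2)
  have dD: "12 + depth c1 <= D" "12 + depth c2 <= D" using Seq.prems by auto
  obtain t1 cf1 where 1: "t1 <= cost e c1" "reaches p f w B cf t1 cf1" "pc cf1 = pc cf + len c1"
    "represents D R k e (sem f w k c1 e s) cf1" "values_le Z k e (sem f w k c1 e s)"
    using Seq.IH(1)[of cf k e s] Seq.prems dD by (auto simp: code_at_append)
  have b1: "below B cf1" using 1(2) by (auto simp: reaches_def)
  obtain t2 cf2 where 2: "t2 <= cost e c2" "reaches p f w B cf1 t2 cf2" "pc cf2 = pc cf1 + len c2"
    "represents D R k e (sem f w k c2 e (sem f w k c1 e s)) cf2"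
    "values_le Z k e (sem f w k c2 e (sem f w k c1 e s))"
    using Seq.IH(2)[of cf1 k e "sem f w k c1 e s"] Seq.prems 1 b1 dD by (auto simp: code_at_append length_code)
  show ?case
    using 1 2 reaches_trans[OF 1(2) 2(2)]
    by (intro exI[of _ "t1 + t2"] exI[of _ cf2]) auto
next
  case (Cond x c1 c2)
  have "5 <= depth c1" by (induction c1) auto
  then have k: "3 < k" "k <= 12" and wf: "wfe R k x" and dD: "12 + depth_expr x <= D" "17 <= D"
    "12 + depth c1 <= D" "12 + depth c2 <= D" and pk: "peak D x Z <= B"
    using Cond.prems by auto
  note E1 = run_code_expr[OF Cond.prems(2) wf k dD(1) Cond.prems(7,8) pk, where f = f and w = w]
  define cf1 where "cf1 = run f w (code_expr D x 12) cf"
  have rep1: "represents D R k e s cf1" using represents_same[OF Cond.prems(2)] E1 k unfolding cf1_def by blast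
  have b1: "below B cf1" using E1 run_below_below unfolding cf1_def by blast
  have pc1: "pc cf1 = pc cf + len_expr x"
    using run_pc[OF linear_code_expr] by (simp add: cf1_def length_code_expr)
  have r1: "reaches p f w B cf (len_expr x) cf1"
    using reaches_run[OF _ linear_code_expr, of p cf D x 12 f w B] E1 Cond.prems(1)
    by (simp add: code_at_append cf1_def length_code_expr)
  let ?else = "pc cf + len_expr x + 3 + len c1"
  have at1: "code_at p (pc cf1) [Jz 12 ?else]" and
    at2: "code_at p (pc cf + len_expr x + 1) (code D k (pc cf + len_expr x + 1) c1)" and
    at3: "code_at p (pc cf + len_expr x + 1 + len c1) [Lit 12 0, Jz 12 (?else + len c2)]" and
    at4: "code_at p ?else (code D k ?else c2)"
    using Cond.prems(1) pc1 unfolding code.simps code_at_append length_code_expr length_code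
    by (auto simp: code_at_Cons add_ac numeral_3_eq_3)
  define cf2 where "cf2 = step p f w cf1"
  have cf2: "cf2 = cf1\<lparr>pc := (if eval e (cells s) x = 0 then ?else else Suc (pc cf1))\<rparr>"
    using step_code_at[OF at1] E1 by (simp add: cf2_def cf1_def[symmetric])
  have b2: "below B cf2" using b1 cf2 by (simp add: below_def)
  have r2: "reaches p f w B cf1 1 cf2" using reaches_step[OF b1] b2 unfolding cf2_def by blast
  have rep2: "represents D R k e s cf2" using rep1 cf2 by (simp add: represents_def)
  show ?case
  proof (cases "eval e (cells s) x = 0")
    case True
    then have pc2: "pc cf2 = ?else" by (simp add: cf2)
    obtain t3 cf3 where 3: "t3 <= cost e c2" "reaches p f w B cf2 t3 cf3" "pc cf3 = pc cf2 + len c2"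
      "represents D R k e (sem f w k c2 e s) cf3" "values_le Z k e (sem f w k c2 e s)"
      using Cond.IH(2)[of cf2 k e s] Cond.prems rep2 b2 pc2 at4 True dD by auto
    show ?thesis
      using 3 True pc2 reaches_trans[OF reaches_trans[OF r1 r2] 3(2)]
      by (intro exI[of _ "len_expr x + 1 + t3"] exI[of _ cf3]) auto
  next
    case False
    then have pc2: "pc cf2 = pc cf + len_expr x + 1" using pc1 by (simp add: cf2)
    obtain t3 cf3 where 3: "t3 <= cost e c1" "reaches p f w B cf2 t3 cf3" "pc cf3 = pc cf2 + len c1"
      "represents D R k e (sem f w k c1 e s) cf3" "values_le Z k e (sem f w k c1 e s)"
      using Cond.IH(1)[of cf2 k e s] Cond.prems rep2 b2 pc2 at2 False dD by auto
    have b3: "below B cf3" using 3(2) by (auto simp: reaches_def)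
    have at3': "code_at p (pc cf3) [Lit 12 0, Jz 12 (?else + len c2)]" using at3 3(3) pc2 by simp
    define cf4 where "cf4 = step p f w cf3"
    have cf4: "cf4 = assign 12 0 cf3" using step_code_at[OF at3'] by (simp add: cf4_def)
    have b4: "below B cf4" using b3 below_assign cf4 by simp
    have r4: "reaches p f w B cf3 1 cf4" using reaches_step[OF b3] b4 unfolding cf4_def by blast
    define cf5 where "cf5 = step p f w cf4"
    have cf5: "cf5 = cf4\<lparr>pc := ?else + len c2\<rparr>"
      using step_code_at[of p cf4 "Jz 12 (?else + len c2)" "[]" f w] at3' 
      by (simp add: cf5_def cf4 code_at_Cons)
    have b5: "below B cf5" using b4 cf5 by (simp add: below_def)
    have r5: "reaches p f w B cf4 1 cf5" using reaches_step[OF b4] b5 unfolding cf5_def by blast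
    have "same_below 12 D cf3 cf5" using dD by (auto simp: cf5 cf4 same_below_def)
    then have "represents D R k e (sem f w k c1 e s) cf5" using represents_same[OF 3(4)] k by blast
    then show ?thesis
      using 3 False reaches_trans[OF reaches_trans[OF reaches_trans[OF reaches_trans[OF r1 r2] 3(2)] r4] r5]
      by (intro exI[of _ "len_expr x + 1 + t3 + 1 + 1"] exI[of _ cf5]) (auto simp: cf5)
  qed
next
  case (Loop q c)
  have k: "3 < k" "7 <= k" "k < 12" and q: "q < 7" and wf: "wfc R (Suc k) c" and dD: "12 + depth c <= D"
    using Loop.prems by auto
  have "5 <= depth c" by (induction c) auto
  then have D: "17 <= D" using dD by simp
  let ?l = "pc cf"
  have at0: "code_at p ?l [Lit k 0]" and at1: "code_at p (?l + 1) [Sub 12 q k, Jz 12 (?l + len c + 7)]" and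
    at2: "code_at p (?l + 3) (code D (Suc k) (?l + 3) c)" and
    at3: "code_at p (?l + 3 + len c) [Lit 12 1, Add k k 12, Lit 12 0, Jz 12 (?l + 1)]"
    using Loop.prems(1) unfolding code.simps code_at_append length_code
    by (auto simp: code_at_Cons code_at_Nil add_ac numeral_3_eq_3)
  let ?S = "%j. fold (%j. sem f w (Suc k) c (e(k := j))) [0..<j] s"
  have B1: "1 <= B" "e q <= Z" using Loop.prems k q by (auto simp: values_le_def)
  \<comment> \<open>The situation at the loop test, after the index has been cleared. Cell
    \<open>k\<close> counts the completed iterations; it lies just outside the \<open>k\<close>
    registers that \<open>represents\<close> inspects.\<close>
  define I where "I j c' \<longleftrightarrow> pc c' = ?l + 1 & below B c' & mem c' k = j & represents D R k e (?S j) c'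
    & values_le Z k e (?S j)" for j c'
  define cf0 where "cf0 = step p f w cf"
  have cf0: "cf0 = assign k 0 cf" using step_code_at[OF at0] by (simp add: cf0_def)
  have b0: "below B cf0" using Loop.prems(7) cf0 below_assign by simp
  have r0: "reaches p f w B cf 1 cf0" using reaches_step[OF Loop.prems(7)] b0 unfolding cf0_def by blast
  have "same_below k D cf cf0" using k D by (auto simp: same_below_def cf0)
  then have I0: "I 0 cf0" using Loop.prems(2,8) b0 represents_same by (auto simp: I_def cf0)
  have head: "\<exists>c2. reaches p f w B c' 2 c2 & pc c2 = (if j = e q then ?l + len c + 7 else ?l + 3)
     & same_below 12 D c' c2 & below B c2" if "I j c'" "j <= e q" for j c'
  proof -
    have at: "code_at p (pc c') [Sub 12 q k, Jz 12 (?l + len c + 7)]" using at1 that by (simp add: I_def)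
    have mq: "mem c' q = e q" using that q k by (auto simp: I_def represents_def holds_regs_def)
    define c1 where "c1 = step p f w c'"
    have c1: "c1 = assign 12 (e q - j) c'" using step_code_at[OF at] that mq by (simp add: c1_def I_def)
    have b1: "below B c1" using that B1 Loop.prems(11) unfolding c1 I_def by (intro below_assign) auto
    have r1: "reaches p f w B c' 1 c1" using reaches_step[of B c'] b1 that unfolding c1_def I_def by blast
    define c2 where "c2 = step p f w c1"
    have c2: "c2 = c1\<lparr>pc := (if e q - j = 0 then ?l + len c + 7 else ?l + 3)\<rparr>"
      using step_code_at[of p c1 "Jz 12 (?l + len c + 7)" "[]" f w] at that
      by (simp add: c2_def c1 code_at_Cons I_def)
    have b2: "below B c2" using b1 c2 by (simp add: below_def)
    have r2: "reaches p f w B c1 1 c2" using reaches_step[OF b1] b2 unfolding c2_def by blast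
    have "same_below 12 D c' c2" using D by (auto simp: c2 c1 same_below_def)
    moreover have "pc c2 = (if j = e q then ?l + len c + 7 else ?l + 3)" using that(2) by (auto simp: c2)
    ultimately show ?thesis using reaches_trans[OF r1 r2] b2 by (intro exI[of _ c2]) (simp add: numeral_2_eq_2)
  qed
  have body: "\<exists>t c'. t <= j * (cost e c + 6) & reaches p f w B cf0 t c' & I j c'" if "j <= e q" for j
    using that
  proof (induction j)
    case 0
    then show ?case using I0 reaches_refl b0 by (intro exI[of _ 0] exI[of _ cf0]) auto
  next
    case (Suc j)
    then obtain t c' where tc: "t <= j * (cost e c + 6)" "reaches p f w B cf0 t c'" "I j c'" by auto
    obtain c2 where c2: "reaches p f w B c' 2 c2" "pc c2 = ?l + 3" "same_below 12 D c' c2" "below B c2"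
      using head[OF tc(3)] Suc.prems by auto
    let ?e = "e(k := j)"
    have rep2: "represents D R (Suc k) ?e (?S j) c2"
      using represents_same[OF _ c2(3)] tc(3) k c2(3)
      by (auto simp: I_def represents_def regs_ok_def holds_regs_def less_Suc_eq same_below_def)
    have v2: "values_le Z (Suc k) ?e (?S j)"
      using tc(3) B1 Suc.prems by (auto simp: I_def values_le_def less_Suc_eq)
    have at2': "code_at p (pc c2) (code D (Suc k) (pc c2) c)" using at2 c2(2) by simp
    have wl: "writes_le f w Z (Suc k) c ?e (?S j)" using Loop.prems(9) Suc.prems by simp
    have k': "7 <= Suc k" "Suc k <= 12" and pk: "peak_com D c Z <= B" using k Loop.prems(10) by auto
    obtain t3 c3 where 3: "t3 <= cost ?e c" "reaches p f w B c2 t3 c3" "pc c3 = pc c2 + len c"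
      "represents D R (Suc k) ?e (sem f w (Suc k) c ?e (?S j)) c3"
      "values_le Z (Suc k) ?e (sem f w (Suc k) c ?e (?S j))"
      using Loop.IH[OF at2' rep2 k' wf dD c2(4) v2 wl pk Loop.prems(11)] by blast
    have b3: "below B c3" using 3(2) by (auto simp: reaches_def)
    have at3': "code_at p (pc c3) [Lit 12 1, Add k k 12, Lit 12 0, Jz 12 (?l + 1)]" using at3 3(3) c2(2) by simp
    have mk: "mem c3 k = j" using 3(4) by (auto simp: represents_def holds_regs_def)
    define c4 where "c4 = run f w [Lit 12 1, Add k k 12, Lit 12 0] c3"
    have c4: "mem c4 = (mem c3)(k := Suc j, 12 := 0)" "pc c4 = ?l + 6 + len c" "comm c4 = comm c3" "out c4 = out c3"
      using k mk 3(3) c2(2) by (auto simp: c4_def fun_eq_iff)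
    have sj: "Suc j <= B" using Suc.prems B1 Loop.prems(11) by simp
    have rb: "run_below f w B [Lit 12 1, Add k k 12, Lit 12 0] c3"
      using b3 sj mk k B1 by (auto simp: below_assign)
    have r4: "reaches p f w B c3 3 c4"
    proof -
      have "code_at p (pc c3) [Lit 12 1, Add k k 12, Lit 12 0]"
        using at3' by (auto simp: code_at_Cons code_at_Nil)
      from reaches_run[OF this _ rb] show ?thesis by (simp add: c4_def numeral_3_eq_3)
    qed
    have b4: "below B c4" using rb run_below_below unfolding c4_def by blast
    define c5 where "c5 = step p f w c4"
    have c5: "c5 = c4\<lparr>pc := ?l + 1\<rparr>"
      using step_code_at[of p c4 "Jz 12 (?l + 1)" "[]" f w] at3' c4 3(3) c2(2)
      by (simp add: c5_def code_at_Cons add_ac)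
    have b5: "below B c5" using b4 c5 by (simp add: below_def)
    have r5: "reaches p f w B c4 1 c5" using reaches_step[OF b4] b5 unfolding c5_def by blast
    have S: "?S (Suc j) = sem f w (Suc k) c ?e (?S j)" by simp
    have "represents D R k ?e (?S (Suc j)) c3"
      using 3(4) unfolding S represents_def holds_regs_def by auto
    moreover have "same_below k D c3 c5" using k D by (auto simp: same_below_def c5 c4)
    ultimately have "represents D R k ?e (?S (Suc j)) c5" using represents_same by blast
    then have "represents D R k e (?S (Suc j)) c5"
      using k by (auto simp: represents_def regs_ok_def holds_regs_def)
    moreover have "values_le Z k e (?S (Suc j))"
      using 3(5) unfolding S values_le_def by (auto simp: less_Suc_eq) 
    ultimately have "I (Suc j) c5" using b5 k by (auto simp: I_def c5 c4)
    moreover have "reaches p f w B cf0 (t + 2 + t3 + 3 + 1) c5"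
      using reaches_trans[OF reaches_trans[OF reaches_trans[OF reaches_trans[OF tc(2) c2(1)] 3(2)] r4] r5] .
    \<comment> \<open>Two steps for the test, three for the increment and one for the jump back make
      up the 6 in \<open>cost\<close>.\<close>
    moreover have "t + 2 + t3 + 3 + 1 <= Suc j * (cost e c + 6)"
      using tc(1) 3(1) cost_upd[OF wf k(2), of e j] by simp
    ultimately show ?case by blast
  qed
  obtain t c' where tc: "t <= e q * (cost e c + 6)" "reaches p f w B cf0 t c'" "I (e q) c'"
    using body by blast
  obtain c2 where c2: "reaches p f w B c' 2 c2" "pc c2 = ?l + len c + 7" "same_below 12 D c' c2" "below B c2"
    using head[OF tc(3)] by auto
  have "represents D R k e (?S (e q)) c2" using tc(3) represents_same[OF _ c2(3)] k by (auto simp: I_def)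
  then show ?case
    using reaches_trans[OF reaches_trans[OF r0 tc(2)] c2(1)] tc c2
    by (intro exI[of _ "1 + t + 2"] exI[of _ c2]) (auto simp: I_def)
qed

section \<open>Static analysis of structured programs\<close>

text \<open>A syntactic guarantee that an expression does not exceed the stored values and the
  constant \<kappa>: subtraction, division and remainder are bounded by their left argument, a
  minimum by either one. Growing sums and products are therefore written below a
  \<open>Minim\<close> with a known cap.\<close>

primrec keeps :: "nat => expr => bool" where
  "keeps \<kappa> (Const k) = (k <= \<kappa>)"
| "keeps \<kappa> (Reg j) = True"
| "keeps \<kappa> (Cell r x) = True"
| "keeps \<kappa> (Bin b x y) = (case b of Plus => False | Times => False | Minim => keeps \<kappa> x \<or> keeps \<kappa> y | _ => keeps \<kappa> x)"

lemma eval_keeps: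
  assumes "keeps \<kappa> x" "wfe R k x" "values_le Z k e s" "\<kappa> <= Z"
  shows "eval e (cells s) x <= Z"
  using assms
proof (induction x)
  case (Bin b x y)
  then show ?case
    by (cases b) (auto intro: le_trans[OF diff_le_self] le_trans[OF div_le_dividend]
        le_trans[OF mod_less_eq_dividend] simp: min_le_iff_disj)
qed (auto simp: values_le_def)

text \<open>In a tame program every value written exceeds the values in the store by at most 1.\<close>

primrec tame :: "nat => com => bool" where
  "tame \<kappa> Skip = True"
| "tame \<kappa> (Write r x y) = (keeps \<kappa> y \<or>
     (\<exists>z. keeps \<kappa> z & (y = Bin Plus z (Const 1) \<or> (\<exists>z'. y = Bin Modulo (Bin Plus z (Const 1)) z'))))"
| "tame \<kappa> (Query d r x y) = True"
| "tame \<kappa> (Emit x) = True"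
| "tame \<kappa> (Accept d) = True"
| "tame \<kappa> (Print x) = True"
| "tame \<kappa> (Seq c1 c2) = (tame \<kappa> c1 & tame \<kappa> c2)"
| "tame \<kappa> (Cond x c1 c2) = (tame \<kappa> c1 & tame \<kappa> c2)"
| "tame \<kappa> (Loop p c) = tame \<kappa> c"

lemma writes_le_mono: "writes_le f w Z k c e s ==> Z <= Z' ==> writes_le f w Z' k c e s"
  by (induction c arbitrary: k e s) (auto split: if_splits)

lemma values_le_mono: "values_le Z k e s ==> Z <= Z' ==> values_le Z' k e s"
  unfolding values_le_def by (meson le_trans)

lemma values_le_put: "values_le Z k e s ==> v <= Z ==> values_le Z k e (put r a v s)"
  by (auto simp: values_le_def)

lemma values_le_upd: "values_le Z k e s ==> j <= Z ==> values_le Z (Suc k) (e(k := j)) s"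
  by (auto simp: values_le_def less_Suc_eq)

lemma values_le_upd_rev: "values_le Z (Suc k) (e(k := j)) s ==> values_le Z k e s"
  by (auto simp: values_le_def less_Suc_eq split: if_splits)

text \<open>A write raises the largest stored value by at most one and costs at least one step, so
  values grow no faster than time.\<close>

lemma tame_writes:
  assumes "tame \<kappa> c" "wfc R k c" "7 <= k" "values_le Z k e s" "\<kappa> <= Z" "\<And>h. f h <= Z" "\<And>i. w i <= Z"
  shows "writes_le f w (Z + cost e c) k c e s & values_le (Z + cost e c) k e (sem f w k c e s)"
  using assms
proof (induction c arbitrary: k e s Z)
  case (Write r x y)
  have "eval e (cells s) y <= Suc Z"
  proof (cases "keeps \<kappa> y")
    case True
    have "wfe R k y" using Write.prems(2) by simp
    from eval_keeps[OF True this Write.prems(4,5)] show ?thesis by simp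
  next
    case False
    then obtain z z' where z: "keeps \<kappa> z" "y = Bin Plus z (Const 1) \<or> y = Bin Modulo (Bin Plus z (Const 1)) z'"
      using Write.prems(1) by auto
    then have "wfe R k z" using Write.prems(2) by auto
    from eval_keeps[OF z(1) this Write.prems(4,5)] have "Suc (eval e (cells s) z) <= Suc Z" by simp
    then show ?thesis using z(2) le_trans[OF mod_less_eq_dividend] by auto
  qed
  then have le: "eval e (cells s) y <= Z + cost e (Write r x y)" by simp
  have v: "values_le (Z + cost e (Write r x y)) k e s"
    by (rule values_le_mono[OF Write.prems(4)]) simp
  show ?case unfolding writes_le.simps sem.simps by (rule conjI[OF le values_le_put[OF v le]])
next
  case (Query d r x y)
  have le: "f h <= Z + cost e (Query d r x y)" for h using Query.prems(6)[of h] by simp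
  have v: "values_le (Z + cost e (Query d r x y)) k e s"
    by (rule values_le_mono[OF Query.prems(4)]) simp
  show ?case unfolding writes_le.simps sem.simps by (rule conjI[OF le values_le_put[OF v le]])
next
  case (Accept d)
  have le: "w i <= Z + cost e (Accept d)" for i using Accept.prems(7)[of i] by simp
  have v: "values_le (Z + cost e (Accept d)) k e (s\<lparr>chan := chan s @ [None]\<rparr>)"
    using values_le_mono[OF Accept.prems(4), of "Z + cost e (Accept d)"] by (simp add: values_le_def)
  show ?case unfolding writes_le.simps sem.simps by (rule conjI[OF le values_le_put[OF v le]])
next
  case (Seq c1 c2)
  have 1: "writes_le f w (Z + cost e c1) k c1 e s & values_le (Z + cost e c1) k e (sem f w k c1 e s)"
    using Seq.IH(1)[of k Z e s] Seq.prems by auto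
  have 2: "writes_le f w (Z + cost e c1 + cost e c2) k c2 e (sem f w k c1 e s)
    & values_le (Z + cost e c1 + cost e c2) k e (sem f w k c2 e (sem f w k c1 e s))"
    using Seq.prems 1 by (intro Seq.IH(2)) (auto simp: trans_le_add1)
  show ?case using 1 2 writes_le_mono[of f w "Z + cost e c1" k c1 e s "Z + cost e c1 + cost e c2"]
    by (simp add: add.assoc)
next
  case (Cond x c1 c2)
  have 1: "writes_le f w (Z + cost e c1) k c1 e s & values_le (Z + cost e c1) k e (sem f w k c1 e s)"
    using Cond.IH(1)[of k Z e s] Cond.prems by auto
  have 2: "writes_le f w (Z + cost e c2) k c2 e s & values_le (Z + cost e c2) k e (sem f w k c2 e s)"
    using Cond.IH(2)[of k Z e s] Cond.prems by auto
  show ?case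
    using 1 2 writes_le_mono[of f w "Z + cost e c1" k c1 e s "Z + cost e (Cond x c1 c2)"]
      writes_le_mono[of f w "Z + cost e c2" k c2 e s "Z + cost e (Cond x c1 c2)"]
      values_le_mono[of "Z + cost e c1" k e "sem f w k c1 e s" "Z + cost e (Cond x c1 c2)"]
      values_le_mono[of "Z + cost e c2" k e "sem f w k c2 e s" "Z + cost e (Cond x c1 c2)"]
    by simp
next
  case (Loop p c)
  let ?S = "%j. fold (%j. sem f w (Suc k) c (e(k := j))) [0..<j] s"
  let ?C = "cost e c"
  have p: "p < k" and wf: "wfc R (Suc k) c" using Loop.prems by auto
  have pz: "e p <= Z" using Loop.prems p by (auto simp: values_le_def)
  have it: "values_le (Z + j * ?C) k e (?S j) & (\<forall>i<j. writes_le f w (Z + j * ?C) (Suc k) c (e(k := i)) (?S i))"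
    if "j <= e p" for j
    using that
  proof (induction j)
    case 0
    then show ?case using Loop.prems by simp
  next
    case (Suc j)
    let ?e = "e(k := j)"
    have v: "values_le (Z + j * ?C) (Suc k) ?e (?S j)"
      by (rule values_le_upd) (use Suc pz in \<open>auto simp: trans_le_add1 simp del: fun_upd_apply\<close>)
    have c: "cost ?e c = ?C" using cost_upd[OF wf] Loop.prems(3) by simp
    have "writes_le f w (Z + j * ?C + cost ?e c) (Suc k) c ?e (?S j)
      & values_le (Z + j * ?C + cost ?e c) (Suc k) ?e (sem f w (Suc k) c ?e (?S j))"
      using Loop.prems v wf by (intro Loop.IH) (auto simp: trans_le_add1 simp del: fun_upd_apply)
    then have *: "writes_le f w (Z + Suc j * ?C) (Suc k) c ?e (?S j)"
      "values_le (Z + Suc j * ?C) (Suc k) ?e (?S (Suc j))"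
      unfolding c by (auto simp: add_ac)
    have v': "values_le (Z + Suc j * ?C) k e (?S (Suc j))"
      by (rule values_le_upd_rev[OF *(2)])
    have "writes_le f w (Z + Suc j * ?C) (Suc k) c (e(k := i)) (?S i)" if "i < Suc j" for i
    proof (cases "i = j")
      case False
      then have "writes_le f w (Z + j * ?C) (Suc k) c (e(k := i)) (?S i)"
        using Suc that by (auto simp del: fun_upd_apply)
      then show ?thesis by (rule writes_le_mono) simp
    qed (use * in simp)
    then show ?case using v' by blast
  qed
  have le: "Z + e p * ?C <= Z + cost e (Loop p c)" by (simp add: algebra_simps)
  show ?case
    using it[of "e p"] values_le_mono[OF _ le] writes_le_mono[OF _ le] by auto
next
  case (Emit x)
  have "values_le (Z + cost e (Emit x)) k e s"
    by (rule values_le_mono[OF Emit.prems(4)]) simp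
  then show ?case by (simp add: values_le_def)
next
  case (Print x)
  have "values_le (Z + cost e (Print x)) k e s"
    by (rule values_le_mono[OF Print.prems(4)]) simp
  then show ?case by (simp add: values_le_def)
qed simp

primrec mods :: "com => nat set" where
  "mods Skip = {}"
| "mods (Write r x y) = {r}"
| "mods (Query d r x y) = {d}"
| "mods (Emit x) = {}"
| "mods (Accept d) = {d}"
| "mods (Print x) = {}"
| "mods (Seq c1 c2) = mods c1 \<union> mods c2"
| "mods (Cond x c1 c2) = mods c1 \<union> mods c2"
| "mods (Loop p c) = mods c"

lemma sem_frame: "r \<notin> mods c ==> cells (sem f w k c e s) r = cells s r"
proof (induction c arbitrary: k e s)
  case (Loop p c)
  have "cells (fold (%j. sem f w (Suc k) c (e(k := j))) xs s) r = cells s r" for xs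
    using Loop by (induction xs arbitrary: s) auto
  then show ?case by simp
qed auto

primrec quiet :: "com => bool" where
  "quiet Skip = True"
| "quiet (Write r x y) = True"
| "quiet (Query d r x y) = True"
| "quiet (Emit x) = False"
| "quiet (Accept d) = False"
| "quiet (Print x) = False"
| "quiet (Seq c1 c2) = (quiet c1 & quiet c2)"
| "quiet (Cond x c1 c2) = (quiet c1 & quiet c2)"
| "quiet (Loop p c) = quiet c"

lemma sem_quiet: "quiet c ==> chan (sem f w k c e s) = chan s & printed (sem f w k c e s) = printed s"
proof (induction c arbitrary: k e s)
  case (Loop p c)
  have "chan (fold (%j. sem f w (Suc k) c (e(k := j))) xs s) = chan s &
    printed (fold (%j. sem f w (Suc k) c (e(k := j))) xs s) = printed s" for xs
    using Loop by (induction xs arbitrary: s) auto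
  then show ?case by simp
qed auto

primrec weight :: "com => nat" where
  "weight Skip = 0"
| "weight (Write r x y) = len_expr x + len_expr y + 23"
| "weight (Query d r x y) = len_expr x + len_expr y + 49"
| "weight (Emit x) = len_expr x + 1"
| "weight (Accept d) = 25"
| "weight (Print x) = len_expr x + 1"
| "weight (Seq c1 c2) = weight c1 + weight c2"
| "weight (Cond x c1 c2) = len_expr x + 3 + weight c1 + weight c2"
| "weight (Loop p c) = weight c + 9"

primrec nest :: "(nat => nat) => com => nat" where
  "nest e Skip = 1"
| "nest e (Write r x y) = 1"
| "nest e (Query d r x y) = 1"
| "nest e (Emit x) = 1"
| "nest e (Accept d) = 1"
| "nest e (Print x) = 1"
| "nest e (Seq c1 c2) = max (nest e c1) (nest e c2)"
| "nest e (Cond x c1 c2) = max (nest e c1) (nest e c2)"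
| "nest e (Loop p c) = max 1 (e p) * nest e c"

lemma nest_pos: "1 <= nest e c"
  by (induction c) auto

lemma le_mult_max:
  fixes a b x y :: nat
  shows "a <= b * x ==> a <= b * max x y" "a <= b * y ==> a <= b * max x y"
  by (meson le_trans max.cobounded1 mult_le_mono2, meson le_trans max.cobounded2 mult_le_mono2)

text \<open>Separates a factor that depends on the program text only from the largest product of
  nested loop bounds. The former goes into the constant of the theorem, the latter is bounded by the
  size of the problem.\<close>

lemma cost_le_weight: "cost e c <= weight c * nest e c"
proof (induction c)
  case (Seq c1 c2)
  then show ?case
    using le_mult_max(1)[OF Seq(1), of "nest e c2"] le_mult_max(2)[OF Seq(2), of "nest e c1"]
    by (simp add: add_mult_distrib)
next
  case (Cond x c1 c2)
  have "1 <= max (nest e c1) (nest e c2)" using nest_pos[of e c1] by simp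
  then have "(len_expr x + 3) * 1 <= (len_expr x + 3) * max (nest e c1) (nest e c2)"
    by (rule mult_le_mono2)
  then show ?case
    using le_mult_max(1)[OF Cond(1), of "nest e c2"] le_mult_max(2)[OF Cond(2), of "nest e c1"]
    by (simp add: add_mult_distrib)
next
  case (Loop p c)
  let ?m = "max 1 (e p)" and ?n = "nest e c"
  have n: "1 <= ?n" by (rule nest_pos)
  have "cost e c + 6 <= (weight c + 6) * ?n" using Loop n by (simp add: add_mult_distrib)
  then have 1: "e p * (cost e c + 6) <= ?m * ((weight c + 6) * ?n)" by (intro mult_le_mono) auto
  have 2: "1 * 1 <= ?m * ?n" by (rule mult_le_mono) (use n in auto)
  have 3: "weight (Loop p c) * (?m * ?n) = ?m * ((weight c + 6) * ?n) + 3 * (?m * ?n)"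
    by (simp add: algebra_simps)
  show ?case using 1 2 3 unfolding cost.simps nest.simps by linarith
qed auto

text \<open>Repetitions over candidates, pieces, digits and messages have constant length, so they
  are unrolled and their index becomes a constant of the program. Machine loops remain for the
  lengths \<open>n\<close>, \<open>m\<close>, \<open>l\<close> and \<open>h\<close>.\<close>

primrec SeqN :: "nat => (nat => com) => com" where
  "SeqN 0 F = Skip"
| "SeqN (Suc n) F = Seq (SeqN n F) (F n)"

primrec SumN :: "nat => (nat => expr) => expr" where
  "SumN 0 F = Const 0"
| "SumN (Suc n) F = Bin Plus (SumN n F) (F n)"

primrec ProdN :: "nat => (nat => expr) => expr" where
  "ProdN 0 F = Const 1"
| "ProdN (Suc n) F = Bin Times (ProdN n F) (F n)"

lemma eval_SumN [simp]: "eval e g (SumN n F) = (\<Sum>k<n. eval e g (F k))"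
  by (induction n) auto

lemma eval_ProdN [simp]: "eval e g (ProdN n F) = (\<Prod>k<n. eval e g (F k))"
  by (induction n) auto

lemma wfe_SumN [simp]: "wfe R k (SumN n F) \<longleftrightarrow> (\<forall>j<n. wfe R k (F j))"
  by (induction n) (auto simp: less_Suc_eq)

lemma wfe_ProdN [simp]: "wfe R k (ProdN n F) \<longleftrightarrow> (\<forall>j<n. wfe R k (F j))"
  by (induction n) (auto simp: less_Suc_eq)

lemma wfc_SeqN [simp]: "wfc R k (SeqN n F) \<longleftrightarrow> (\<forall>j<n. wfc R k (F j))"
  by (induction n) (auto simp: less_Suc_eq)

lemma tame_SeqN [simp]: "tame \<kappa> (SeqN n F) \<longleftrightarrow> (\<forall>j<n. tame \<kappa> (F j))"
  by (induction n) (auto simp: less_Suc_eq)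

lemma quiet_SeqN [simp]: "quiet (SeqN n F) \<longleftrightarrow> (\<forall>j<n. quiet (F j))"
  by (induction n) (auto simp: less_Suc_eq)

lemma mods_SeqN [simp]: "mods (SeqN n F) = (\<Union>j<n. mods (F j))"
  by (induction n) (auto simp: less_Suc_eq)

lemma nest_SeqN_le: "(\<And>j. j < n ==> nest e (F j) <= m) ==> 1 <= m ==> nest e (SeqN n F) <= m"
  by (induction n) auto

lemma sem_SeqN_inv:
  assumes "I 0 s" "\<And>j s. j < n ==> I j s ==> I (Suc j) (sem f w k (F j) e s)"
  shows "I n (sem f w k (SeqN n F) e s)"
  using assms(2) by (induction n) (use assms(1) in auto)

lemma fold_upt_inv:
  assumes "I 0 s" "\<And>j s. j < m ==> I j s ==> I (Suc j) (F j s)"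
  shows "I (m::nat) (fold F [0..<m] s)"
proof -
  have "I j (fold F [0..<j] s)" if "j <= m" for j
    using that by (induction j) (use assms in auto)
  then show ?thesis by simp
qed

definition polynomially :: "(nat => nat) => bool" where
  "polynomially f \<longleftrightarrow> (\<exists>c. \<forall>Z. f Z <= (Z + 2) ^ c)"

lemma polynomially_const: "polynomially (%Z. k)"
proof -
  have "k <= (Z + 2) ^ k" for Z :: nat
    using less_exp[of k] power_mono[of 2 "Z + 2" k] by simp
  then show ?thesis unfolding polynomially_def by blast
qed

lemma polynomially_id: "polynomially (%Z. Z)"
  unfolding polynomially_def by (rule exI[of _ 1]) simp

lemma polynomially_mult:
  assumes "polynomially f" "polynomially g"
  shows "polynomially (%Z. f Z * g Z)"
proof -
  obtain a b where "\<And>Z. f Z <= (Z + 2) ^ a" "\<And>Z. g Z <= (Z + 2) ^ b"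
    using assms by (auto simp: polynomially_def)
  then have "f Z * g Z <= (Z + 2) ^ (a + b)" for Z
    by (simp add: power_add mult_le_mono)
  then show ?thesis by (auto simp: polynomially_def)
qed

lemma polynomially_add:
  assumes "polynomially f" "polynomially g"
  shows "polynomially (%Z. f Z + g Z)"
proof -
  obtain a b where ab: "\<And>Z. f Z <= (Z + 2) ^ a" "\<And>Z. g Z <= (Z + 2) ^ b"
    using assms by (auto simp: polynomially_def)
  have "f Z + g Z <= (Z + 2) ^ (Suc (a + b))" for Z
  proof -
    have "(Z + 2) ^ a <= (Z + 2) ^ (a + b)" "(Z + 2) ^ b <= (Z + 2) ^ (a + b)"
      by (auto intro: power_increasing)
    then have "f Z + g Z <= 2 * (Z + 2) ^ (a + b)" using ab[of Z] by linarith
    also have "\<dots> <= (Z + 2) * (Z + 2) ^ (a + b)" by simp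
    finally show ?thesis by simp
  qed
  then show ?thesis unfolding polynomially_def by blast
qed

lemmas polynomially_intros =
  polynomially_const polynomially_id polynomially_mult polynomially_add

lemma polynomially_peak: "polynomially (peak D x)"
proof (induction x)
  case (Cell r x)
  then show ?case unfolding peak.simps by (intro polynomially_intros)
qed (simp_all add: polynomially_intros)

lemma polynomially_peak_addr: "polynomially g ==> polynomially (%Z. peak_addr D r (g Z) Z)"
  unfolding peak_addr_def by (intro polynomially_intros)

lemma polynomially_peak_com: "polynomially (peak_com D c)"
proof (induction c)
  case (Loop p c)
  then show ?case unfolding peak_com.simps by (intro polynomially_intros)
qed (simp_all add: polynomially_intros polynomially_peak polynomially_peak_addr)

lemma peak_mono: "Z <= Z' ==> peak D x Z <= peak D x Z'"
  by (induction x) (auto intro!: add_mono mult_le_mono)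

lemma peak_addr_mono2: "a <= a' ==> Z <= Z' ==> peak_addr D r a Z <= peak_addr D r a' Z'"
  unfolding peak_addr_def by (auto intro!: add_mono mult_le_mono)

lemma peak_com_mono: "Z <= Z' ==> peak_com D c Z <= peak_com D c Z'"
  by (induction c) (auto intro!: add_mono peak_mono peak_addr_mono2)

section \<open>Simulating a machine with coded transmissions\<close>

text \<open>Arrays: \<open>RX\<close> candidates, \<open>RH\<close> table of the code,
  \<open>RP\<close> positions, \<open>RB\<close> positions saved in the runs, \<open>RG\<close>
  digits of a message, \<open>RW\<close> its codeword, \<open>RL\<close> lists of digits,
  \<open>RC\<close> credits. The others serve as single variables: \<open>VS\<close> and
  \<open>VR\<close> are places in the codeword for sending and receiving, \<open>VO\<close> counts
  stored outputs, \<open>VH\<close> transmissions, \<open>VA\<close> holds the last oracle answer or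
  received symbol, \<open>VC\<close> an agreement, \<open>VL\<close> a list length,
  \<open>VB\<close> the identified and \<open>VK\<close> the elected candidate, \<open>VE\<close>
  the code length.\<close>

abbreviation "RX == (0::nat)"
abbreviation "RH == (17::nat)"
abbreviation "RP == (2::nat)"
abbreviation "RB == (3::nat)"
abbreviation "RG == (4::nat)"
abbreviation "RW == (5::nat)"
abbreviation "RL == (6::nat)"
abbreviation "VS == (7::nat)"
abbreviation "VR == (8::nat)"
abbreviation "VO == (9::nat)"
abbreviation "VH == (10::nat)"
abbreviation "VA == (11::nat)"
abbreviation "VC == (12::nat)"
abbreviation "VL == (13::nat)"
abbreviation "VB == (14::nat)"
abbreviation "RC == (15::nat)"
abbreviation "VK == (16::nat)"
abbreviation "VE == (18::nat)"

abbreviation Var :: "nat => expr" where "Var v == Cell v (Const 0)"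
abbreviation lt :: "expr => expr => expr" where
  "lt x y == Bin Minim (Const 1) (Bin Minus y x)"

text \<open>Access to the protocol padded from \<open>n\<close> (register 0) to \<open>m\<close>
  (register 1) rounds. In the additional rounds Alice sends 0, which an oracle reports as 1.\<close>

definition query_padded :: "bool => nat => nat => expr => expr => com" where
  "query_padded al d r x y =
     Cond (lt y (Reg 0)) (Query d r x y) (Write d (Const 0) (if al then lt y (Reg 1) else Const 0))"

definition pad_oracle :: "bool => nat => nat => (nat list => nat) => nat list => nat" where
  "pad_oracle al n m f h = (if length h < n then f h else if al & length h < m then 1 else 0)"

lemma sem_query_padded:
  assumes "e 0 <= e 1"
  shows "sem f w k (query_padded al d r x y) e s =
    put d 0 (pad_oracle al (e 0) (e 1) f
      (map (cells s r) [eval e (cells s) x..<eval e (cells s) x + eval e (cells s) y])) s"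
  using assms by (auto simp: query_padded_def pad_oracle_def)

definition bump :: "nat => com" where
  "bump v = Write v (Const 0) (Bin Modulo (Bin Plus (Var v) (Const 1)) (Reg 4))"

definition sent :: "nat option list => nat" where
  "sent xs = length (filter (%x. x ~= None) xs)"

primrec rcvd :: "(nat => nat) => nat => nat option list => nat list" where
  "rcvd w k [] = []"
| "rcvd w k (x # xs) = (if x = None then [w k] else []) @ rcvd w (Suc k) xs"

text \<open>A transmitted symbol carries the symbol of the given scheme as its remainder modulo
  \<open>q\<close> and a code symbol as its quotient. The codeword is repeated with period
  \<open>l\<close>, and its place advances in transmissions only.\<close>

primrec encode :: "nat => nat => (nat => nat) => nat => nat option list => nat option list" where
  "encode q l W k [] = []"
| "encode q l W k (x # xs) =
     (case x of None => None # encode q l W k xs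
      | Some v => Some (v + q * W (k mod l)) # encode q l W (Suc k) xs)"

text \<open>A histogram replaces the received word: as codewords are repeated with period
  \<open>l\<close>, the agreement with a codeword depends only on how often each code symbol arrived
  at each place modulo \<open>l\<close>. Computing an agreement then costs time proportional to
  \<open>l\<close> instead of \<open>h\<close>.\<close>

definition tally :: "nat => nat => nat => nat list => nat => nat" where
  "tally q Q l ys a = card {k. k < length ys & k mod l * Q + ys ! k div q = a}"

lemma sent_snoc: "sent (xs @ [x]) = sent xs + (if x = None then 0 else 1)"
  by (simp add: sent_def)

lemma rcvd_append: "rcvd w k (xs @ ys) = rcvd w k xs @ rcvd w (k + length xs) ys"
  by (induction xs arbitrary: k) auto

lemma encode_append: "encode q l W k (xs @ ys) = encode q l W k xs @ encode q l W (k + sent xs) ys"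
  by (induction xs arbitrary: k) (auto simp: sent_def split: option.splits)

lemma length_encode: "length (encode q l W k xs) = length xs"
  by (induction xs arbitrary: k) (auto split: option.splits)

lemma length_rcvd: "length (rcvd w k xs) + sent xs = length xs"
  by (induction xs arbitrary: k) (auto simp: sent_def)

lemma tally_snoc:
  "tally q Q l (ys @ [y]) a = tally q Q l ys a + (if length ys mod l * Q + y div q = a then 1 else 0)"
proof -
  let ?A = "{k. k < length ys & k mod l * Q + ys ! k div q = a}"
  have "{k. k < length (ys @ [y]) & k mod l * Q + (ys @ [y]) ! k div q = a}
    = ?A \<union> (if length ys mod l * Q + y div q = a then {length ys} else {})"
    by (auto simp: nth_append less_Suc_eq)
  moreover have "finite ?A" "length ys \<notin> ?A" by auto
  ultimately show ?thesis by (auto simp: tally_def)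
qed

lemma tally_le: "tally q Q l ys a <= length ys"
  unfolding tally_def using card_mono[of "{..<length ys}" "{k. k < length ys & k mod l * Q + ys ! k div q = a}"]
  by auto

section \<open>Translation of the given program, instruction by instruction\<close>

locale simulation =
  fixes al :: bool and q Q sz sg i F S :: nat
  assumes FS: "18 <= F" "18 <= S" "F ~= S"
begin

abbreviation src :: "nat => expr" where "src a == Cell S (Const a)"

definition slot_ix :: expr where
  "slot_ix = Bin Plus (Bin Times (Const (i * sz)) (Reg 1)) (Var VO)"

definition tally_ix :: expr where
  "tally_ix = Bin Plus (Bin Times (Var VR) (Const Q)) (Bin Divide (Var VA) (Const q))"

text \<open>The output of a badly corrupted run is arbitrary. It is cut off after
  \<open>sz * m\<close> symbols, so that it stays in the slots of this run, and reduced modulo the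
  alphabet size. A list of at most \<open>sz\<close> transcripts is left intact by both
  measures.\<close>

fun trans :: "instr => com" where
  "trans (Lit d k) = Write S (Const d) (Const k)"
| "trans (Add d a b) = Write S (Const d) (Bin Plus (src a) (src b))"
| "trans (Sub d a b) = Write S (Const d) (Bin Minus (src a) (src b))"
| "trans (Mul d a b) = Write S (Const d) (Bin Times (src a) (src b))"
| "trans (Div d a b) = Write S (Const d) (Bin Divide (src a) (src b))"
| "trans (Load d a) = Write S (Const d) (Cell S (src a))"
| "trans (Store a b) = Write S (src a) (src b)"
| "trans (Jz a l) = Skip"
| "trans (Ask d a l) = Seq (query_padded al VA S (src a) (src l)) (Write S (Const d) (Var VA))"
| "trans (Send a) =
     Seq (Emit (Bin Plus (src a) (Bin Times (Const q) (Cell RW (Var VS)))))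
       (Seq (bump VS) (Write VH (Const 0) (Bin Plus (Var VH) (Const 1))))"
| "trans (Recv d) =
     Seq (Accept VA) (Seq (Write F tally_ix (Bin Plus (Cell F tally_ix) (Const 1)))
       (Seq (bump VR) (Write S (Const d) (Bin Modulo (Var VA) (Const q)))))"
| "trans (Out a) =
     Cond (lt (Var VO) (Bin Times (Const sz) (Reg 1)))
       (Seq (Write RX slot_ix (Bin Modulo (src a) (Const sg)))
         (Write VO (Const 0) (Bin Plus (Var VO) (Const 1)))) Skip"
| "trans Halt = Skip"

text \<open>\<open>s0\<close> is the store at the start of the run. All arrays that the translation
  does not write keep their contents; in particular the codeword in \<open>RW\<close> stays fixed
  while it is sent.\<close>

definition mirrors :: "(nat => nat) => (nat => nat) => store => config => store => bool" where
  "mirrors e w s0 c s \<longleftrightarrow>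
     cells s S = mem c &
     chan s = chan s0 @ encode q (e 4) (cells s0 RW) 0 (comm c) &
     printed s = printed s0 &
     cells s VS 0 = sent (comm c) mod e 4 &
     cells s VH 0 = sent (comm c) &
     cells s VR 0 = length (rcvd w (length (chan s0)) (comm c)) mod e 4 &
     cells s VO 0 = min (length (out c)) (sz * e 1) &
     (\<forall>a. cells s RX a =
        (if i * sz * e 1 <= a & a < i * sz * e 1 + cells s VO 0
         then (out c ! (a - i * sz * e 1)) mod sg else cells s0 RX a)) &
     cells s F = tally q Q (e 4) (rcvd w (length (chan s0)) (comm c)) &
     (\<forall>r. r \<notin> {S, F, VS, VH, VR, VO, VA, RX} --> cells s r = cells s0 r)"

definition window :: "(nat => nat) => store => nat => nat" where
  "window w s0 k = w (length (chan s0) + k) mod q"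

lemma sem_trans:
  assumes m: "mirrors e w s0 c s" and e: "e 0 <= e 1" and I: "linear I"
  shows "mirrors e w s0 (exec (pad_oracle al (e 0) (e 1) f) (window w s0) I c) (sem f w k (trans I) e s)"
proof (cases I)
  case (Ask d a l)
  then show ?thesis using m FS e by (auto simp: mirrors_def sem_query_padded)
next
  case (Send a)
  have "(sent (comm c) mod e 4 + 1) mod e 4 = (sent (comm c) + 1) mod e 4" by (rule mod_add_left_eq)
  then show ?thesis using m FS Send
    by (auto simp: mirrors_def bump_def sent_snoc rcvd_append encode_append)
next
  case (Recv d)
  let ?ys = "rcvd w (length (chan s0)) (comm c)"
  have md: "(length ?ys mod e 4 + 1) mod e 4 = (length ?ys + 1) mod e 4" by (rule mod_add_left_eq)
  have ch: "length (chan s) = length (chan s0) + length (comm c)"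
    using m by (simp add: mirrors_def length_encode)
  show ?thesis using m FS Recv md ch
    by (auto simp: mirrors_def bump_def sent_snoc rcvd_append encode_append tally_snoc tally_ix_def
        window_def fun_eq_iff)
next
  case (Out a)
  show ?thesis
  proof (cases "length (out c) < sz * e 1")
    case True
    then have "min (length (out c)) (sz * e 1) = length (out c)"
      "min (Suc (length (out c))) (sz * e 1) = Suc (length (out c))" by auto
    then show ?thesis using m FS Out True
      by (auto simp: mirrors_def slot_ix_def nth_append)
  next
    case False
    then have "min (length (out c)) (sz * e 1) = sz * e 1"
      "min (Suc (length (out c))) (sz * e 1) = sz * e 1" by auto
    then show ?thesis using m FS Out False
      by (auto simp: mirrors_def nth_append)
  qed
qed (use m FS I in \<open>auto simp: mirrors_def\<close>)

lemma trans_writes_le: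
  assumes m: "mirrors e w s0 c s" and e: "e 0 <= e 1" and I: "linear I"
    and Z: "below Z (exec (pad_oracle al (e 0) (e 1) f) (window w s0) I c)" "below Z c"
    and v: "values_le Z 7 e s"
    and "\<And>h. f h <= Z" "\<And>j. w j <= Z" "length (comm c) < Z" "1 <= Z" "sz * e 1 <= Z" "0 < e 4" "0 < sg" "sg <= Z" "0 < q"
  shows "writes_le f w Z k (trans I) e s"
proof -
  have e4: "e 4 <= Z" using v by (simp add: values_le_def)
  have Z1: "mem (exec (pad_oracle al (e 0) (e 1) f) (window w s0) I c) a <= Z" for a
    using Z(1) by (simp add: below_def)
  have md: "x mod e 4 <= Z" for x using e4 \<open>0 < e 4\<close> mod_less_divisor[of "e 4" x] by linarith
  have sgm: "x mod sg <= Z" for x using \<open>0 < sg\<close> \<open>sg <= Z\<close> mod_less_divisor[of sg x] by linarith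
  show ?thesis
  proof (cases I)
    case (Ask d a l)
    have *: "cells s S = mem c" using m by (simp add: mirrors_def)
    show ?thesis using Ask Z1[of d] assms(7) \<open>1 <= Z\<close> e *
      by (auto simp: query_padded_def pad_oracle_def)
  next
    case (Send a)
    have "sent (comm c) < Z" using assms(9) length_rcvd[of w 0 "comm c"] by linarith
    then show ?thesis using Send m FS md by (auto simp: bump_def mirrors_def)
  next
    case (Recv d)
    let ?ys = "rcvd w (length (chan s0)) (comm c)"
    have "length ?ys < Z" using assms(9) length_rcvd[of w "length (chan s0)" "comm c"] by linarith
    then have t: "Suc (tally q Q (e 4) ?ys x) <= Z" for x using tally_le[of q Q "e 4" ?ys x] by linarith
    have "w j mod q <= Z" for j using assms(8)[of j] le_trans[OF mod_less_eq_dividend] by blast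
    then show ?thesis using Recv m FS md t assms(8) by (auto simp: bump_def mirrors_def tally_ix_def)
  next
    case (Out a)
    then show ?thesis using m FS sgm \<open>sz * e 1 <= Z\<close> by (auto simp: mirrors_def slot_ix_def split: if_splits)
  next
    case (Lit d k)
    then show ?thesis using Z1[of d] m FS by (simp add: mirrors_def)
  next
    case (Add d a b)
    then show ?thesis using Z1[of d] m FS by (simp add: mirrors_def)
  next
    case (Sub d a b)
    then show ?thesis using Z1[of d] m FS by (simp add: mirrors_def)
  next
    case (Mul d a b)
    then show ?thesis using Z1[of d] m FS by (simp add: mirrors_def)
  next
    case (Div d a b)
    then show ?thesis using Z1[of d] m FS by (simp add: mirrors_def)
  next
    case (Load d a)
    then show ?thesis using Z1[of d] m FS by (simp add: mirrors_def)
  next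
    case (Store a b)
    then show ?thesis using Z(2) m FS by (simp add: mirrors_def below_def)
  qed (use I in auto)
qed

lemma wfc_trans: "S < R ==> F < R ==> wfc R 7 (trans I)"
  using FS by (cases I) (auto simp: query_padded_def bump_def slot_ix_def tally_ix_def)

lemma cost_trans: "cost e (trans I) <= 300"
  by (cases I) (auto simp: query_padded_def bump_def slot_ix_def tally_ix_def)

definition block_len :: "instr => nat" where
  "block_len I = (case I of Jz a l => 11 | Halt => 2 | _ => len (trans I))"

text \<open>Because of \<open>take\<close>, every jump target beyond the program refers to the end
  of the simulation, in accordance with \<open>halted\<close>.\<close>

definition block_pos :: "nat => program => nat => nat" where
  "block_pos l0 P k = l0 + sum_list (map block_len (take k P))"

definition block :: "nat => nat => program => nat => instr list" where
  "block D l0 P k = (case P ! k of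
     Jz a l => code_expr D (src a) 12 @ [Jz 12 (block_pos l0 P l)]
   | Halt => [Lit 12 0, Jz 12 (block_pos l0 P (length P))]
   | I => code D 7 (block_pos l0 P k) (trans I))"

definition sim_code :: "nat => nat => program => instr list" where
  "sim_code D l0 P = concat (map (block D l0 P) [0..<length P])"

definition sim_len :: "program => nat" where
  "sim_len P = sum_list (map block_len P)"

lemma length_block: "length (block D l0 P k) = block_len (P ! k)"
  by (cases "P ! k") (auto simp: block_def block_len_def length_code length_code_expr length_code_addr length_code_write)

lemma block_pos_Suc: "k < length P ==> block_pos l0 P (Suc k) = block_pos l0 P k + block_len (P ! k)"
  by (simp add: block_pos_def take_Suc_conv_app_nth)

lemma block_pos_end: "length P <= k ==> block_pos l0 P k = l0 + sim_len P"
  by (simp add: block_pos_def sim_len_def)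

lemma length_blocks:
  "k <= length P ==> l0 + length (concat (map (block D l0 P) [0..<k])) = block_pos l0 P k"
  by (induction k) (auto simp: block_pos_Suc length_block block_pos_def[of l0 P 0] simp flip: add.assoc)

lemma length_sim_code: "length (sim_code D l0 P) = sim_len P"
  using length_blocks[of "length P" P l0 D] by (simp add: sim_code_def block_pos_end)

lemma code_at_block:
  assumes "code_at p l0 (sim_code D l0 P)" "k < length P"
  shows "code_at p (block_pos l0 P k) (block D l0 P k)"
proof -
  obtain d where "length P = k + Suc d" using assms(2) less_imp_Suc_add by fastforce
  then have "[0..<length P] = [0..<k] @ k # [Suc k..<length P]"
    using upt_add_eq_append[of 0 k "Suc d"] upt_conv_Cons[of k "length P"] by simp
  then have "sim_code D l0 P = concat (map (block D l0 P) [0..<k]) @ block D l0 P k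
     @ concat (map (block D l0 P) [Suc k..<length P])"
    by (simp add: sim_code_def)
  then show ?thesis
    using assms length_blocks[of k P l0 D] by (simp add: code_at_append)
qed

text \<open>Induction on the simulated steps, each of which takes at most 300 machine steps. The
  claim covers every \<open>t\<close>, since a halted configuration repeats itself and then nothing
  has to be executed.\<close>

lemma reaches_simulation:
  fixes P e w s0 f m
  defines "f' == pad_oracle al (e 0) (e 1) f"
  defines "cs == (%t. (step P f' (window w s0) ^^ t) (initial m))"
  assumes at: "code_at p l0 (sim_code D l0 P)"
    and rep: "represents D R 7 e s0 cf" "pc cf = l0" "below B cf" "mirrors e w s0 (initial m) s0"
    and R: "S < R" "F < R" and D: "\<And>I. I \<in> set P ==> 12 + depth (trans I) <= D" "17 <= D"
    and e: "e 0 <= e 1"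
    and B: "\<And>I. I \<in> set P ==> peak_com D (trans I) Z <= B" "\<And>a l. Jz a l \<in> set P ==> peak D (src a) Z <= B" "Z <= B"
    and Z: "values_le Z 7 e s0" "\<And>h. f h <= Z" "\<And>j. w j <= Z" "\<And>u. below Z (cs u)" "\<And>u. length (comm (cs u)) < Z"
      "1 <= Z" "sz * e 1 <= Z" "0 < e 4" "0 < sg" "sg <= Z" "0 < q"
  shows "\<exists>u s cf'. u <= 300 * t & reaches p f w B cf u cf' & pc cf' = block_pos l0 P (pc (cs t)) &
    represents D R 7 e s cf' & mirrors e w s0 (cs t) s & values_le Z 7 e s"
proof (induction t)
  case 0
  have "pc cf = block_pos l0 P (pc (cs 0))" using rep by (simp add: cs_def initial_def block_pos_def)
  then show ?case using rep Z(1) reaches_refl[OF rep(3)]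
    by (intro exI[of _ 0] exI[of _ s0] exI[of _ cf]) (auto simp: cs_def)
next
  case (Suc t)
  then obtain u s cf' where IH: "u <= 300 * t" "reaches p f w B cf u cf'" "pc cf' = block_pos l0 P (pc (cs t))"
    "represents D R 7 e s cf'" "mirrors e w s0 (cs t) s" "values_le Z 7 e s" by blast
  have cs: "cs (Suc t) = step P f' (window w s0) (cs t)" by (simp add: cs_def)
  have b: "below B cf'" using IH(2) by (auto simp: reaches_def)
  show ?case
  proof (cases "halted P (cs t)")
    case True
    then have "cs (Suc t) = cs t" by (simp add: cs step_def)
    then show ?thesis using IH by (intro exI[of _ u] exI[of _ s] exI[of _ cf']) auto
  next
    case False
    let ?k = "pc (cs t)"
    let ?I = "P ! ?k"
    have k: "?k < length P" "?I ~= Halt" using False by (auto simp: halted_def)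
    have cs': "cs (Suc t) = exec f' (window w s0) ?I (cs t)" using False by (simp add: cs step_def)
    have atk: "code_at p (pc cf') (block D l0 P ?k)" using code_at_block[OF at k(1)] IH(3) by simp
    show ?thesis
    proof (cases "linear ?I")
      case True
      have bl: "block D l0 P ?k = code D 7 (pc cf') (trans ?I)" "block_len ?I = len (trans ?I)"
        using True IH(3) by (cases ?I; simp add: block_def block_len_def)+
      have at': "code_at p (pc cf') (code D 7 (pc cf') (trans ?I))" using atk bl by simp
      have mem: "?I \<in> set P" using k by simp
      have wl: "writes_le f w Z 7 (trans ?I) e s"
        using trans_writes_le[OF IH(5) e True, of Z f 7] Z IH(6) cs' by (metis f'_def)
      obtain v cf2 where 2: "v <= cost e (trans ?I)" "reaches p f w B cf' v cf2" "pc cf2 = pc cf' + len (trans ?I)"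
        "represents D R 7 e (sem f w 7 (trans ?I) e s) cf2" "values_le Z 7 e (sem f w 7 (trans ?I) e s)"
        using reaches_code[OF at' IH(4) _ _ wfc_trans[OF R] D(1)[OF mem] b IH(6) wl B(1)[OF mem] B(3)] by auto
      have "pc (cs (Suc t)) = Suc ?k" using exec_linear_pc[OF True] cs' by simp
      then have "pc cf2 = block_pos l0 P (pc (cs (Suc t)))"
        using 2(3) bl IH(3) k by (simp add: block_pos_Suc)
      moreover have "mirrors e w s0 (cs (Suc t)) (sem f w 7 (trans ?I) e s)"
        using sem_trans[OF IH(5) e True, of f 7] cs' f'_def by simp
      moreover have "u + v <= 300 * Suc t" using IH(1) 2(1) cost_trans[of e ?I] by simp
      ultimately show ?thesis using reaches_trans[OF IH(2) 2(2)] 2 by blast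
    next
      case False
      then obtain a l where J: "?I = Jz a l" using k by (cases ?I) auto
      have bl: "block D l0 P ?k = code_expr D (src a) 12 @ [Jz 12 (block_pos l0 P l)]" by (simp add: block_def J)
      have at1: "code_at p (pc cf') (code_expr D (src a) 12)" and at2: "code_at p (pc cf' + 10) [Jz 12 (block_pos l0 P l)]"
        using atk unfolding bl code_at_append length_code_expr by simp_all
      have pk: "peak D (src a) Z <= B" using B(2)[of a l] k J by (metis nth_mem)
      have wf: "wfe R 7 (src a)" using R by simp
      have dd: "12 + depth_expr (src a) <= D" using D(2) by simp
      have "3 < (7::nat)" "7 <= (12::nat)" by auto
      note E = run_code_expr[OF IH(4) wf this dd b IH(6) pk, where f = f and w = w]
      define c1 where "c1 = run f w (code_expr D (src a) 12) cf'"
      have r1: "reaches p f w B cf' 10 c1"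
        using reaches_run[OF at1 linear_code_expr] E length_code_expr[of D "src a" 12] by (simp add: c1_def)
      have pc1: "pc c1 = pc cf' + 10"
        using run_pc[OF linear_code_expr, of f w D "src a" 12 cf'] length_code_expr[of D "src a" 12] by (simp add: c1_def)
      have b1: "below B c1" using r1 by (auto simp: reaches_def)
      define c2 where "c2 = step p f w c1"
      have "mem c1 12 = mem (cs t) a" using E IH(5) by (simp add: c1_def mirrors_def)
      then have c2: "c2 = c1\<lparr>pc := (if mem (cs t) a = 0 then block_pos l0 P l else Suc (pc c1))\<rparr>"
        using step_code_at[of p c1 "Jz 12 (block_pos l0 P l)" "[]" f w] at2 pc1 by (simp add: c2_def)
      have b2: "below B c2" using b1 c2 by (simp add: below_def)
      have r2: "reaches p f w B c1 1 c2" using reaches_step[OF b1] b2 unfolding c2_def by blast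
      have "Suc (pc c1) = block_pos l0 P (Suc ?k)"
        using pc1 IH(3) k by (simp add: block_pos_Suc block_len_def J)
      then have "pc c2 = block_pos l0 P (pc (cs (Suc t)))" by (simp add: c2 cs' J)
      moreover have "same_below 12 D cf' c2" using E unfolding c1_def[symmetric] c2 by (auto simp: same_below_def)
      then have "represents D R 7 e s c2" using represents_same[OF IH(4)] by simp
      moreover have "mirrors e w s0 (cs (Suc t)) s" using IH(5) by (simp add: mirrors_def cs' J)
      moreover have "u + 10 + 1 <= 300 * Suc t" using IH(1) by simp
      ultimately show ?thesis using reaches_trans[OF reaches_trans[OF IH(2) r1] r2] IH(6) by blast
    qed
  qed
qed

lemma reaches_simulation_end:
  fixes P e w s0 f m
  defines "f' == pad_oracle al (e 0) (e 1) f"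
  defines "cs == (%t. (step P f' (window w s0) ^^ t) (initial m))"
  assumes at: "code_at p l0 (sim_code D l0 P)"
    and rep: "represents D R 7 e s0 cf" "pc cf = l0" "below B cf" "mirrors e w s0 (initial m) s0"
    and R: "S < R" "F < R" and D: "\<And>I. I \<in> set P ==> 12 + depth (trans I) <= D" "17 <= D"
    and e: "e 0 <= e 1"
    and B: "\<And>I. I \<in> set P ==> peak_com D (trans I) Z <= B" "\<And>a l. Jz a l \<in> set P ==> peak D (src a) Z <= B" "Z <= B"
    and Z: "values_le Z 7 e s0" "\<And>h. f h <= Z" "\<And>j. w j <= Z" "\<And>u. below Z (cs u)" "\<And>u. length (comm (cs u)) < Z"
      "1 <= Z" "sz * e 1 <= Z" "0 < e 4" "0 < sg" "sg <= Z" "0 < q"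
    and halt: "halted P (cs t)"
  shows "\<exists>u s cf'. u <= 300 * t + 2 & reaches p f w B cf u cf' & pc cf' = l0 + sim_len P &
    represents D R 7 e s cf' & mirrors e w s0 (cs t) s & values_le Z 7 e s"
proof -
  have "\<exists>u s cf'. u <= 300 * t & reaches p f w B cf u cf' & pc cf' = block_pos l0 P (pc (cs t)) &
    represents D R 7 e s cf' & mirrors e w s0 (cs t) s & values_le Z 7 e s"
    unfolding cs_def f'_def
    by (rule reaches_simulation[OF at rep R _ D(2) e _ _ B(3) Z(1)])
      (use D(1) B(1,2) Z in \<open>simp_all add: cs_def f'_def\<close>)
  then obtain u s cf' where IH: "u <= 300 * t" "reaches p f w B cf u cf'" "pc cf' = block_pos l0 P (pc (cs t))"
    "represents D R 7 e s cf'" "mirrors e w s0 (cs t) s" "values_le Z 7 e s"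
    by blast
  have b: "below B cf'" using IH(2) by (auto simp: reaches_def)
  show ?thesis
  proof (cases "length P <= pc (cs t)")
    case True
    then have "pc cf' = l0 + sim_len P" using IH(3) block_pos_end by simp
    then show ?thesis using IH by (intro exI[of _ u] exI[of _ s] exI[of _ cf']) auto
  next
    case False
    let ?k = "pc (cs t)"
    have k: "?k < length P" "P ! ?k = Halt" using False halt by (auto simp: halted_def)
    have at': "code_at p (pc cf') [Lit 12 0, Jz 12 (l0 + sim_len P)]"
      using code_at_block[OF at k(1)] IH(3) by (simp add: block_def k(2) block_pos_end)
    define c1 where "c1 = step p f w cf'"
    have c1: "c1 = assign 12 0 cf'" using step_code_at[OF at'] by (simp add: c1_def)
    have b1: "below B c1" using b c1 below_assign by simp
    have r1: "reaches p f w B cf' 1 c1" using reaches_step[OF b] b1 unfolding c1_def by blast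
    define c2 where "c2 = step p f w c1"
    have c2: "c2 = c1\<lparr>pc := l0 + sim_len P\<rparr>"
      using step_code_at[of p c1 "Jz 12 (l0 + sim_len P)" "[]" f w] at' by (simp add: c2_def c1 code_at_Cons)
    have b2: "below B c2" using b1 c2 by (simp add: below_def)
    have r2: "reaches p f w B c1 1 c2" using reaches_step[OF b1] b2 unfolding c2_def by blast
    have "same_below 12 D cf' c2" using D(2) by (auto simp: same_below_def c2 c1)
    then have "represents D R 7 e s c2" using represents_same[OF IH(4)] by simp
    moreover have "u + 1 + 1 <= 300 * t + 2" using IH(1) by simp
    moreover have "pc c2 = l0 + sim_len P" by (simp add: c2)
    ultimately show ?thesis using reaches_trans[OF reaches_trans[OF IH(2) r1] r2] IH(5,6) by blast
  qed
qed

end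

section \<open>A Hadamard code over a prime field\<close>

text \<open>The inner product, over the field with \<open>p\<close> elements, of the base
  \<open>p\<close> digit vectors of \<open>d\<close> and \<open>x\<close>: the symbol at place
  \<open>x\<close> of the Hadamard codeword of \<open>d\<close>.\<close>

function had :: "nat => nat => nat => nat" where
  "had p d x = (if d = 0 \<or> p <= 1 then 0 else (d mod p * (x mod p) + had p (d div p) (x div p)) mod p)"
  by pat_completeness auto
termination by (relation "measure (%(p, d, x). d)") auto

declare had.simps [simp del]

lemma had_less: "1 < p ==> had p d x < p"
  by (subst had.simps) auto

lemma had_rec: "1 < p ==> had p d x = (d mod p * (x mod p) + had p (d div p) (x div p)) mod p"
  using had.simps[of p d x] had.simps[of p 0 "x div p"] by auto

lemma had_0: "had p 0 x = 0"
  by (simp add: had.simps)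

lemma cong_dvd_mod: "int p dvd int (a mod p) - int (b mod p) + c \<longleftrightarrow> int p dvd int a - int b + c"
proof -
  have *: "int x = int p * int (x div p) + int (x mod p)" for x
    by (metis mult_div_mod_eq of_nat_add of_nat_mult)
  have "int a - int b + c = (int (a mod p) - int (b mod p) + c) + int p * (int (a div p) - int (b div p))"
    using *[of a] *[of b] by (simp add: algebra_simps)
  then show ?thesis by (simp only:) (rule dvd_add_left_iff[symmetric], simp)
qed

text \<open>Induction on the number of digits. If the higher digits differ, then the induction
  hypothesis applies for each lowest digit of \<open>x\<close>, whose contribution joins the offset
  \<open>c\<close>. Otherwise the lowest digits differ, and a nontrivial linear equation over the
  field fixes the lowest digit of \<open>x\<close>. The offset is what makes the induction go
  through.\<close>

lemma had_collisions:
  assumes p: "prime p"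
  shows "d < p ^ k ==> d' < p ^ k ==> d ~= d' ==>
    p * card {x. x < p ^ k & int p dvd int (had p d x) - int (had p d' x) + c} <= p ^ k"
proof (induction k arbitrary: d d' c)
  case 0
  then show ?case by simp
next
  case (Suc k)
  have p1: "1 < p" using p prime_gt_1_nat by blast
  define d0 d1 d0' d1' where "d0 = d mod p" "d1 = d div p" "d0' = d' mod p" "d1' = d' div p"
  note defs = d0_d1_d0'_d1'_def
  let ?A = "{x. x < p ^ Suc k & int p dvd int (had p d x) - int (had p d' x) + c}"
  let ?B = "%x0. {x1. x1 < p ^ k &
    int p dvd int (had p d1 x1) - int (had p d1' x1) + ((int d0 - int d0') * int x0 + c)}"
  have lt: "x div p < p ^ k" if "x < p ^ Suc k" for x
    using that by (simp add: less_mult_imp_div_less mult.commute)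
  have cond: "int p dvd int (had p d x) - int (had p d' x) + c \<longleftrightarrow>
    int p dvd int (had p d1 (x div p)) - int (had p d1' (x div p)) + ((int d0 - int d0') * int (x mod p) + c)" for x
    unfolding had_rec[OF p1, of d] had_rec[OF p1, of d'] cong_dvd_mod defs
    by (simp add: algebra_simps)
  have sub: "?A \<subseteq> (\<Union>x0\<in>{..<p}. (%x1. x0 + p * x1) ` ?B x0)"
  proof
    fix x assume x: "x \<in> ?A"
    have "x = x mod p + p * (x div p)" by simp
    moreover have "x div p \<in> ?B (x mod p)" using x lt cond by auto
    moreover have "x mod p < p" using p1 by simp
    ultimately show "x \<in> (\<Union>x0\<in>{..<p}. (%x1. x0 + p * x1) ` ?B x0)" by blast
  qed
  have "card ?A <= card (\<Union>x0\<in>{..<p}. (%x1. x0 + p * x1) ` ?B x0)"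
    by (rule card_mono[OF _ sub]) auto
  also have "\<dots> <= (\<Sum>x0<p. card ((%x1. x0 + p * x1) ` ?B x0))"
    by (rule card_UN_le) auto
  also have "\<dots> <= (\<Sum>x0<p. card (?B x0))"
    by (intro sum_mono card_image_le) auto
  finally have le: "card ?A <= (\<Sum>x0<p. card (?B x0))" .
  show ?case
  proof (cases "d1 = d1'")
    case False
    have "d1 < p ^ k" "d1' < p ^ k" using Suc.prems lt by (auto simp: defs)
    then have "p * card (?B x0) <= p ^ k" for x0 using Suc.IH False by blast
    then have "(\<Sum>x0<p. p * card (?B x0)) <= (\<Sum>x0<p. p ^ k)" by (intro sum_mono)
    then have "p * (\<Sum>x0<p. card (?B x0)) <= p ^ Suc k" by (simp add: sum_distrib_left)
    then show ?thesis using le_trans[OF mult_le_mono2[OF le, of p]] by blast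
  next
    case True
    then have ne: "d0 ~= d0'" using Suc.prems(3) by (metis defs(1-4) div_mult_mod_eq)
    have uniq: "x = y" if "x < p" "y < p" "int p dvd (int d0 - int d0') * int x + c"
      "int p dvd (int d0 - int d0') * int y + c" for x y
    proof -
      have "int p dvd (int d0 - int d0') * (int x - int y)"
        using dvd_diff[OF that(3,4)] by (simp add: algebra_simps)
      moreover have "\<not> int p dvd (int d0 - int d0')"
      proof
        assume a: "int p dvd (int d0 - int d0')"
        have "d0 < p" "d0' < p" using p1 by (auto simp: defs)
        then have "\<bar>int d0 - int d0'\<bar> < int p" by linarith
        then show False using a ne zdvd_imp_le[of "int p" "\<bar>int d0 - int d0'\<bar>"] by auto
      qed
      ultimately have "int p dvd (int x - int y)"
        using p prime_dvd_mult_iff[of "int p"] by auto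
      moreover have "\<bar>int x - int y\<bar> < int p" using that by linarith
      ultimately show "x = y" using zdvd_imp_le[of "int p" "\<bar>int x - int y\<bar>"] by auto
    qed
    let ?X = "{x0. x0 < p & int p dvd (int d0 - int d0') * int x0 + c}"
    have "card (?B x0) = (if x0 \<in> ?X then p ^ k else 0)" if "x0 < p" for x0
      using True that by auto
    then have "(\<Sum>x0<p. card (?B x0)) = (\<Sum>x0<p. if x0 \<in> ?X then p ^ k else 0)" by simp
    also have "\<dots> = card ?X * p ^ k"
      by (simp add: sum.If_cases Int_def)
    also have "\<dots> <= 1 * p ^ k"
    proof (rule mult_le_mono1)
      show "card ?X <= 1"
        using uniq by (intro card_le_Suc0_iff_eq[THEN iffD2, simplified One_nat_def[symmetric]]) auto
    qed
    finally have "card ?A <= p ^ k" using le by linarith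
    then show ?thesis by simp
  qed
qed

text \<open>The \<open>h\<close> places form at most \<open>h div l + 1\<close> periods, and each of
  them contains at most \<open>l / p\<close> agreements; the additional \<open>l\<close> accounts
  for the incomplete period.\<close>

lemma had_agreement:
  assumes p: "prime p" and l: "l = p ^ k" and d: "d < l" "d' < l" "d ~= d'"
  shows "p * card {r. r < h & had p d (r mod l) = had p d' (r mod l)} <= h + l"
proof -
  let ?A = "{x. x < l & had p d x = had p d' x}"
  have "?A \<subseteq> {x. x < p ^ k & int p dvd int (had p d x) - int (had p d' x) + 0}" using l by auto
  then have "card ?A <= card {x. x < p ^ k & int p dvd int (had p d x) - int (had p d' x) + 0}"
    by (intro card_mono) auto
  then have A: "p * card ?A <= l"
    using had_collisions[OF p, of d k d' 0] d l by (meson le_trans mult_le_mono2)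
  have l0: "0 < l" using d by simp
  have sub: "(%r. (r div l, r mod l)) ` {r. r < h & had p d (r mod l) = had p d' (r mod l)} \<subseteq> {..h div l} \<times> ?A"
    using l0 by (auto intro: div_le_mono)
  have "inj_on (%r. (r div l, r mod l)) {r. r < h & had p d (r mod l) = had p d' (r mod l)}"
    by (rule inj_onI) (metis div_mult_mod_eq prod.inject)
  then have "card {r. r < h & had p d (r mod l) = had p d' (r mod l)} <= card ({..h div l} \<times> ?A)"
    using sub by (intro card_inj_on_le) auto
  also have "\<dots> = (h div l + 1) * card ?A" by (simp add: card_cartesian_product)
  finally have "p * card {r. r < h & had p d (r mod l) = had p d' (r mod l)} <= (h div l + 1) * (p * card ?A)"
    using mult_le_mono2[of _ "(h div l + 1) * card ?A" p] by (simp add: mult_ac)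
  also have "\<dots> <= (h div l + 1) * l" using A by (rule mult_le_mono2)
  also have "\<dots> <= h + l" by (simp add: add_mult_distrib)
  finally show ?thesis .
qed

lemma digit_sum:
  fixes a :: "nat => nat"
  assumes "\<And>k. k < C ==> a k < p"
  shows "(\<Sum>k<C. a k * p ^ k) < p ^ C & (\<forall>j<C. (\<Sum>k<C. a k * p ^ k) div p ^ j mod p = a j)"
  using assms
proof (induction C)
  case 0
  then show ?case by simp
next
  case (Suc C)
  let ?S = "\<Sum>k<C. a k * p ^ k"
  have IH: "?S < p ^ C" "\<And>j. j < C ==> ?S div p ^ j mod p = a j" using Suc by auto
  have p: "0 < p" using Suc.prems[of 0] by simp
  have aC: "a C < p" using Suc.prems by simp
  have "?S + a C * p ^ C < (a C + 1) * p ^ C" using IH(1) by simp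
  also have "\<dots> <= p * p ^ C" using aC by (intro mult_le_mono1) simp
  finally have 1: "?S + a C * p ^ C < p ^ Suc C" by simp
  have 2: "(?S + a C * p ^ C) div p ^ j mod p = a j" if "j < Suc C" for j
  proof (cases "j = C")
    case True
    have "(a C * p ^ C + ?S) div p ^ C = a C" by (rule block_div_mod(1)[OF IH(1)])
    then have "(?S + a C * p ^ C) div p ^ C = a C" by (simp only: add.commute)
    then show ?thesis using True aC by simp
  next
    case False
    then have "j < C" using that by simp
    then obtain m where m: "C = j + Suc m" using less_imp_Suc_add by fastforce
    have "a C * p ^ C = (a C * p ^ m * p) * p ^ j" by (simp add: m power_add mult_ac)
    then have "(?S + a C * p ^ C) div p ^ j = a C * p ^ m * p + ?S div p ^ j"
      using p by (simp only:) (rule div_mult_self1, simp)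
    then show ?thesis using IH(2)[of j] False that by simp
  qed
  show ?case using 1 2 by simp
qed

text \<open>A symbol of the code for a message of \<open>C\<close> digits: the Hadamard symbols of
  all digits at the same place, packed as base \<open>p\<close> digits. Each digit of the message
  can thus be list decoded by itself.\<close>

definition csym :: "nat => nat => (nat => nat) => nat => nat" where
  "csym p C dg x = (\<Sum>k<C. had p (dg k) x * p ^ k)"

lemma csym_less: "1 < p ==> csym p C dg x < p ^ C"
  unfolding csym_def by (rule digit_sum[THEN conjunct1]) (rule had_less)

lemma csym_digit: "1 < p ==> k < C ==> csym p C dg x div p ^ k mod p = had p (dg k) x"
  unfolding csym_def by (rule digit_sum[THEN conjunct2, rule_format]) (rule had_less)

text \<open>A Johnson type bound. Among \<open>2 * g\<close> such sets the sizes add up to at least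
  \<open>2 * h\<close>, while the intersections over ordered pairs add up to at most
  \<open>8 * g * g * h / p < h\<close>. This contradicts that all sets lie among \<open>h\<close>
  points, and it is the origin of the condition on \<open>p\<close>.\<close>

lemma few_large_sets:
  fixes A :: "nat => nat set"
  assumes "finite L" "0 < g" "0 < h" and sub: "\<And>d. d \<in> L ==> A d \<subseteq> {..<h}"
    and large: "\<And>d. d \<in> L ==> h <= g * card (A d)"
    and small: "\<And>d d'. d \<in> L ==> d' \<in> L ==> d ~= d' ==> p * card (A d \<inter> A d') <= 2 * h"
    and p: "8 * g * g < p"
  shows "card L < 2 * g"
proof (rule ccontr)
  assume "\<not> card L < 2 * g"
  then have "2 * g <= card L" by simp
  then obtain M where M: "M \<subseteq> L" "card M = 2 * g" "finite M"
    by (rule obtain_subset_with_card_n)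
  define m where "m r = (\<Sum>d\<in>M. of_bool (r \<in> A d) :: nat)" for r
  have cA: "card (A d) = (\<Sum>r<h. of_bool (r \<in> A d))" if "d \<in> M" for d
  proof -
    have "{..<h} \<inter> {r. r \<in> A d} = A d" using sub M that by blast
    then show ?thesis by (simp add: sum_of_bool_eq)
  qed
  have cAA: "card (A d \<inter> A d') = (\<Sum>r<h. of_bool (r \<in> A d) * of_bool (r \<in> A d'))" if "d \<in> M" "d' \<in> M" for d d'
  proof -
    have "{..<h} \<inter> {r. r \<in> A d & r \<in> A d'} = A d \<inter> A d'" using sub M that by blast
    then show ?thesis by (simp only: of_bool_conj[symmetric] sum_of_bool_eq finite_lessThan) simp
  qed
  define S where "S = (\<Sum>d\<in>M. card (A d))"
  have S1: "S = (\<Sum>r<h. m r)"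
    unfolding S_def m_def using cA by (simp add: sum.swap[of _ M])
  have S2: "(\<Sum>d\<in>M. \<Sum>d'\<in>M. card (A d \<inter> A d')) = (\<Sum>r<h. m r * m r)"
  proof -
    have "(\<Sum>d\<in>M. \<Sum>d'\<in>M. card (A d \<inter> A d')) = (\<Sum>d\<in>M. \<Sum>d'\<in>M. \<Sum>r<h. of_bool (r \<in> A d) * of_bool (r \<in> A d'))"
      using cAA by (intro sum.cong refl) auto
    also have "\<dots> = (\<Sum>d\<in>M. \<Sum>r<h. \<Sum>d'\<in>M. of_bool (r \<in> A d) * of_bool (r \<in> A d'))"
      by (intro sum.cong refl sum.swap)
    also have "\<dots> = (\<Sum>r<h. \<Sum>d\<in>M. \<Sum>d'\<in>M. of_bool (r \<in> A d) * of_bool (r \<in> A d'))"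
      by (rule sum.swap)
    also have "\<dots> = (\<Sum>r<h. m r * m r)" by (simp add: m_def sum_product)
    finally show ?thesis .
  qed
  define off where "off = (\<Sum>d\<in>M. \<Sum>d'\<in>M - {d}. card (A d \<inter> A d'))"
  have "(\<Sum>d\<in>M. \<Sum>d'\<in>M. card (A d \<inter> A d')) = S + off"
    unfolding S_def off_def sum.distrib[symmetric] using M(3)
    by (intro sum.cong refl) (simp add: sum.remove)
  then have SO: "(\<Sum>r<h. m r * m r) = S + off" using S2 by simp
  \<comment> \<open>Summed over \<open>r\<close> this square inequality replaces a Bonferroni
    estimate for the union: the total size is at most \<open>h\<close> plus the total of the
    intersections.\<close>
  have "2 * m r <= 1 + m r * m r" for r
    by (cases "m r") auto
  then have "(\<Sum>r<h. 2 * m r) <= (\<Sum>r<h. 1 + m r * m r)" by (intro sum_mono)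
  moreover have "(\<Sum>r<h. 1 + m r * m r) = h + (\<Sum>r<h. m r * m r)" by (simp only: sum.distrib) simp
  ultimately have "2 * S <= h + (\<Sum>r<h. m r * m r)" by (simp add: S1 sum_distrib_left)
  then have le: "S <= h + off" using SO by linarith
  have "p * off <= (\<Sum>d\<in>M. \<Sum>d'\<in>M - {d}. 2 * h)"
    unfolding off_def sum_distrib_left using small M(1) by (intro sum_mono) auto
  also have "\<dots> <= (\<Sum>d\<in>M. \<Sum>d'\<in>M. 2 * h)" using M(3) by (intro sum_mono sum_mono2) auto
  also have "\<dots> = 8 * g * g * h" using M(2) by simp
  also have "\<dots> < p * h" using p \<open>0 < h\<close> by simp
  finally have "off < h" by simp
  moreover have "2 * h <= S"
  proof -
    have "(\<Sum>d\<in>M. h) <= (\<Sum>d\<in>M. g * card (A d))" using large M(1) by (intro sum_mono) auto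
    then have "2 * g * h <= g * S" using M(2) by (simp add: S_def sum_distrib_left)
    then show ?thesis using \<open>0 < g\<close> by simp
  qed
  ultimately show False using le by linarith
qed

lemma sum_tally:
  assumes l: "0 < l" and Q: "\<And>y. y \<in> set ys ==> y div q < Q"
  shows "(\<Sum>x<l. \<Sum>c<Q. of_bool (P c x) * tally q Q l ys (x * Q + c))
    = card {k. k < length ys & P (ys ! k div q) (k mod l)}"
  using Q
proof (induction ys rule: rev_induct)
  case Nil
  then show ?case by (simp add: tally_def)
next
  case (snoc y ys)
  let ?x0 = "length ys mod l" and ?c0 = "y div q"
  have c0: "?c0 < Q" and x0: "?x0 < l" using snoc.prems l by auto
  have eq: "?x0 * Q + ?c0 = x * Q + c \<longleftrightarrow> x = ?x0 & c = ?c0" if "c < Q" for x c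
  proof
    assume a: "?x0 * Q + ?c0 = x * Q + c"
    have "(?x0 * Q + ?c0) div Q = (x * Q + c) div Q" "(?x0 * Q + ?c0) mod Q = (x * Q + c) mod Q"
      using a by simp_all
    then show "x = ?x0 & c = ?c0" using block_div_mod[OF c0] block_div_mod[OF that] by simp
  qed simp
  have "(\<Sum>x<l. \<Sum>c<Q. of_bool (P c x) * tally q Q l (ys @ [y]) (x * Q + c)) =
    (\<Sum>x<l. \<Sum>c<Q. of_bool (P c x) * tally q Q l ys (x * Q + c))
    + (\<Sum>x<l. \<Sum>c<Q. of_bool (P c x) * (if x = ?x0 & c = ?c0 then 1 else 0))"
    unfolding sum.distrib[symmetric]
    by (intro sum.cong refl) (auto simp: tally_snoc eq distrib_left)
  also have "(\<Sum>x<l. \<Sum>c<Q. of_bool (P c x) * (if x = ?x0 & c = ?c0 then 1 else 0)) = (of_bool (P ?c0 ?x0) :: nat)"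
  proof -
    have "(\<Sum>c<Q. of_bool (P c x) * (if x = ?x0 & c = ?c0 then 1 else 0)) = (if x = ?x0 then of_bool (P ?c0 ?x0) else (0::nat))" for x
    proof (cases "x = ?x0")
      case True
      have "(\<Sum>c<Q. of_bool (P c x) * (if x = ?x0 & c = ?c0 then 1 else 0)) = (\<Sum>c<Q. if c = ?c0 then of_bool (P ?c0 ?x0) else (0::nat))"
        using True by (intro sum.cong) auto
      then show ?thesis using c0 True by simp
    qed simp
    then show ?thesis using x0 by simp
  qed
  also have "(\<Sum>x<l. \<Sum>c<Q. of_bool (P c x) * tally q Q l ys (x * Q + c))
     = card {k. k < length ys & P (ys ! k div q) (k mod l)}"
    using snoc by simp
  also have "\<dots> + of_bool (P ?c0 ?x0) = card {k. k < length (ys @ [y]) & P ((ys @ [y]) ! k div q) (k mod l)}"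
  proof -
    let ?A = "{k. k < length ys & P (ys ! k div q) (k mod l)}"
    have "{k. k < length (ys @ [y]) & P ((ys @ [y]) ! k div q) (k mod l)}
      = ?A \<union> (if P ?c0 ?x0 then {length ys} else {})"
      by (auto simp: nth_append less_Suc_eq)
    moreover have "finite ?A" "length ys \<notin> ?A" by auto
    ultimately show ?thesis by auto
  qed
  finally show ?case .
qed

lemma sum_tally_word:
  assumes l: "0 < l" and Q: "\<And>y. y \<in> set ys ==> y div q < Q" and W: "\<And>x. x < l ==> W x < Q"
  shows "(\<Sum>x<l. tally q Q l ys (x * Q + W x)) = card {k. k < length ys & ys ! k div q = W (k mod l)}"
proof -
  have "(\<Sum>c<Q. of_bool (c = W x) * tally q Q l ys (x * Q + c)) = tally q Q l ys (x * Q + W x)" if "x < l" for x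
  proof -
    have "(\<Sum>c<Q. of_bool (c = W x) * tally q Q l ys (x * Q + c)) = (\<Sum>c<Q. if c = W x then tally q Q l ys (x * Q + c) else 0)"
      by (intro sum.cong) auto
    then show ?thesis using W[OF that] by simp
  qed
  then have "(\<Sum>x<l. tally q Q l ys (x * Q + W x)) = (\<Sum>x<l. \<Sum>c<Q. of_bool (c = W x) * tally q Q l ys (x * Q + c))"
    by simp
  then show ?thesis using sum_tally[OF l Q, where P = "%c x. c = W x"] by simp
qed

lemma four_digits:
  fixes v l :: nat
  assumes "v < l ^ 4"
  shows "(\<Sum>j<4. v div l ^ j mod l * l ^ j) = v"
proof -
  have "(\<Sum>j<k. v div l ^ j mod l * l ^ j) = v mod l ^ k" for k
  proof (induction k)
    case (Suc k)
    have "v mod (l ^ k * l) = l ^ k * (v div l ^ k mod l) + v mod l ^ k" by (rule mod_mult2_eq)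
    then show ?case using Suc by (simp add: mult.commute)
  qed simp
  then show ?thesis using assms by simp
qed

section \<open>Executions of coding schemes\<close>

lemma step_halted: "halted p c ==> (step p f w ^^ k) c = c"
  by (induction k) (auto simp: step_def)

lemma halted_mono:
  assumes "halted p ((step p f w ^^ t) c)" "t <= u"
  shows "(step p f w ^^ u) c = (step p f w ^^ t) c"
proof -
  obtain k where "u = k + t" using assms(2) by (metis le_add_diff_inverse2)
  then show ?thesis using step_halted[OF assms(1), where f = f and w = w and k = k] by (simp add: funpow_add)
qed

lemma final_eq:
  assumes "halts_by S \<Pi> n w P t"
  shows "final S \<Pi> n w P = state S \<Pi> n w P t"
proof -
  define t0 where "t0 = (LEAST t. halts_by S \<Pi> n w P t)"
  have "halts_by S \<Pi> n w P t0" "t0 <= t"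
    unfolding t0_def using assms by (auto intro: LeastI Least_le)
  then have "state S \<Pi> n w P t = state S \<Pi> n w P t0"
    using halted_mono[where p = "prog S P" and f = "oracle_of \<Pi> n P" and w = w and t = t0 and c = "initial n" and u = t]
    by (simp add: halts_by_def state_def)
  then show ?thesis unfolding final_def t0_def[symmetric] ..
qed

lemma nonadaptiveD:
  assumes "nonadaptive_scheme \<sigma> S" "1 <= n" "\<Pi> \<in> protocols \<sigma>" "w \<in> words S"
  shows "0 < rounds S n" "\<exists>t. halts_by S \<Pi> n w P t" "length (comm (final S \<Pi> n w P)) = rounds S n"
    and "i < rounds S n ==> turn S n i = P ==> \<exists>v<alphabet S. comm (final S \<Pi> n w P) ! i = Some v"
    and "i < rounds S n ==> turn S n i ~= P ==> comm (final S \<Pi> n w P) ! i = None"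
proof -
  have 1: "rounds S n > 0 & (\<forall>\<Pi>\<in>protocols \<sigma>. \<forall>w\<in>words S. \<forall>P.
          (\<exists>t. halts_by S \<Pi> n w P t) &
          length (comm (final S \<Pi> n w P)) = rounds S n &
          (\<forall>i<rounds S n.
             if turn S n i = P
             then \<exists>v<alphabet S. comm (final S \<Pi> n w P) ! i = Some v
             else comm (final S \<Pi> n w P) ! i = None))"
    using assms(1)[unfolded nonadaptive_scheme_def, THEN spec, of n] assms(2) by simp
  then have 2: "(\<exists>t. halts_by S \<Pi> n w P t) &
          length (comm (final S \<Pi> n w P)) = rounds S n &
          (\<forall>i<rounds S n.
             if turn S n i = P
             then \<exists>v<alphabet S. comm (final S \<Pi> n w P) ! i = Some v
             else comm (final S \<Pi> n w P) ! i = None)"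
    using assms(3,4) by (elim conjE) (drule (1) bspec, drule (1) bspec, erule allE)
  show "0 < rounds S n" using 1 by (rule conjunct1)
  show "\<exists>t. halts_by S \<Pi> n w P t" "length (comm (final S \<Pi> n w P)) = rounds S n" using 2 by simp_all
  show "\<exists>v<alphabet S. comm (final S \<Pi> n w P) ! i = Some v" if "i < rounds S n" "turn S n i = P"
    using 2 that by simp
  show "comm (final S \<Pi> n w P) ! i = None" if "i < rounds S n" "turn S n i ~= P"
    using 2 that by simp
qed

lemma step_grows: "\<exists>xs ys. comm (step p f w c) = comm c @ xs & length xs <= 1 & out (step p f w c) = out c @ ys & length ys <= 1"
proof (cases "halted p c")
  case False
  then show ?thesis by (cases "p ! pc c") (auto simp: step_def)
qed (auto simp: step_def)

lemma length_comm_state: "length (comm (state S \<Pi> n w P t)) <= t" "length (out (state S \<Pi> n w P t)) <= t"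
proof (induction t)
  case (Suc t)
  obtain xs ys where "comm (state S \<Pi> n w P (Suc t)) = comm (state S \<Pi> n w P t) @ xs" "length xs <= 1"
    "out (state S \<Pi> n w P (Suc t)) = out (state S \<Pi> n w P t) @ ys" "length ys <= 1"
    using step_grows[of "prog S P" "oracle_of \<Pi> n P" w "state S \<Pi> n w P t"] by (auto simp: state_def)
  then show "length (comm (state S \<Pi> n w P (Suc t))) <= Suc t" "length (out (state S \<Pi> n w P (Suc t))) <= Suc t"
    using Suc by auto
qed (auto simp: state_def initial_def)

text \<open>Either both configurations still coincide, or round \<open>m\<close> is over in both of
  them. When round \<open>m\<close> is executed its entry in \<open>comm\<close> is already
  determined: a transmission precedes any knowledge of \<open>w m\<close>, and a reception is
  recorded as \<open>None\<close> whatever it delivers.\<close>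

lemma step_causal:
  fixes p :: program and f :: "nat list => nat"
  assumes agree: "\<And>i. i < m ==> w i = w' i"
    and "c = c' \<or> m < length (comm c) & m < length (comm c') & take (Suc m) (comm c) = take (Suc m) (comm c')"
  defines "d == step p f w c" and "d' == step p f w' c'"
  shows "d = d' & length (comm d) <= m \<or> m < length (comm d) & m < length (comm d') & take (Suc m) (comm d) = take (Suc m) (comm d')"
proof (cases "m < length (comm c) & m < length (comm c') & take (Suc m) (comm c) = take (Suc m) (comm c')")
  case True
  obtain xs where 1: "comm d = comm c @ xs" using step_grows unfolding d_def by blast
  obtain ys where 2: "comm d' = comm c' @ ys" using step_grows unfolding d'_def by blast
  show ?thesis using True unfolding 1 2 by auto
next
  case False
  then have eq: "c = c'" and le: "length (comm c) <= m" using assms(2) by auto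
  have "d = d' \<or> length (comm c) = m & comm d = comm c @ [None] & comm d' = comm c @ [None]"
  proof (cases "halted p c")
    case False
    then show ?thesis
      using agree le unfolding d_def d'_def eq[symmetric]
      by (cases "p ! pc c") (auto simp: step_def le_less)
  qed (auto simp: d_def d'_def eq step_def)
  then show ?thesis using le by (auto simp: not_less[symmetric]) 
qed

lemma state_causal:
  assumes agree: "\<And>i. i < m ==> w i = w' i"
  shows "state S \<Pi> n w P t = state S \<Pi> n w' P t \<or>
    m < length (comm (state S \<Pi> n w P t)) & m < length (comm (state S \<Pi> n w' P t)) &
    take (Suc m) (comm (state S \<Pi> n w P t)) = take (Suc m) (comm (state S \<Pi> n w' P t))"
proof (induction t)
  case (Suc t)
  then show ?case
    using step_causal[where m = m and w = w and w' = w' and c = "state S \<Pi> n w P t"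
        and c' = "state S \<Pi> n w' P t" and p = "prog S P" and f = "oracle_of \<Pi> n P"] agree
    by (auto simp: state_def)
qed (simp add: state_def)

lemma final_causal:
  assumes "nonadaptive_scheme \<sigma> S" "1 <= n" "\<Pi> \<in> protocols \<sigma>" "w \<in> words S" "w' \<in> words S"
    and "\<And>i. i < m ==> w i = w' i" "k <= m"
  shows "comm (final S \<Pi> n w P) ! k = comm (final S \<Pi> n w' P) ! k"
proof -
  obtain t t' where t: "halts_by S \<Pi> n w P t" "halts_by S \<Pi> n w' P t'"
    using nonadaptiveD(2)[OF assms(1-3)] assms(4,5) by blast
  let ?u = "max t t'"
  have u: "halts_by S \<Pi> n w P ?u" "halts_by S \<Pi> n w' P ?u"
    using t halted_mono[where p = "prog S P" and f = "oracle_of \<Pi> n P" and c = "initial n" and u = ?u]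
    unfolding halts_by_def state_def by (metis max.cobounded1 max.cobounded2)+
  show ?thesis
    unfolding final_eq[OF u(1)] final_eq[OF u(2)]
    using state_causal[of m w w' S \<Pi> n P ?u] assms(6,7)
    by (metis le_imp_less_Suc nth_take)
qed

lemma list_decodingD:
  assumes "list_decoding \<sigma> S s \<rho>" "1 <= n" "\<Pi> \<in> protocols \<sigma>" "w \<in> words S"
    and "real (corruptions S \<Pi> n w) <= \<rho> * real (rounds S n)"
  obtains ts where "out (final S \<Pi> n w P) = concat ts" "length ts <= s"
    "set ts \<subseteq> transcripts \<sigma> n" "transcript \<Pi> n \<in> set ts"
proof -
  have "\<exists>ts. out (final S \<Pi> n w P) = concat ts & length ts <= s &
    set ts \<subseteq> transcripts \<sigma> n & transcript \<Pi> n \<in> set ts"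
    using assms(1)[unfolded list_decoding_def, THEN spec, of n] assms(2-5) by simp
  then show ?thesis using that by blast
qed

text \<open>The word is fixed round by round; by causality changing it in round \<open>m\<close>
  leaves everything transmitted up to round \<open>m\<close> as it was. Setting it to 0 beyond the
  last round makes the word determined by its first \<open>rounds S n\<close> symbols, as the
  counting argument requires.\<close>

lemma honest_word:
  assumes S: "nonadaptive_scheme \<sigma> S" "1 <= n" "\<Pi> \<in> protocols \<sigma>" "0 < alphabet S"
  shows "\<exists>w\<in>words S. (\<forall>i\<ge>rounds S n. w i = 0) & corruptions S \<Pi> n w = 0"
proof -
  have "\<exists>w\<in>words S. (\<forall>i\<ge>m. w i = 0) & (\<forall>i<m. comm (final S \<Pi> n w (turn S n i)) ! i = Some (w i))"
    if "m <= rounds S n" for m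
    using that
  proof (induction m)
    case 0
    show ?case using S(4) by (intro bexI[of _ "%_. 0"]) (auto simp: words_def)
  next
    case (Suc m)
    then obtain w where w: "w \<in> words S" "\<forall>i\<ge>m. w i = 0"
      "\<forall>i<m. comm (final S \<Pi> n w (turn S n i)) ! i = Some (w i)" by auto
    obtain v where v: "v < alphabet S" "comm (final S \<Pi> n w (turn S n m)) ! m = Some v"
      using nonadaptiveD(4)[OF S(1-3) w(1), of m "turn S n m"] Suc.prems by auto
    define w' where "w' = w(m := v)"
    have w': "w' \<in> words S" "\<And>i. i ~= m ==> w' i = w i" "w' m = v"
      using w(1) v(1) by (auto simp: words_def w'_def)
    have eq: "comm (final S \<Pi> n w' P) ! i = comm (final S \<Pi> n w P) ! i" if "i <= m" for i P
      using final_causal[OF S(1-3) w'(1) w(1), of m i P] that w'(2) by simp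
    have "\<forall>i\<ge>Suc m. w' i = 0" using w(2) w'(2) by simp
    moreover have "comm (final S \<Pi> n w' (turn S n i)) ! i = Some (w' i)" if "i < Suc m" for i
      using that eq[of i] w(3) v(2) w'(2,3) by (cases "i = m") auto
    ultimately show ?case using w'(1) by blast
  qed
  then obtain w where "w \<in> words S" "\<forall>i\<ge>rounds S n. w i = 0"
    "\<forall>i<rounds S n. comm (final S \<Pi> n w (turn S n i)) ! i = Some (w i)" by blast
  then show ?thesis by (intro bexI[of _ w]) (auto simp: corruptions_def)
qed

lemma transcript_props: "length (transcript \<Pi> n) = n" "k <= n ==> take k (transcript \<Pi> n) = transcript \<Pi> k"
  by (induction n) (auto simp: le_Suc_eq)

lemma transcript_nth: "k < n ==> transcript \<Pi> n ! k = next_symbol \<Pi> (transcript \<Pi> k)"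
proof (induction n)
  case (Suc n)
  then show ?case by (cases "k = n") (auto simp: nth_append transcript_props)
qed simp

lemma concat_equal_lengths:
  assumes "\<forall>t\<in>set ts. length t = n" "j < length ts"
  shows "take n (drop (j * n) (concat ts)) = ts ! j" "(j + 1) * n <= length (concat ts)"
  using assms
proof (induction ts arbitrary: j)
  case (Cons t ts)
  {
    case 1
    then show ?case using Cons.IH(1)[of "j - 1"] by (cases j) auto
  next
    case 2
    then show ?case using Cons.IH(2)[of "j - 1"] by (cases j) auto
  }
qed auto

text \<open>
  If only Alice speaks, then Bob's list depends on the received word only, so the words have to
  account for all transcripts.
\<close>

lemma rounds_lower_bound:
  assumes S: "nonadaptive_scheme \<sigma> S" "list_decoding \<sigma> S s \<rho>" "0 <= \<rho>" "1 <= n" "0 < alphabet S" "1 <= \<sigma>"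
  shows "\<sigma> ^ n <= alphabet S ^ rounds S n * s"
proof -
  let ?N = "rounds S n"
  define pr :: "nat list => protocol" where
    "pr x = \<lparr>speaker = %_. Alice, next_symbol = %h. if length h < n then x ! length h else 0\<rparr>" for x
  have pr: "pr x \<in> protocols \<sigma>" if "x \<in> transcripts \<sigma> n" for x
  proof -
    have "x ! k < \<sigma>" if "k < n" for k
    proof -
      have "x ! k \<in> set x" using \<open>x \<in> transcripts \<sigma> n\<close> that by (simp add: transcripts_def)
      then show ?thesis using \<open>x \<in> transcripts \<sigma> n\<close> by (auto simp: transcripts_def)
    qed
    then show ?thesis using S(6) by (auto simp: pr_def protocols_def)
  qed
  have tr: "transcript (pr x) k = take k x" if "length x = n" "k <= n" for x k
    using that(2)
  proof (induction k)
    case (Suc k)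
    then show ?case using that(1) by (simp add: pr_def take_Suc_conv_app_nth)
  qed simp
  define ow where "ow x = (SOME w. w \<in> words S & (\<forall>i\<ge>?N. w i = 0) & corruptions S (pr x) n w = 0)" for x
  have ow: "ow x \<in> words S & (\<forall>i\<ge>?N. ow x i = 0) & corruptions S (pr x) n (ow x) = 0" if "x \<in> transcripts \<sigma> n" for x
  proof -
    have "\<exists>w. w \<in> words S & (\<forall>i\<ge>?N. w i = 0) & corruptions S (pr x) n w = 0"
      using honest_word[OF S(1,4) pr[OF that] S(5)] by (simp add: Bex_def)
    then show ?thesis unfolding ow_def by (rule someI_ex)
  qed
  define G where "G w = out (final S (pr []) n w Bob)" for w
  have or: "oracle_of (pr x) n Bob = oracle_of (pr []) n Bob" for x
    by (rule ext) (simp add: oracle_of_def pr_def)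
  have outG: "out (final S (pr x) n w Bob) = G w" for x w
    unfolding G_def final_def halts_by_def state_def or[of x] ..
  have "\<exists>j<s. x = take n (drop (j * n) (G (ow x)))" if x: "x \<in> transcripts \<sigma> n" for x
  proof -
    have lx: "length x = n" using x by (simp add: transcripts_def)
    have owx: "ow x \<in> words S" "corruptions S (pr x) n (ow x) = 0" using ow[OF x] by auto
    have cor: "real (corruptions S (pr x) n (ow x)) <= \<rho> * real ?N" using owx(2) S(3) by simp
    obtain ts where ts: "G (ow x) = concat ts" "length ts <= s" "set ts \<subseteq> transcripts \<sigma> n"
      "transcript (pr x) n \<in> set ts"
      by (rule list_decodingD[OF S(2,4) pr[OF x] owx(1) cor, of Bob, unfolded outG])
    then obtain j where j: "j < length ts" "ts ! j = x" using tr[OF lx, of n] lx by (auto simp: in_set_conv_nth)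
    have "\<forall>t\<in>set ts. length t = n" using ts(3) by (auto simp: transcripts_def)
    then show ?thesis using concat_equal_lengths(1)[OF _ j(1)] j ts by (intro exI[of _ j]) auto
  qed
  then have "\<forall>x\<in>transcripts \<sigma> n. \<exists>j. j < s & x = take n (drop (j * n) (G (ow x)))" by blast
  then obtain jj where "\<forall>x\<in>transcripts \<sigma> n. jj x < s & x = take n (drop (jj x * n) (G (ow x)))"
    unfolding bchoice_iff by blast
  then have jj: "jj x < s & x = take n (drop (jj x * n) (G (ow x)))" if "x \<in> transcripts \<sigma> n" for x
    using that by blast
  \<comment> \<open>The received word fixes Bob's output, and the index \<open>jj x\<close> selects
    \<open>x\<close> from it, so this pair determines \<open>x\<close>.\<close>
  let ?h = "%x. (map (ow x) [0..<?N], jj x)"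
  have inj: "inj_on ?h (transcripts \<sigma> n)"
  proof (rule inj_onI)
    fix x y assume xy: "x \<in> transcripts \<sigma> n" "y \<in> transcripts \<sigma> n" "?h x = ?h y"
    then have e: "map (ow x) [0..<?N] = map (ow y) [0..<?N]" and jeq: "jj x = jj y" by auto
    have "ow x i = ow y i" for i
    proof (cases "i < ?N")
      case True
      then show ?thesis using arg_cong[OF e, of "%xs. xs ! i"] by simp
    qed (use ow xy in auto)
    then have "ow x = ow y" by (rule ext)
    have "x = take n (drop (jj x * n) (G (ow x)))" using jj[OF xy(1)] by (rule conjunct2)
    also have "\<dots> = take n (drop (jj y * n) (G (ow y)))" by (simp only: jeq \<open>ow x = ow y\<close>)
    also have "\<dots> = y" using jj[OF xy(2)] by (rule conjunct2[THEN sym])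
    finally show "x = y" .
  qed
  have sub: "?h ` transcripts \<sigma> n \<subseteq> {xs. set xs \<subseteq> {..<alphabet S} & length xs = ?N} \<times> {..<s}"
  proof
    fix z assume "z \<in> ?h ` transcripts \<sigma> n"
    then obtain x where x: "x \<in> transcripts \<sigma> n" "z = ?h x" by blast
    have "ow x i < alphabet S" for i using ow[OF x(1)] by (simp add: words_def)
    then show "z \<in> {xs. set xs \<subseteq> {..<alphabet S} & length xs = ?N} \<times> {..<s}"
      using jj[OF x(1)] by (auto simp: x(2))
  qed
  have "card (transcripts \<sigma> n) <= card ({xs. set xs \<subseteq> {..<alphabet S} & length xs = ?N} \<times> {..<s})"
    using inj sub by (rule card_inj_on_le) (auto intro: finite_lists_length_eq)
  also have "\<dots> = alphabet S ^ ?N * s" by (simp add: card_cartesian_product card_lists_length_eq)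
  also have "card (transcripts \<sigma> n) = \<sigma> ^ n"
  proof -
    have "transcripts \<sigma> n = {xs. set xs \<subseteq> {..<\<sigma>} & length xs = n}" by (auto simp: transcripts_def)
    then show ?thesis by (simp add: card_lists_length_eq)
  qed
  finally show ?thesis .
qed

text \<open>In an undisturbed execution Alice goes through all rounds and prints at least one
  transcript, and a step contributes at most one round or one printed symbol. Consequently extra
  work linear in the length and in the rounds is within the time of the given scheme.\<close>

lemma time_lower_bound:
  assumes S: "nonadaptive_scheme \<sigma> S" "list_decoding \<sigma> S s \<rho>" "0 <= \<rho>" "runs_in \<sigma> S T" "1 <= n" "0 < alphabet S" "1 <= \<sigma>"
  shows "n <= T n" "rounds S n <= T n"
proof -
  define \<Pi> :: protocol where "\<Pi> = \<lparr>speaker = %_. Alice, next_symbol = %_. 0\<rparr>"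
  have p: "\<Pi> \<in> protocols \<sigma>" using S(7) by (simp add: \<Pi>_def protocols_def)
  obtain w where w: "w \<in> words S" "corruptions S \<Pi> n w = 0"
    using honest_word[OF S(1,5) p S(6)] by blast
  obtain tA tB where t: "halts_by S \<Pi> n w Alice tA" "tA + tB <= T n"
    using S(4,5) p w(1) unfolding runs_in_def by blast
  have "length (comm (final S \<Pi> n w Alice)) = rounds S n"
    by (rule nonadaptiveD(3)[OF S(1,5) p w(1)])
  then show "rounds S n <= T n" using length_comm_state(1)[of S \<Pi> n w Alice tA] t final_eq[OF t(1)] by simp
  have cor: "real (corruptions S \<Pi> n w) <= \<rho> * real (rounds S n)" using w S(3) by simp
  obtain ts where ts: "out (final S \<Pi> n w Alice) = concat ts" "set ts \<subseteq> transcripts \<sigma> n"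
    "transcript \<Pi> n \<in> set ts"
    by (rule list_decodingD[OF S(2,5) p w(1) cor, of Alice])
  then obtain j where j: "j < length ts" by (auto simp: in_set_conv_nth)
  have "\<forall>t\<in>set ts. length t = n" using ts(2) by (auto simp: transcripts_def)
  then have "n <= length (concat ts)" using concat_equal_lengths(2)[OF _ j] by fastforce
  then show "n <= T n" using length_comm_state(2)[of S \<Pi> n w Alice tA] t final_eq[OF t(1)] ts(1) by simp
qed

section \<open>Candidate transcripts\<close>

text \<open>Short protocols are padded to a length at which the given scheme has enough rounds for
  the code.\<close>

definition pad_protocol :: "nat => protocol => protocol" where
  "pad_protocol n \<Pi> = \<lparr>speaker = %k. if k < n then speaker \<Pi> k else Alice,
     next_symbol = %h. if length h < n then next_symbol \<Pi> h else 0\<rparr>"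

lemma pad_protocol_in: "\<Pi> \<in> protocols \<sigma> ==> 1 <= \<sigma> ==> pad_protocol n \<Pi> \<in> protocols \<sigma>"
  by (auto simp: pad_protocol_def protocols_def)

lemma pad_oracle_eq:
  "n <= m ==> pad_oracle (P = Alice) n m (oracle_of \<Pi> n P) = oracle_of (pad_protocol n \<Pi>) m P"
  by (auto simp: fun_eq_iff pad_oracle_def oracle_of_def pad_protocol_def)

lemma transcript_pad: "k <= n ==> transcript (pad_protocol n \<Pi>) k = transcript \<Pi> k"
  by (induction k) (auto simp: pad_protocol_def transcript_props)

definition consistent :: "(nat list => nat) => nat list => bool" where
  "consistent f t \<longleftrightarrow> (\<forall>j<length t. f (take j t) ~= 0 --> t ! j = f (take j t) - 1)"

lemma transcript_consistent: "consistent (oracle_of \<Pi> n P) (transcript \<Pi> n)"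
  by (auto simp: consistent_def oracle_of_def transcript_props transcript_nth)

text \<open>Repairing proceeds from left to right and queries the prefix that is already repaired,
  which makes any string consistent. A string that is consistent is reproduced: as long as the
  prefixes coincide, the oracle dictates the symbol that is already there. So the true transcript
  survives.\<close>

lemma repaired:
  assumes "length r = length x" "\<And>j. j < length x ==> r ! j = (if f (take j r) = 0 then x ! j else f (take j r) - 1)"
  shows "consistent f r" "consistent f x ==> r = x"
proof -
  show "consistent f r" using assms by (auto simp: consistent_def)
  assume c: "consistent f x"
  have "take j r = take j x" if "j <= length x" for j
    using that
  proof (induction j)
    case (Suc j)
    then have "r ! j = x ! j" using assms(2)[of j] c by (auto simp: consistent_def)
    then show ?case using Suc assms(1) by (simp add: take_Suc_conv_app_nth)
  qed simp
  then show "r = x" using assms(1) by (metis order_refl take_all)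
qed

text \<open>The value \<open>m\<close> stands for equality, so that stored divergence positions
  double as an equality test between candidates.\<close>

definition first_diff :: "nat => nat list => nat list => nat" where
  "first_diff m x y = (if \<exists>j<m. x ! j ~= y ! j then LEAST j. x ! j ~= y ! j else m)"

lemma first_diff_props:
  assumes "length x = m" "length y = m" "x ~= y"
  defines "d == first_diff m x y"
  shows "d < m" "x ! d ~= y ! d" "take d x = take d y"
proof -
  have ex: "\<exists>j<m. x ! j ~= y ! j" using assms by (metis nth_equalityI)
  then have d: "d = (LEAST j. x ! j ~= y ! j)" by (simp add: d_def first_diff_def)
  obtain j where j: "j < m" "x ! j ~= y ! j" using ex by blast
  show "x ! d ~= y ! d" unfolding d using j(2) by (rule LeastI)
  show dm: "d < m" unfolding d using j Least_le[of "%j. x ! j ~= y ! j" j] by simp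
  show "take d x = take d y"
  proof (rule nth_equalityI)
    fix i assume "i < length (take d x)"
    then have "i < d" by simp
    then show "take d x ! i = take d y ! i" using not_less_Least[of i "%j. x ! j ~= y ! j"] d by auto
  qed (use assms in simp)
qed

lemma first_diff_same: "first_diff m x x = m"
  by (simp add: first_diff_def)

lemma first_diff_le:
  assumes "length x = m" "length y = m"
  shows "first_diff m x y <= m"
  using first_diff_props(1)[OF assms] first_diff_same[of m x] by (cases "x = y") auto

lemma first_diff_eq_iff: "length x = m ==> length y = m ==> first_diff m x y = m \<longleftrightarrow> x = y"
  using first_diff_props(1)[of x m y] first_diff_same[of m x] by (cases "x = y") auto

text \<open>In a round in which \<open>P\<close> speaks, the oracle dictates the same continuation
  of the common prefix to both candidates.\<close>

lemma consistent_diverge: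
  assumes "consistent (oracle_of \<Pi> m P) x" "consistent (oracle_of \<Pi> m P) y" "length x = m" "length y = m" "x ~= y"
  shows "speaker \<Pi> (first_diff m x y) ~= P"
proof
  assume sp: "speaker \<Pi> (first_diff m x y) = P"
  note d = first_diff_props[OF assms(3-5)]
  have "oracle_of \<Pi> m P (take (first_diff m x y) x) ~= 0" using d(1) sp assms(3) by (simp add: oracle_of_def)
  then have "x ! first_diff m x y = oracle_of \<Pi> m P (take (first_diff m x y) x) - 1"
    "y ! first_diff m x y = oracle_of \<Pi> m P (take (first_diff m x y) x) - 1"
    using assms(1-4) d by (simp_all add: consistent_def)
  then show False using d(2) by simp
qed

text \<open>
  Alice's candidates leave the transcript where Bob speaks and vice versa, so of the two departures
  one comes first, and there the candidates differ.
\<close>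

lemma agreeing_candidates:
  assumes len: "length x = m" "length y = m"
    and x: "consistent (oracle_of \<Pi> m Alice) x" and y: "consistent (oracle_of \<Pi> m Bob) y"
    and dx: "first_diff m x (transcript \<Pi> m) \<in> I" and dy: "first_diff m y (transcript \<Pi> m) \<in> I"
    and agree: "\<And>i. i \<in> I ==> i < m ==> x ! i = y ! i"
  shows "y = transcript \<Pi> m"
proof (rule ccontr)
  let ?t = "transcript \<Pi> m"
  assume ne: "y ~= ?t"
  have lt: "length ?t = m" by (rule transcript_props)
  note py = first_diff_props[OF len(2) lt ne]
  have sy: "speaker \<Pi> (first_diff m y ?t) ~= Bob"
    by (rule consistent_diverge[OF y transcript_consistent len(2) lt ne])
  show False
  proof (cases "x = ?t")
    case True
    then show False using agree[OF dy py(1)] py(2) by simp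
  next
    case False
    note px = first_diff_props[OF len(1) lt False]
    have sx: "speaker \<Pi> (first_diff m x ?t) ~= Alice"
      by (rule consistent_diverge[OF x transcript_consistent len(1) lt False])
    then have "first_diff m x ?t ~= first_diff m y ?t" using sy by (metis party.exhaust)
    then consider "first_diff m x ?t < first_diff m y ?t" | "first_diff m y ?t < first_diff m x ?t" by linarith
    then show False
    proof cases
      case 1
      then have "y ! first_diff m x ?t = ?t ! first_diff m x ?t" using py(3) by (metis nth_take)
      then show False using agree[OF dx px(1)] px(2) by simp
    next
      case 2
      then have "x ! first_diff m y ?t = ?t ! first_diff m y ?t" using px(3) by (metis nth_take)
      then show False using agree[OF dy py(1)] py(2) by simp
    qed
  qed
qed

section \<open>The messages of the parties and their evaluation\<close>

definition less_expr :: "expr => expr => expr" where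
  "less_expr x y = Bin Minim (Const 1) (Bin Minus y x)"

definition eq_expr :: "expr => expr => expr" where
  "eq_expr x y = Bin Minus (Const 1) (Bin Plus (Bin Minus x y) (Bin Minus y x))"

definition le_expr :: "expr => expr => expr" where
  "le_expr x y = Bin Minus (Const 1) (Bin Minus x y)"

lemma eval_less_expr [simp]: "eval e c (less_expr x y) = of_bool (eval e c x < eval e c y)"
  by (auto simp: less_expr_def)

lemma eval_eq_expr [simp]: "eval e c (eq_expr x y) = of_bool (eval e c x = eval e c y)"
  by (auto simp: eq_expr_def)

lemma eval_le_expr [simp]: "eval e c (le_expr x y) = of_bool (eval e c x <= eval e c y)"
  by (auto simp: le_expr_def)

lemma wfe_cmp [simp]:
  "wfe R k (less_expr x y) \<longleftrightarrow> wfe R k x & wfe R k y"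
  "wfe R k (eq_expr x y) \<longleftrightarrow> wfe R k x & wfe R k y"
  "wfe R k (le_expr x y) \<longleftrightarrow> wfe R k x & wfe R k y"
  by (auto simp: less_expr_def eq_expr_def le_expr_def)

abbreviation plus_expr (infixl \<open>\<oplus>\<close> 65) where "x \<oplus> y == Bin Plus x y"
abbreviation times_expr (infixl \<open>\<otimes>\<close> 70) where "x \<otimes> y == Bin Times x y"

abbreviation "LN == Reg 1"
abbreviation "LL == Reg 4"

primrec pow_expr :: "nat => expr" where
  "pow_expr 0 = Const 1"
| "pow_expr (Suc j) = pow_expr j \<otimes> LL"

lemma eval_pow_expr [simp]: "eval e c (pow_expr j) = e 4 ^ j"
  by (induction j) auto

lemma wfe_pow_expr [simp]: "4 < k ==> wfe R k (pow_expr j)"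
  by (induction j) auto

definition slot :: "(nat => nat) => nat => nat => nat list" where
  "slot X m k = map (%j. X (k * m + j)) [0..<m]"

lemma length_slot [simp]: "length (slot X m k) = m"
  by (simp add: slot_def)

lemma slot_nth: "j < m ==> slot X m k ! j = X (k * m + j)"
  by (simp add: slot_def)

lemma slot_cong: "(\<And>j. j < m ==> X (k * m + j) = Y (k * m + j)) ==> slot X m k = slot Y m k"
  by (simp add: slot_def)

text \<open>The value of a candidate at a position of a message; positions outside have value 0.\<close>

definition at_pos :: "nat => nat list => nat => nat" where
  "at_pos m x i = (if i < m then x ! i else 0)"

text \<open>\<open>b\<close> is the number of runs, \<open>ls\<close> the list size of the given
  scheme and \<open>p\<close> the size of the field. A digit is listed if it agrees with at least a
  \<open>1 / g\<close> fraction of the received symbols; by the bound on \<open>p\<close> fewer than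
  \<open>2 * g\<close> digits do.\<close>

locale coder =
  fixes b ls \<sigma> g p :: nat
  assumes p: "prime p" "8 * g * g < p" and g: "0 < g"
begin

definition M where "M = b * ls"
definition \<Lambda> where "\<Lambda> = 2 * g"
text \<open>Number of positions in a message: the divergences of all ordered pairs of own
  candidates, and for each run the \<open>M * M\<close> positions received from the other party in
  all \<Lambda>\<open>^ 4\<close> readings, one for each choice from the lists of four digits. The
  \<open>nf\<close> fields add the value of each candidate at each position; every field takes four
  digits in base \<open>l\<close>.\<close>

definition np where "np = M * M + b * (\<Lambda> ^ 4 * (M * M))"
definition nf where "nf = np + M * np"
definition C where "C = 4 * nf"
definition Q where "Q = p ^ C"
text \<open>Each piece has its own tally array and each run its own array for the simulated memory,
  so these start out as 0 and never have to be cleared.\<close>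

definition RF :: "nat => nat" where "RF i = 19 + i"
definition RS :: "nat => nat" where "RS i = 19 + 2 * b + i"
definition NR :: nat where "NR = 19 + 3 * b"

lemma p1: "1 < p" using p prime_gt_1_nat by blast
lemma Q0: "0 < Q" using p1 by (simp add: Q_def)
lemma \<Lambda>0: "0 < \<Lambda>" using g by (simp add: \<Lambda>_def)

definition repair :: "bool => nat => com" where
  "repair al k = Loop 1 (Seq (query_padded al VA RX (Const k \<otimes> LN) (Reg 7))
     (Cond (Var VA) (Write RX (Const k \<otimes> LN \<oplus> Reg 7) (Bin Minus (Var VA) (Const 1))) Skip))"

definition diverge :: "nat => com" where
  "diverge z = Seq (Write RP (Const z) LN)
     (Loop 1 (Cond (eq_expr (Cell RP (Const z)) LN \<otimes>
         le_expr (eq_expr (Cell RX (Const (z div M) \<otimes> LN \<oplus> Reg 7)) (Cell RX (Const (z mod M) \<otimes> LN \<oplus> Reg 7))) (Const 0))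
       (Write RP (Const z) (Reg 7)) Skip))"

text \<open>The value at \<open>x\<close> if \<open>x < m\<close>, and 0 otherwise. The outer
  minimum lets \<open>keeps\<close> recognise that the value is bounded by a stored one.\<close>

definition value_expr :: "nat => expr => expr" where
  "value_expr k x = Bin Minim (Cell RX (Const k \<otimes> LN \<oplus> x)) (Cell RX (Const k \<otimes> LN \<oplus> x) \<otimes> less_expr x LN)"

definition field_expr :: "nat => expr" where
  "field_expr i = (if i < np then Cell RP (Const i)
     else value_expr ((i - np) div np) (Cell RP (Const ((i - np) mod np))))"

definition digits :: com where
  "digits = SeqN C (%k. Write RG (Const k) (Bin Modulo (Bin Divide (field_expr (k div 4)) (pow_expr (k mod 4))) LL))"

text \<open>The cap \<open>Q - 1\<close> leaves symbols computed from a correct table unchanged. It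
  makes the write tame and keeps every transmitted symbol inside the alphabet whatever the table
  contains.\<close>

definition codeword :: com where
  "codeword = Loop 4 (Write RW (Reg 7) (Bin Minim (Const (Q - 1))
     (SumN C (%k. Cell RH (Cell RG (Const k) \<otimes> LL \<oplus> Reg 7) \<otimes> Const (p ^ k)))))"

definition save :: "nat => com" where
  "save i = SeqN (M * M) (%z. Write RB (Const (i * (M * M) + z)) (Cell RP (Const z)))"

definition reset :: com where
  "reset = Seq (Seq (Write VS (Const 0) (Const 0)) (Write VR (Const 0) (Const 0)))
     (Seq (Write VO (Const 0) (Const 0)) (Write VH (Const 0) (Const 0)))"

definition slots_pre :: "bool => com" where
  "slots_pre al = Seq (SeqN M (repair al)) (SeqN (M * M) diverge)"

text \<open>The final write puts the padded length into cell 0 of the simulated memory, where the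
  given program expects its input.\<close>

definition pre :: "bool => nat => com" where
  "pre al i = Seq (slots_pre al) (Seq (if i < b then save i else Skip)
     (Seq digits (Seq codeword (Seq reset (if i < b then Write (RS i) (Const 0) LN else Skip)))))"

definition agree_digit :: "nat => nat => com" where
  "agree_digit i k = Seq (Write VC (Const 0) (Const 0))
     (Loop 4 (Write VC (Const 0) (Bin Minim (Reg 6) (Var VC \<oplus>
       SumN Q (%c. eq_expr (Const (c div p ^ k mod p)) (Cell RH (Reg 7 \<otimes> LL \<oplus> Reg 8))
         \<otimes> Cell (RF i) (Reg 8 \<otimes> Const Q \<oplus> Const c))))))"

text \<open>Decoding by exhaustive search: every digit is compared with the histogram,
  \<open>l\<close> digits at \<open>l\<close> places each. The test on \<open>VL\<close> confines
  the writes to the \<Lambda> cells of this list.\<close>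

definition list_digit :: "nat => nat => com" where
  "list_digit i k = Seq (Write VL (Const 0) (Const 0))
     (Loop 4 (Seq (agree_digit i k)
       (Cond (le_expr (Reg 6) (Const g \<otimes> Var VC) \<otimes> less_expr (Var VL) (Const \<Lambda>))
         (Seq (Write RL (Const ((i * C + k) * \<Lambda>) \<oplus> Var VL) (Reg 7)) (Write VL (Const 0) (Var VL \<oplus> Const 1)))
         Skip)))"

text \<open>\<open>z\<close> enumerates pairs: its remainder modulo \<open>M * M\<close> is the
  number of a position in the other party's message, and the base \<Lambda> digits of its quotient
  choose one entry from each of the four lists for that position.\<close>

definition positions :: "nat => com" where
  "positions i = SeqN (\<Lambda> ^ 4 * (M * M)) (%z.
     Write RP (Const (M * M + i * (\<Lambda> ^ 4 * (M * M)) + z))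
       (Bin Minim (Reg 5) (SumN 4 (%j.
         Cell RL (Const ((i * C + (4 * (z mod (M * M)) + j)) * \<Lambda> + z div (M * M) div \<Lambda> ^ j mod \<Lambda>)) \<otimes> pow_expr j))))"

definition post :: "nat => com" where
  "post i = Seq (SeqN C (list_digit i)) (if i < b then positions i else Skip)"

definition message_digits :: "nat => nat => com" where
  "message_digits i z = SeqN C (%k. Write RG (Const k) (Cell RL (Const ((i * C + k) * \<Lambda> + z div \<Lambda> ^ k mod \<Lambda>))))"

definition agree :: "nat => com" where
  "agree i = Seq (Write VC (Const 0) (Const 0))
     (Loop 4 (Write VC (Const 0) (Bin Minim (Reg 6) (Var VC \<oplus>
       Cell (RF i) (Reg 7 \<otimes> Const Q \<oplus> Cell RW (Reg 7))))))"

definition received_expr :: "nat => expr" where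
  "received_expr i = SumN 4 (%j. Cell RG (Const (4 * i + j)) \<otimes> pow_expr j)"

text \<open>Products and sums of truth values 0 and 1 express universal and existential quantifiers;
  the condition itself is \<open>matches\<close>.\<close>

definition match_expr :: "nat => nat => expr" where
  "match_expr j k =
     ProdN (M * M) (%i. SumN np (%z. eq_expr (received_expr z) (Cell RB (Const (j * (M * M) + i)))))
     \<otimes> SumN M (%r. ProdN np (%z. eq_expr (value_expr k (received_expr z)) (received_expr (np + r * np + z))))"

text \<open>Stage \<open>j\<close> considers the candidates that Bob had before run
  \<open>j\<close>, together with the positions he saved then. Later stages overwrite earlier ones:
  a match at a stage before the transcript was found may be spurious, whereas the stage of the
  second usable run is bound to match.\<close>

definition identify :: com where
  "identify = Seq (Write VB (Const 0) (Const M))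
     (SeqN b (%j. SeqN (j * ls) (%k. Cond (match_expr j k) (Write VB (Const 0) (Const k)) Skip)))"

text \<open>A candidate may occupy several slots, and all slots that equal the identified one are
  credited. A slot keeps the best score that any message gives it in this piece.\<close>

definition credit :: "nat => com" where
  "credit i = SeqN M (%k. Cond (less_expr (Var VB) (Const M) \<otimes>
       (eq_expr (Cell RP (Const (k * M) \<oplus> Var VB)) LN \<otimes> less_expr (Cell RC (Const (i * M + k))) (Var VC)))
     (Write RC (Const (i * M + k)) (Var VC)) Skip)"

definition judge :: "nat => com" where
  "judge i = SeqN (\<Lambda> ^ C) (%z. Seq (message_digits i z) (Seq codeword (Seq (agree i) (Seq identify (credit i)))))"

definition total_expr :: "expr => expr" where
  "total_expr x = SumN (2 * b) (%i. Cell RC (Const (i * M) \<oplus> x))"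

definition elect :: com where
  "elect = Seq (Write VK (Const 0) (Const 0))
     (SeqN M (%k. Cond (less_expr (total_expr (Var VK)) (total_expr (Const k))) (Write VK (Const 0) (Const k)) Skip))"

text \<open>Only the first \<open>n\<close> of the \<open>m\<close> symbols are printed, which
  removes the padding.\<close>

definition answer :: com where
  "answer = Seq (Seq (SeqN (2 * b) judge) elect) (Loop 0 (Print (Cell RX (Var VK \<otimes> LN \<oplus> Reg 7))))"

text \<open>Register 5 serves as a cap here and in \<open>positions\<close>. It holds
  \<open>p * m\<close> while the length is computed and \<open>l ^ 4\<close> afterwards.\<close>

definition find_length :: com where
  "find_length = Seq (Write VE (Const 0) (Const 1))
     (Loop 1 (Cond (le_expr (Var VE \<otimes> Var VE \<otimes> Var VE \<otimes> Var VE) LN)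
       (Write VE (Const 0) (Bin Minim (Reg 5) (Var VE \<otimes> Const p))) Skip))"

definition table :: com where
  "table = Loop 4 (Loop 4 (Write RH (Reg 7 \<otimes> LL \<oplus> Reg 8)
     (Bin Minim (Const p) (Bin Modulo (Bin Modulo (Reg 7) (Const p) \<otimes> Bin Modulo (Reg 8) (Const p)
       \<oplus> Cell RH (Bin Divide (Reg 7) (Const p) \<otimes> LL \<oplus> Bin Divide (Reg 8) (Const p))) (Const p)))))"

definition talk :: "nat => com" where
  "talk q = Loop 6 (Seq (Emit (Const q \<otimes> Cell RW (Var VS))) (bump VS))"

definition listen :: "nat => nat => com" where
  "listen q i = Loop 6 (Seq (Accept VA) (Seq
     (Write (RF i) (Var VR \<otimes> Const Q \<oplus> Bin Divide (Var VA) (Const q))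
       (Cell (RF i) (Var VR \<otimes> Const Q \<oplus> Bin Divide (Var VA) (Const q)) \<oplus> Const 1)) (bump VR)))"

lemmas coms = repair_def diverge_def value_expr_def field_expr_def digits_def codeword_def save_def reset_def
  slots_pre_def pre_def agree_digit_def list_digit_def positions_def post_def message_digits_def agree_def
  received_expr_def match_expr_def identify_def credit_def judge_def total_expr_def elect_def answer_def
  find_length_def table_def talk_def listen_def query_padded_def bump_def

lemma wfc_coms:
  shows "i < 2 * b ==> wfc NR 7 (pre al i)" "i < 2 * b ==> wfc NR 7 (post i)"
    "wfc NR 7 answer" "wfc NR 7 find_length" "wfc NR 7 table" "wfc NR 7 (talk q)" "i < 2 * b ==> wfc NR 7 (listen q i)"
  by (auto simp: coms NR_def RF_def RS_def)

definition \<kappa> where "\<kappa> = Q + M + p + 1"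

lemma below_M: "j < b ==> k < j * ls ==> k < M"
  unfolding M_def by (meson le_less_trans less_imp_le less_le_trans mult_le_mono1)

lemma tame_coms:
  shows "tame \<kappa> (pre al i)" "tame \<kappa> (post i)" "tame \<kappa> answer" "tame \<kappa> find_length" "tame \<kappa> table"
    "tame \<kappa> (talk q)" "tame \<kappa> (listen q i)"
proof -
  have c: "Q - 1 <= \<kappa>" "p <= \<kappa>" "M <= \<kappa>" "1 <= \<kappa>" by (auto simp: \<kappa>_def)
  show "tame \<kappa> (pre al i)" "tame \<kappa> (post i)" "tame \<kappa> find_length" "tame \<kappa> table" "tame \<kappa> (talk q)" "tame \<kappa> (listen q i)"
    using c by (simp_all add: coms)
  have k: "k <= \<kappa>" if "k < M" for k using that c by simp
  then have "k <= \<kappa>" if "j < b" "k < j * ls" for j k using below_M[OF that] by simp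
  then have "tame \<kappa> identify" using c by (simp add: identify_def)
  moreover have "tame \<kappa> elect" using k by (simp add: elect_def)
  ultimately show "tame \<kappa> answer" using c by (simp add: answer_def judge_def message_digits_def codeword_def agree_def credit_def)
qed

lemma quiet_coms:
  shows "quiet (pre al i)" "quiet (post i)" "quiet find_length" "quiet table"
  by (auto simp: coms)

lemma mods_coms:
  shows "mods (repair al k) = {VA, RX}" "mods (diverge z) = {RP}"
    "mods (save i) \<subseteq> {RB}" "mods digits \<subseteq> {RG}" "mods codeword = {RW}" "mods reset = {VS, VR, VO, VH}"
    "mods (list_digit i k) = {VC, VL, RL}" "mods (agree_digit i k) = {VC}" "mods (positions i) \<subseteq> {RP}"
    "mods (message_digits i z) \<subseteq> {RG}" "mods (agree i) = {VC}" "mods identify \<subseteq> {VB}" "mods (credit i) \<subseteq> {RC}"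
    "mods (judge i) \<subseteq> {RG, RW, VC, VB, RC}" "mods elect \<subseteq> {VK}"
    "mods find_length = {VE}" "mods table = {RH}" "mods (talk q) = {VS}" "mods (listen q i) = {VA, RF i, VR}"
    "mods (post i) \<subseteq> {VC, VL, RL, RP}" "mods (slots_pre al) \<subseteq> {VA, RX, RP}"
    "mods (pre al i) \<subseteq> {VA, RX, RP, RB, RG, RW, VS, VR, VO, VH, RS i}"
    "mods answer \<subseteq> {RG, RW, VC, VB, RC, VK}"
  by (auto simp: coms split: if_splits)

end

section \<open>What the commands for messages compute\<close>

lemma slot_disjoint:
  fixes k k' m j :: nat
  assumes "k ~= k'" "j < m"
  shows "\<not> (k * m <= k' * m + j & k' * m + j < k * m + m)"
proof
  assume a: "k * m <= k' * m + j & k' * m + j < k * m + m"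
  have "(k' * m + j) div m = k'" by (rule block_div_mod(1)[OF assms(2)])
  moreover have "(k' * m + j) div m = k"
  proof -
    obtain i where i: "k' * m + j = k * m + i" using a le_Suc_ex by blast
    then have "i < m" using a by simp
    then show ?thesis unfolding i by (rule block_div_mod(1))
  qed
  ultimately show False using assms(1) by simp
qed

locale coder_exec = coder b ls \<sigma> g p for b ls \<sigma> g p :: nat +
  fixes al :: bool and f :: "nat list => nat" and w e :: "nat => nat" and m l h :: nat
  assumes env: "e 0 <= m" "e (Suc 0) = m" "e 4 = l" "e 5 = l ^ 4" "e 6 = h" and m0: "0 < m" and l0: "0 < l"
begin

abbreviation "f1 == pad_oracle al (e 0) m f"

lemma sem_repair:
  fixes k st
  defines "s' == %st. sem f w 7 (repair al k) e st"
  shows "\<exists>r. length r = m &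
    (\<forall>j<m. r ! j = (if f1 (take j r) = 0 then cells st RX (k * m + j) else f1 (take j r) - 1)) &
    cells (s' st) RX = (%a. if k * m <= a & a < k * m + m then r ! (a - k * m) else cells st RX a)"
proof -
  let ?X = "cells st RX"
  define I where "I j s \<longleftrightarrow> (\<exists>r. length r = j &
    (\<forall>i<j. r ! i = (if f1 (take i r) = 0 then ?X (k * m + i) else f1 (take i r) - 1)) &
    cells s RX = (%a. if k * m <= a & a < k * m + j then r ! (a - k * m) else ?X a))" for j :: nat and s :: store
  have "I (e 1) (s' st)"
    unfolding s'_def repair_def sem.simps(9)
  proof (rule fold_upt_inv)
    show "I 0 st" by (auto simp: I_def)
  next
    fix j s assume j: "j < e 1" and "I j s"
    then obtain r where r: "length r = j" "\<forall>i<j. r ! i = (if f1 (take i r) = 0 then ?X (k * m + i) else f1 (take i r) - 1)"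
      "cells s RX = (%a. if k * m <= a & a < k * m + j then r ! (a - k * m) else ?X a)"
      unfolding I_def by blast
    have mp: "map (cells s RX) [k * m..<k * m + j] = r"
      by (rule nth_equalityI) (auto simp: r(1,3))
    let ?v = "if f1 r = 0 then ?X (k * m + j) else f1 r - 1"
    let ?s1 = "put VA 0 (f1 r) s"
    have q: "sem f w 8 (query_padded al VA RX (Const k \<otimes> LN) (Reg 7)) (e(7 := j)) s = ?s1"
      by (subst sem_query_padded) (simp_all add: env mp)
    have "I (Suc j) (sem f w 8 (Seq (query_padded al VA RX (Const k \<otimes> LN) (Reg 7))
      (Cond (Var VA) (Write RX (Const k \<otimes> LN \<oplus> Reg 7) (Bin Minus (Var VA) (Const 1))) Skip)) (e(7 := j)) s)"
      (is "I _ ?s2")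
    proof -
      have "cells ?s2 RX = (%a. if k * m <= a & a < k * m + Suc j then (r @ [?v]) ! (a - k * m) else ?X a)"
        using r(1) unfolding sem.simps q by (auto simp: env r(3) fun_eq_iff nth_append less_Suc_eq)
      moreover have "\<forall>i<Suc j. (r @ [?v]) ! i = (if f1 (take i (r @ [?v])) = 0 then ?X (k * m + i) else f1 (take i (r @ [?v])) - 1)"
        using r(1,2) by (auto simp: nth_append less_Suc_eq)
      ultimately show ?thesis unfolding I_def using r(1) by (intro exI[of _ "r @ [?v]"]) simp
    qed
    then show "I (Suc j) (sem f w (Suc 7) (Seq (query_padded al VA RX (Const k \<otimes> LN) (Reg 7))
      (Cond (Var VA) (Write RX (Const k \<otimes> LN \<oplus> Reg 7) (Bin Minus (Var VA) (Const 1))) Skip)) (e(7 := j)) s)"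
      by simp
  qed
  then show ?thesis by (simp add: I_def env)
qed

lemma repair_slot:
  fixes st k
  defines "X == cells st RX" and "X' == cells (sem f w 7 (repair al k) e st) RX"
  shows "consistent f1 (slot X' m k)" "consistent f1 (slot X m k) ==> slot X' m k = slot X m k"
    and "k' ~= k ==> slot X' m k' = slot X m k'"
    and "\<forall>a. X a < \<sigma> ==> \<forall>h. f1 h <= \<sigma> ==> 0 < \<sigma> ==> \<forall>a. X' a < \<sigma>"
proof -
  obtain r where r: "length r = m" "\<forall>j<m. r ! j = (if f1 (take j r) = 0 then X (k * m + j) else f1 (take j r) - 1)"
    "X' = (%a. if k * m <= a & a < k * m + m then r ! (a - k * m) else X a)"
    using sem_repair[where k = k and st = st] unfolding X_def X'_def by blast
  have sl: "slot X' m k = r" by (rule nth_equalityI) (auto simp: slot_nth r(1,3))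
  have 1: "length r = length (slot X m k)" using r by simp
  have 2: "r ! j = (if f1 (take j r) = 0 then slot X m k ! j else f1 (take j r) - 1)" if "j < length (slot X m k)" for j
    using r(2) that by (simp add: slot_nth)
  show "consistent f1 (slot X' m k)" unfolding sl by (rule repaired(1)[OF 1 2])
  show "slot X' m k = slot X m k" if "consistent f1 (slot X m k)" unfolding sl by (rule repaired(2)[OF 1 2 that])
  show "slot X' m k' = slot X m k'" if "k' ~= k"
    by (rule slot_cong) (use slot_disjoint[OF that[symmetric]] in \<open>auto simp: r(3)\<close>)
  show "\<forall>a. X' a < \<sigma>" if a: "\<forall>a. X a < \<sigma>" "\<forall>h. f1 h <= \<sigma>" "0 < \<sigma>"
  proof -
    have "r ! j < \<sigma>" if "j < m" for j
    proof (cases "f1 (take j r) = 0")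
      case True
      then have "r ! j = X (k * m + j)" using r(2) that by simp
      then show ?thesis using a(1) by simp
    next
      case False
      then have "r ! j = f1 (take j r) - 1" "f1 (take j r) <= \<sigma>" using r(2) that a(2) by simp_all
      then show ?thesis using a(3) False by linarith
    qed
    then show ?thesis using a(1) by (auto simp: r(3))
  qed
qed

lemma sem_diverge:
  fixes st z
  defines "s' == sem f w 7 (diverge z) e st" and "X == cells st RX"
  shows "cells s' RP = (cells st RP)(z := first_diff m (slot X m (z div M)) (slot X m (z mod M)))"
    "cells s' RX = X"
proof -
  let ?x = "slot X m (z div M)" and ?y = "slot X m (z mod M)"
  define I where "I j s \<longleftrightarrow> cells s RX = X & (\<exists>v. cells s RP = (cells st RP)(z := v) &
    (if \<exists>i<j. ?x ! i ~= ?y ! i then v = (LEAST i. ?x ! i ~= ?y ! i) else v = m))" for j :: nat and s :: store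
  have "I (e 1) s'"
    unfolding s'_def diverge_def sem.simps(2,7,9)
  proof (rule fold_upt_inv)
    show "I 0 (put RP (eval e (cells st) (Const z)) (eval e (cells st) LN) st)"
      by (auto simp: I_def X_def env)
  next
    fix j s assume j: "j < e 1" and i: "I j s"
    then obtain v where v: "cells s RP = (cells st RP)(z := v)"
      "if \<exists>i<j. ?x ! i ~= ?y ! i then v = (LEAST i. ?x ! i ~= ?y ! i) else v = m" and X: "cells s RX = X"
      unfolding I_def by blast
    have jm: "j < m" using j env by simp
    have xj: "?x ! j = X (z div M * m + j)" "?y ! j = X (z mod M * m + j)" using jm by (simp_all add: slot_nth)
    have vm: "v = m \<longleftrightarrow> \<not> (\<exists>i<j. ?x ! i ~= ?y ! i)"
    proof
      assume "v = m"
      show "\<not> (\<exists>i<j. ?x ! i ~= ?y ! i)"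
      proof
        assume ex: "\<exists>i<j. ?x ! i ~= ?y ! i"
        then obtain i where "i < j" "?x ! i ~= ?y ! i" by blast
        then have "v <= i" using v(2) ex Least_le[of "%i. ?x ! i ~= ?y ! i" i] by simp
        then show False using \<open>v = m\<close> \<open>i < j\<close> jm by simp
      qed
    qed (use v(2) in auto)
    have least: "(LEAST i. ?x ! i ~= ?y ! i) = j" if "?x ! j ~= ?y ! j" "\<not> (\<exists>i<j. ?x ! i ~= ?y ! i)"
      by (rule Least_equality) (use that in \<open>auto simp: not_less[symmetric]\<close>)
    let ?c = "Cond (eq_expr (Cell RP (Const z)) LN \<otimes>
         le_expr (eq_expr (Cell RX (Const (z div M) \<otimes> LN \<oplus> Reg 7)) (Cell RX (Const (z mod M) \<otimes> LN \<oplus> Reg 7))) (Const 0))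
       (Write RP (Const z) (Reg 7)) Skip"
    have "sem f w (Suc 7) ?c (e(7 := j)) s = (if v = m & ?x ! j ~= ?y ! j then put RP z j s else s)"
      using v(1) X by (simp add: env xj)
    moreover have "I (Suc j) (if v = m & ?x ! j ~= ?y ! j then put RP z j s else s)"
    proof (cases "v = m & ?x ! j ~= ?y ! j")
      case True
      then have "\<exists>i<Suc j. ?x ! i ~= ?y ! i" "(LEAST i. ?x ! i ~= ?y ! i) = j" using least vm by auto
      then show ?thesis using True X v(1) by (auto simp: I_def)
    next
      case False
      then have "(\<exists>i<Suc j. ?x ! i ~= ?y ! i) \<longleftrightarrow> (\<exists>i<j. ?x ! i ~= ?y ! i)" using vm by (auto simp: less_Suc_eq)
      then show ?thesis using False X v by (auto simp: I_def)
    qed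
    ultimately show "I (Suc j) (sem f w (Suc 7) ?c (e(7 := j)) s)" by simp
  qed
  then have I: "I m s'" by (simp add: env)
  then show "cells s' RX = X" by (simp add: I_def)
  have "first_diff m ?x ?y = (if \<exists>i<m. ?x ! i ~= ?y ! i then LEAST i. ?x ! i ~= ?y ! i else m)"
    by (simp add: first_diff_def)
  then show "cells s' RP = (cells st RP)(z := first_diff m ?x ?y)" using I by (auto simp: I_def split: if_splits)
qed

lemma sem_slots_pre:
  fixes st
  defines "s' == sem f w 7 (slots_pre al) e st" and "X == cells st RX"
  defines "X' == cells s' RX"
  shows "\<And>k. k < M ==> consistent f1 (slot X' m k)"
    and "\<And>k. k < M ==> consistent f1 (slot X m k) ==> slot X' m k = slot X m k"
    and "\<forall>a. X a < \<sigma> ==> \<forall>h. f1 h <= \<sigma> ==> 0 < \<sigma> ==> \<forall>a. X' a < \<sigma>"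
    and "cells s' RP = (%z. if z < M * M then first_diff m (slot X' m (z div M)) (slot X' m (z mod M)) else cells st RP z)"
proof -
  define s1 where "s1 = sem f w 7 (SeqN M (repair al)) e st"
  define I where "I j s \<longleftrightarrow> (\<forall>k<j. consistent f1 (slot (cells s RX) m k)) &
    (\<forall>k. consistent f1 (slot X m k) --> slot (cells s RX) m k = slot X m k) &
    ((\<forall>a. X a < \<sigma>) --> (\<forall>h. f1 h <= \<sigma>) --> 0 < \<sigma> --> (\<forall>a. cells s RX a < \<sigma>)) &
    cells s RP = cells st RP" for j :: nat and s :: store
  have I1: "I M s1"
    unfolding s1_def
  proof (rule sem_SeqN_inv)
    show "I 0 st" by (simp add: I_def X_def)
  next
    fix j s assume j: "j < M" and i: "I j s"
    note R = repair_slot[where st = s and k = j]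
    let ?s = "sem f w 7 (repair al j) e s"
    have "consistent f1 (slot (cells ?s RX) m k)" if "k < Suc j" for k
    proof (cases "k = j")
      case False
      then show ?thesis using R(3)[OF False] i that by (simp add: I_def less_Suc_eq)
    qed (use R(1) in simp)
    moreover have "slot (cells ?s RX) m k = slot X m k" if c: "consistent f1 (slot X m k)" for k
    proof -
      have e: "slot (cells s RX) m k = slot X m k" using i c by (simp add: I_def)
      show ?thesis
      proof (cases "k = j")
        case True
        then show ?thesis using R(2) e c by simp
      qed (use R(3) e in simp)
    qed
    moreover have "(\<forall>a. X a < \<sigma>) --> (\<forall>h. f1 h <= \<sigma>) --> 0 < \<sigma> --> (\<forall>a. cells ?s RX a < \<sigma>)"
      using R(4) i unfolding I_def by blast
    moreover have "cells ?s RP = cells s RP" by (rule sem_frame) (simp add: mods_coms)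
    ultimately show "I (Suc j) ?s" using i unfolding I_def by simp
  qed
  define J where "J j s \<longleftrightarrow> cells s RX = cells s1 RX & cells s RP =
    (%z. if z < j then first_diff m (slot (cells s1 RX) m (z div M)) (slot (cells s1 RX) m (z mod M)) else cells st RP z)" for j :: nat and s :: store
  have "J (M * M) s'"
    unfolding s'_def slots_pre_def sem.simps s1_def[symmetric]
  proof (rule sem_SeqN_inv)
    show "J 0 s1" using I1 by (simp add: J_def I_def)
  next
    fix j s assume "J j s"
    then have X: "cells s RX = cells s1 RX" and P: "cells s RP = (%z. if z < j then
      first_diff m (slot (cells s1 RX) m (z div M)) (slot (cells s1 RX) m (z mod M)) else cells st RP z)"
      by (simp_all add: J_def)
    have "cells (sem f w 7 (diverge j) e s) RP = (%z. if z < Suc j then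
      first_diff m (slot (cells s1 RX) m (z div M)) (slot (cells s1 RX) m (z mod M)) else cells st RP z)"
      unfolding sem_diverge X P by (auto simp: fun_eq_iff)
    then show "J (Suc j) (sem f w 7 (diverge j) e s)" by (simp add: J_def sem_diverge X)
  qed
  then have X': "X' = cells s1 RX" and RP: "cells s' RP = (%z. if z < M * M then first_diff m (slot X' m (z div M)) (slot X' m (z mod M)) else cells st RP z)"
    by (auto simp: J_def X'_def)
  show "consistent f1 (slot X' m k)" if "k < M" for k using I1 that by (simp add: I_def X')
  show "slot X' m k = slot X m k" if "k < M" "consistent f1 (slot X m k)" for k using I1 that by (simp add: I_def X')
  show "\<forall>a. X' a < \<sigma>" if "\<forall>a. X a < \<sigma>" "\<forall>h. f1 h <= \<sigma>" "0 < \<sigma>" using I1 that unfolding I_def X' by blast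
  show "cells s' RP = (%z. if z < M * M then first_diff m (slot X' m (z div M)) (slot X' m (z mod M)) else cells st RP z)"
    by (rule RP)
qed

definition field :: "(nat => nat) => (nat => nat) => nat => nat" where
  "field P X i = (if i < np then P i else at_pos m (slot X m ((i - np) div np)) (P ((i - np) mod np)))"

lemma eval_value_expr:
  "e' (Suc 0) = m ==> eval e' c (value_expr k x) = at_pos m (slot (c RX) m k) (eval e' c x)"
  by (auto simp: value_expr_def at_pos_def slot_nth)

lemma eval_field_expr: "eval e c (field_expr i) = field (c RP) (c RX) i"
  by (simp add: field_expr_def field_def eval_value_expr env)

lemma sem_writes:
  assumes "\<And>j c. (\<And>r. r ~= R ==> c r = cells st r) ==> eval e c (F j) = v j"
    and "\<And>j. j < n ==> x j = a + j"
  shows "sem f w 7 (SeqN n (%j. Write R (Const (x j)) (F j))) e st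
    = st\<lparr>cells := (cells st)(R := (%z. if a <= z & z < a + n then v (z - a) else cells st R z))\<rparr>"
  using assms(2)
proof (induction n)
  case 0
  show ?case by (rule store.equality) (auto simp: fun_eq_iff)
next
  case (Suc n)
  define u where "u = st\<lparr>cells := (cells st)(R := (%z. if a <= z & z < a + n then v (z - a) else cells st R z))\<rparr>"
  have 1: "sem f w 7 (SeqN n (%j. Write R (Const (x j)) (F j))) e st = u"
    unfolding u_def by (rule Suc.IH) (rule Suc.prems, simp)
  have 2: "eval e (cells u) (F n) = v n" by (rule assms(1)) (simp add: u_def)
  have "sem f w 7 (SeqN (Suc n) (%j. Write R (Const (x j)) (F j))) e st = put R (a + n) (v n) u"
    using 1 2 Suc.prems[of n] by simp
  also have "\<dots> = st\<lparr>cells := (cells st)(R := (%z. if a <= z & z < a + Suc n then v (z - a) else cells st R z))\<rparr>"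
    by (rule store.equality) (auto simp: u_def fun_eq_iff)
  finally show ?case .
qed

lemma sem_digits:
  "cells (sem f w 7 digits e st) RG =
    (%k. if k < C then field (cells st RP) (cells st RX) (k div 4) div l ^ (k mod 4) mod l else cells st RG k)"
proof -
  have "eval e c (Bin Modulo (Bin Divide (field_expr (k div 4)) (pow_expr (k mod 4))) LL)
    = field (cells st RP) (cells st RX) (k div 4) div l ^ (k mod 4) mod l"
    if "\<And>r. r ~= RG ==> c r = cells st r" for k c
    using that[of RP] that[of RX] by (simp add: eval_field_expr env)
  from sem_writes[of RG st, OF this, of C "%k. k" 0] show ?thesis
    by (auto simp: digits_def fun_eq_iff)
qed

definition table_ok :: "store => bool" where
  "table_ok st \<longleftrightarrow> (\<forall>d<l. \<forall>x<l. cells st RH (d * l + x) = had p d x)"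

lemma sem_codeword:
  assumes "table_ok st" "\<And>k. k < C ==> cells st RG k < l"
  shows "cells (sem f w 7 codeword e st) RW = (%x. if x < l then csym p C (cells st RG) x else cells st RW x)"
proof -
  define I where "I j s \<longleftrightarrow> cells s RH = cells st RH & cells s RG = cells st RG &
    cells s RW = (%x. if x < j then csym p C (cells st RG) x else cells st RW x)" for j :: nat and s :: store
  have "I (e 4) (sem f w 7 codeword e st)"
    unfolding codeword_def sem.simps
  proof (rule fold_upt_inv)
    show "I 0 st" by (simp add: I_def)
  next
    fix j s assume j: "j < e 4" and i: "I j s"
    have "eval (e(7 := j)) (cells s) (SumN C (%k. Cell RH (Cell RG (Const k) \<otimes> LL \<oplus> Reg 7) \<otimes> Const (p ^ k)))
      = csym p C (cells st RG) j"
      using i j assms by (simp add: I_def csym_def env table_ok_def)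
    moreover have "csym p C (cells st RG) j <= Q - 1"
      using csym_less[OF p1, of C "cells st RG" j] by (simp add: Q_def)
    ultimately show "I (Suc j) (put RW (eval (e(7 := j)) (cells s) (Reg 7)) (eval (e(7 := j)) (cells s)
      (Bin Minim (Const (Q - 1)) (SumN C (%k. Cell RH (Cell RG (Const k) \<otimes> LL \<oplus> Reg 7) \<otimes> Const (p ^ k))))) s)"
      using i by (auto simp: I_def fun_eq_iff min_absorb2)
  qed
  then show ?thesis by (simp add: I_def env)
qed

lemma sem_codeword_less:
  assumes "\<forall>x. cells st RW x < Q"
  shows "\<forall>x. cells (sem f w 7 codeword e st) RW x < Q"
  unfolding codeword_def sem.simps
proof (rule fold_upt_inv[where I = "%j (s :: store). \<forall>x. cells s RW x < Q"])
  fix j and s :: store assume "\<forall>x. cells s RW x < Q"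
  then show "\<forall>x. cells (put RW (eval (e(7 := j)) (cells s) (Reg 7)) (eval (e(7 := j)) (cells s)
      (Bin Minim (Const (Q - 1)) (SumN C (%k. Cell RH (Cell RG (Const k) \<otimes> LL \<oplus> Reg 7) \<otimes> Const (p ^ k))))) s) RW x < Q"
    using Q0 by (auto simp: min_less_iff_disj)
qed (use assms in simp)

lemma sem_save:
  "cells (sem f w 7 (save i) e st) RB =
    (%z. if i * (M * M) <= z & z < i * (M * M) + M * M then cells st RP (z - i * (M * M)) else cells st RB z)"
  unfolding save_def
  by (subst sem_writes[where a = "i * (M * M)" and v = "cells st RP"]) (auto simp: fun_eq_iff)

definition position :: "(nat => nat) => nat => nat => nat" where
  "position L i z = (\<Sum>j<4. L ((i * C + (4 * (z mod (M * M)) + j)) * \<Lambda> + z div (M * M) div \<Lambda> ^ j mod \<Lambda>) * l ^ j)"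

lemma sem_positions:
  "cells (sem f w 7 (positions i) e st) RP =
    (%z. if M * M + i * (\<Lambda> ^ 4 * (M * M)) <= z & z < M * M + i * (\<Lambda> ^ 4 * (M * M)) + \<Lambda> ^ 4 * (M * M)
      then min (l ^ 4) (position (cells st RL) i (z - (M * M + i * (\<Lambda> ^ 4 * (M * M))))) else cells st RP z)"
  unfolding positions_def
  by (subst sem_writes[where a = "M * M + i * (\<Lambda> ^ 4 * (M * M))" and v = "%z. min (l ^ 4) (position (cells st RL) i z)"])
    (auto simp: position_def env fun_eq_iff)

end

text \<open>As long as the fourth power is at most \<open>m\<close>, the value is multiplied by
  \<open>p\<close>, thus at least doubled, and so exceeds the number of iterations made. Hence
  \<open>m\<close> iterations suffice.\<close>

lemma (in coder) sem_find_length: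
  fixes f w st
  assumes e: "e (Suc 0) = m" "e 5 = p * m" and m: "0 < m"
  defines "v == cells (sem f w 7 find_length e st) VE 0"
  shows "\<exists>k. v = p ^ k" "m < v ^ 4" "v ^ 4 <= p ^ 4 * m"
proof -
  define I where "I j u \<longleftrightarrow> (\<exists>k. cells u VE 0 = p ^ k) & cells u VE 0 ^ 4 <= p ^ 4 * m &
    (m < cells u VE 0 ^ 4 \<or> j < cells u VE 0)" for j :: nat and u :: store
  have "I (e 1) (sem f w 7 find_length e st)"
    unfolding find_length_def sem.simps(2,7,9)
  proof (rule fold_upt_inv)
    have "1 <= p ^ 4 * m" using p1 m by (simp add: Suc_le_eq)
    then show "I 0 (put VE (eval e (cells st) (Const 0)) (eval e (cells st) (Const 1)) st)"
      by (auto simp: I_def intro: exI[of _ 0])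
  next
    fix j and u :: store assume "j < e 1" and I: "I j u"
    let ?v = "cells u VE 0"
    let ?c = "Cond (le_expr (Var VE \<otimes> Var VE \<otimes> Var VE \<otimes> Var VE) LN)
       (Write VE (Const 0) (Bin Minim (Reg 5) (Var VE \<otimes> Const p))) Skip"
    obtain k where k: "?v = p ^ k" using I by (auto simp: I_def)
    have v0: "0 < ?v" using k p1 by simp
    have v4: "?v * ?v * ?v * ?v = ?v ^ 4" by (simp add: power4_eq_xxxx)
    have s: "sem f w (Suc 7) ?c (e(7 := j)) u = (if ?v ^ 4 <= m then put VE 0 (min (p * m) (?v * p)) u else u)"
      by (simp add: e v4)
    show "I (Suc j) (sem f w (Suc 7) ?c (e(7 := j)) u)"
    proof (cases "?v ^ 4 <= m")
      case True
      have "?v ^ 1 <= ?v ^ 4" using v0 by (intro power_increasing) auto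
      then have "?v <= m" using True by simp
      then have "?v * p <= p * m" by (simp add: mult.commute)
      then have "min (p * m) (?v * p) = ?v * p" by simp
      moreover have "(?v * p) ^ 4 <= p ^ 4 * m" using True by (simp add: power_mult_distrib)
      moreover have "Suc j < ?v * p"
      proof -
        have "j < ?v" using I True by (auto simp: I_def)
        moreover have "?v * 2 <= ?v * p" using p1 by (intro mult_le_mono2) simp
        ultimately show ?thesis using v0 by linarith
      qed
      moreover have "\<exists>k'. ?v * p = p ^ k'" using k by (intro exI[of _ "Suc k"]) simp
      moreover have "I (Suc j) (put VE 0 x u)" if "(\<exists>k'. x = p ^ k')" "x ^ 4 <= p ^ 4 * m" "Suc j < x" for x
        using that by (simp add: I_def)
      ultimately show ?thesis unfolding s using True by simp
    next
      case False
      then show ?thesis unfolding s using I by (auto simp: I_def)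
    qed
  qed
  then have I: "(\<exists>k. v = p ^ k) & v ^ 4 <= p ^ 4 * m & (m < v ^ 4 \<or> m < v)" by (simp add: I_def v_def e)
  then show "\<exists>k. v = p ^ k" "v ^ 4 <= p ^ 4 * m" by auto
  have "v ^ 1 <= v ^ 4" if "m < v" using that by (intro power_increasing) auto
  then show "m < v ^ 4" using I by (auto intro: less_le_trans)
qed

context coder_exec
begin

lemma cell_index:
  fixes x x' d d' :: nat
  assumes "x < l" "x' < l" "d * l + x = d' * l + x'"
  shows "d = d'" "x = x'"
  using arg_cong[OF assms(3), of "%z. z div l"] arg_cong[OF assms(3), of "%z. z mod l"]
  unfolding block_div_mod[OF assms(1)] block_div_mod[OF assms(2)] by simp_all

text \<open>The entry for \<open>(d, x)\<close> is computed from the one for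
  \<open>(d div p, x div p)\<close>, which was filled before it. The only exception is
  \<open>(0, 0)\<close>, which reads itself and relies on the initial 0.\<close>

lemma sem_table:
  assumes "cells st RH 0 = 0"
  shows "table_ok (sem f w 7 table e st)"
proof -
  define ok where "ok d x u \<longleftrightarrow> cells u RH (d * l + x) = had p d x" for d x and u :: store
  define I where "I d u \<longleftrightarrow> (\<forall>d'<d. \<forall>x<l. ok d' x u) & (d = 0 --> cells u RH 0 = 0)" for d :: nat and u :: store
  have "I (e 4) (sem f w 7 table e st)"
    unfolding table_def sem.simps(9)
  proof (rule fold_upt_inv)
    show "I 0 st" using assms by (simp add: I_def)
  next
    fix d and u :: store assume d: "d < e 4" and I: "I d u"
    define J where "J x v \<longleftrightarrow> (\<forall>d'<d. \<forall>x<l. ok d' x v) & (\<forall>x'<x. ok d x' v) & (d = 0 & x = 0 --> cells v RH 0 = 0)"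
      for x :: nat and v :: store
    let ?wr = "Write RH (Reg 7 \<otimes> LL \<oplus> Reg 8) (Bin Minim (Const p) (Bin Modulo (Bin Modulo (Reg 7) (Const p) \<otimes> Bin Modulo (Reg 8) (Const p)
       \<oplus> Cell RH (Bin Divide (Reg 7) (Const p) \<otimes> LL \<oplus> Bin Divide (Reg 8) (Const p))) (Const p)))"
    have "J ((e(7 := d)) 4) (fold (%j. sem f w (Suc (Suc 7)) ?wr ((e(7 := d))(Suc 7 := j))) [0..<(e(7 := d)) 4] u)"
    proof (rule fold_upt_inv)
      show "J 0 u" using I by (auto simp: I_def J_def)
    next
      fix x and v :: store assume x: "x < (e(7 := d)) 4" and J: "J x v"
      have dl: "d < l" "x < l" using d x by (simp_all add: env)
      have xp: "x div p <= x" "x div p < l" using dl div_le_dividend[of x p] by linarith+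
      have rd: "cells v RH (d div p * l + x div p) = had p (d div p) (x div p)"
      proof (cases "d = 0")
        case False
        then have "d div p < d" using p1 by simp
        then show ?thesis using J xp by (simp add: J_def ok_def)
      next
        case True
        show ?thesis
        proof (cases "x = 0")
          case True
          then show ?thesis using J \<open>d = 0\<close> by (simp add: J_def had_0)
        next
          case False
          then have "x div p < x" using p1 by simp
          then show ?thesis using J \<open>d = 0\<close> by (simp add: J_def ok_def)
        qed
      qed
      have hl: "had p d x <= p" using had_less[OF p1, of d x] by simp
      have s: "sem f w (Suc (Suc 7)) ?wr ((e(7 := d))(Suc 7 := x)) v = put RH (d * l + x) (had p d x) v"
        using hl by (simp add: env rd had_rec[OF p1, of d x, symmetric])
      have keep: "ok d' x' (put RH (d * l + x) (had p d x) v)" if "ok d' x' v" "x' < l" for d' x'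
        using that cell_index[OF that(2) dl(2), of d' d] by (auto simp: ok_def)
      have "ok d x (put RH (d * l + x) (had p d x) v)" by (simp add: ok_def)
      then show "J (Suc x) (sem f w (Suc (Suc 7)) ?wr ((e(7 := d))(Suc 7 := x)) v)"
        unfolding s using J keep dl by (auto simp: J_def less_Suc_eq)
    qed
    then show "I (Suc d) (fold (%j. sem f w (Suc (Suc 7)) ?wr ((e(7 := d))(Suc 7 := j))) [0..<(e(7 := d)) 4] u)"
      by (auto simp: I_def J_def env less_Suc_eq)
  qed
  then show ?thesis by (auto simp: I_def table_ok_def ok_def env)
qed

section \<open>List decoding of the digits of a received message\<close>

definition agreement :: "nat list => nat => nat => nat => nat set" where
  "agreement ys q k d = {r. r < h & ys ! r div q div p ^ k mod p = had p d (r mod l)}"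

definition piece_ok :: "store => nat => nat list => nat => bool" where
  "piece_ok st i ys q \<longleftrightarrow> cells st (RF i) = tally q Q l ys & length ys = h & (\<forall>y\<in>set ys. y div q < Q)"

lemma piece_ok_cong: "cells st (RF i) = cells st' (RF i) ==> piece_ok st i ys q = piece_ok st' i ys q"
  by (simp add: piece_ok_def)

lemma sem_agree_digit:
  assumes t: "table_ok st" and ok: "piece_ok st i ys q" and e': "e' 4 = l" "e' 6 = h" "e' 7 = d" and d: "d < l"
  shows "cells (sem f w 8 (agree_digit i k) e' st) VC 0 = card (agreement ys q k d)"
proof -
  define S where "S x = (\<Sum>c<Q. of_bool (c div p ^ k mod p = had p d x) * tally q Q l ys (x * Q + c))" for x
  have tot: "(\<Sum>x<l. S x) = card (agreement ys q k d)"
    unfolding S_def agreement_def using ok l0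
    by (subst sum_tally[where P = "%c x. c div p ^ k mod p = had p d x"]) (auto simp: piece_ok_def)
  have "card (agreement ys q k d) <= card {..<h}" by (rule card_mono) (auto simp: agreement_def)
  then have le: "(\<Sum>x<j. S x) <= h" if "j <= l" for j
    using sum_mono2[of "{..<l}" "{..<j}" S] that tot by auto
  define I where "I j u \<longleftrightarrow> (\<forall>r. r ~= VC --> cells u r = cells st r) & cells u VC 0 = (\<Sum>x<j. S x)" for j :: nat and u :: store
  let ?wr = "Write VC (Const 0) (Bin Minim (Reg 6) (Var VC \<oplus>
       SumN Q (%c. eq_expr (Const (c div p ^ k mod p)) (Cell RH (Reg 7 \<otimes> LL \<oplus> Reg 8))
         \<otimes> Cell (RF i) (Reg 8 \<otimes> Const Q \<oplus> Const c))))"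
  have "I (e' 4) (sem f w 8 (agree_digit i k) e' st)"
    unfolding agree_digit_def sem.simps(7,9)
  proof (rule fold_upt_inv)
    show "I 0 (sem f w 8 (Write VC (Const 0) (Const 0)) e' st)" by (simp add: I_def)
  next
    fix j and u :: store assume j: "j < e' 4" and I: "I j u"
    have jl: "j < l" using j e' by simp
    have fr: "cells u RH = cells st RH" "cells u (RF i) = tally q Q l ys"
      using I ok by (simp_all add: I_def piece_ok_def RF_def)
    have rd: "cells st RH (d * l + j) = had p d j" using t d jl by (simp add: table_ok_def)
    have ev: "eval (e'(8 := j)) (cells u) (SumN Q (%c. eq_expr (Const (c div p ^ k mod p)) (Cell RH (Reg 7 \<otimes> LL \<oplus> Reg 8))
         \<otimes> Cell (RF i) (Reg 8 \<otimes> Const Q \<oplus> Const c))) = S j"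
      by (simp add: fr e' rd S_def)
    have "sem f w (Suc 8) ?wr (e'(8 := j)) u = put VC 0 (min h (cells u VC 0 + S j)) u"
      using ev by (simp add: e')
    also have "min h (cells u VC 0 + S j) = (\<Sum>x<Suc j. S x)"
      using I le[of "Suc j"] jl by (simp add: I_def min_def)
    finally show "I (Suc j) (sem f w (Suc 8) ?wr (e'(8 := j)) u)" using I by (simp add: I_def)
  qed
  then show ?thesis using tot by (simp add: I_def e')
qed

definition good :: "nat list => nat => nat => nat => bool" where
  "good ys q k d \<longleftrightarrow> h <= g * card (agreement ys q k d)"

text \<open>Two different digits agree in at most \<open>(h + l) / p \<le> 2 * h / p\<close> places,
  so the places where each agrees with the received word form large sets with small
  intersections.\<close>

lemma few_good:
  assumes "l = p ^ kk" "0 < h" "l <= h"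
  shows "card {d. d < l & good ys q k d} < \<Lambda>"
  unfolding \<Lambda>_def
proof (rule few_large_sets[where A = "agreement ys q k" and h = h and p = p])
  fix d d' assume d: "d \<in> {d. d < l & good ys q k d}" "d' \<in> {d. d < l & good ys q k d}" "d ~= d'"
  have "agreement ys q k d \<inter> agreement ys q k d' \<subseteq> {r. r < h & had p d (r mod l) = had p d' (r mod l)}"
    by (auto simp: agreement_def)
  then have "card (agreement ys q k d \<inter> agreement ys q k d') <= card {r. r < h & had p d (r mod l) = had p d' (r mod l)}"
    by (intro card_mono) auto
  then have "p * card (agreement ys q k d \<inter> agreement ys q k d')
      <= p * card {r. r < h & had p d (r mod l) = had p d' (r mod l)}"
    by (rule mult_le_mono2)
  also have "\<dots> <= h + l" using had_agreement[OF p(1) assms(1), of d d' h] d by simp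
  finally have "p * card (agreement ys q k d \<inter> agreement ys q k d') <= h + l" .
  then show "p * card (agreement ys q k d \<inter> agreement ys q k d') <= 2 * h" using assms(3) by simp
qed (use g p(2) assms(2) in \<open>auto simp: good_def agreement_def\<close>)

text \<open>Since fewer than \<Lambda> digits are good, the list never fills up and no good digit is
  turned away. Its length after the digits below \<open>d\<close> is
  \<open>card (G d)\<close>.\<close>

lemma sem_list_digit:
  fixes st i k
  assumes t: "table_ok st" and ok: "piece_ok st i ys q" and l: "l = p ^ kk" "0 < h" "l <= h"
  defines "L' == cells (sem f w 7 (list_digit i k) e st) RL" and "B == (i * C + k) * \<Lambda>"
  shows "\<forall>d<l. good ys q k d --> (\<exists>j<\<Lambda>. L' (B + j) = d)"
    and "\<forall>z. z < B \<or> B + \<Lambda> <= z --> L' z = cells st RL z"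
    and "\<forall>z. cells st RL z < l ==> \<forall>z. L' z < l"
proof -
  define G where "G d = {d'. d' < d & good ys q k d'}" for d
  have G: "card (G d) < \<Lambda>" if "d <= l" for d
  proof -
    have "card (G d) <= card (G l)" using that by (intro card_mono) (auto simp: G_def)
    also have "\<dots> < \<Lambda>" unfolding G_def by (rule few_good[OF l])
    finally show ?thesis .
  qed
  have GS: "card (G (Suc d)) = card (G d) + of_bool (good ys q k d)" for d
  proof -
    have "G (Suc d) = G d \<union> (if good ys q k d then {d} else {})" by (auto simp: G_def less_Suc_eq)
    moreover have "finite (G d)" "d \<notin> G d" by (auto simp: G_def)
    ultimately show ?thesis by auto
  qed
  define I where "I d u \<longleftrightarrow> (\<forall>r. r \<notin> {VC, VL, RL} --> cells u r = cells st r) & cells u VL 0 = card (G d) &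
    (\<forall>d'\<in>G d. \<exists>j<card (G d). cells u RL (B + j) = d') &
    (\<forall>z. z < B \<or> B + \<Lambda> <= z --> cells u RL z = cells st RL z) &
    ((\<forall>z. cells st RL z < l) --> (\<forall>z. cells u RL z < l))" for d :: nat and u :: store
  let ?cond = "Cond (le_expr (Reg 6) (Const g \<otimes> Var VC) \<otimes> less_expr (Var VL) (Const \<Lambda>))
         (Seq (Write RL (Const B \<oplus> Var VL) (Reg 7)) (Write VL (Const 0) (Var VL \<oplus> Const 1))) Skip"
  have "I (e 4) (sem f w 7 (list_digit i k) e st)"
    unfolding list_digit_def sem.simps(7)[of f w 7] sem.simps(9) B_def[symmetric]
  proof (rule fold_upt_inv)
    show "I 0 (sem f w 7 (Write VL (Const 0) (Const 0)) e st)" by (simp add: I_def G_def)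
  next
    fix d and u :: store assume d: "d < e 4" and I: "I d u"
    have dl: "d < l" using d env by simp
    define u1 where "u1 = sem f w 8 (agree_digit i k) (e(7 := d)) u"
    have fr: "cells u1 r = cells u r" if "r ~= VC" for r
      unfolding u1_def by (rule sem_frame) (use that in \<open>simp add: mods_coms\<close>)
    have tu: "table_ok u" "piece_ok u i ys q"
      using t ok I by (auto simp: I_def table_ok_def piece_ok_def RF_def)
    have acc: "cells u1 VC 0 = card (agreement ys q k d)"
      unfolding u1_def by (rule sem_agree_digit[OF tu]) (simp_all add: env dl)
    have VL: "cells u1 VL 0 = card (G d)" "card (G d) < \<Lambda>" using I fr[of VL] G[of d] dl by (auto simp: I_def)
    have RL: "cells u1 RL = cells u RL" by (rule fr) simp
    have s: "sem f w 8 ?cond (e(7 := d)) u1 =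
      (if good ys q k d then put VL 0 (Suc (card (G d))) (put RL (B + card (G d)) d u1) else u1)"
      using VL acc by (simp add: env good_def)
    have "I (Suc d) (sem f w 8 ?cond (e(7 := d)) u1)"
    proof (cases "good ys q k d")
      case True
      then have c: "card (G (Suc d)) = Suc (card (G d))" using GS by simp
      have gs: "G (Suc d) = insert d (G d)" using True by (auto simp: G_def less_Suc_eq)
      have "\<exists>j<Suc (card (G d)). ((cells u RL)(B + card (G d) := d)) (B + j) = d'" if "d' \<in> G (Suc d)" for d'
      proof (cases "d' = d")
        case False
        then have "d' \<in> G d" using that gs by simp
        then obtain j where "j < card (G d)" "cells u RL (B + j) = d'" using I unfolding I_def by blast
        then show ?thesis by (intro exI[of _ j]) auto
      qed auto
      then have 3: "\<forall>d'\<in>G (Suc d). \<exists>j<card (G (Suc d)). ((cells u RL)(B + card (G d) := d)) (B + j) = d'"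
        unfolding c by blast
      define u2 where "u2 = put VL 0 (Suc (card (G d))) (put RL (B + card (G d)) d u1)"
      have u2: "cells u2 RL = (cells u RL)(B + card (G d) := d)" "cells u2 VL 0 = card (G (Suc d))"
        "\<And>r. r \<notin> {VC, VL, RL} ==> cells u2 r = cells u1 r"
        by (simp_all add: u2_def RL c)
      have 1: "\<forall>r. r \<notin> {VC, VL, RL} --> cells u2 r = cells st r"
        using u2(3) fr I by (simp add: I_def)
      have 4: "\<forall>z. z < B \<or> B + \<Lambda> <= z --> cells u2 RL z = cells st RL z"
      proof (intro allI impI)
        fix z assume z: "z < B \<or> B + \<Lambda> <= z"
        then have "z ~= B + card (G d)" using VL(2) by auto
        moreover have "cells u RL z = cells st RL z" using z I unfolding I_def by blast
        ultimately show "cells u2 RL z = cells st RL z" by (simp add: u2(1))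
      qed
      have 5: "(\<forall>z. cells st RL z < l) --> (\<forall>z. cells u2 RL z < l)"
        using I dl by (simp add: u2(1) I_def)
      have "I (Suc d) u2" unfolding I_def using 1 u2(2) 3[folded u2(1)] 4 5 by blast
      then show ?thesis unfolding s u2_def using True by simp
    next
      case False
      then have c: "G (Suc d) = G d" by (auto simp: G_def less_Suc_eq)
      have 1: "\<forall>r. r \<notin> {VC, VL, RL} --> cells u1 r = cells st r"
        using fr I by (simp add: I_def)
      have "I (Suc d) u1" unfolding I_def c RL using 1 VL(1) I[unfolded I_def] by blast
      then show ?thesis unfolding s using False by simp
    qed
    then show "I (Suc d) (sem f w (Suc 7) (Seq (agree_digit i k) ?cond) (e(7 := d)) u)"
      unfolding sem.simps(7) u1_def by simp
  qed
  then have I: "I l (sem f w 7 (list_digit i k) e st)" by (simp add: env)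
  show "\<forall>z. z < B \<or> B + \<Lambda> <= z --> L' z = cells st RL z" using I by (simp add: I_def L'_def)
  show "\<forall>z. L' z < l" if "\<forall>z. cells st RL z < l" using I that by (simp add: I_def L'_def)
  show "\<forall>d<l. good ys q k d --> (\<exists>j<\<Lambda>. L' (B + j) = d)"
  proof (intro allI impI)
    fix d assume "d < l" "good ys q k d"
    then have "d \<in> G l" by (simp add: G_def)
    then obtain j where "j < card (G l)" "L' (B + j) = d" using I unfolding I_def L'_def by blast
    then show "\<exists>j<\<Lambda>. L' (B + j) = d" using less_trans[OF _ G[OF order_refl]] by blast
  qed
qed

lemma sem_lists:
  fixes st i
  assumes t: "table_ok st" and ok: "piece_ok st i ys q" and l: "l = p ^ kk" "0 < h" "l <= h"
  defines "L' == cells (sem f w 7 (SeqN C (list_digit i)) e st) RL"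
  shows "\<forall>k<C. \<forall>d<l. good ys q k d --> (\<exists>j<\<Lambda>. L' ((i * C + k) * \<Lambda> + j) = d)"
    and "\<forall>z. z < i * C * \<Lambda> \<or> (i * C + C) * \<Lambda> <= z --> L' z = cells st RL z"
    and "\<forall>z. cells st RL z < l ==> \<forall>z. L' z < l"
proof -
  define I where "I n u \<longleftrightarrow> (\<forall>r. r \<notin> {VC, VL, RL} --> cells u r = cells st r) &
    (\<forall>k<n. \<forall>d<l. good ys q k d --> (\<exists>j<\<Lambda>. cells u RL ((i * C + k) * \<Lambda> + j) = d)) &
    (\<forall>z. z < i * C * \<Lambda> \<or> (i * C + n) * \<Lambda> <= z --> cells u RL z = cells st RL z) &
    ((\<forall>z. cells st RL z < l) --> (\<forall>z. cells u RL z < l))" for n :: nat and u :: store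
  have "I C (sem f w 7 (SeqN C (list_digit i)) e st)"
  proof (rule sem_SeqN_inv)
    show "I 0 st" by (simp add: I_def)
  next
    fix n and u :: store assume "n < C" and I: "I n u"
    have tu: "table_ok u" "piece_ok u i ys q"
      using t ok I by (auto simp: I_def table_ok_def piece_ok_def RF_def)
    let ?v = "sem f w 7 (list_digit i n) e u" and ?B = "(i * C + n) * \<Lambda>"
    note L = sem_list_digit[OF tu l, of n]
    have 1: "\<forall>r. r \<notin> {VC, VL, RL} --> cells ?v r = cells st r"
      using I sem_frame[of _ "list_digit i n" f w 7 e u] by (simp add: I_def mods_coms)
    have 2: "\<exists>j<\<Lambda>. cells ?v RL ((i * C + k) * \<Lambda> + j) = d" if k: "k < Suc n" "d < l" "good ys q k d" for k d
    proof (cases "k = n")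
      case True
      then show ?thesis using L(1) k by simp
    next
      case False
      then obtain j where j: "j < \<Lambda>" "cells u RL ((i * C + k) * \<Lambda> + j) = d"
        using I k unfolding I_def by (metis less_antisym)
      have "(i * C + k + 1) * \<Lambda> <= (i * C + n) * \<Lambda>" using False k by (intro mult_le_mono1) simp
      then have "(i * C + k) * \<Lambda> + j < ?B" using j(1) by simp
      then show ?thesis using L(2) j by auto
    qed
    have 3: "cells ?v RL z = cells st RL z" if "z < i * C * \<Lambda> \<or> (i * C + Suc n) * \<Lambda> <= z" for z
    proof -
      have "z < ?B \<or> ?B + \<Lambda> <= z" using that by (auto simp: add_mult_distrib)
      then have "cells ?v RL z = cells u RL z" using L(2) by blast
      also have "\<dots> = cells st RL z"
      proof -
        have "z < i * C * \<Lambda> \<or> (i * C + n) * \<Lambda> <= z" using that by (auto simp: add_mult_distrib)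
        then show ?thesis using I unfolding I_def by blast
      qed
      finally show ?thesis .
    qed
    have 4: "(\<forall>z. cells st RL z < l) --> (\<forall>z. cells ?v RL z < l)" using I L(3) unfolding I_def by blast
    show "I (Suc n) ?v" unfolding I_def using 1 2 3 4 by blast
  qed
  then show "\<forall>k<C. \<forall>d<l. good ys q k d --> (\<exists>j<\<Lambda>. L' ((i * C + k) * \<Lambda> + j) = d)"
    "\<forall>z. z < i * C * \<Lambda> \<or> (i * C + C) * \<Lambda> <= z --> L' z = cells st RL z"
    "\<forall>z. cells st RL z < l ==> \<forall>z. L' z < l"
    unfolding I_def L'_def by blast+
qed

end

context coder_exec
begin

section \<open>Matching messages against candidates and crediting them\<close>

definition received :: "(nat => nat) => nat => nat" where
  "received dg i = (\<Sum>j<4. dg (4 * i + j) * l ^ j)"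

text \<open>The two conditions under which \<open>agreeing_candidates\<close> can be applied: the
  message covers all positions that Bob had at stage \<open>j\<close>, and at all its positions
  candidate \<open>k\<close> has the values that the message reports for one and the same candidate
  \<open>r\<close> of Alice.\<close>

definition matches :: "(nat => nat) => (nat => nat) => (nat => nat) => nat => nat => bool" where
  "matches dg B X j k \<longleftrightarrow> (\<forall>i<M * M. \<exists>z<np. received dg z = B (j * (M * M) + i)) &
     (\<exists>r<M. \<forall>z<np. at_pos m (slot X m k) (received dg z) = received dg (np + r * np + z))"

lemma prod_of_bool: "(\<Prod>k<(n::nat). of_bool (P k) :: nat) = of_bool (\<forall>k<n. P k)"
  by (induction n) (auto simp: less_Suc_eq)

lemma sum_of_bool_pos: "(\<Sum>k<(n::nat). of_bool (P k) :: nat) ~= 0 \<longleftrightarrow> (\<exists>k<n. P k)"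
  by (induction n) (auto simp: less_Suc_eq)

lemma prod_pos: "(\<Prod>k<(n::nat). a k :: nat) ~= 0 \<longleftrightarrow> (\<forall>k<n. a k ~= 0)"
  by (induction n) (auto simp: less_Suc_eq)

lemma eval_match_expr: "eval e c (match_expr j k) ~= 0 \<longleftrightarrow> matches (c RG) (c RB) (c RX) j k"
proof -
  have rc: "eval e c (received_expr i) = received (c RG) i" for i
    by (simp add: received_expr_def received_def env)
  have vl: "eval e c (value_expr k x) = at_pos m (slot (c RX) m k) (eval e c x)" for x
    by (rule eval_value_expr) (simp add: env)
  have 1: "eval e c (ProdN (M * M) (%i. SumN np (%z. eq_expr (received_expr z) (Cell RB (Const (j * (M * M) + i)))))) ~= 0
    \<longleftrightarrow> (\<forall>i<M * M. \<exists>z<np. received (c RG) z = c RB (j * (M * M) + i))"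
    unfolding eval_ProdN prod_pos eval_SumN eval_eq_expr sum_of_bool_pos rc by simp
  have 2: "eval e c (SumN M (%r. ProdN np (%z. eq_expr (value_expr k (received_expr z)) (received_expr (np + r * np + z))))) ~= 0
    \<longleftrightarrow> (\<exists>r<M. \<forall>z<np. at_pos m (slot (c RX) m k) (received (c RG) z) = received (c RG) (np + r * np + z))"
    unfolding eval_ProdN prod_of_bool eval_SumN eval_eq_expr sum_of_bool_pos rc vl ..
  show ?thesis unfolding match_expr_def eval.simps ap.simps matches_def using 1 2 by simp
qed

definition identified :: "(nat => nat) => (nat => nat) => (nat => nat) => nat => nat => bool" where
  "identified dg B X n v \<longleftrightarrow>
     (v = M & (\<forall>j<n. \<forall>k<j * ls. \<not> matches dg B X j k)) \<or>
     (v < M & (\<exists>j<n. v < j * ls & matches dg B X j v & (\<forall>j'<n. \<forall>k<j' * ls. matches dg B X j' k --> j' <= j)))"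

lemma sem_identify:
  "identified (cells st RG) (cells st RB) (cells st RX) b (cells (sem f w 7 identify e st) VB 0)"
proof -
  let ?m = "matches (cells st RG) (cells st RB) (cells st RX)"
  let ?id = "identified (cells st RG) (cells st RB) (cells st RX)"
  define I where "I j u \<longleftrightarrow> (\<forall>r. r ~= VB --> cells u r = cells st r) & ?id j (cells u VB 0)" for j :: nat and u :: store
  have "I b (sem f w 7 identify e st)"
    unfolding identify_def sem.simps(7)
  proof (rule sem_SeqN_inv)
    show "I 0 (sem f w 7 (Write VB (Const 0) (Const M)) e st)" by (simp add: I_def identified_def)
  next
    fix j and u :: store assume j: "j < b" and I: "I j u"
    define J where "J n x \<longleftrightarrow> (\<forall>r. r ~= VB --> cells x r = cells st r) &
      ((\<exists>k<n. ?m j k) & cells x VB 0 < n & ?m j (cells x VB 0) \<or>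
       (\<forall>k<n. \<not> ?m j k) & cells x VB 0 = cells u VB 0)" for n :: nat and x :: store
    have J: "J (j * ls) (sem f w 7 (SeqN (j * ls) (%k. Cond (match_expr j k) (Write VB (Const 0) (Const k)) Skip)) e u)"
    proof (rule sem_SeqN_inv)
      show "J 0 u" using I by (simp add: I_def J_def)
    next
      fix n and x :: store assume "n < j * ls" and J: "J n x"
      have fr: "cells x RG = cells st RG" "cells x RB = cells st RB" "cells x RX = cells st RX"
        using J by (simp_all add: J_def)
      have "sem f w 7 (Cond (match_expr j n) (Write VB (Const 0) (Const n)) Skip) e x = (if ?m j n then put VB 0 n x else x)"
        using eval_match_expr[of "cells x" j n] by (simp add: fr)
      moreover have "J (Suc n) (if ?m j n then put VB 0 n x else x)"
      proof (cases "?m j n")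
        case True
        then show ?thesis using J by (auto simp: J_def)
      next
        case False
        then show ?thesis using J by (auto simp: J_def less_Suc_eq)
      qed
      ultimately show "J (Suc n) (sem f w 7 (Cond (match_expr j n) (Write VB (Const 0) (Const n)) Skip) e x)" by simp
    qed
    let ?x = "sem f w 7 (SeqN (j * ls) (%k. Cond (match_expr j k) (Write VB (Const 0) (Const k)) Skip)) e u"
    have "?id (Suc j) (cells ?x VB 0)"
    proof (cases "\<exists>k<j * ls. ?m j k")
      case True
      then have v: "cells ?x VB 0 < j * ls" "?m j (cells ?x VB 0)" using J by (auto simp: J_def)
      have "cells ?x VB 0 < M" using below_M[OF j v(1)] .
      moreover have "\<forall>j'<Suc j. \<forall>k<j' * ls. ?m j' k --> j' <= j" by simp
      ultimately show ?thesis using v unfolding identified_def by blast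
    next
      case False
      then have v: "cells ?x VB 0 = cells u VB 0" using J by (auto simp: J_def)
      have id: "?id j (cells u VB 0)" using I by (simp add: I_def)
      have nm: "\<not> ?m j k" if "k < j * ls" for k using False that by blast
      show ?thesis
        using id unfolding identified_def v
      proof (elim disjE conjE exE)
        assume "cells u VB 0 = M" "\<forall>j'<j. \<forall>k<j' * ls. \<not> ?m j' k"
        then show "cells u VB 0 = M & (\<forall>ja<Suc j. \<forall>k<ja * ls. \<not> ?m ja k) \<or>
          cells u VB 0 < M & (\<exists>ja<Suc j. cells u VB 0 < ja * ls & ?m ja (cells u VB 0) &
            (\<forall>j'<Suc j. \<forall>k<j' * ls. ?m j' k --> j' <= ja))"
          using nm by (auto simp: less_Suc_eq)
      next
        fix j0 assume a: "cells u VB 0 < M" "j0 < j" "cells u VB 0 < j0 * ls" "?m j0 (cells u VB 0)"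
          "\<forall>j'<j. \<forall>k<j' * ls. ?m j' k --> j' <= j0"
        have "\<forall>j'<Suc j. \<forall>k<j' * ls. ?m j' k --> j' <= j0" using a(5) nm by (auto simp: less_Suc_eq)
        then show "cells u VB 0 = M & (\<forall>ja<Suc j. \<forall>k<ja * ls. \<not> ?m ja k) \<or>
          cells u VB 0 < M & (\<exists>ja<Suc j. cells u VB 0 < ja * ls & ?m ja (cells u VB 0) &
            (\<forall>j'<Suc j. \<forall>k<j' * ls. ?m j' k --> j' <= ja))"
          using a less_SucI by blast
      qed
    qed
    then show "I (Suc j) ?x" using J by (simp add: I_def J_def)
  qed
  then show ?thesis by (simp add: I_def)
qed

lemma sem_agree:
  assumes ok: "piece_ok st i ys q" and W: "\<And>x. x < l ==> cells st RW x < Q"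
  shows "cells (sem f w 7 (agree i) e st) VC 0 = card {r. r < h & ys ! r div q = cells st RW (r mod l)}"
proof -
  let ?W = "cells st RW"
  define S where "S x = tally q Q l ys (x * Q + ?W x)" for x
  have ys: "length ys = h" using ok by (simp add: piece_ok_def)
  have tot: "(\<Sum>x<l. S x) = card {r. r < h & ys ! r div q = ?W (r mod l)}"
    unfolding S_def ys[symmetric] using ok by (intro sum_tally_word[OF l0 _ W]) (auto simp: piece_ok_def)
  have "card {r. r < h & ys ! r div q = ?W (r mod l)} <= card {..<h}" by (rule card_mono) auto
  then have le: "(\<Sum>x<j. S x) <= h" if "j <= l" for j
    using sum_mono2[of "{..<l}" "{..<j}" S] that tot by auto
  define I where "I j u \<longleftrightarrow> (\<forall>r. r ~= VC --> cells u r = cells st r) & cells u VC 0 = (\<Sum>x<j. S x)" for j :: nat and u :: store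
  let ?wr = "Write VC (Const 0) (Bin Minim (Reg 6) (Var VC \<oplus> Cell (RF i) (Reg 7 \<otimes> Const Q \<oplus> Cell RW (Reg 7))))"
  have "I (e 4) (sem f w 7 (agree i) e st)"
    unfolding agree_def sem.simps(7,9)
  proof (rule fold_upt_inv)
    show "I 0 (sem f w 7 (Write VC (Const 0) (Const 0)) e st)" by (simp add: I_def)
  next
    fix j and u :: store assume j: "j < e 4" and I: "I j u"
    have jl: "j < l" using j env by simp
    have fr: "cells u RW = ?W" "cells u (RF i) = tally q Q l ys"
      using I ok by (simp_all add: I_def piece_ok_def RF_def)
    have "sem f w (Suc 7) ?wr (e(7 := j)) u = put VC 0 (min h (cells u VC 0 + S j)) u"
      by (simp add: env fr S_def)
    also have "min h (cells u VC 0 + S j) = (\<Sum>x<Suc j. S x)"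
      using I le[of "Suc j"] jl by (simp add: I_def min_def)
    finally show "I (Suc j) (sem f w (Suc 7) ?wr (e(7 := j)) u)" using I by (simp add: I_def)
  qed
  then show ?thesis using tot by (simp add: I_def env)
qed

definition chosen :: "(nat => nat) => nat => nat => nat => nat" where
  "chosen L i z k = L ((i * C + k) * \<Lambda> + z div \<Lambda> ^ k mod \<Lambda>)"

definition score :: "(nat => nat) => nat => nat => nat list => nat => nat" where
  "score L i z ys q = card {r. r < h & ys ! r div q = csym p C (chosen L i z) (r mod l)}"

text \<open>The credit in piece \<open>i\<close> is the maximal score among the messages that
  identify the candidate. The first half says that it is an upper bound, the second that it is
  attained or 0; the true transcript needs the former, its rivals the latter.\<close>

definition judged :: "store => nat => nat => nat list => nat => (nat => nat) => bool" where
  "judged st i n ys q R \<longleftrightarrow>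
     (\<forall>z<n. \<exists>v. identified (chosen (cells st RL) i z) (cells st RB) (cells st RX) b v &
        (\<forall>k<M. v < M --> slot (cells st RX) m v = slot (cells st RX) m k --> score (cells st RL) i z ys q <= R (i * M + k))) &
     (\<forall>k<M. R (i * M + k) = 0 \<or> (\<exists>z<n. \<exists>v<M. identified (chosen (cells st RL) i z) (cells st RB) (cells st RX) b v &
        slot (cells st RX) m v = slot (cells st RX) m k & R (i * M + k) = score (cells st RL) i z ys q))"

definition base :: "store => store => bool" where
  "base st u \<longleftrightarrow> (\<forall>r. r \<notin> {RG, RW, VC, VB, RC} --> cells u r = cells st r)"

lemma sem_judge:
  assumes t: "table_ok st" and ok: "piece_ok st i ys q" and L: "\<forall>z. cells st RL z < l"
    and P: "\<forall>z<M * M. cells st RP z = first_diff m (slot (cells st RX) m (z div M)) (slot (cells st RX) m (z mod M))"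
    and u0: "base st u0" "\<forall>k<M. cells u0 RC (i * M + k) = 0"
  defines "u' == sem f w 7 (judge i) e u0"
  shows "base st u'" "judged st i (\<Lambda> ^ C) ys q (cells u' RC)"
    "\<And>i' k. i' ~= i ==> k < M ==> cells u' RC (i' * M + k) = cells u0 RC (i' * M + k)"
proof -
  let ?L = "cells st RL" and ?X = "cells st RX" and ?B = "cells st RB"
  define I where "I n u \<longleftrightarrow> base st u & judged st i n ys q (cells u RC) &
     (\<forall>i' k. i' ~= i --> k < M --> cells u RC (i' * M + k) = cells u0 RC (i' * M + k))" for n :: nat and u :: store
  have "I (\<Lambda> ^ C) u'"
    unfolding u'_def judge_def
  proof (rule sem_SeqN_inv)
    show "I 0 u0" using u0 by (simp add: I_def judged_def)
  next
    fix z and u :: store assume z: "z < \<Lambda> ^ C" and I: "I z u"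
    have bu: "base st u" using I by (simp add: I_def)
    define u1 where "u1 = sem f w 7 (message_digits i z) e u"
    have RG1: "cells u1 RG k = chosen ?L i z k" if "k < C" for k
    proof -
      have "eval e c (Cell RL (Const ((i * C + k) * \<Lambda> + z div \<Lambda> ^ k mod \<Lambda>))) = chosen (cells u RL) i z k"
        if "\<And>r. r ~= RG ==> c r = cells u r" for k c
        using that[of RL] by (simp add: chosen_def)
      from sem_writes[of RG u, OF this, of C "%k. k" 0] have "cells u1 RG k = chosen (cells u RL) i z k"
        using \<open>k < C\<close> by (simp add: u1_def message_digits_def)
      then show ?thesis using bu by (simp add: base_def)
    qed
    have fr1: "cells u1 r = cells u r" if "r ~= RG" for r
      unfolding u1_def by (rule sem_frame) (use that mods_coms(10) in blast)
    define u2 where "u2 = sem f w 7 codeword e u1"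
    have t1: "table_ok u1" using t bu fr1[of RH] by (simp add: table_ok_def base_def)
    have dl: "cells u1 RG k < l" if "k < C" for k using RG1[OF that] L by (simp add: chosen_def)
    have W2: "cells u2 RW x = csym p C (chosen ?L i z) x" if "x < l" for x
    proof -
      have "csym p C (cells u1 RG) x = csym p C (chosen ?L i z) x" unfolding csym_def using RG1 by (intro sum.cong) auto
      then show ?thesis using sem_codeword[OF t1 dl] that by (simp add: u2_def)
    qed
    have fr2: "cells u2 r = cells u1 r" if "r ~= RW" for r
      unfolding u2_def by (rule sem_frame) (use that in \<open>simp add: mods_coms\<close>)
    define u3 where "u3 = sem f w 7 (agree i) e u2"
    have ok2: "piece_ok u2 i ys q"
      using ok bu fr1[of "RF i"] fr2[of "RF i"] by (simp add: piece_ok_def base_def RF_def)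
    have WQ: "cells u2 RW x < Q" if "x < l" for x using W2[OF that] csym_less[OF p1] by (simp add: Q_def)
    have VC3: "cells u3 VC 0 = score ?L i z ys q"
    proof -
      have "{r. r < h & ys ! r div q = cells u2 RW (r mod l)} = {r. r < h & ys ! r div q = csym p C (chosen ?L i z) (r mod l)}"
        using W2 l0 by auto
      then show ?thesis using sem_agree[OF ok2 WQ] by (simp add: u3_def score_def)
    qed
    have fr3: "cells u3 r = cells u2 r" if "r ~= VC" for r
      unfolding u3_def by (rule sem_frame) (use that in \<open>simp add: mods_coms\<close>)
    define u4 where "u4 = sem f w 7 identify e u3"
    have fr4: "cells u4 r = cells u3 r" if "r ~= VB" for r
      unfolding u4_def by (rule sem_frame) (use that mods_coms(12) in blast)
    define v where "v = cells u4 VB 0"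
    have rcv: "received (cells u3 RG) y = received (chosen ?L i z) y" if "y < nf" for y
      unfolding received_def using RG1 fr2[of RG] fr3[of RG] that by (intro sum.cong refl) (simp add: C_def)
    have npf: "np <= nf" "\<And>r y. r < M ==> y < np ==> np + r * np + y < nf"
    proof -
      show "np <= nf" by (simp add: nf_def)
      fix r y assume "r < M" "y < np"
      then have "r * np + y < (r + 1) * np" "(r + 1) * np <= M * np" by (simp, intro mult_le_mono1, simp)
      then show "np + r * np + y < nf" by (simp add: nf_def)
    qed
    have mt: "matches (cells u3 RG) B X j k = matches (chosen ?L i z) B X j k" for B X j k
    proof -
      have a: "received (cells u3 RG) y = received (chosen ?L i z) y" if "y < np" for y
        using rcv npf(1) that by simp
      have c: "received (cells u3 RG) (np + r * np + y) = received (chosen ?L i z) (np + r * np + y)" if "r < M" "y < np" for r y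
        using rcv npf(2)[OF that] by simp
      have 1: "(\<exists>y<np. received (cells u3 RG) y = x) \<longleftrightarrow> (\<exists>y<np. received (chosen ?L i z) y = x)" for x
        using a by auto
      have 2: "(\<exists>r<M. \<forall>y<np. at_pos m (slot X m k) (received (cells u3 RG) y) = received (cells u3 RG) (np + r * np + y)) \<longleftrightarrow>
        (\<exists>r<M. \<forall>y<np. at_pos m (slot X m k) (received (chosen ?L i z) y) = received (chosen ?L i z) (np + r * np + y))"
        using a c by (intro ex_cong conj_cong refl all_cong) auto
      show ?thesis unfolding matches_def 1 2 ..
    qed
    have BX: "cells u3 RB = ?B" "cells u3 RX = ?X"
      using bu fr1 fr2 fr3 by (simp_all add: base_def)
    have id: "identified (chosen ?L i z) ?B ?X b v"
      using sem_identify[of u3] unfolding v_def u4_def BX identified_def mt .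
    define u5 where "u5 = sem f w 7 (credit i) e u4"
    have RP4: "cells u4 RP = cells st RP" using bu fr1[of RP] fr2[of RP] fr3[of RP] fr4[of RP] by (simp add: base_def)
    have VC4: "cells u4 VC 0 = score ?L i z ys q" using VC3 fr4[of VC] by simp
    have RC4: "cells u4 RC = cells u RC" using fr1[of RC] fr2[of RC] fr3[of RC] fr4[of RC] by simp
    define S where "S = score ?L i z ys q"
    define hit where "hit k \<longleftrightarrow> v < M & slot ?X m v = slot ?X m k" for k
    define J where "J n x \<longleftrightarrow> (\<forall>r. r ~= RC --> cells x r = cells u4 r) &
      cells x RC = (%a. if i * M <= a & a < i * M + n & hit (a - i * M) then max (cells u RC a) S else cells u RC a)" for n :: nat and x :: store
    have J: "J M u5"
      unfolding u5_def credit_def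
    proof (rule sem_SeqN_inv)
      show "J 0 u4" by (auto simp: J_def RC4)
    next
      fix k and x :: store assume k: "k < M" and J: "J k x"
      have fr: "cells x VB 0 = v" "cells x VC 0 = S" "cells x RP = cells st RP"
        using J VC4 RP4 by (simp_all add: J_def v_def S_def)
      have rc: "cells x RC (i * M + k) = cells u RC (i * M + k)" using J by (simp add: J_def)
      have Pv: "cells st RP (k * M + v) = m \<longleftrightarrow> slot ?X m v = slot ?X m k" if "v < M"
      proof -
        have "(k + 1) * M <= M * M" using k by (intro mult_le_mono1) simp
        then have lt: "k * M + v < M * M" using that by simp
        have "(k * M + v) div M = k" "(k * M + v) mod M = v" using block_div_mod[OF that] by simp_all
        then have "cells st RP (k * M + v) = first_diff m (slot ?X m k) (slot ?X m v)" using P lt by simp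
        then show ?thesis using first_diff_eq_iff[of "slot ?X m k" m "slot ?X m v"] by auto
      qed
      let ?c = "Cond (less_expr (Var VB) (Const M) \<otimes>
          (eq_expr (Cell RP (Const (k * M) \<oplus> Var VB)) LN \<otimes> less_expr (Cell RC (Const (i * M + k))) (Var VC)))
          (Write RC (Const (i * M + k)) (Var VC)) Skip"
      have "sem f w 7 ?c e x = (if hit k & cells u RC (i * M + k) < S then put RC (i * M + k) S x else x)"
        using fr rc Pv by (auto simp: env hit_def)
      moreover have "J (Suc k) (if hit k & cells u RC (i * M + k) < S then put RC (i * M + k) S x else x)"
        using J by (auto simp: J_def fun_eq_iff less_Suc_eq max_def)
      ultimately show "J (Suc k) (sem f w 7 ?c e x)" by simp
    qed
    have s5: "sem f w 7 (Seq (message_digits i z) (Seq codeword (Seq (agree i) (Seq identify (credit i))))) e u = u5"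
      by (simp add: u5_def u4_def u3_def u2_def u1_def)
    have b5: "base st u5"
      using bu fr1 fr2 fr3 fr4 J by (simp add: base_def J_def)
    have R5: "cells u5 RC (i * M + k) = (if hit k then max (cells u RC (i * M + k)) S else cells u RC (i * M + k))" if "k < M" for k
      using J that by (simp add: J_def)
    have o5: "cells u5 RC (i' * M + k) = cells u RC (i' * M + k)" if "i' ~= i" "k < M" for i' k
      using J slot_disjoint[of i i' k M] that by (auto simp: J_def)
    have jd: "judged st i z ys q (cells u RC)" using I by (simp add: I_def)
    have up: "cells u RC (i * M + k) <= cells u5 RC (i * M + k)" if "k < M" for k using R5[OF that] by simp
    have j1: "\<exists>v. identified (chosen ?L i y) ?B ?X b v &
        (\<forall>k<M. v < M --> slot ?X m v = slot ?X m k --> score ?L i y ys q <= cells u5 RC (i * M + k))" if "y < Suc z" for y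
    proof (cases "y = z")
      case True
      have "\<forall>k<M. v < M --> slot ?X m v = slot ?X m k --> score ?L i y ys q <= cells u5 RC (i * M + k)"
        using R5 True by (auto simp: hit_def S_def)
      then show ?thesis using id True by blast
    next
      case False
      then have "y < z" using that by simp
      then obtain v' where "identified (chosen ?L i y) ?B ?X b v'"
        "\<forall>k<M. v' < M --> slot ?X m v' = slot ?X m k --> score ?L i y ys q <= cells u RC (i * M + k)"
        using jd unfolding judged_def by blast
      then show ?thesis using up le_trans by blast
    qed
    have j2: "cells u5 RC (i * M + k) = 0 \<or> (\<exists>y<Suc z. \<exists>v<M. identified (chosen ?L i y) ?B ?X b v &
        slot ?X m v = slot ?X m k & cells u5 RC (i * M + k) = score ?L i y ys q)" if k: "k < M" for k
    proof (cases "hit k & cells u RC (i * M + k) < S")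
      case True
      then have "cells u5 RC (i * M + k) = score ?L i z ys q" using R5[OF k] by (simp add: S_def max_def)
      then show ?thesis using True id unfolding hit_def by blast
    next
      case False
      then have "cells u5 RC (i * M + k) = cells u RC (i * M + k)" using R5[OF k] by (auto simp: max_def)
      then show ?thesis using jd k less_SucI unfolding judged_def by metis
    qed
    have "judged st i (Suc z) ys q (cells u5 RC)" unfolding judged_def using j1 j2 by blast
    moreover have "\<forall>i' k. i' ~= i --> k < M --> cells u5 RC (i' * M + k) = cells u0 RC (i' * M + k)"
      using o5 I by (simp add: I_def)
    ultimately have "I (Suc z) u5" using b5 by (simp add: I_def)
    then show "I (Suc z) (sem f w 7 (Seq (message_digits i z) (Seq codeword (Seq (agree i) (Seq identify (credit i))))) e u)"
      unfolding s5 .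
  qed
  then show "base st u'" "judged st i (\<Lambda> ^ C) ys q (cells u' RC)"
    "\<And>i' k. i' ~= i ==> k < M ==> cells u' RC (i' * M + k) = cells u0 RC (i' * M + k)"
    unfolding I_def by blast+
qed

lemma sem_answer:
  assumes t: "table_ok st" and ok: "\<And>i. i < 2 * b ==> piece_ok st i (ys i) q" and L: "\<forall>z. cells st RL z < l"
    and P: "\<forall>z<M * M. cells st RP z = first_diff m (slot (cells st RX) m (z div M)) (slot (cells st RX) m (z mod M))"
    and R0: "\<forall>a. cells st RC a = 0" and M0: "0 < M"
  shows "\<exists>R kb. (\<forall>i<2 * b. judged st i (\<Lambda> ^ C) (ys i) q R) & kb < M &
    (\<forall>k<M. (\<Sum>i<2 * b. R (i * M + k)) <= (\<Sum>i<2 * b. R (i * M + kb))) &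
    printed (sem f w 7 answer e st) = printed st @ take (e 0) (slot (cells st RX) m kb) &
    chan (sem f w 7 answer e st) = chan st"
proof -
  define u1 where "u1 = sem f w 7 (SeqN (2 * b) judge) e st"
  define I where "I n u \<longleftrightarrow> base st u & (\<forall>i<n. judged st i (\<Lambda> ^ C) (ys i) q (cells u RC)) &
    (\<forall>i k. n <= i --> k < M --> cells u RC (i * M + k) = 0)" for n :: nat and u :: store
  have I1: "I (2 * b) u1"
    unfolding u1_def
  proof (rule sem_SeqN_inv)
    show "I 0 st" using R0 by (simp add: I_def base_def)
  next
    fix i and u :: store assume i: "i < 2 * b" and I: "I i u"
    have u: "base st u" "\<forall>k<M. cells u RC (i * M + k) = 0" using I by (simp_all add: I_def)
    note J = sem_judge[OF t ok[OF i] L P u]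
    let ?u = "sem f w 7 (judge i) e u"
    have "judged st i' (\<Lambda> ^ C) (ys i') q (cells ?u RC)" if "i' < Suc i" for i'
    proof (cases "i' = i")
      case False
      then have "judged st i' (\<Lambda> ^ C) (ys i') q (cells u RC)" using I that by (simp add: I_def)
      then show ?thesis unfolding judged_def using J(3)[OF False] by simp
    qed (use J(2) in simp)
    then show "I (Suc i) ?u" using J(1,3) I by (simp add: I_def)
  qed
  let ?R = "cells u1 RC"
  define T where "T k = (\<Sum>i<2 * b. ?R (i * M + k))" for k
  define u2 where "u2 = sem f w 7 elect e u1"
  define K where "K n u \<longleftrightarrow> (\<forall>r. r ~= VK --> cells u r = cells u1 r) & cells u VK 0 < M & (\<forall>k<n. T k <= T (cells u VK 0))"
    for n :: nat and u :: store
  have K: "K M u2"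
    unfolding u2_def elect_def sem.simps(7)
  proof (rule sem_SeqN_inv)
    show "K 0 (sem f w 7 (Write VK (Const 0) (Const 0)) e u1)" using M0 by (simp add: K_def)
  next
    fix k and u :: store assume k: "k < M" and K: "K k u"
    have "cells u RC = ?R" using K by (simp add: K_def)
    then have "sem f w 7 (Cond (less_expr (total_expr (Var VK)) (total_expr (Const k))) (Write VK (Const 0) (Const k)) Skip) e u
      = (if T (cells u VK 0) < T k then put VK 0 k u else u)"
      by (simp add: total_expr_def T_def)
    moreover have "K (Suc k) (if T (cells u VK 0) < T k then put VK 0 k u else u)"
    proof (cases "T (cells u VK 0) < T k")
      case True
      then have "T k' <= T k" if "k' < Suc k" for k'
        using K that by (cases "k' = k") (auto simp: K_def less_Suc_eq intro: le_trans less_imp_le)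
      then show ?thesis using True K k by (simp add: K_def)
    next
      case False
      then show ?thesis using K by (auto simp: K_def less_Suc_eq)
    qed
    ultimately show "K (Suc k) (sem f w 7 (Cond (less_expr (total_expr (Var VK)) (total_expr (Const k))) (Write VK (Const 0) (Const k)) Skip) e u)"
      by simp
  qed
  define kb where "kb = cells u2 VK 0"
  have X2: "cells u2 RX = cells st RX" using K I1 by (simp add: K_def I_def base_def)
  have q2: "printed u2 = printed st" "chan u2 = chan st"
    using sem_quiet[of "Seq (SeqN (2 * b) judge) elect" f w 7 e st]
    by (simp_all add: u1_def u2_def coms)
  define J where "J n u \<longleftrightarrow> cells u = cells u2 & chan u = chan st & printed u = printed st @ take n (slot (cells st RX) m kb)"
    for n :: nat and u :: store
  have "J (e 0) (sem f w 7 answer e st)"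
    unfolding answer_def sem.simps(7)[of f w 7] sem.simps(9) u1_def[symmetric] u2_def[symmetric]
  proof (rule fold_upt_inv)
    show "J 0 u2" using q2 by (simp add: J_def)
  next
    fix j and u :: store assume j: "j < e 0" and J: "J j u"
    then have "j < m" using env by simp
    then have "take (Suc j) (slot (cells st RX) m kb) = take j (slot (cells st RX) m kb) @ [cells st RX (kb * m + j)]"
      by (simp add: take_Suc_conv_app_nth slot_nth)
    then show "J (Suc j) (sem f w (Suc 7) (Print (Cell RX (Var VK \<otimes> LN \<oplus> Reg 7))) (e(7 := j)) u)"
      using J X2 by (simp add: J_def env kb_def)
  qed
  moreover have "kb < M" "\<forall>k<M. T k <= T kb" using K by (simp_all add: K_def kb_def)
  ultimately show ?thesis using I1 unfolding J_def I_def T_def by blast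
qed

end

section \<open>The programs of the new scheme\<close>

text \<open>Registers are constant inside a command. The ones that depend on computed values, namely
  \<open>l\<close>, \<open>l ^ 4\<close> and \<open>h\<close>, are assigned between
  commands.\<close>

datatype item = Run com | Set nat expr | Sim nat

locale builder = coder b ls \<sigma> g p for b ls \<sigma> g p :: nat +
  fixes q D :: nat and al :: bool and P :: program
  assumes q0: "0 < q" and \<sigma>0: "0 < \<sigma>" and D0: "17 <= D"
begin

lemma simulation: "simulation (RF i) (RS j)" if "i < 2 * b" for i j
  using that by unfold_locales (auto simp: RF_def RS_def)

abbreviation "tr i == simulation.trans al q Q ls \<sigma> i (RF i) (RS i)"
abbreviation "mirror i == simulation.mirrors q Q ls \<sigma> i (RF i) (RS i)"

fun item_len :: "item => nat" where
  "item_len (Run c) = len c"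
| "item_len (Set j x) = len_expr x + 2"
| "item_len (Sim i) = simulation.sim_len al q Q ls \<sigma> i (RF i) (RS i) P"

fun item_code :: "nat => item => instr list" where
  "item_code l (Run c) = code D 7 l c"
| "item_code l (Set j x) = code_expr D x 12 @ [Lit j 0, Add j j 12]"
| "item_code l (Sim i) = simulation.sim_code al q Q ls \<sigma> i (RF i) (RS i) D l P"

primrec items_len :: "item list => nat" where
  "items_len [] = 0"
| "items_len (x # xs) = item_len x + items_len xs"

primrec items_code :: "nat => item list => instr list" where
  "items_code l [] = []"
| "items_code l (x # xs) = item_code l x @ items_code (l + item_len x) xs"

definition item_ok :: "item => bool" where
  "item_ok x \<longleftrightarrow> (case x of Run c => wfc NR 7 c & tame \<kappa> c & 12 + depth c <= D
     | Set j x => 3 < j & j < 7 & wfe NR 7 x & 12 + depth_expr x <= D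
     | Sim i => i < b & (\<forall>I\<in>set P. 12 + depth (tr i I) <= D))"

definition item_peak :: "nat => item => nat" where
  "item_peak Z x = (case x of Run c => peak_com D c Z | Set j x => peak D x Z
     | Sim i => sum_list (map (%I. peak_com D (tr i I) Z + (case I of Jz a l => peak D (Cell (RS i) (Const a)) Z | _ => 0)) P))"

lemma length_item_code: "item_ok x ==> length (item_code l x) = item_len x"
proof (cases x)
  case (Sim i)
  assume "item_ok x"
  then have "i < 2 * b" using Sim by (simp add: item_ok_def)
  then show ?thesis using Sim simulation.length_sim_code[OF simulation] by simp
qed (auto simp: length_code length_code_expr)

lemma code_at_items_append:
  "list_all item_ok xs ==> code_at pr l (items_code l (xs @ ys)) \<longleftrightarrow>
    code_at pr l (items_code l xs) & code_at pr (l + items_len xs) (items_code (l + items_len xs) ys)"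
proof (induction xs arbitrary: l)
  case Nil
  then show ?case by (auto simp: code_at_def)
next
  case (Cons x xs)
  then show ?case by (simp add: code_at_append length_item_code add.assoc)
qed

lemma items_len_append: "items_len (xs @ ys) = items_len xs + items_len ys"
  by (induction xs) auto

lemma length_items_code: "list_all item_ok xs ==> length (items_code l xs) = items_len xs"
  by (induction xs arbitrary: l) (auto simp: length_item_code)

text \<open>
  \<open>Zm\<close> bounds all values in the store and \<open>B\<close> all memory cells, for all programs considered.
\<close>

definition does ::
  "(nat list => nat) => (nat => nat) => nat => nat => item list => (nat => nat) => store => nat => nat =>
   ((nat => nat) => store => bool) => bool" where
  "does f w B Zm xs e s V t Post \<longleftrightarrow>
     (list_all item_ok xs --> (\<forall>x\<in>set xs. item_peak Zm x <= B) --> V + t <= Zm --> Zm <= B --> values_le V 7 e s -->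
      (\<forall>pr cf. code_at pr (pc cf) (items_code (pc cf) xs) --> represents D NR 7 e s cf --> below B cf -->
        (\<exists>u cf' e' s'. u <= t & reaches pr f w B cf u cf' & pc cf' = pc cf + items_len xs &
           represents D NR 7 e' s' cf' & values_le (V + t) 7 e' s' & Post e' s')))"

lemma does_append:
  assumes 1: "does f w B Zm xs e s V t Q1" and 2: "\<And>e' s'. Q1 e' s' ==> does f w B Zm ys e' s' (V + t) t' Q2"
  shows "does f w B Zm (xs @ ys) e s V (t + t') Q2"
  unfolding does_def
proof (intro impI allI)
  fix pr cf
  assume a: "list_all item_ok (xs @ ys)" "\<forall>x\<in>set (xs @ ys). item_peak Zm x <= B" "V + (t + t') <= Zm" "Zm <= B"
    "values_le V 7 e s" "code_at pr (pc cf) (items_code (pc cf) (xs @ ys))" "represents D NR 7 e s cf" "below B cf"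
  have ok: "list_all item_ok xs" "list_all item_ok ys" using a(1) by auto
  have at: "code_at pr (pc cf) (items_code (pc cf) xs)" "code_at pr (pc cf + items_len xs) (items_code (pc cf + items_len xs) ys)"
    using a(6) code_at_items_append[OF ok(1)] by auto
  have pk: "\<forall>x\<in>set xs. item_peak Zm x <= B" "\<forall>x\<in>set ys. item_peak Zm x <= B" "V + t <= Zm" "V + t + t' <= Zm"
    using a(2,3) by auto
  obtain u cf1 e1 s1 where 1: "u <= t" "reaches pr f w B cf u cf1" "pc cf1 = pc cf + items_len xs"
    "represents D NR 7 e1 s1 cf1" "values_le (V + t) 7 e1 s1" "Q1 e1 s1"
    using 1[unfolded does_def, rule_format, OF ok(1) _ pk(3) a(4,5) at(1) a(7,8)] pk(1) by blast
  have b1: "below B cf1" using 1(2) by (auto simp: reaches_def)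
  have at2: "code_at pr (pc cf1) (items_code (pc cf1) ys)" using at(2) 1(3) by simp
  obtain u' cf2 e2 s2 where 2: "u' <= t'" "reaches pr f w B cf1 u' cf2" "pc cf2 = pc cf1 + items_len ys"
    "represents D NR 7 e2 s2 cf2" "values_le (V + t + t') 7 e2 s2" "Q2 e2 s2"
    using 2[OF 1(6), unfolded does_def, rule_format, OF ok(2) _ pk(4) a(4) 1(5) at2 1(4) b1] pk(2) by blast
  show "\<exists>u cf' e' s'. u <= t + t' & reaches pr f w B cf u cf' & pc cf' = pc cf + items_len (xs @ ys) &
           represents D NR 7 e' s' cf' & values_le (V + (t + t')) 7 e' s' & Q2 e' s'"
    using reaches_trans[OF 1(2) 2(2)] 1 2
    by (intro exI[of _ "u + u'"] exI[of _ cf2] exI[of _ e2] exI[of _ s2]) (auto simp: items_len_append add.assoc)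
qed

lemma does_weaken:
  assumes "does f w B Zm xs e s V t Q1" "\<And>e' s'. Q1 e' s' ==> Q2 e' s'" "t <= t'"
  shows "does f w B Zm xs e s V t' Q2"
  unfolding does_def
proof (intro impI allI)
  fix pr cf
  assume a: "list_all item_ok xs" "\<forall>x\<in>set xs. item_peak Zm x <= B" "V + t' <= Zm" "Zm <= B"
    "values_le V 7 e s" "code_at pr (pc cf) (items_code (pc cf) xs)" "represents D NR 7 e s cf" "below B cf"
  have z: "V + t <= Zm" "V + t <= V + t'" using a(3) assms(3) by simp_all
  obtain u cf1 e1 s1 where 1: "u <= t" "reaches pr f w B cf u cf1" "pc cf1 = pc cf + items_len xs"
    "represents D NR 7 e1 s1 cf1" "values_le (V + t) 7 e1 s1" "Q1 e1 s1"
    using assms(1)[unfolded does_def, rule_format, OF a(1) _ z(1) a(4-8)] a(2) by blast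
  then show "\<exists>u cf' e' s'. u <= t' & reaches pr f w B cf u cf' & pc cf' = pc cf + items_len xs &
           represents D NR 7 e' s' cf' & values_le (V + t') 7 e' s' & Q2 e' s'"
    using assms(2,3) values_le_mono[OF 1(5) z(2)] by (intro exI[of _ u] exI[of _ cf1] exI[of _ e1] exI[of _ s1]) auto
qed

lemma does_Nil: "does f w B Zm [] e s V 0 (%e' s'. e' = e & s' = s)"
  unfolding does_def using reaches_refl by fastforce

lemma does_Run:
  assumes "\<kappa> <= V" "\<And>h. f h <= V" "\<And>i. w i <= V"
  shows "does f w B Zm [Run c] e s V (cost e c) (%e' s'. e' = e & s' = sem f w 7 c e s)"
  unfolding does_def
proof (intro impI allI)
  fix pr cf
  assume a: "list_all item_ok [Run c]" "\<forall>x\<in>set [Run c]. item_peak Zm x <= B" "V + cost e c <= Zm" "Zm <= B"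
    "values_le V 7 e s" "code_at pr (pc cf) (items_code (pc cf) [Run c])" "represents D NR 7 e s cf" "below B cf"
  have ok: "wfc NR 7 c" "tame \<kappa> c" "12 + depth c <= D" "peak_com D c Zm <= B" using a(1,2) by (auto simp: item_ok_def item_peak_def)
  have pk: "peak_com D c (V + cost e c) <= B" using peak_com_mono[OF a(3), of D c] ok(4) by simp
  have Z: "V + cost e c <= B" using a(3,4) by simp
  have seven: "7 <= (7::nat)" "7 <= (12::nat)" by simp_all
  have wr: "writes_le f w (V + cost e c) 7 c e s"
    using tame_writes[where f = f and w = w, OF ok(2,1) seven(1) a(5) assms] by blast
  have v: "values_le (V + cost e c) 7 e s" by (rule values_le_mono[OF a(5)]) simp
  have at: "code_at pr (pc cf) (code D 7 (pc cf) c)" using a(6) by simp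
  from reaches_code[OF at a(7) seven ok(1,3) a(8) v wr pk Z]
  show "\<exists>u cf' e' s'. u <= cost e c & reaches pr f w B cf u cf' & pc cf' = pc cf + items_len [Run c] &
           represents D NR 7 e' s' cf' & values_le (V + cost e c) 7 e' s' & e' = e & s' = sem f w 7 c e s"
    by auto
qed

lemma does_Set:
  assumes le: "eval e (cells s) x <= V"
  shows "does f w B Zm [Set j x] e s V (len_expr x + 2) (%e' s'. e' = e(j := eval e (cells s) x) & s' = s)"
  unfolding does_def
proof (intro impI allI)
  fix pr cf
  assume a: "list_all item_ok [Set j x]" "\<forall>x\<in>set [Set j x]. item_peak Zm x <= B" "V + (len_expr x + 2) <= Zm" "Zm <= B"
    "values_le V 7 e s" "code_at pr (pc cf) (items_code (pc cf) [Set j x])" "represents D NR 7 e s cf" "below B cf"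
  have ok: "3 < j" "j < 7" "wfe NR 7 x" "12 + depth_expr x <= D" "peak D x Zm <= B"
    using a(1,2) by (auto simp: item_ok_def item_peak_def)
  let ?v = "eval e (cells s) x"
  have VZ: "V <= Zm" using a(3) by simp
  have pk: "peak D x V <= B" using peak_mono[OF VZ, of D x] ok(5) by simp
  have "3 < (7::nat)" "7 <= (12::nat)" by simp_all
  note E = run_code_expr[OF a(7) ok(3) this ok(4) a(8,5) pk, where f = f and w = w]
  define c1 where "c1 = run f w (code_expr D x 12) cf"
  define is' where "is' = code_expr D x 12 @ [Lit j 0, Add j j 12]"
  have vB: "?v <= B" using le VZ a(4) by simp
  have b1: "below B c1" using E run_below_below unfolding c1_def by blast
  have m1: "mem c1 12 = ?v" using E by (simp add: c1_def)
  have rb: "run_below f w B is' cf"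
    using E b1 m1 vB ok(2) unfolding is'_def run_below_append c1_def[symmetric] by (auto simp: below_assign)
  have lin: "list_all linear is'" by (simp add: is'_def linear_code_expr)
  have c2: "mem (run f w is' cf) = (mem c1)(j := ?v)" "comm (run f w is' cf) = comm c1" "out (run f w is' cf) = out c1"
    using m1 ok(2) unfolding is'_def run_append c1_def[symmetric] by (auto simp: fun_eq_iff)
  have rep1: "represents D NR 7 e s c1" using represents_same[OF a(7), of 12] E unfolding c1_def by simp
  have ne: "loc D NR (e 1) k y ~= j" for k y using loc_ge[of D NR "e 1" k y] ok(2) D0 by linarith
  have "represents D NR 7 (e(j := ?v)) s (run f w is' cf)"
    using rep1 ok(1) ne unfolding represents_def c2 by (auto simp: regs_ok_def holds_regs_def holds_cells_def)
  moreover have "values_le (V + (len_expr x + 2)) 7 (e(j := ?v)) s"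
  proof -
    have "values_le V 7 (e(j := ?v)) s" using a(5) le by (auto simp: values_le_def)
    then show ?thesis by (rule values_le_mono) simp
  qed
  moreover have "reaches pr f w B cf (length is') (run f w is' cf)"
    using reaches_run[OF _ lin rb] a(6) by (simp add: is'_def)
  moreover have "length is' = len_expr x + 2" by (simp add: is'_def length_code_expr)
  ultimately show "\<exists>u cf' e' s'. u <= len_expr x + 2 & reaches pr f w B cf u cf' & pc cf' = pc cf + items_len [Set j x] &
           represents D NR 7 e' s' cf' & values_le (V + (len_expr x + 2)) 7 e' s' & e' = e(j := ?v) & s' = s"
    using run_pc[OF lin, of f w cf] by (intro exI[of _ "length is'"] exI[of _ "run f w is' cf"]) auto
qed

lemma does_Sim:
  fixes f w e s m i
  defines "cs == (%t. (step P (pad_oracle al (e 0) (e 1) f) (%k. w (length (chan s) + k) mod q) ^^ t) (initial m))"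
  assumes mi: "mirror i e w s (initial m) s" and e: "e 0 <= e 1"
    and Z: "\<And>h. f h <= V" "\<And>j. w j <= V" "\<And>u. below V (cs u)" "\<And>u. length (comm (cs u)) < V"
      "1 <= V" "ls * e 1 <= V" "0 < e 4" "\<sigma> <= V"
    and halt: "halted P (cs t)"
  shows "does f w B Zm [Sim i] e s V (300 * t + 2) (%e' s'. e' = e & mirror i e w s (cs t) s')"
  unfolding does_def
proof (intro impI allI)
  fix pr cf
  assume a: "list_all item_ok [Sim i]" "\<forall>x\<in>set [Sim i]. item_peak Zm x <= B" "V + (300 * t + 2) <= Zm" "Zm <= B"
    "values_le V 7 e s" "code_at pr (pc cf) (items_code (pc cf) [Sim i])" "represents D NR 7 e s cf" "below B cf"
  have i: "i < b" "i < 2 * b" and Dd: "\<And>I. I \<in> set P ==> 12 + depth (tr i I) <= D"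
    using a(1) by (auto simp: item_ok_def)
  interpret sm: simulation al q Q ls \<sigma> i "RF i" "RS i" by (rule simulation[OF i(2)])
  have VZ: "V <= Zm" using a(3) by simp
  let ?pk = "%I. peak_com D (tr i I) Zm + (case I of Jz a l => peak D (Cell (RS i) (Const a)) Zm | _ => 0)"
  have pk: "?pk I <= B" if "I \<in> set P" for I
  proof -
    have "?pk I <= sum_list (map ?pk P)" by (rule member_le_sum_list) (use that in auto)
    also have "\<dots> <= B" using a(2) by (simp add: item_peak_def)
    finally show ?thesis .
  qed
  have B1: "peak_com D (tr i I) V <= B" if "I \<in> set P" for I
    using pk[OF that] peak_com_mono[OF VZ, of D "tr i I"] by simp
  have B2: "peak D (Cell (RS i) (Const a)) V <= B" if "Jz a l \<in> set P" for a l
    using pk[OF that] peak_mono[OF VZ, of D "Cell (RS i) (Const a)"] by simp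
  have R: "RS i < NR" "RF i < NR" using i by (simp_all add: RS_def RF_def NR_def)
  have at: "code_at pr (pc cf) (sm.sim_code D (pc cf) P)" using a(6) by simp
  have win: "sm.window w s = (%k. w (length (chan s) + k) mod q)" by (simp add: sm.window_def fun_eq_iff)
  have "\<exists>u s' cf'. u <= 300 * t + 2 & reaches pr f w B cf u cf' & pc cf' = pc cf + sm.sim_len P &
    represents D NR 7 e s' cf' & sm.mirrors e w s ((step P (pad_oracle al (e 0) (e 1) f) (sm.window w s) ^^ t) (initial m)) s' & values_le V 7 e s'"
    by (rule sm.reaches_simulation_end[OF at a(7) refl a(8) mi R Dd D0 e B1 B2 _ a(5)])
      (use Z halt a(4) VZ q0 \<sigma>0 in \<open>simp_all add: cs_def win\<close>)
  then obtain u s' cf' where *: "u <= 300 * t + 2" "reaches pr f w B cf u cf'" "pc cf' = pc cf + sm.sim_len P"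
    "represents D NR 7 e s' cf'" "sm.mirrors e w s (cs t) s'" "values_le V 7 e s'"
    unfolding win cs_def by blast
  have "values_le (V + (300 * t + 2)) 7 e s'" by (rule values_le_mono[OF *(6)]) simp
  then show "\<exists>u cf' e' s'. u <= 300 * t + 2 & reaches pr f w B cf u cf' & pc cf' = pc cf + items_len [Sim i] &
           represents D NR 7 e' s' cf' & values_le (V + (300 * t + 2)) 7 e' s' & e' = e & mirror i e w s (cs t) s'"
    using * by (intro exI[of _ u] exI[of _ cf'] exI[of _ e] exI[of _ s']) simp
qed

end

section \<open>Register contents and running times\<close>

context coder
begin

definition envr :: "nat => nat => nat => nat => nat => nat => nat" where
  "envr n m l l4 h = (%j. 0)(0 := n, 1 := m, 2 := 2 * m, 3 := (2 * NR - 1) * (2 * m), 4 := l, 5 := l4, 6 := h)"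

lemma envr_simps [simp]:
  "envr n m l l4 h 0 = n" "envr n m l l4 h (Suc 0) = m" "envr n m l l4 h 2 = 2 * m"
  "envr n m l l4 h 3 = (2 * NR - 1) * (2 * m)" "envr n m l l4 h 4 = l" "envr n m l l4 h 5 = l4" "envr n m l l4 h 6 = h"
  by (simp_all add: envr_def)

lemma envr_upd [simp]:
  "(envr n m l l4 h)(4 := l') = envr n m l' l4 h" "(envr n m l l4 h)(5 := l5) = envr n m l l5 h"
  "(envr n m l l4 h)(6 := h') = envr n m l l4 h'"
  by (auto simp: envr_def)

text \<open>The lower bound lets four digits in base \<open>l\<close> represent any position, with
  \<open>m\<close> included. The upper bound, within one factor \<open>p\<close> of it, makes the
  length unique and short.\<close>

definition fits :: "nat => nat => bool" where
  "fits m l \<longleftrightarrow> (\<exists>k. l = p ^ k) & m < l ^ 4 & l ^ 4 <= p ^ 4 * m"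

lemma fits_unique:
  assumes "fits m l" "fits m l'"
  shows "l = l'"
proof -
  have *: "\<not> k < k'" if "m < (p ^ k) ^ 4" "(p ^ k') ^ 4 <= p ^ 4 * m" for k k'
  proof
    assume "k < k'"
    then have "p ^ Suc k <= p ^ k'" using p1 by (intro power_increasing) auto
    then have "(p ^ Suc k) ^ 4 <= (p ^ k') ^ 4" by (rule power_mono) simp
    moreover have "(p ^ Suc k) ^ 4 = p ^ 4 * (p ^ k) ^ 4" by (simp add: power_mult_distrib)
    moreover have "p ^ 4 * m < p ^ 4 * (p ^ k) ^ 4" using that(1) p1 by simp
    ultimately show False using that(2) by linarith
  qed
  obtain k k' where k: "l = p ^ k" "l' = p ^ k'" using assms by (auto simp: fits_def)
  then show ?thesis using *[of k k'] *[of k' k] assms by (auto simp: fits_def intro: antisym[of k k'])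
qed

text \<open>Machine loops are nested only in the computations with digits and code symbols, and
  there both run up to \<open>l\<close>. As \<open>l * l\<close> is linear in \<open>m\<close>, all
  commands take linear time.\<close>

lemma nest_coms:
  assumes "1 <= W" "e 1 <= W" "e 4 * e 4 <= W" "e 6 <= W" "e 0 <= W"
  shows "nest e (pre al i) <= W" "nest e (post i) <= W" "nest e answer <= W" "nest e find_length <= W"
    "nest e table <= W" "nest e (talk q) <= W" "nest e (listen q i) <= W"
proof -
  have l: "e 4 <= W" using le_trans[OF le_square assms(3)] .
  have l2: "max 1 (e 4) * max 1 (e 4) <= W" using assms(1,3) l by (cases "e 4 = 0") (auto simp: max_def)
  have c: "nest e codeword <= W" using l assms by (simp add: codeword_def)
  have "nest e (slots_pre al) <= W"
    unfolding slots_pre_def using assms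
    by (simp add: nest_SeqN_le repair_def diverge_def query_padded_def)
  then show "nest e (pre al i) <= W"
    unfolding pre_def using c assms by (simp add: nest_SeqN_le save_def digits_def reset_def)
  have "nest e (list_digit i k) <= W" for k
    using l2 assms l by (simp add: list_digit_def agree_digit_def)
  then show "nest e (post i) <= W"
    unfolding post_def using assms by (simp add: nest_SeqN_le positions_def)
  have "nest e identify <= W" unfolding identify_def using assms by (simp add: nest_SeqN_le)
  then have "nest e (judge i) <= W" for i
    unfolding judge_def using c l assms by (intro nest_SeqN_le) (simp_all add: nest_SeqN_le message_digits_def agree_def credit_def)
  then show "nest e answer <= W"
    unfolding answer_def elect_def using assms by (simp add: nest_SeqN_le)
  show "nest e find_length <= W" "nest e table <= W" "nest e (talk q) <= W" "nest e (listen q i) <= W"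
    using assms l l2 by (simp_all add: find_length_def table_def talk_def listen_def bump_def)
qed

lemma cost_coms: "nest e c <= W ==> cost e c <= weight c * W"
  using cost_le_weight[of e c] by (meson le_trans mult_le_mono2)

lemma sem_pre_frame:
  assumes "i < 2 * b"
  shows "cells (sem f w k (pre al i) e s) VS 0 = 0" "cells (sem f w k (pre al i) e s) VR 0 = 0"
    "cells (sem f w k (pre al i) e s) VO 0 = 0" "cells (sem f w k (pre al i) e s) VH 0 = 0"
    "i < b ==> cells (sem f w k (pre al i) e s) (RS i) = (cells s (RS i))(0 := e 1)"
    "r \<notin> {VA, RX, RP, RB, RG, RW, VS, VR, VO, VH, RS i} ==> cells (sem f w k (pre al i) e s) r = cells s r"
    "chan (sem f w k (pre al i) e s) = chan s" "printed (sem f w k (pre al i) e s) = printed s"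
proof -
  define s1 where "s1 = sem f w k (slots_pre al) e s"
  define s2 where "s2 = sem f w k (if i < b then save i else Skip) e s1"
  define s3 where "s3 = sem f w k digits e s2"
  define s4 where "s4 = sem f w k codeword e s3"
  define s5 where "s5 = sem f w k reset e s4"
  have eq: "sem f w k (pre al i) e s = sem f w k (if i < b then Write (RS i) (Const 0) LN else Skip) e s5"
    by (simp add: pre_def s1_def s2_def s3_def s4_def s5_def)
  show "cells (sem f w k (pre al i) e s) VS 0 = 0" "cells (sem f w k (pre al i) e s) VR 0 = 0"
    "cells (sem f w k (pre al i) e s) VO 0 = 0" "cells (sem f w k (pre al i) e s) VH 0 = 0"
    unfolding eq s5_def by (auto simp: reset_def RS_def)
  show "cells (sem f w k (pre al i) e s) r = cells s r" if "r \<notin> {VA, RX, RP, RB, RG, RW, VS, VR, VO, VH, RS i}"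
    by (rule sem_frame) (use that mods_coms(22)[of al i] in blast)
  show "chan (sem f w k (pre al i) e s) = chan s" "printed (sem f w k (pre al i) e s) = printed s"
    using sem_quiet[OF quiet_coms(1)] by simp_all
  assume i: "i < b"
  have "cells s1 (RS i) = cells s (RS i)" unfolding s1_def
    by (rule sem_frame) (use mods_coms(21)[of al] in \<open>auto simp: RS_def\<close>)
  moreover have "cells s2 (RS i) = cells s1 (RS i)" unfolding s2_def
    by (rule sem_frame) (use mods_coms(3)[of i] in \<open>auto simp: RS_def\<close>)
  moreover have "cells s3 (RS i) = cells s2 (RS i)" unfolding s3_def
    by (rule sem_frame) (use mods_coms(4) in \<open>auto simp: RS_def\<close>)
  moreover have "cells s4 (RS i) = cells s3 (RS i)" unfolding s4_def
    by (rule sem_frame) (use mods_coms(5) in \<open>auto simp: RS_def\<close>)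
  moreover have "cells s5 (RS i) = cells s4 (RS i)" unfolding s5_def
    by (rule sem_frame) (use mods_coms(6) in \<open>auto simp: RS_def\<close>)
  ultimately show "cells (sem f w k (pre al i) e s) (RS i) = (cells s (RS i))(0 := e 1)"
    unfolding eq using i by simp
qed

end

context builder
begin

definition init_items :: "item list" where
  "init_items = [Run find_length, Set 4 (Var VE), Set 5 (pow_expr 4), Run table]"

definition run_items :: "nat => item list" where
  "run_items i = [Run (pre al i), Sim i, Set 6 (Var VH), Run (post i)]"

definition end_items :: "nat => item list" where
  "end_items i = (if al then [Run (pre al i), Run (talk q)] else [Run (pre al i), Run (listen q i), Run (post i)])"

definition all_items :: "item list" where
  "all_items = init_items @ concat (map run_items [0..<b]) @ concat (map end_items [b..<2 * b])
     @ (if al then [] else [Run answer])"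

end

section \<open>The complete execution of one party\<close>

locale party_run = builder b ls \<sigma> g p q D al P for b ls \<sigma> g p q D al P +
  fixes f :: "nat list => nat" and w :: "nat => nat" and n m l h N Tm V0 B Zm W :: nat and tm :: "(nat => nat) => nat"
  assumes nm: "0 < n" "n <= m" and fit: "fits m l"
    and V0: "\<kappa> <= V0" "\<And>x. f x <= V0" "\<And>i. w i <= V0" "1 <= V0" "ls * m <= V0" "\<sigma> <= V0" "p ^ 4 * m <= V0"
      "(2 * NR - 1) * (2 * m) <= V0"
    and W: "1 <= W" "m <= W" "l * l <= W" "h <= W"
    and tm: "\<And>ws. (\<forall>k. ws k < q) ==> tm ws <= Tm"
      "\<And>ws. (\<forall>k. ws k < q) ==> halted P ((step P (pad_oracle al n m f) ws ^^ tm ws) (initial m))"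
    and cs: "\<And>ws u. (\<forall>k. ws k < q) ==> below V0 ((step P (pad_oracle al n m f) ws ^^ u) (initial m))"
      "\<And>ws u. (\<forall>k. ws k < q) ==> length (comm ((step P (pad_oracle al n m f) ws ^^ u) (initial m))) < V0"
      "\<And>ws. (\<forall>k. ws k < q) ==> sent (comm ((step P (pad_oracle al n m f) ws ^^ tm ws) (initial m))) = h"
      "\<And>ws. (\<forall>k. ws k < q) ==> length (comm ((step P (pad_oracle al n m f) ws ^^ tm ws) (initial m))) = N"
begin

text \<open>The number \<open>h\<close> of transmissions per run is not computed but counted in
  \<open>VH\<close>, so register 6 is 0 until the first run is over.\<close>

abbreviation ev :: "nat => nat => nat" where "ev k == envr n m l (l ^ 4) (if k = 0 then 0 else h)"
abbreviation "eh == envr n m l (l ^ 4) h"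

definition ws :: "store => nat => nat" where "ws s k = w (length (chan s) + k) mod q"
definition fin :: "(nat => nat) => config" where
  "fin v = (step P (pad_oracle al n m f) v ^^ tm v) (initial m)"

definition st0 :: store where "st0 = \<lparr>cells = %_ _. 0, chan = [], printed = []\<rparr>"

definition start :: "store => bool" where
  "start s \<longleftrightarrow> coder_exec.table_ok p l s & chan s = [] & printed s = [] & (\<forall>r. r \<notin> {VE, RH} --> cells s r = (%_. 0))"

text \<open>The store before piece \<open>j\<close>, after its preparation, after the communication
  and after the evaluation. A run is described by \<open>mirror\<close> instead of a semantics,
  since machine code of the given scheme is executed there.\<close>

definition link :: "nat => store => store => store => store => bool" where
  "link j s s1 s2 s' \<longleftrightarrow>
     (if j < b then s1 = sem f w 7 (pre al j) (ev j) s & mirror j (ev j) w s1 (fin (ws s1)) s2 & s' = sem f w 7 (post j) eh s2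
      else s1 = sem f w 7 (pre al j) eh s &
        (if al then s2 = sem f w 7 (talk q) eh s1 & s' = s2
         else s2 = sem f w 7 (listen q j) eh s1 & s' = sem f w 7 (post j) eh s2))"

definition history :: "nat => (nat => store) => (nat => store) => (nat => store) => bool" where
  "history k s s1 s2 \<longleftrightarrow> start (s 0) & (\<forall>j<k. link j (s j) (s1 j) (s2 j) (s (Suc j)))"

definition Inv :: "nat => (nat => nat) => store => bool" where
  "Inv k e s \<longleftrightarrow> e = ev k & (\<forall>i\<ge>k. i < 2 * b --> cells s (RF i) = (%_. 0)) & (\<forall>i\<ge>k. i < b --> cells s (RS i) = (%_. 0)) &
     (\<exists>ss s1 s2. history k ss s1 s2 & ss k = s)"

lemma l0: "0 < l" using fit nm by (cases l) (auto simp: fits_def)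
lemma l4: "l ^ 4 <= V0" using fit V0(7) by (auto simp: fits_def)

lemma exec: "coder_exec g p (ev k) m l (if k = 0 then 0 else h)" "coder_exec g p eh m l h"
  by unfold_locales (use nm l0 in auto)

definition t_init where "t_init = weight find_length * W + len_expr (Var VE) + len_expr (pow_expr 4) + 4 + weight table * W"

lemma nests:
  assumes "e = envr n m l' l4 h'" "l' = 0 \<or> l' = l" "h' = 0 \<or> h' = h"
  shows "1 <= W" "e 1 <= W" "e 4 * e 4 <= W" "e 6 <= W" "e 0 <= W"
  using assms W nm by auto

lemma V_mono: "V0 <= V ==> \<kappa> <= V & f x <= V & w i <= V & 1 <= V & ls * m <= V & \<sigma> <= V"
  using V0(1,4-6) V0(2)[of x] V0(3)[of i] by linarith

lemma does_init: "does f w B Zm init_items (envr n m 0 (p * m) 0) st0 V0 t_init (%e s. e = ev 0 & start s)"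
proof -
  let ?e = "envr n m 0 (p * m) 0"
  let ?s1 = "sem f w 7 find_length ?e st0"
  have m0: "0 < m" using nm by simp
  have "fits m (cells ?s1 VE 0)"
    using sem_find_length[of ?e m f w st0] m0 unfolding fits_def by simp
  then have l: "cells ?s1 VE 0 = l" using fit fits_unique by blast
  have fr: "cells ?s1 r = (%_. 0)" if "r ~= VE" for r
    using sem_frame[of r find_length f w 7 ?e st0] that mods_coms(16) by (simp add: st0_def)
  have q1: "chan ?s1 = []" "printed ?s1 = []"
    using sem_quiet[OF quiet_coms(3), of f w 7 ?e st0] by (simp_all add: st0_def)
  have c1: "cost ?e find_length <= weight find_length * W"
    by (intro cost_coms nest_coms(4) nests[OF refl]) auto
  let ?t1 = "weight find_length * W"
  have d1: "does f w B Zm [Run find_length] ?e st0 V0 ?t1 (%e s. e = ?e & s = ?s1)"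
    by (rule does_weaken[OF does_Run _ c1]) (use V0 in auto)
  let ?t2 = "len_expr (Var VE) + 2"
  have lV: "l <= V0 + t" for t
  proof -
    have "l ^ 1 <= l ^ 4" using l0 by (intro power_increasing) auto
    then show ?thesis using l4 by simp
  qed
  have d2: "does f w B Zm [Set 4 (Var VE)] ?e ?s1 (V0 + ?t1) ?t2 (%e s. e = envr n m l (p * m) 0 & s = ?s1)"
    by (rule does_weaken[OF does_Set]) (use l lV in auto)
  let ?e2 = "envr n m l (p * m) 0"
  let ?t3 = "len_expr (pow_expr 4) + 2"
  have d3: "does f w B Zm [Set 5 (pow_expr 4)] ?e2 ?s1 (V0 + ?t1 + ?t2) ?t3 (%e s. e = ev 0 & s = ?s1)"
    by (rule does_weaken[OF does_Set]) (use l4 in auto)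
  let ?s4 = "sem f w 7 table (ev 0) ?s1"
  have c4: "cost (ev 0) table <= weight table * W"
    by (intro cost_coms nest_coms(5) nests[OF refl]) auto
  have st: "start ?s4"
  proof -
    interpret E: coder_exec b ls \<sigma> g p al f w "ev 0" m l "if (0::nat) = 0 then 0 else h" by (rule exec)
    have "E.table_ok ?s4" by (rule E.sem_table) (simp add: fr)
    moreover have "cells ?s4 r = (%_. 0)" if "r \<notin> {VE, RH}" for r
      using sem_frame[of r table f w 7 "ev 0" ?s1] that mods_coms(17) fr by simp
    ultimately show ?thesis using sem_quiet[OF quiet_coms(4), of f w 7 "ev 0" ?s1] q1 by (simp add: start_def)
  qed
  have d4: "does f w B Zm [Run table] (ev 0) ?s1 (V0 + ?t1 + ?t2 + ?t3) (weight table * W) (%e s. e = ev 0 & start s)"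
    by (rule does_weaken[OF does_Run _ c4]) (use V_mono[of "V0 + ?t1 + ?t2 + ?t3"] st in auto)
  have "does f w B Zm (([Run find_length] @ [Set 4 (Var VE)]) @ [Set 5 (pow_expr 4)] @ [Run table]) ?e st0 V0
    ((?t1 + ?t2) + (?t3 + weight table * W)) (%e s. e = ev 0 & start s)"
  proof (rule does_append[where ?Q1.0 = "%e s. e = ?e2 & s = ?s1"])
    show "does f w B Zm ([Run find_length] @ [Set 4 (Var VE)]) ?e st0 V0 (?t1 + ?t2) (%e s. e = ?e2 & s = ?s1)"
      by (rule does_append[OF d1]) (use d2 in auto)
    fix e' s' assume "e' = ?e2 & s' = ?s1"
    then show "does f w B Zm ([Set 5 (pow_expr 4)] @ [Run table]) e' s' (V0 + (?t1 + ?t2)) (?t3 + weight table * W) (%e s. e = ev 0 & start s)"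
      using does_append[OF d3, of "[Run table]" "weight table * W" "%e s. e = ev 0 & start s"] d4 by (auto simp: add.assoc)
  qed
  moreover have "([Run find_length] @ [Set 4 (Var VE)]) @ [Set 5 (pow_expr 4)] @ [Run table] = init_items" by (simp add: init_items_def)
  moreover have "(?t1 + ?t2) + (?t3 + weight table * W) = t_init" by (simp add: t_init_def)
  ultimately show ?thesis by (simp only:)
qed


definition t_run where
  "t_run i = weight (pre al i) * W + (300 * Tm + 2) + (len_expr (Var VH) + 2) + weight (post i) * W"

definition t_end where
  "t_end i = weight (pre al i) * W + (weight (talk q) + weight (listen q i)) * W + weight (post i) * W"

lemma history_extend:
  assumes "history k ss s1 s2" "link k (ss k) a c s'"
  shows "history (Suc k) (ss(Suc k := s')) (s1(k := a)) (s2(k := c))"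
  using assms unfolding history_def by (auto simp: less_Suc_eq)

lemma does_run_items:
  assumes i: "i < b" and I: "Inv i e s" and V: "V0 <= V"
  shows "does f w B Zm (run_items i) e s V (t_run i) (Inv (Suc i))"
proof -
  have i2: "i < 2 * b" using i by simp
  interpret sm: simulation al q Q ls \<sigma> i "RF i" "RS i" by (rule simulation[OF i2])
  obtain ss r1 r2 where hist: "history i ss r1 r2" "ss i = s" using I by (auto simp: Inv_def)
  have e: "e = ev i" using I by (simp add: Inv_def)
  define s1 where "s1 = sem f w 7 (pre al i) (ev i) s"
  have z: "cells s (RF k) = (%_. 0)" if "i <= k" "k < 2 * b" for k using I that by (simp add: Inv_def)
  have z': "cells s (RS k) = (%_. 0)" if "i <= k" "k < b" for k using I that by (simp add: Inv_def)
  note pf = sem_pre_frame[OF i2, where f = f and w = w and k = 7 and al = al and e = "ev i" and s = s, folded s1_def]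
  have RF1: "cells s1 (RF k) = (%_. 0)" if "i <= k" "k < 2 * b" for k
    using pf(6)[of "RF k"] z[OF that] i that by (simp add: RF_def RS_def)
  have RS1: "cells s1 (RS k) = (%_. 0)" if "Suc i <= k" "k < b" for k
    using pf(6)[of "RS k"] z'[of k] i that by (simp add: RS_def)
  have mi: "sm.mirrors (ev i) w s1 (initial m) s1"
    using pf(1-5) i z'[of i] RF1[of i] i2
    by (auto simp: sm.mirrors_def initial_def sent_def tally_def fun_eq_iff)
  define t where "t = tm (ws s1)"
  have wsq: "\<forall>k. ws s1 k < q" using q0 by (simp add: ws_def)
  have wse: "(%k. w (length (chan s1) + k) mod q) = ws s1" by (simp add: ws_def fun_eq_iff)
  let ?cs = "%t. (step P (pad_oracle al (ev i 0) (ev i 1) f) (%k. w (length (chan s1) + k) mod q) ^^ t) (initial m)"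
  have cse: "?cs u = (step P (pad_oracle al n m f) (ws s1) ^^ u) (initial m)" for u by (simp add: wse)
  have d1: "does f w B Zm [Run (pre al i)] e s V (weight (pre al i) * W) (%e s. e = ev i & s = s1)"
  proof (rule does_weaken[OF does_Run])
    show "cost e (pre al i) <= weight (pre al i) * W"
      unfolding e by (intro cost_coms nest_coms(1) nests[OF refl]) auto
  qed (use V_mono[OF V] e s1_def in auto)
  let ?V1 = "V + weight (pre al i) * W"
  have V1: "V0 <= ?V1" using V by simp
  have d2: "does f w B Zm [Sim i] (ev i) s1 ?V1 (300 * Tm + 2) (%e s. e = ev i & sm.mirrors (ev i) w s1 (fin (ws s1)) s)"
  proof (rule does_weaken[OF does_Sim[OF mi]])
    show "halted P (?cs t)" unfolding cse t_def by (rule tm(2)[OF wsq])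
    show "300 * t + 2 <= 300 * Tm + 2" using tm(1)[OF wsq] by (simp add: t_def)
    fix e' s' assume "e' = ev i & sm.mirrors (ev i) w s1 (?cs t) s'"
    then show "e' = ev i & sm.mirrors (ev i) w s1 (fin (ws s1)) s'" unfolding cse fin_def t_def by simp
  next
    fix u
    have "below V0 (?cs u)" unfolding cse by (rule cs(1)[OF wsq])
    then show "below ?V1 (?cs u)" using V1 unfolding below_def by (meson le_trans)
    have "length (comm (?cs u)) < V0" unfolding cse by (rule cs(2)[OF wsq])
    then show "length (comm (?cs u)) < ?V1" using V1 by linarith
  qed (use V_mono[OF V1] nm l0 in auto)
  let ?V2 = "?V1 + (300 * Tm + 2)" and ?h = "len_expr (Var VH) + 2"
  have hV: "h <= V0"
    using cs(3)[OF wsq] cs(4)[OF wsq] cs(2)[OF wsq, of "tm (ws s1)"] length_rcvd[of w 0 "comm (fin (ws s1))"] unfolding fin_def by linarith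
  have d3: "does f w B Zm [Set 6 (Var VH)] e' s' ?V2 ?h (%e s. e = eh & s = s')"
    if "e' = ev i & sm.mirrors (ev i) w s1 (fin (ws s1)) s'" for e' s'
  proof -
    have "cells s' VH 0 = h" using that cs(3)[OF wsq] by (simp add: sm.mirrors_def fin_def)
    then show ?thesis using that hV V by (intro does_weaken[OF does_Set]) auto
  qed
  let ?V3 = "?V2 + ?h"
  have V3: "V0 <= ?V3" using V by simp
  have d4: "does f w B Zm [Run (post i)] e' s' ?V3 (weight (post i) * W) (Inv (Suc i))"
    if e': "e' = eh" and mr: "sm.mirrors (ev i) w s1 (fin (ws s1)) s'" for e' s'
  proof (rule does_weaken[OF does_Run])
    show "cost e' (post i) <= weight (post i) * W"
      unfolding e' by (intro cost_coms nest_coms(2) nests[OF refl]) auto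
    fix e2 s2 assume a: "e2 = e' & s2 = sem f w 7 (post i) e' s'"
    have lk: "link i (ss i) s1 s' s2" using i mr a e' hist(2) by (simp add: link_def s1_def)
    have fr: "cells s2 r = cells s1 r" if "r \<notin> {RS i, RF i, VS, VH, VR, VO, VA, RX, VC, VL, RL, RP}" for r
    proof -
      have "cells s2 r = cells s' r" using a sem_frame[of r "post i"] that mods_coms(20)[of i] by blast
      then show ?thesis using mr that by (simp add: sm.mirrors_def)
    qed
    have 1: "cells s2 (RF k) = (%_. 0)" if "Suc i <= k" "k < 2 * b" for k
      using fr[of "RF k"] RF1[of k] that i by (simp add: RF_def RS_def)
    have 2: "cells s2 (RS k) = (%_. 0)" if "Suc i <= k" "k < b" for k
      using fr[of "RS k"] RS1[of k] that i by (simp add: RF_def RS_def)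
    have 3: "\<exists>ss s1 s2'. history (Suc i) ss s1 s2' & ss (Suc i) = s2"
      using history_extend[OF hist(1) lk] by (metis fun_upd_same)
    show "Inv (Suc i) e2 s2" unfolding Inv_def using 1 2 3 a e' by simp
  qed (use V_mono[OF V3] in auto)
  have "does f w B Zm ((([Run (pre al i)] @ [Sim i]) @ [Set 6 (Var VH)]) @ [Run (post i)]) e s V
    (((weight (pre al i) * W + (300 * Tm + 2)) + ?h) + weight (post i) * W) (Inv (Suc i))"
  proof (rule does_append[where ?Q1.0 = "%e s. e = eh & sm.mirrors (ev i) w s1 (fin (ws s1)) s"])
    show "does f w B Zm (([Run (pre al i)] @ [Sim i]) @ [Set 6 (Var VH)]) e s V ((weight (pre al i) * W + (300 * Tm + 2)) + ?h)
      (%e s. e = eh & sm.mirrors (ev i) w s1 (fin (ws s1)) s)"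
    proof (rule does_append[where ?Q1.0 = "%e s. e = ev i & sm.mirrors (ev i) w s1 (fin (ws s1)) s"])
      show "does f w B Zm ([Run (pre al i)] @ [Sim i]) e s V (weight (pre al i) * W + (300 * Tm + 2))
        (%e s. e = ev i & sm.mirrors (ev i) w s1 (fin (ws s1)) s)"
        by (rule does_append[OF d1]) (use d2 in auto)
      fix e' s' assume a: "e' = ev i & sm.mirrors (ev i) w s1 (fin (ws s1)) s'"
      show "does f w B Zm [Set 6 (Var VH)] e' s' (V + (weight (pre al i) * W + (300 * Tm + 2))) ?h
        (%e s. e = eh & sm.mirrors (ev i) w s1 (fin (ws s1)) s)"
        using does_weaken[OF d3[OF a], of "%e s. e = eh & sm.mirrors (ev i) w s1 (fin (ws s1)) s" ?h] a by (simp add: add.assoc)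
    qed
    fix e' s' assume "e' = eh & sm.mirrors (ev i) w s1 (fin (ws s1)) s'"
    then show "does f w B Zm [Run (post i)] e' s' (V + ((weight (pre al i) * W + (300 * Tm + 2)) + ?h)) (weight (post i) * W) (Inv (Suc i))"
      using d4[of e' s'] by (simp only: add.assoc)
  qed
  then show ?thesis by (simp add: run_items_def t_run_def)
qed

lemma does_end_items:
  assumes i: "b <= i" "i < 2 * b" and I: "Inv i e s" and V: "V0 <= V"
  shows "does f w B Zm (end_items i) e s V (t_end i) (Inv (Suc i))"
proof -
  obtain ss r1 r2 where hist: "history i ss r1 r2" "ss i = s" using I by (auto simp: Inv_def)
  have e: "e = eh" using I i by (simp add: Inv_def)
  have evS: "ev (Suc i) = eh" by simp
  define s1 where "s1 = sem f w 7 (pre al i) eh s"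
  note pf = sem_pre_frame(6)[OF i(2), where f = f and w = w and k = 7 and al = al and e = eh and s = s, folded s1_def]
  have RF1: "cells s1 (RF k) = (%_. 0)" if "i <= k" "k < 2 * b" for k
    using pf[of "RF k"] I that i by (simp add: RF_def RS_def Inv_def)
  have d1: "does f w B Zm [Run (pre al i)] e s V (weight (pre al i) * W) (%e s. e = eh & s = s1)"
  proof (rule does_weaken[OF does_Run])
    show "cost e (pre al i) <= weight (pre al i) * W"
      unfolding e by (intro cost_coms nest_coms(1) nests[OF refl]) auto
  qed (use V_mono[OF V] e s1_def in auto)
  let ?V1 = "V + weight (pre al i) * W"
  have V1: "V0 <= ?V1" using V by simp
  have ext: "\<exists>ss s1 s2'. history (Suc i) ss s1 s2' & ss (Suc i) = s'" if "link i (ss i) s1 s2 s'" for s2 s'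
    using history_extend[OF hist(1) that] by (metis fun_upd_same)
  show ?thesis
  proof (cases al)
    case True
    let ?s2 = "sem f w 7 (talk q) eh s1"
    have lk: "link i (ss i) s1 ?s2 ?s2" using True i hist(2) unfolding link_def s1_def by simp
    have RF2: "cells ?s2 (RF k) = (%_. 0)" if "Suc i <= k" "k < 2 * b" for k
      using sem_frame[of "RF k" "talk q" f w 7 eh s1] mods_coms(18)[of q] RF1[of k] that by (simp add: RF_def)
    have I2: "Inv (Suc i) eh ?s2" unfolding Inv_def using RF2 ext[OF lk] i by simp
    have d2: "does f w B Zm [Run (talk q)] eh s1 ?V1 (weight (talk q) * W) (Inv (Suc i))"
    proof (rule does_weaken[OF does_Run])
      show "cost eh (talk q) <= weight (talk q) * W"
        by (intro cost_coms nest_coms(6) nests[OF refl]) auto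
    qed (use V_mono[OF V1] I2 in auto)
    have "does f w B Zm ([Run (pre al i)] @ [Run (talk q)]) e s V (weight (pre al i) * W + weight (talk q) * W) (Inv (Suc i))"
      by (rule does_append[OF d1]) (use d2 in auto)
    moreover have "end_items i = [Run (pre al i)] @ [Run (talk q)]" unfolding end_items_def using True by simp
    ultimately show ?thesis using does_weaken[of _ _ _ _ _ _ _ _ _ "Inv (Suc i)" "Inv (Suc i)" "t_end i"] by (simp add: t_end_def add_mult_distrib)
  next
    case False
    let ?s2 = "sem f w 7 (listen q i) eh s1"
    let ?s3 = "sem f w 7 (post i) eh ?s2"
    have lk: "link i (ss i) s1 ?s2 ?s3" using False i hist(2) unfolding link_def s1_def by simp
    have RF3: "cells ?s3 (RF k) = (%_. 0)" if "Suc i <= k" "k < 2 * b" for k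
    proof -
      have "cells ?s3 (RF k) = cells ?s2 (RF k)"
        by (rule sem_frame) (use mods_coms(20)[of i] in \<open>auto simp: RF_def\<close>)
      also have "\<dots> = cells s1 (RF k)"
        by (rule sem_frame) (use mods_coms(19)[of q i] that in \<open>auto simp: RF_def\<close>)
      finally show ?thesis using RF1[of k] that by simp
    qed
    have I3: "Inv (Suc i) eh ?s3" unfolding Inv_def using RF3 ext[OF lk] i by simp
    have d2: "does f w B Zm [Run (listen q i)] eh s1 ?V1 (weight (listen q i) * W) (%e s. e = eh & s = ?s2)"
    proof (rule does_weaken[OF does_Run])
      show "cost eh (listen q i) <= weight (listen q i) * W"
        by (intro cost_coms nest_coms(7) nests[OF refl]) auto
    qed (use V_mono[OF V1] in auto)
    let ?V2 = "?V1 + weight (listen q i) * W"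
    have V2: "V0 <= ?V2" using V by simp
    have d3: "does f w B Zm [Run (post i)] eh ?s2 ?V2 (weight (post i) * W) (Inv (Suc i))"
    proof (rule does_weaken[OF does_Run])
      show "cost eh (post i) <= weight (post i) * W"
        by (intro cost_coms nest_coms(2) nests[OF refl]) auto
    qed (use V_mono[OF V2] I3 in auto)
    have "does f w B Zm ([Run (pre al i)] @ ([Run (listen q i)] @ [Run (post i)])) e s V
      (weight (pre al i) * W + (weight (listen q i) * W + weight (post i) * W)) (Inv (Suc i))"
    proof (rule does_append[OF d1])
      fix e' s' assume "e' = eh & s' = s1"
      then show "does f w B Zm ([Run (listen q i)] @ [Run (post i)]) e' s' ?V1 (weight (listen q i) * W + weight (post i) * W) (Inv (Suc i))"
        using does_append[OF d2, of "[Run (post i)]" "weight (post i) * W" "Inv (Suc i)"] d3 by auto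
    qed
    moreover have "end_items i = [Run (pre al i)] @ ([Run (listen q i)] @ [Run (post i)])" unfolding end_items_def using False by simp
    ultimately show ?thesis using does_weaken[of _ _ _ _ _ _ _ _ _ "Inv (Suc i)" "Inv (Suc i)" "t_end i"] by (simp add: t_end_def add_mult_distrib)
  qed
qed

definition Done :: "(nat => nat) => store => bool" where
  "Done e s \<longleftrightarrow> (\<exists>ss s1 s2. history (2 * b) ss s1 s2 & s = (if al then ss (2 * b) else sem f w 7 answer eh (ss (2 * b))))"

definition t_all where
  "t_all = t_init + ((\<Sum>i<b. t_run i) + ((\<Sum>i<b. t_end (b + i)) + weight answer * W))"

lemma does_all:
  assumes b0: "0 < b"
  shows "does f w B Zm all_items (envr n m 0 (p * m) 0) st0 V0 t_all Done"
proof -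
  have r: "does f w B Zm (concat (map run_items [0..<k])) e s V (\<Sum>i<k. t_run i) (Inv k)"
    if "Inv 0 e s" "V0 <= V" "k <= b" for k e s V
    using that(3)
  proof (induction k)
    case 0
    then show ?case using does_weaken[OF does_Nil] that by auto
  next
    case (Suc k)
    have "does f w B Zm (concat (map run_items [0..<k]) @ run_items k) e s V ((\<Sum>i<k. t_run i) + t_run k) (Inv (Suc k))"
      by (rule does_append[OF Suc.IH]) (use Suc.prems that does_run_items in auto)
    then show ?case by simp
  qed
  have en: "does f w B Zm (concat (map end_items [b..<b + k])) e s V (\<Sum>i<k. t_end (b + i)) (Inv (b + k))"
    if "Inv b e s" "V0 <= V" "k <= b" for k e s V
    using that(3)
  proof (induction k)
    case 0
    then show ?case using does_weaken[OF does_Nil] that by auto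
  next
    case (Suc k)
    have "does f w B Zm (concat (map end_items [b..<b + k]) @ end_items (b + k)) e s V ((\<Sum>i<k. t_end (b + i)) + t_end (b + k)) (Inv (Suc (b + k)))"
      by (rule does_append[OF Suc.IH]) (use Suc.prems that does_end_items in auto)
    then show ?case by simp
  qed
  have an: "does f w B Zm (if al then [] else [Run answer]) e s V (weight answer * W) Done"
    if I: "Inv (2 * b) e s" and V: "V0 <= V" for e s V
  proof -
    obtain ss r1 r2 where hist: "history (2 * b) ss r1 r2" "ss (2 * b) = s" using I by (auto simp: Inv_def)
    have e: "e = eh" using I b0 by (simp add: Inv_def)
    show ?thesis
    proof (cases al)
      case True
      then have "Done e s" using hist unfolding Done_def by auto
      then show ?thesis using True does_weaken[OF does_Nil] by auto
    next
      case False
      have "Done e (sem f w 7 answer e s)" using hist False e unfolding Done_def by auto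
      moreover have "cost e answer <= weight answer * W"
        unfolding e by (intro cost_coms nest_coms(3) nests[OF refl]) auto
      ultimately have "does f w B Zm [Run answer] e s V (weight answer * W) Done"
        using V_mono[OF V] by (intro does_weaken[OF does_Run]) auto
      then show ?thesis using False by simp
    qed
  qed
  have I0: "Inv 0 e s" if "e = ev 0 & start s" for e s
    using that by (auto simp: Inv_def start_def history_def RF_def RS_def intro!: exI[of _ "%_. s"])
  show ?thesis
    unfolding all_items_def t_all_def
  proof (rule does_append[OF does_init])
    fix e s assume a: "e = ev 0 & start s"
    show "does f w B Zm (concat (map run_items [0..<b]) @ concat (map end_items [b..<2 * b]) @ (if al then [] else [Run answer])) e s
      (V0 + t_init) ((\<Sum>i<b. t_run i) + ((\<Sum>i<b. t_end (b + i)) + weight answer * W)) Done"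
    proof (rule does_append[OF r[OF I0[OF a]]])
      fix e s assume b: "Inv b e s"
      have bb: "[b..<2 * b] = [b..<b + b]" by (simp add: mult_2)
      show "does f w B Zm (concat (map end_items [b..<2 * b]) @ (if al then [] else [Run answer])) e s
        (V0 + t_init + (\<Sum>i<b. t_run i)) ((\<Sum>i<b. t_end (b + i)) + weight answer * W) Done"
        unfolding bb by (rule does_append[OF en[OF b]]) (use an in \<open>auto simp: mult_2\<close>)
    qed simp_all
  qed
qed

end

section \<open>Why the candidate with the largest credit is correct\<close>

text \<open>What the two executions provide for the decoding argument, stated apart from the
  programs. \<open>XA i\<close>, \<open>PA i\<close> and \<open>XB i\<close>, \<open>PB i\<close>
  are the candidates and positions of Alice and Bob after the preparation of piece \<open>i\<close>,
  \<open>ya i\<close> and \<open>yb i\<close> the words they receive in it, and \<open>c i\<close>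
  counts its corruptions. \<open>LA\<close> are Alice's lists and \<open>st\<close> is Bob's store
  at the end; \<open>R\<close> are the credits.\<close>

locale duel = coder_exec b ls \<sigma> g p al f w e m l h
  for b ls \<sigma> g p :: nat and al f w e m l h +
  fixes \<Pi> :: protocol and XA XB PA PB :: "nat => nat => nat" and LA :: "nat => nat" and ya yb :: "nat => nat list"
    and st :: store and R :: "nat => nat" and c :: "nat => nat" and q kk :: nat and \<epsilon> :: real
  assumes sizes: "\<sigma> <= m" "m < l ^ 4" "l = p ^ kk" "0 < h" "l <= h" "0 < b"
    and eps: "0 < \<epsilon>" "\<epsilon> <= 1 / 6" "2 / \<epsilon> <= real g" "3 / \<epsilon> <= real b"
    and consA: "\<And>j k. j < 2 * b ==> k < M ==> consistent (oracle_of \<Pi> m Alice) (slot (XA j) m k)"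
    and consB: "\<And>j k. j < 2 * b ==> k < M ==> consistent (oracle_of \<Pi> m Bob) (slot (XB j) m k)"
    and smallA: "\<And>j a. j < 2 * b ==> XA j a < \<sigma>" and smallB: "\<And>j a. j < 2 * b ==> XB j a < \<sigma>"
    and stable: "\<And>i j k. i <= j ==> j < 2 * b ==> k < M ==> k < i * ls ==> slot (XB j) m k = slot (XB i) m k"
    and foundA: "\<And>u j. u < b ==> real (c u) <= (1 - 2 * \<epsilon>) * h ==> u < j ==> j < 2 * b ==>
      \<exists>k<Suc u * ls. slot (XA j) m k = transcript \<Pi> m"
    and foundB: "\<And>u j. u < b ==> real (c u) <= (1 - 2 * \<epsilon>) * h ==> u < j ==> j < 2 * b ==>
      \<exists>k<Suc u * ls. slot (XB j) m k = transcript \<Pi> m"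
    and divA: "\<And>j z. j < 2 * b ==> z < M * M ==> PA j z = first_diff m (slot (XA j) m (z div M)) (slot (XA j) m (z mod M))"
    and divB: "\<And>j z. j < 2 * b ==> z < M * M ==> PB j z = first_diff m (slot (XB j) m (z div M)) (slot (XB j) m (z mod M))"
    and posA: "\<And>u j z. u < j ==> j < 2 * b ==> u < b ==> z < \<Lambda> ^ 4 * (M * M) ==>
      PA j (M * M + u * (\<Lambda> ^ 4 * (M * M)) + z) = min (l ^ 4) (position LA u z)"
    and lessA: "\<And>j z. j < 2 * b ==> PA j z < l ^ 4" and lessB: "\<And>j z. j < 2 * b ==> PB j z < l ^ 4"
    and listA: "\<And>u k d. u < b ==> k < C ==> d < l ==> good (ya u) q k d ==> \<exists>j<\<Lambda>. LA ((u * C + k) * \<Lambda> + j) = d"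
    and listB: "\<And>u k d. u < 2 * b ==> k < C ==> d < l ==> good (yb u) q k d ==> \<exists>j<\<Lambda>. cells st RL ((u * C + k) * \<Lambda> + j) = d"
    and stL: "\<And>z. cells st RL z < l"
    and stB: "\<And>j z. j < b ==> z < M * M ==> cells st RB (j * (M * M) + z) = PB j z"
    and stX: "cells st RX = XB (2 * b - 1)"
    and jud: "\<And>i. i < 2 * b ==> judged st i (\<Lambda> ^ C) (yb i) q R"
    and errA: "\<And>i. i < 2 * b ==>
      card {r. r < h & yb i ! r div q ~= csym p C (%k. field (PA i) (XA i) (k div 4) div l ^ (k mod 4) mod l) (r mod l)} <= c i"
    and errB: "\<And>i. i < b ==>
      card {r. r < h & ya i ! r div q ~= csym p C (%k. field (PB i) (XB i) (k div 4) div l ^ (k mod 4) mod l) (r mod l)} <= c i"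
    and tot: "(\<Sum>i<2 * b. real (c i)) <= b * h - 6 * \<epsilon> * b * h"
begin

abbreviation "tr == transcript \<Pi> m"
abbreviation "XF == XB (2 * b - 1)"
definition "dA i k = field (PA i) (XA i) (k div 4) div l ^ (k mod 4) mod l"
definition "dB i k = field (PB i) (XB i) (k div 4) div l ^ (k mod 4) mod l"
text \<open>A run has \<open>2 * h\<close> rounds, so the threshold is the list decoding radius
  \<open>1 / 2 -\<close> \<epsilon> of the given scheme. Open runs are the usable ones.\<close>

definition "open_run u \<longleftrightarrow> u < b & real (c u) <= (1 - 2 * \<epsilon>) * h"

lemma dA_less: "dA i k < l" and dB_less: "dB i k < l"
  using l0 by (simp_all add: dA_def dB_def)

lemma field_less:
  assumes "\<And>z. P z < l ^ 4" "\<And>a. X a < \<sigma>"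
  shows "field P X i < l ^ 4"
proof -
  have "X a < l ^ 4" for a using assms(2)[of a] sizes by linarith
  moreover have "0 < l ^ 4" using l0 by simp
  ultimately show ?thesis using assms(1) by (simp add: field_def at_pos_def slot_nth)
qed

lemma received_digits: "F z < l ^ 4 ==> received (%k. F (k div 4) div l ^ (k mod 4) mod l) z = F z"
  using four_digits[of "F z" l] by (simp add: received_def)

lemma received_dA: "i < 2 * b ==> received (dA i) z = field (PA i) (XA i) z"
  unfolding dA_def using lessA smallA field_less by (intro received_digits) blast

lemma received_dB: "i < 2 * b ==> received (dB i) z = field (PB i) (XB i) z"
  unfolding dB_def using lessB smallB field_less by (intro received_digits) blast

lemma good_digits:
  assumes er: "card {r. r < h & ys ! r div q ~= csym p C dg (r mod l)} <= d" and "h <= g * (h - d)" "k < C"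
  shows "good ys q k (dg k)"
proof -
  let ?E = "{r. r < h & ys ! r div q ~= csym p C dg (r mod l)}"
  have "{..<h} - ?E \<subseteq> agreement ys q k (dg k)"
    using assms(3) p1 by (auto simp: agreement_def csym_digit)
  moreover have "finite (agreement ys q k (dg k))" by (simp add: agreement_def)
  ultimately have "card ({..<h} - ?E) <= card (agreement ys q k (dg k))" by (rule card_mono[rotated])
  moreover have "card ({..<h} - ?E) = h - card ?E" by (subst card_Diff_subset) auto
  ultimately have "h - d <= card (agreement ys q k (dg k))" using er by linarith
  then show ?thesis unfolding good_def using assms(2) by (meson le_trans mult_le_mono2)
qed

lemma digits_exist:
  fixes a :: "nat => nat"
  assumes "\<And>k. k < n ==> a k < \<Lambda>"
  shows "\<exists>z<\<Lambda> ^ n. \<forall>k<n. z div \<Lambda> ^ k mod \<Lambda> = a k"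
  using digit_sum[of n a \<Lambda>, OF assms] by blast

text \<open>At least a \<open>2 *\<close> \<epsilon> fraction of the code symbols of an open run is
  correct, and this exceeds \<open>1 / g\<close> since \<open>g\<close> is at least
  \<open>2 /\<close> \<epsilon>.\<close>

lemma open_many:
  assumes "open_run u"
  shows "h <= g * (h - c u)"
proof -
  have c: "real (c u) <= (1 - 2 * \<epsilon>) * h" using assms by (simp add: open_run_def)
  have g2: "2 <= g * \<epsilon>" using eps by (simp add: field_simps)
  have "(1 - 2 * \<epsilon>) * h <= h" using eps by (simp add: algebra_simps)
  then have ch: "c u <= h" using c by linarith
  have "real h <= 2 * (2 * real h)" by simp
  also have "\<dots> <= (g * \<epsilon>) * (2 * real h)" using g2 by (intro mult_right_mono) auto
  also have "\<dots> = g * (2 * \<epsilon> * h)" by simp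
  also have "\<dots> <= g * (real h - c u)" using c by (intro mult_left_mono) (auto simp: algebra_simps)
  also have "\<dots> = real (g * (h - c u))" using ch by (simp add: of_nat_diff)
  finally show ?thesis by linarith
qed

text \<open>In an open run every digit of Bob's message passes the threshold of Alice's lists, so
  one of the \<Lambda>\<open>^ 4\<close> readings of each position is the right one. Alice includes
  all readings in her later messages.\<close>

lemma positions_listed:
  assumes u: "open_run u" "u < i" "i < 2 * b" and z: "z < M * M"
  shows "\<exists>z'<np. PA i z' = PB u z"
proof -
  have ub: "u < b" using u by (simp add: open_run_def)
  have zn: "z < np" using z by (simp add: np_def)
  then have zC: "4 * z + j < C" if "j < 4" for j using that by (simp add: C_def nf_def)
  have "\<exists>a<\<Lambda>. LA ((u * C + (4 * z + j)) * \<Lambda> + a) = dB u (4 * z + j)" if "j < 4" for j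
    by (rule listA[OF ub zC[OF that] dB_less])
      (rule good_digits[OF errB[OF ub, folded dB_def] open_many[OF u(1)] zC[OF that]])
  then obtain a where a: "\<And>j. j < 4 ==> a j < \<Lambda> & LA ((u * C + (4 * z + j)) * \<Lambda> + a j) = dB u (4 * z + j)" by metis
  obtain y where y: "y < \<Lambda> ^ 4" "\<forall>j<4. y div \<Lambda> ^ j mod \<Lambda> = a j" using digits_exist[of 4 a] a by blast
  define z' where "z' = y * (M * M) + z"
  have z': "z' mod (M * M) = z" "z' div (M * M) = y" using z block_div_mod[of z "M * M" y] by (simp_all add: z'_def)
  have "Suc y * (M * M) <= \<Lambda> ^ 4 * (M * M)" using y(1) by (intro mult_right_mono) auto
  then have zL: "z' < \<Lambda> ^ 4 * (M * M)" using z unfolding z'_def by simp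
  have "position LA u z' = received (dB u) z"
    unfolding position_def received_def z' using y(2) a by (intro sum.cong) auto
  also have "\<dots> = PB u z" using received_dB[of u z] ub zn by (simp add: field_def)
  finally have "PA i (M * M + u * (\<Lambda> ^ 4 * (M * M)) + z') = PB u z"
    using posA[OF u(2,3) ub zL] lessB[of u z] ub by simp
  moreover have "M * M + u * (\<Lambda> ^ 4 * (M * M)) + z' < np"
  proof -
    have "Suc u * (\<Lambda> ^ 4 * (M * M)) <= b * (\<Lambda> ^ 4 * (M * M))" using ub by (intro mult_right_mono) auto
    then show ?thesis using zL by (simp add: np_def)
  qed
  ultimately show ?thesis by blast
qed

lemma slot_index: "k < Suc u * ls ==> u < b ==> k < M"
  unfolding M_def by (meson Suc_leI less_le_trans mult_le_mono1)

lemma pair_index: "r < M ==> k < M ==> r * M + k < M * M"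
proof -
  assume a: "r < M" "k < M"
  then have "Suc r * M <= M * M" by (intro mult_right_mono) auto
  then show ?thesis using a by simp
qed

text \<open>After \<open>u1\<close> the transcript is a candidate of both parties, and after
  \<open>u2\<close> Alice knows Bob's positions of stage \<open>u2\<close>. So the transcript
  matches at stage \<open>u2\<close>, which forces the identified stage \<open>j\<close> to be at
  least \<open>u2\<close>. At such a stage the transcript is among Bob's candidates, hence the
  divergence of candidate \<open>v\<close> from it is one of the saved positions, and a match turns
  \<open>v\<close> into the transcript.\<close>

lemma message_decodes:
  assumes u: "open_run u1" "open_run u2" "u1 < u2" "u2 < i" "i < 2 * b"
    and dg: "\<And>k. k < C ==> dg k = dA i k"
    and v: "identified dg (cells st RB) (cells st RX) b v"
  shows "v < M & slot XF m v = tr"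
proof -
  let ?B = "cells st RB" and ?b = "2 * b - 1"
  have ub: "u1 < b" "u2 < b" using u by (simp_all add: open_run_def)
  have b1: "?b < 2 * b" using ub by linarith
  have rec: "received dg z = field (PA i) (XA i) z" if "z < nf" for z
  proof -
    have "received dg z = received (dA i) z"
      unfolding received_def using that by (intro sum.cong) (auto simp: dg C_def)
    then show ?thesis using received_dA[OF u(5)] by simp
  qed
  have rP: "received dg z = PA i z" if "z < np" for z using that rec[of z] by (simp add: nf_def field_def)
  have rX: "received dg (np + r * np + z) = at_pos m (slot (XA i) m r) (PA i z)" if "r < M" "z < np" for r z
  proof -
    have "Suc r * np <= M * np" using that by (intro mult_right_mono) auto
    then have "np + r * np + z < nf" using that by (simp add: nf_def)
    then show ?thesis using that rec[of "np + r * np + z"] by (simp add: field_def)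
  qed
  obtain ka where ka: "ka < Suc u1 * ls" "slot (XA i) m ka = tr" using foundA[of u1 i] u by (auto simp: open_run_def)
  have kaM: "ka < M" using slot_index[OF ka(1) ub(1)] .
  obtain kb where kb: "kb < Suc u1 * ls" "slot (XB u2) m kb = tr" using foundB[of u1 u2] u ub by (auto simp: open_run_def)
  have kbM: "kb < M" using slot_index[OF kb(1) ub(1)] .
  have kb2: "kb < j * ls" if "u2 <= j" for j
  proof -
    have "Suc u1 * ls <= j * ls" using that u by (intro mult_right_mono) auto
    then show ?thesis using kb(1) by linarith
  qed
  have kbs: "slot (XB j) m kb = tr" if "u2 <= j" "j < 2 * b" for j
    using stable[OF that kbM kb2[OF order_refl]] kb(2) by simp
  \<comment> \<open>The transcript is matched by Alice's own copy of it, in her slot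
    \<open>ka\<close>.\<close>
  have m2: "matches dg ?B XF u2 kb"
    unfolding matches_def
  proof (intro conjI allI impI)
    fix z assume z: "z < M * M"
    obtain z' where "z' < np" "PA i z' = PB u2 z" using positions_listed[OF u(2,4,5) z] by blast
    then show "\<exists>z'<np. received dg z' = ?B (u2 * (M * M) + z)" using rP stB[OF ub(2) z] by auto
  next
    have "slot XF m kb = tr" by (rule kbs) (use b1 ub in auto)
    then show "\<exists>r<M. \<forall>z<np. at_pos m (slot XF m kb) (received dg z) = received dg (np + r * np + z)"
      using rP rX ka(2) kaM by (intro exI[of _ ka]) auto
  qed
  from v[unfolded identified_def stX] obtain j where j: "v < M" "j < b" "v < j * ls" "matches dg ?B XF j v" "u2 <= j"
  proof (elim disjE)
    assume "v = M & (\<forall>j<b. \<forall>k<j * ls. \<not> matches dg ?B XF j k)"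
    then have "\<not> matches dg ?B XF u2 kb" using ub(2) kb2[OF order_refl] by simp
    then show thesis using m2 by simp
  next
    assume "v < M & (\<exists>j<b. v < j * ls & matches dg ?B XF j v & (\<forall>j'<b. \<forall>k<j' * ls. matches dg ?B XF j' k --> j' <= j))"
    then obtain j where j: "v < M" "j < b" "v < j * ls" "matches dg ?B XF j v"
      and mx: "\<forall>j'<b. \<forall>k<j' * ls. matches dg ?B XF j' k --> j' <= j" by (elim exE conjE)
    have "u2 <= j" using mx[rule_format, OF ub(2) kb2[OF order_refl] m2] .
    then show thesis using that j by simp
  qed
  obtain r where r0: "r < M" "\<forall>z<np. at_pos m (slot XF m v) (received dg z) = received dg (np + r * np + z)"
    using j(4) unfolding matches_def by (elim exE conjE)
  have r: "r < M" "\<And>z. z < np ==> at_pos m (slot XF m v) (PA i z) = at_pos m (slot (XA i) m r) (PA i z)"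
    using r0 rP rX by simp_all
  have sv: "slot XF m v = slot (XB j) m v" by (rule stable) (use j b1 in auto)
  let ?I = "PA i ` {..<np}"
  have mn: "M * M <= np" by (simp add: np_def)
  have "slot XF m v = transcript \<Pi> m"
  proof (rule agreeing_candidates[of "slot (XA i) m r" m _ _ ?I])
    show "consistent (oracle_of \<Pi> m Alice) (slot (XA i) m r)" using consA u(5) r by simp
    show "consistent (oracle_of \<Pi> m Bob) (slot XF m v)" by (rule consB) (use b1 j in auto)
    have "PA i (r * M + ka) = first_diff m (slot (XA i) m r) tr"
      using divA[OF u(5) pair_index[OF r(1) kaM]] kaM ka(2) by simp
    then show "first_diff m (slot (XA i) m r) tr \<in> ?I"
      using pair_index[OF r(1) kaM] mn by (intro image_eqI[of _ _ "r * M + ka"]) auto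
    have pi: "v * M + kb < M * M" by (rule pair_index[OF j(1) kbM])
    \<comment> \<open>Both \<open>v\<close> and \<open>kb\<close> lie below \<open>j * ls\<close>,
      so these slots have not changed since stage \<open>j\<close>, and the position saved then is
      the divergence of the final candidates.\<close>
    have "PB j (v * M + kb) = first_diff m (slot XF m v) tr"
      using divB[of j, OF _ pi] j kbM kbs[OF j(5)] sv by simp
    moreover have "\<forall>i<M * M. \<exists>z<np. received dg z = ?B (j * (M * M) + i)" using j(4) unfolding matches_def by (elim conjE)
    then obtain z where "z < np" "received dg z = PB j (v * M + kb)" using pi stB[OF j(2) pi] by auto
    ultimately show "first_diff m (slot XF m v) tr \<in> ?I" using rP[of z] by force
    fix a assume "a \<in> ?I" "a < m"
    then obtain z where "z < np" "a = PA i z" by auto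
    then show "slot (XA i) m r ! a = slot XF m v ! a" using r(2)[of z] \<open>a < m\<close> by (simp add: at_pos_def)
  qed simp_all
  then show ?thesis using j(1) by simp
qed

text \<open>Where both codewords agree with the received word they agree with each other, in
  particular in the Hadamard codewords of the digits at index \<open>k\<close>, which differ. By
  inclusion and exclusion the two agreements exceed \<open>h\<close> by at most a
  \<open>2 / p\<close> fraction of it.\<close>

lemma distinct_messages:
  assumes "\<And>k. d k < l" "\<And>k. d' k < l" "k < C" "d k ~= d' k"
  shows "p * (card {r. r < h & ys ! r div q = csym p C d (r mod l)} + card {r. r < h & ys ! r div q = csym p C d' (r mod l)})
    <= p * h + 2 * h"
proof -
  let ?A = "{r. r < h & ys ! r div q = csym p C d (r mod l)}" and ?B = "{r. r < h & ys ! r div q = csym p C d' (r mod l)}"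
  let ?D = "{r. r < h & had p (d k) (r mod l) = had p (d' k) (r mod l)}"
  have "?A \<inter> ?B \<subseteq> ?D"
  proof
    fix r assume "r \<in> ?A \<inter> ?B"
    then have r: "r < h" "csym p C d (r mod l) = csym p C d' (r mod l)" by auto
    have "had p (d k) (r mod l) = csym p C d (r mod l) div p ^ k mod p" by (simp only: csym_digit[OF p1 assms(3)])
    also have "\<dots> = had p (d' k) (r mod l)" by (simp only: r(2) csym_digit[OF p1 assms(3)])
    finally show "r \<in> ?D" using r(1) by simp
  qed
  then have 1: "card (?A \<inter> ?B) <= card ?D" by (intro card_mono) auto
  have "card (?A \<union> ?B) <= card {..<h}" by (intro card_mono) auto
  then have "card ?A + card ?B <= h + card ?D" using 1 card_Un_Int[of ?A ?B] by simp
  then have "p * (card ?A + card ?B) <= p * h + p * card ?D" unfolding add_mult_distrib2[symmetric] by (rule mult_le_mono2)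
  moreover have "p * card ?D <= h + l" by (rule had_agreement[OF p(1) sizes(3)]) (use assms in auto)
  ultimately show ?thesis using sizes(5) by linarith
qed

lemma chosen_less: "chosen (cells st RL) i z k < l"
  by (simp add: chosen_def stL)

lemma R_le: "i < 2 * b ==> k < M ==> R (i * M + k) <= h"
proof -
  assume a: "i < 2 * b" "k < M"
  have "score L i z ys q <= h" for L z ys
  proof -
    have "score L i z ys q <= card {..<h}" unfolding score_def by (intro card_mono) auto
    then show ?thesis by simp
  qed
  moreover have "R (i * M + k) = 0 \<or> (\<exists>z. R (i * M + k) = score (cells st RL) i z (yb i) q)"
    using jud[OF a(1), unfolded judged_def, THEN conjunct2, rule_format, OF a(2)] by auto
  ultimately show ?thesis by auto
qed

text \<open>If too few symbols are correct for Alice's message to be listed, then the right hand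
  side is at most \<open>- h\<close>, and credits lie between 0 and \<open>h\<close>. Otherwise her
  message is among the candidates for messages, it credits the transcript with at least
  \<open>h - c i\<close>, and any message that credits a rival differs from hers and so scores at
  most \<open>c i\<close> plus an \<epsilon> fraction of \<open>h\<close>.\<close>

lemma credit_gap:
  assumes u: "open_run u1" "open_run u2" "u1 < u2" "u2 < i" "i < 2 * b"
    and k: "kt < M" "slot XF m kt = tr" "ky < M" "slot XF m ky ~= tr"
  shows "real (R (i * M + kt)) - real (R (i * M + ky)) >= h - 2 * real (c i) - \<epsilon> * h"
proof (cases "h <= g * (h - c i)")
  case False
  have gp: "0 < real g" using g by simp
  have "real g * (real h - c i) <= h"
  proof (cases "c i <= h")
    case True
    have "real (g * (h - c i)) <= real h" using False by (intro of_nat_mono) simp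
    then show ?thesis using True by (simp add: of_nat_diff)
  next
    case f: False
    then have "real g * (real h - c i) <= 0" using gp by (intro mult_nonneg_nonpos) auto
    then show ?thesis by linarith
  qed
  then have "real h - c i <= h / g" using gp by (simp add: field_simps)
  also have "\<dots> = h * (1 / g)" by simp
  also have "\<dots> <= h * (\<epsilon> / 2)" using eps gp by (intro mult_left_mono) (auto simp: field_simps)
  finally have "real h - c i <= \<epsilon> * h / 2" by (simp add: mult.commute)
  moreover have "real (R (i * M + ky)) <= h" using R_le[OF u(5) k(3)] by simp
  ultimately show ?thesis by simp
next
  case True
  let ?L = "cells st RL"
  note er = errA[OF u(5), folded dA_def]
  have "\<exists>a<\<Lambda>. ?L ((i * C + k) * \<Lambda> + a) = dA i k" if "k < C" for k
    by (rule listB[OF u(5) that dA_less]) (rule good_digits[OF er True that])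
  then obtain a where a: "\<And>k. k < C ==> a k < \<Lambda> & ?L ((i * C + k) * \<Lambda> + a k) = dA i k" by metis
  obtain z where z: "z < \<Lambda> ^ C" "\<forall>k<C. z div \<Lambda> ^ k mod \<Lambda> = a k" using digits_exist[of C a] a by blast
  have ch: "chosen ?L i z k = dA i k" if "k < C" for k using a[OF that] z(2) that by (simp add: chosen_def)
  let ?A = "{r. r < h & yb i ! r div q = csym p C (dA i) (r mod l)}"
  let ?E = "{r. r < h & yb i ! r div q ~= csym p C (dA i) (r mod l)}"
  have cs: "csym p C (chosen ?L i z) x = csym p C (dA i) x" for x
    unfolding csym_def by (intro sum.cong) (auto simp: ch)
  have sc: "score ?L i z (yb i) q = card ?A" unfolding score_def cs ..
  have "card (?A \<union> ?E) = card ?A + card ?E" by (rule card_Un_disjoint) auto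
  moreover have "?A \<union> ?E = {..<h}" by auto
  ultimately have AE: "h <= card ?A + c i" using er by simp
  obtain v where v: "identified (chosen ?L i z) (cells st RB) XF b v"
    "\<forall>k<M. v < M --> slot XF m v = slot XF m k --> score ?L i z (yb i) q <= R (i * M + k)"
    using jud[OF u(5), unfolded judged_def stX, THEN conjunct1, rule_format, OF z(1)] by (elim exE conjE)
  have "card ?A <= R (i * M + kt)"
    using v(2) k(1) message_decodes[OF u ch v(1)[folded stX]] k(2) sc by simp
  then have rt: "real h - c i <= R (i * M + kt)" using AE by linarith
  have ry: "R (i * M + ky) <= c i + \<epsilon> * h"
    using jud[OF u(5), unfolded judged_def stX, THEN conjunct2, rule_format, OF k(3)]
  proof (elim disjE exE conjE)
    assume "R (i * M + ky) = 0"
    then show ?thesis using eps by simp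
  next
    fix z' v' assume z': "v' < M" "identified (chosen ?L i z') (cells st RB) XF b v'"
      "slot XF m v' = slot XF m ky" "R (i * M + ky) = score ?L i z' (yb i) q"
    \<comment> \<open>Alice's own message identifies the transcript only, so a message in favour of
      the rival differs from it in some digit.\<close>
    have "\<not> (\<forall>k<C. chosen ?L i z' k = dA i k)"
      using message_decodes[OF u _ z'(2)[folded stX]] z'(3) k(4) by auto
    then obtain k where "k < C" "chosen ?L i z' k ~= dA i k" by blast
    then have "p * (score ?L i z' (yb i) q + card ?A) <= p * h + 2 * h"
      unfolding score_def by (intro distinct_messages chosen_less dA_less)
    then have "p * (R (i * M + ky) + h) <= p * (h + c i) + 2 * h"
    proof -
      have "p * (R (i * M + ky) + h) <= p * (R (i * M + ky) + (card ?A + c i))" using AE by (intro mult_le_mono2) simp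
      also have "\<dots> = p * (R (i * M + ky) + card ?A) + p * c i" by (simp add: algebra_simps)
      also have "\<dots> <= p * h + 2 * h + p * c i" using \<open>p * (score ?L i z' (yb i) q + card ?A) <= p * h + 2 * h\<close> z'(4) by simp
      finally show ?thesis by (simp add: algebra_simps)
    qed
    then have "real (p * (R (i * M + ky) + h)) <= real (p * (h + c i) + 2 * h)" by (rule of_nat_mono)
    then have "real p * (R (i * M + ky) + h) <= p * (real h + c i) + 2 * h" by simp
    then have "real p * (R (i * M + ky) - real (c i)) <= 2 * real h" by (simp add: algebra_simps)
    also have "2 * real h <= p * (\<epsilon> * h)"
    proof -
      have "g <= 8 * g * g" using g by simp
      then have "real g <= p" using p(2) by linarith
      then have "real g * \<epsilon> <= p * \<epsilon>" using eps by (intro mult_right_mono) auto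
      moreover have "2 <= real g * \<epsilon>" using eps by (simp add: field_simps)
      ultimately have "2 <= p * \<epsilon>" by linarith
      then have "2 * real h <= (p * \<epsilon>) * h" by (intro mult_right_mono) auto
      then show ?thesis by (simp add: mult.assoc)
    qed
    finally show ?thesis using p1 by simp
  qed
  show ?thesis using rt ry by linarith
qed

text \<open>Otherwise \<open>b - 1\<close> runs would contain more than \<open>(1 - 2 *\<close>
  \<epsilon>\<open>) * h\<close> corruptions each, which exceeds the budget because
  \<epsilon>\<open>* b\<close> is at least 3. The minimal choice makes all other runs before
  \<open>u2\<close> expensive for the adversary.\<close>

lemma two_open_runs:
  "\<exists>u1 u2. open_run u1 & open_run u2 & u1 < u2 & (\<forall>i<u2. i ~= u1 --> \<not> open_run i)"
proof -
  let ?U = "{u. open_run u}"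
  have fin: "finite ?U" "?U \<subseteq> {..<b}" by (auto simp: open_run_def intro: finite_subset[of _ "{..<b}"])
  have eb: "3 <= \<epsilon> * b" using eps by (simp add: field_simps)
  have "\<not> card ?U <= 1"
  proof
    assume le: "card ?U <= 1"
    have "(\<Sum>i\<in>{..<b} - ?U. (1 - 2 * \<epsilon>) * h) <= (\<Sum>i\<in>{..<b} - ?U. real (c i))"
      by (intro sum_mono) (auto simp: open_run_def)
    also have "\<dots> <= (\<Sum>i<2 * b. real (c i))" by (intro sum_mono2) auto
    finally have "real (card ({..<b} - ?U)) * ((1 - 2 * \<epsilon>) * h) <= b * h - 6 * \<epsilon> * b * h" using tot by simp
    moreover have "real b - 1 <= card ({..<b} - ?U)" using le fin by (simp add: card_Diff_subset)
    then have "(real b - 1) * ((1 - 2 * \<epsilon>) * h) <= real (card ({..<b} - ?U)) * ((1 - 2 * \<epsilon>) * h)"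
      using eps by (intro mult_right_mono) auto
    ultimately have "(real b - 1) * (1 - 2 * \<epsilon>) * h <= (b - 6 * \<epsilon> * b) * h" by (simp add: algebra_simps)
    then have "(real b - 1) * (1 - 2 * \<epsilon>) <= b - 6 * \<epsilon> * b" using sizes(4) by simp
    then have "4 * (\<epsilon> * b) + 2 * \<epsilon> <= 1" by (simp add: algebra_simps)
    then show False using eb eps by linarith
  qed
  then have c2: "2 <= card ?U" by linarith
  have ne: "?U ~= {}"
  proof
    assume "?U = {}"
    then show False using c2 by (simp only: card.empty)
  qed
  define u1 where "u1 = Min ?U"
  have u1: "u1 \<in> ?U" "\<And>i. i \<in> ?U ==> u1 <= i"
    unfolding u1_def using Min_in[OF fin(1) ne] Min_le[OF fin(1)] by blast+
  have "card (?U - {u1}) ~= 0" using c2 u1(1) fin by simp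
  then have ne2: "?U - {u1} ~= {}" by (rule contrapos_nn) (simp only: card.empty)
  define u2 where "u2 = Min (?U - {u1})"
  have u2: "u2 \<in> ?U - {u1}" using fin ne2 unfolding u2_def by (intro Min_in) auto
  have u2m: "u2 <= i" if "i \<in> ?U - {u1}" for i using fin that unfolding u2_def by (intro Min_le) auto
  show ?thesis
  proof (intro exI conjI allI impI)
    show "u1 < u2" using u1(2)[of u2] u2 by auto
    show "\<not> open_run i" if "i < u2" "i ~= u1" for i using u2m[of i] that by auto
    show "open_run u1" using u1(1) by simp
    show "open_run u2" using u2 by simp
  qed
qed

text \<open>If a rival won, the differences \<open>D\<close> of credits would sum to at most 0. They
  sum to at least the sum of all \<open>B i\<close> minus \<open>4 * h\<close>, and the budget of
  corruptions makes that at least \<open>(7 *\<close> \<epsilon>\<open>* b - 4) * h\<close>, which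
  is positive.\<close>

theorem elected_is_transcript:
  assumes kb: "kb < M" "\<And>k. k < M ==> (\<Sum>i<2 * b. R (i * M + k)) <= (\<Sum>i<2 * b. R (i * M + kb))"
  shows "slot XF m kb = tr"
proof (rule ccontr)
  assume ne: "slot XF m kb ~= tr"
  obtain u1 u2 where u: "open_run u1" "open_run u2" "u1 < u2" and un: "\<forall>i<u2. i ~= u1 --> \<not> open_run i"
    using two_open_runs by (elim exE conjE)
  have ub: "u1 < b" "u2 < b" using u(1,2) by (simp_all add: open_run_def)
  have c1: "real (c u1) <= (1 - 2 * \<epsilon>) * h" using u(1) by (simp add: open_run_def)
  have b1: "u1 < 2 * b - 1" "2 * b - 1 < 2 * b" using ub u(3) by linarith+
  obtain kt where kt: "kt < Suc u1 * ls" "slot XF m kt = tr"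
    using foundB[OF ub(1) c1 b1] by (elim exE conjE)
  have ktM: "kt < M" using slot_index[OF kt(1) ub(1)] .
  define D where "D i = real (R (i * M + kt)) - real (R (i * M + kb))" for i
  \<comment> \<open>The larger slack for runs is chosen so that a run that is not open has
    \<open>B i \<le> - h\<close>, where the trivial bound on credits suffices.\<close>
  define B where "B i = real h - 2 * real (c i) - (if i < b then 4 * \<epsilon> * h else \<epsilon> * h)" for i
  \<comment> \<open>After \<open>u2\<close> the credit gap applies, and before it all runs except
    \<open>u1\<close> are not open. In \<open>u1\<close> and \<open>u2\<close> credits may be
    misplaced although few symbols are corrupted; as \<open>B i \<le> h\<close> and
    \<open>D i \<ge> - h\<close>, an allowance of \<open>2 * h\<close> covers each of them.\<close>
  have DB: "D i + (if i = u1 then 2 * real h else 0) + (if i = u2 then 2 * real h else 0) >= B i" if i: "i < 2 * b" for i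
  proof (cases "u2 < i")
    case True
    have "0 <= \<epsilon> * h" using eps by simp
    then show ?thesis using credit_gap[OF u(1-3) True i ktM kt(2) kb(1) ne] u(3) True by (simp add: D_def B_def)
  next
    case False
    have Dh: "D i >= - real h" using R_le[OF i kb(1)] by (simp add: D_def)
    show ?thesis
    proof (cases "i = u1 \<or> i = u2")
      case True
      have "0 <= \<epsilon> * h" using eps by simp
      then show ?thesis using True Dh u(3) ub by (auto simp: B_def)
    next
      case f: False
      then have "\<not> open_run i" "i < b" using un False ub by auto
      then have "(1 - 2 * \<epsilon>) * h < c i" by (simp add: open_run_def)
      then show ?thesis using f Dh \<open>i < b\<close> by (simp add: B_def algebra_simps)
    qed
  qed
  have "(\<Sum>i<2 * b. B i) <= (\<Sum>i<2 * b. D i + (if i = u1 then 2 * real h else 0) + (if i = u2 then 2 * real h else 0))"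
    by (intro sum_mono) (use DB in auto)
  also have "\<dots> = (\<Sum>i<2 * b. D i) + 4 * h" using ub by (simp add: sum.distrib)
  finally have 0: "(\<Sum>i<2 * b. B i) <= (\<Sum>i<2 * b. D i) + 4 * h" .
  have "(\<Sum>i<2 * b. D i) = real (\<Sum>i<2 * b. R (i * M + kt)) - real (\<Sum>i<2 * b. R (i * M + kb))"
    unfolding D_def by (simp add: sum_subtractf)
  also have "\<dots> <= 0" using of_nat_mono[OF kb(2)[OF ktM], where ?'a = real] by simp
  finally have 1: "(\<Sum>i<2 * b. B i) <= 4 * h" using 0 by linarith
  have "(\<Sum>i<2 * b. if i < b then 4 * \<epsilon> * h else \<epsilon> * h) = (\<Sum>i<b. 4 * \<epsilon> * h) + (\<Sum>i\<in>{b..<2 * b}. \<epsilon> * h)"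
  proof -
    have "{..<2 * b} = {..<b} \<union> {b..<2 * b}" by auto
    then show ?thesis by (simp add: sum.union_disjoint ivl_disj_int)
  qed
  also have "\<dots> = 5 * \<epsilon> * b * h" by simp
  finally have 3: "(\<Sum>i<2 * b. if i < b then 4 * \<epsilon> * h else \<epsilon> * h) = 5 * \<epsilon> * b * h" .
  have 2: "(\<Sum>i<2 * b. B i) = 2 * b * h - 2 * (\<Sum>i<2 * b. real (c i)) - 5 * \<epsilon> * b * h"
    unfolding B_def sum_subtractf 3 by (simp add: sum_distrib_left)
  have "7 * (\<epsilon> * b) * h <= 4 * h" using 1 2 tot by (simp add: algebra_simps)
  then have "7 * (\<epsilon> * b) <= 4" using sizes(4) by simp
  moreover have "3 <= \<epsilon> * b" using eps by (simp add: field_simps)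
  ultimately show False by linarith
qed

end

section \<open>The stores of a party in the course of an execution\<close>

lemma set_rcvd: "set (rcvd w k xs) \<subseteq> range w"
  by (induction xs arbitrary: k) auto

context coder_exec
begin

lemma sem_pre:
  fixes st i
  defines "s' == sem f w 7 (pre al i) e st"
  assumes i: "i < 2 * b" and t: "table_ok st"
  shows "\<And>k. k < M ==> consistent f1 (slot (cells s' RX) m k)"
    and "\<And>k. k < M ==> consistent f1 (slot (cells st RX) m k) ==> slot (cells s' RX) m k = slot (cells st RX) m k"
    and "\<forall>a. cells st RX a < \<sigma> ==> \<forall>h. f1 h <= \<sigma> ==> 0 < \<sigma> ==> \<forall>a. cells s' RX a < \<sigma>"
    and "cells s' RP = (%z. if z < M * M then first_diff m (slot (cells s' RX) m (z div M)) (slot (cells s' RX) m (z mod M))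
      else cells st RP z)"
    and "cells s' RB = (%z. if i < b & i * (M * M) <= z & z < i * (M * M) + M * M then cells s' RP (z - i * (M * M)) else cells st RB z)"
    and "\<And>x. x < l ==> cells s' RW x
      = csym p C (%k. field (cells s' RP) (cells s' RX) (k div 4) div l ^ (k mod 4) mod l) x"
    and "\<forall>x. cells st RW x < Q ==> \<forall>x. cells s' RW x < Q"
proof -
  define s1 where "s1 = sem f w 7 (slots_pre al) e st"
  define s2 where "s2 = sem f w 7 (if i < b then save i else Skip) e s1"
  define s3 where "s3 = sem f w 7 digits e s2"
  define s4 where "s4 = sem f w 7 codeword e s3"
  define s5 where "s5 = sem f w 7 reset e s4"
  have eq: "s' = sem f w 7 (if i < b then Write (RS i) (Const 0) LN else Skip) e s5"
    by (simp add: s'_def pre_def s1_def s2_def s3_def s4_def s5_def)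
  have f1': "cells s1 r = cells st r" if "r \<notin> {VA, RX, RP}" for r
    unfolding s1_def by (rule sem_frame) (use mods_coms(21)[of al] that in blast)
  have f2: "cells s2 r = cells s1 r" if "r ~= RB" for r
    unfolding s2_def by (rule sem_frame) (use mods_coms(3)[of i] that in auto)
  have f3: "cells s3 r = cells s2 r" if "r ~= RG" for r
    unfolding s3_def by (rule sem_frame) (use mods_coms(4) that in auto)
  have f4: "cells s4 r = cells s3 r" if "r ~= RW" for r
    unfolding s4_def by (rule sem_frame) (use mods_coms(5) that in auto)
  have f5: "cells s5 r = cells s4 r" if "r \<notin> {VS, VR, VO, VH}" for r
    unfolding s5_def by (rule sem_frame) (use mods_coms(6) that in auto)
  have f6: "cells s' r = cells s5 r" if "r ~= RS i" for r
    unfolding eq by (rule sem_frame) (use that in auto)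
  have RSi: "18 < RS i" by (simp add: RS_def)
  have X: "cells s' RX = cells s1 RX" "cells s3 RX = cells s1 RX" "cells s2 RX = cells s1 RX"
    and P: "cells s' RP = cells s1 RP" "cells s3 RP = cells s1 RP" "cells s2 RP = cells s1 RP"
    and B: "cells s' RB = cells s2 RB" and W: "cells s' RW = cells s4 RW" "cells s3 RW = cells st RW"
    and H: "cells s3 RH = cells st RH"
    using RSi by (simp_all add: f1' f2 f3 f4 f5 f6)
  note S = sem_slots_pre[where st = st, folded s1_def]
  show "\<And>k. k < M ==> consistent f1 (slot (cells s' RX) m k)"
    and "\<And>k. k < M ==> consistent f1 (slot (cells st RX) m k) ==> slot (cells s' RX) m k = slot (cells st RX) m k"
    and "\<forall>a. cells st RX a < \<sigma> ==> \<forall>h. f1 h <= \<sigma> ==> 0 < \<sigma> ==> \<forall>a. cells s' RX a < \<sigma>"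
    and "cells s' RP = (%z. if z < M * M then first_diff m (slot (cells s' RX) m (z div M)) (slot (cells s' RX) m (z mod M))
      else cells st RP z)"
    unfolding X P by (fact S)+
  have "cells s1 RB = cells st RB" by (rule f1') simp
  then show "cells s' RB = (%z. if i < b & i * (M * M) <= z & z < i * (M * M) + M * M then cells s' RP (z - i * (M * M)) else cells st RB z)"
    unfolding B P s2_def using sem_save[of i s1] by (cases "i < b") (auto simp: fun_eq_iff)
  have t3: "table_ok s3" using t H by (simp add: table_ok_def)
  have G: "cells s3 RG k = field (cells s1 RP) (cells s1 RX) (k div 4) div l ^ (k mod 4) mod l" if "k < C" for k
    using that X P sem_digits[of s2, folded s3_def] by simp
  have "cells s4 RW = (%x. if x < l then csym p C (cells s3 RG) x else cells s3 RW x)"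
    unfolding s4_def by (rule sem_codeword[OF t3]) (use G l0 in auto)
  then show "cells s' RW x = csym p C (%k. field (cells s' RP) (cells s' RX) (k div 4) div l ^ (k mod 4) mod l) x" if "x < l" for x
    using that G unfolding W X P by (simp add: csym_def)
  show "\<forall>x. cells st RW x < Q ==> \<forall>x. cells s' RW x < Q"
    unfolding W using sem_codeword_less[of s3, folded s4_def] W(2) by simp
qed

lemma sem_post:
  fixes st i
  defines "s' == sem f w 7 (post i) e st"
  assumes t: "table_ok st" and ok: "piece_ok st i ys q" and l: "l = p ^ kk" "0 < h" "l <= h"
  shows "\<forall>k<C. \<forall>d<l. good ys q k d --> (\<exists>j<\<Lambda>. cells s' RL ((i * C + k) * \<Lambda> + j) = d)"
    and "\<forall>z. z < i * C * \<Lambda> \<or> (i * C + C) * \<Lambda> <= z --> cells s' RL z = cells st RL z"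
    and "\<forall>z. cells st RL z < l ==> \<forall>z. cells s' RL z < l"
    and "cells s' RP = (%z. if i < b & M * M + i * (\<Lambda> ^ 4 * (M * M)) <= z & z < M * M + i * (\<Lambda> ^ 4 * (M * M)) + \<Lambda> ^ 4 * (M * M)
      then min (l ^ 4) (position (cells s' RL) i (z - (M * M + i * (\<Lambda> ^ 4 * (M * M))))) else cells st RP z)"
proof -
  define u where "u = sem f w 7 (SeqN C (list_digit i)) e st"
  have eq: "s' = sem f w 7 (if i < b then positions i else Skip) e u" by (simp add: s'_def post_def u_def)
  have RLu: "cells s' RL = cells u RL" unfolding eq by (rule sem_frame) (use mods_coms(9)[of i] in auto)
  have RPu: "cells u RP = cells st RP" unfolding u_def by (rule sem_frame) (auto simp: mods_coms(7))
  note S = sem_lists[OF t ok l, folded u_def]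
  show "\<forall>k<C. \<forall>d<l. good ys q k d --> (\<exists>j<\<Lambda>. cells s' RL ((i * C + k) * \<Lambda> + j) = d)"
    and "\<forall>z. z < i * C * \<Lambda> \<or> (i * C + C) * \<Lambda> <= z --> cells s' RL z = cells st RL z"
    and "\<forall>z. cells st RL z < l ==> \<forall>z. cells s' RL z < l"
    unfolding RLu by (fact S)+
  show "cells s' RP = (%z. if i < b & M * M + i * (\<Lambda> ^ 4 * (M * M)) <= z & z < M * M + i * (\<Lambda> ^ 4 * (M * M)) + \<Lambda> ^ 4 * (M * M)
      then min (l ^ 4) (position (cells s' RL) i (z - (M * M + i * (\<Lambda> ^ 4 * (M * M))))) else cells st RP z)"
  proof (cases "i < b")
    case True
    then have "cells s' RP = cells (sem f w 7 (positions i) e u) RP" by (simp add: eq)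
    then show ?thesis unfolding RLu using True by (auto simp: sem_positions RPu fun_eq_iff)
  next
    case False
    then show ?thesis using RPu by (simp add: eq)
  qed
qed

lemma sem_talk:
  fixes q
  assumes "cells st VS 0 = 0"
  shows "chan (sem f w 7 (talk q) e st) = chan st @ map (%k. Some (q * cells st RW (k mod l))) [0..<h]"
    "printed (sem f w 7 (talk q) e st) = printed st"
proof -
  define I where "I j u \<longleftrightarrow> cells u RW = cells st RW & cells u VS 0 = j mod l & printed u = printed st &
    chan u = chan st @ map (%k. Some (q * cells st RW (k mod l))) [0..<j]" for j :: nat and u :: store
  have "I (e 6) (sem f w 7 (talk q) e st)"
    unfolding talk_def sem.simps
  proof (rule fold_upt_inv)
    show "I 0 st" using assms by (simp add: I_def)
    fix j u assume "I j u"
    then show "I (Suc j) (sem f w (Suc 7) (bump VS) (e(7 := j))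
      (u\<lparr>chan := chan u @ [Some (eval (e(7 := j)) (cells u) (Const q \<otimes> Cell RW (Var VS)))]\<rparr>))"
      by (auto simp: I_def bump_def env mod_Suc_eq)
  qed
  then show "chan (sem f w 7 (talk q) e st) = chan st @ map (%k. Some (q * cells st RW (k mod l))) [0..<h]"
    "printed (sem f w 7 (talk q) e st) = printed st"
    by (simp_all add: I_def env)
qed

lemma sem_listen:
  fixes st i q
  assumes "cells st VR 0 = 0" "cells st (RF i) = (%_. 0)"
  defines "s' == sem f w 7 (listen q i) e st"
  shows "cells s' (RF i) = tally q Q l (map (%k. w (length (chan st) + k)) [0..<h])"
    "chan s' = chan st @ replicate h None" "printed s' = printed st"
proof -
  define I where "I j u \<longleftrightarrow> cells u VR 0 = j mod l & printed u = printed st &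
    cells u (RF i) = tally q Q l (map (%k. w (length (chan st) + k)) [0..<j]) &
    chan u = chan st @ replicate j None" for j :: nat and u :: store
  have R: "RF i ~= VR" "RF i ~= VA" "VR ~= RF i" "VA ~= RF i" by (simp_all add: RF_def)
  have "I (e 6) (sem f w 7 (listen q i) e st)"
    unfolding listen_def sem.simps
  proof (rule fold_upt_inv)
    show "I 0 st" using assms(1,2) by (simp add: I_def tally_def fun_eq_iff)
    fix j u assume I: "I j u"
    let ?a = "j mod l * Q + w (length (chan st) + j) div q"
    define v where "v = sem f w 8 (Seq (Accept VA) (Seq
     (Write (RF i) (Var VR \<otimes> Const Q \<oplus> Bin Divide (Var VA) (Const q))
       (Cell (RF i) (Var VR \<otimes> Const Q \<oplus> Bin Divide (Var VA) (Const q)) \<oplus> Const 1)) (bump VR))) (e(7 := j)) u"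
    have "cells v VR 0 = Suc j mod l" "printed v = printed st" "chan v = chan st @ replicate (Suc j) None"
      using I R by (auto simp: v_def I_def bump_def env mod_Suc_eq replicate_append_same)
    moreover have "cells v (RF i) = (cells u (RF i))(?a := cells u (RF i) ?a + 1)"
      using I R by (auto simp: v_def I_def bump_def)
    then have "cells v (RF i) = tally q Q l (map (%k. w (length (chan st) + k)) [0..<Suc j])"
      using I by (auto simp: I_def tally_snoc fun_eq_iff)
    ultimately have "I (Suc j) v" by (simp add: I_def)
    then show "I (Suc j) (sem f w (Suc 7) (bump VR) (e(7 := j)) (put (RF i)
        (eval (e(7 := j)) (cells (put VA 0 (w (length (chan u))) (u\<lparr>chan := chan u @ [None]\<rparr>))) (Var VR \<otimes> Const Q \<oplus> Bin Divide (Var VA) (Const q)))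
        (eval (e(7 := j)) (cells (put VA 0 (w (length (chan u))) (u\<lparr>chan := chan u @ [None]\<rparr>)))
          (Cell (RF i) (Var VR \<otimes> Const Q \<oplus> Bin Divide (Var VA) (Const q)) \<oplus> Const 1))
        (put VA 0 (w (length (chan u))) (u\<lparr>chan := chan u @ [None]\<rparr>))))"
      unfolding v_def by simp
  qed
  then show "cells s' (RF i) = tally q Q l (map (%k. w (length (chan st) + k)) [0..<h])"
    "chan s' = chan st @ replicate h None" "printed s' = printed st"
    by (simp_all add: I_def env s'_def)
qed

end

locale party_history = party_run b ls \<sigma> g p q D al P f w n m l h N Tm V0 B Zm W tm
  for b ls \<sigma> g p q D al P f w n m l h N Tm V0 B Zm W tm +
  fixes ss r1 r2 :: "nat => store"
  assumes H: "history (2 * b) ss r1 r2" and hl: "0 < h" "l <= h" and f\<sigma>: "\<And>x. pad_oracle al n m f x <= \<sigma>"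
    and wq: "\<And>i. w i < q * Q" and b0: "0 < b" and N2: "N = 2 * h" and \<sigma>m: "\<sigma> <= m"
begin

sublocale E: coder_exec b ls \<sigma> g p al f w eh m l h by (rule exec(2))

abbreviation "fn == pad_oracle al n m f"
abbreviation "XX j == cells (r1 j) RX"
abbreviation "PP j == cells (r1 j) RP"

text \<open>The round in which piece \<open>j\<close> starts: runs take \<open>N\<close> rounds, the
  pieces in which only Alice talks take \<open>h\<close>.\<close>

definition cl :: "nat => nat" where "cl j = (if j <= b then j * N else b * N + (j - b) * h)"
definition run :: "nat => config" where "run j = fin (%k. w (j * N + k) mod q)"
definition ys :: "nat => nat list" where
  "ys j = (if j < b then rcvd w (j * N) (comm (run j)) else map (%k. w (cl j + k)) [0..<h])"
definition part :: "nat => nat option list" where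
  "part j = (if j < b then encode q l (cells (r1 j) RW) 0 (comm (run j))
     else if al then map (%k. Some (q * cells (r1 j) RW (k mod l))) [0..<h] else replicate h None)"

lemma cl_Suc: "cl (Suc j) = cl j + (if j < b then N else h)"
  by (cases j b rule: linorder_cases) (auto simp: cl_def Suc_diff_le)

lemma cl_mono: "i <= j ==> cl i <= cl j"
  by (rule lift_Suc_mono_le[of cl]) (auto simp: cl_Suc)

lemma lp: obtains kk where "l = p ^ kk" using fit by (auto simp: fits_def)

lemma m4: "m < l ^ 4" using fit by (simp add: fits_def)

lemma links: "j < 2 * b ==> link j (ss j) (r1 j) (r2 j) (ss (Suc j))"
  using H by (simp add: history_def)

lemma pre_eq: "j < 2 * b ==> r1 j = sem f w 7 (pre al j) (ev j) (ss j)"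
  using links[of j] b0 unfolding link_def by (auto split: if_splits)

lemma frame_pre: "j < 2 * b ==> r \<notin> {VA, RX, RP, RB, RG, RW, VS, VR, VO, VH, RS j} ==> cells (r1 j) r = cells (ss j) r"
  unfolding pre_eq by (rule sem_pre_frame(6))

lemma chan_pre: "j < 2 * b ==> chan (r1 j) = chan (ss j)" "j < 2 * b ==> printed (r1 j) = printed (ss j)"
  unfolding pre_eq by (rule sem_pre_frame(7,8), assumption)+

lemma zero_pre: "j < 2 * b ==> cells (r1 j) VS 0 = 0" "j < 2 * b ==> cells (r1 j) VR 0 = 0"
  unfolding pre_eq by (rule sem_pre_frame(1,2), assumption)+

lemma frame_mid:
  assumes "j < 2 * b" "r \<notin> {RS j, RF j, VS, VH, VR, VO, VA, RX}"
  shows "cells (r2 j) r = cells (r1 j) r"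
proof (cases "j < b")
  case True
  interpret sm: simulation al q Q ls \<sigma> j "RF j" "RS j" by (rule simulation[OF assms(1)])
  show ?thesis using links[OF assms(1)] True assms(2) unfolding link_def by (simp add: sm.mirrors_def)
next
  case False
  then have "r2 j = sem f w 7 (if al then talk q else listen q j) eh (r1 j)"
    using links[OF assms(1)] unfolding link_def by (auto split: if_splits)
  then show ?thesis using sem_frame[of r "if al then talk q else listen q j"] mods_coms(18,19) assms(2) by auto
qed

lemma RX_mid: "b <= j ==> j < 2 * b ==> cells (r2 j) RX = cells (r1 j) RX"
proof -
  assume a: "b <= j" "j < 2 * b"
  then have "r2 j = sem f w 7 (if al then talk q else listen q j) eh (r1 j)"
    using links[OF a(2)] unfolding link_def by (auto split: if_splits)
  then show ?thesis using sem_frame[of RX "if al then talk q else listen q j"] mods_coms(18,19) by (auto simp: RF_def)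
qed

definition has_post :: "nat => bool" where "has_post j \<longleftrightarrow> j < b \<or> \<not> al"

lemma post_eq: "j < 2 * b ==> ss (Suc j) = (if has_post j then sem f w 7 (post j) eh (r2 j) else r2 j)"
  using links[of j] unfolding link_def has_post_def by (auto split: if_splits)

lemma frame_post: "j < 2 * b ==> r \<notin> {VC, VL, RL, RP} ==> cells (ss (Suc j)) r = cells (r2 j) r"
  unfolding post_eq using sem_frame[of r "post j" f w 7 eh "r2 j"] mods_coms(20)[of j] by (cases "has_post j") auto

lemma chan_post: "j < 2 * b ==> chan (ss (Suc j)) = chan (r2 j) & printed (ss (Suc j)) = printed (r2 j)"
  unfolding post_eq using sem_quiet[OF quiet_coms(2)] by auto

text \<open>The ranges keep transmitted symbols in the alphabet and let all fields of a message fit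
  into four digits. Tally arrays of pieces to come are still 0, and credits are assigned only at the
  very end.\<close>

definition okay :: "nat => bool" where
  "okay j \<longleftrightarrow> E.table_ok (ss j) & (\<forall>a. cells (ss j) RC a = 0) & printed (ss j) = [] & (\<forall>x. cells (ss j) RW x < Q) &
     (\<forall>z. cells (ss j) RL z < l) & (\<forall>a. cells (ss j) RX a < \<sigma>) & (\<forall>z. cells (ss j) RP z < l ^ 4) &
     (\<forall>i\<ge>j. i < 2 * b --> cells (ss j) (RF i) = (%_. 0)) & length (chan (ss j)) = cl j"

lemma okay_0: "okay 0"
  using H Q0 l0 \<sigma>0 unfolding history_def start_def okay_def by (auto simp: RF_def cl_def)

lemma table_pre: "j < 2 * b ==> E.table_ok (ss j) ==> E.table_ok (r1 j)"
  using frame_pre[of j RH] by (simp add: E.table_ok_def RS_def)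

lemma table_mid: "j < 2 * b ==> E.table_ok (r1 j) ==> E.table_ok (r2 j)"
  using frame_mid[of j RH] by (simp add: E.table_ok_def RS_def RF_def)

lemma pre_spec:
  assumes "j < 2 * b" "okay j"
  shows "\<And>k. k < M ==> consistent fn (slot (XX j) m k)"
    and "\<And>k. k < M ==> consistent fn (slot (cells (ss j) RX) m k) ==> slot (XX j) m k = slot (cells (ss j) RX) m k"
    and "\<And>a. XX j a < \<sigma>"
    and "PP j = (%z. if z < M * M then first_diff m (slot (XX j) m (z div M)) (slot (XX j) m (z mod M)) else cells (ss j) RP z)"
    and "cells (r1 j) RB = (%z. if j < b & j * (M * M) <= z & z < j * (M * M) + M * M then PP j (z - j * (M * M)) else cells (ss j) RB z)"
    and "\<And>x. x < l ==> cells (r1 j) RW x = csym p C (%k. E.field (PP j) (XX j) (k div 4) div l ^ (k mod 4) mod l) x"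
    and "\<And>x. cells (r1 j) RW x < Q"
    and "\<And>z. PP j z < l ^ 4"
proof -
  interpret J: coder_exec b ls \<sigma> g p al f w "ev j" m l "if j = 0 then 0 else h" by (rule exec(1))
  have t: "J.table_ok (ss j)" using assms(2) by (simp add: okay_def)
  have ev0: "pad_oracle al (ev j 0) m f = fn" by simp
  note S = J.sem_pre[OF assms(1) t, folded pre_eq[OF assms(1)], unfolded ev0]
  show "\<And>k. k < M ==> consistent fn (slot (XX j) m k)"
    and "\<And>k. k < M ==> consistent fn (slot (cells (ss j) RX) m k) ==> slot (XX j) m k = slot (cells (ss j) RX) m k"
    and PPe: "PP j = (%z. if z < M * M then first_diff m (slot (XX j) m (z div M)) (slot (XX j) m (z mod M)) else cells (ss j) RP z)"
    and "cells (r1 j) RB = (%z. if j < b & j * (M * M) <= z & z < j * (M * M) + M * M then PP j (z - j * (M * M)) else cells (ss j) RB z)"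
    and "\<And>x. x < l ==> cells (r1 j) RW x = csym p C (%k. E.field (PP j) (XX j) (k div 4) div l ^ (k mod 4) mod l) x"
    by (fact S)+
  show "\<And>a. XX j a < \<sigma>" using S(3) assms(2) f\<sigma> \<sigma>0 by (simp add: okay_def)
  show "\<And>x. cells (r1 j) RW x < Q" using S(7) assms(2) by (simp add: okay_def)
  have "first_diff m (slot (XX j) m x) (slot (XX j) m y) < l ^ 4" for x y
    using first_diff_le[of "slot (XX j) m x" m "slot (XX j) m y"] m4 by simp
  then show "PP j z < l ^ 4" for z using assms(2) unfolding PPe by (simp add: okay_def)
qed

lemma run_eq:
  assumes "j < b" "okay j"
  shows "fin (ws (r1 j)) = run j"
proof -
  have "ws (r1 j) = (%k. w (j * N + k) mod q)"
    using assms chan_pre[of j] by (auto simp: ws_def okay_def cl_def)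
  then show ?thesis by (simp add: run_def)
qed

lemma run_comm: "sent (comm (run j)) = h" "length (comm (run j)) = N"
  unfolding run_def fin_def using q0 by (auto intro!: cs)

lemma mid_spec:
  assumes "j < 2 * b" "okay j"
  shows "chan (r2 j) = chan (ss j) @ part j" "printed (r2 j) = []" "length (part j) = cl (Suc j) - cl j" "cl j <= cl (Suc j)"
    "has_post j ==> E.piece_ok (r2 j) j (ys j) q"
    and "j < b ==> cells (r2 j) RX = (%a. if j * ls * m <= a & a < j * ls * m + min (length (out (run j))) (ls * m)
       then (out (run j) ! (a - j * ls * m)) mod \<sigma> else XX j a)"
proof -
  have len: "length (chan (r1 j)) = cl j" and pr: "printed (r1 j) = []" using assms chan_pre[of j] by (simp_all add: okay_def)
  have dq: "w i div q < Q" for i using wq[of i] by (simp add: less_mult_imp_div_less mult.commute)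
  have RF0: "cells (r1 j) (RF j) = (%_. 0)"
    using frame_pre[OF assms(1), of "RF j"] assms by (simp add: okay_def RF_def RS_def)
  show le: "cl j <= cl (Suc j)" by (simp add: cl_Suc)
  have L: "length (part j) = cl (Suc j) - cl j" using run_comm(2)[of j] by (auto simp: part_def length_encode cl_Suc)
  then show "length (part j) = cl (Suc j) - cl j" .
  {
    assume j: "j < b"
    interpret sm: simulation al q Q ls \<sigma> j "RF j" "RS j" by (rule simulation[OF assms(1)])
    have mi: "sm.mirrors (ev j) w (r1 j) (run j) (r2 j)"
      using links[OF assms(1)] unfolding link_def run_eq[OF j assms(2)] if_P[OF j] by (elim conjE)
    have "length (rcvd w (j * N) (comm (run j))) = h" using length_rcvd[of w "j * N" "comm (run j)"] run_comm[of j] N2 by linarith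
    then have "E.piece_ok (r2 j) j (ys j) q"
      using mi j len set_rcvd[of w "j * N" "comm (run j)"] dq by (auto simp: E.piece_ok_def sm.mirrors_def ys_def cl_def)
    moreover have "chan (r2 j) = chan (ss j) @ part j & printed (r2 j) = []"
      using mi j chan_pre[OF assms(1)] pr by (simp add: sm.mirrors_def part_def)
    moreover have "cells (r2 j) RX = (%a. if j * ls * m <= a & a < j * ls * m + min (length (out (run j))) (ls * m)
       then (out (run j) ! (a - j * ls * m)) mod \<sigma> else XX j a)"
      using mi by (auto simp: sm.mirrors_def fun_eq_iff)
    ultimately have "chan (r2 j) = chan (ss j) @ part j & printed (r2 j) = [] & E.piece_ok (r2 j) j (ys j) q &
      cells (r2 j) RX = (%a. if j * ls * m <= a & a < j * ls * m + min (length (out (run j))) (ls * m)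
       then (out (run j) ! (a - j * ls * m)) mod \<sigma> else XX j a)" by blast
  }
  note 1 = this
  have 2: "chan (r2 j) = chan (ss j) @ part j & printed (r2 j) = [] & (has_post j --> E.piece_ok (r2 j) j (ys j) q)" if j: "\<not> j < b"
  proof (cases "has_post j")
    case False
    then have "r2 j = sem f w 7 (talk q) eh (r1 j)" using links[OF assms(1)] j unfolding link_def has_post_def by simp
    then show ?thesis using E.sem_talk[OF zero_pre(1)[OF assms(1)], of q] chan_pre[OF assms(1)] pr j False
      unfolding part_def has_post_def by simp
  next
    case True
    then have "r2 j = sem f w 7 (listen q j) eh (r1 j)" using links[OF assms(1)] j unfolding link_def has_post_def by simp
    note S = E.sem_listen[OF zero_pre(2)[OF assms(1)] RF0, of q, folded this]
    have "E.piece_ok (r2 j) j (ys j) q" using S(1) len dq j by (auto simp: E.piece_ok_def ys_def)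
    then show ?thesis using S chan_pre[OF assms(1)] pr j True unfolding part_def has_post_def by simp
  qed
  show "chan (r2 j) = chan (ss j) @ part j" "printed (r2 j) = []" using 1 2 by (cases "j < b"; simp)+
  show "has_post j ==> E.piece_ok (r2 j) j (ys j) q" using 1 2 by (cases "j < b") simp_all
  show "j < b ==> cells (r2 j) RX = (%a. if j * ls * m <= a & a < j * ls * m + min (length (out (run j))) (ls * m)
       then (out (run j) ! (a - j * ls * m)) mod \<sigma> else XX j a)" using 1 by simp
qed

lemma post_spec:
  assumes "j < 2 * b" "okay j" "has_post j"
  shows "\<forall>k<C. \<forall>d<l. E.good (ys j) q k d --> (\<exists>i<\<Lambda>. cells (ss (Suc j)) RL ((j * C + k) * \<Lambda> + i) = d)"
    and "\<forall>z. z < j * C * \<Lambda> \<or> (j * C + C) * \<Lambda> <= z --> cells (ss (Suc j)) RL z = cells (ss j) RL z"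
    and "\<forall>z. cells (ss (Suc j)) RL z < l"
    and "cells (ss (Suc j)) RP = (%z. if j < b & M * M + j * (\<Lambda> ^ 4 * (M * M)) <= z & z < M * M + j * (\<Lambda> ^ 4 * (M * M)) + \<Lambda> ^ 4 * (M * M)
      then min (l ^ 4) (E.position (cells (ss (Suc j)) RL) j (z - (M * M + j * (\<Lambda> ^ 4 * (M * M))))) else PP j z)"
proof -
  obtain kk where kk: "l = p ^ kk" by (rule lp)
  have t: "E.table_ok (r2 j)" using assms table_pre table_mid by (simp add: okay_def)
  have eq: "sem f w 7 (post j) eh (r2 j) = ss (Suc j)" using post_eq[OF assms(1)] assms(3) by simp
  have RLe: "cells (r2 j) RL = cells (ss j) RL"
    using frame_mid[OF assms(1), of RL] frame_pre[OF assms(1), of RL] by (simp add: RS_def RF_def)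
  have RPe: "cells (r2 j) RP = PP j" using frame_mid[OF assms(1), of RP] by (simp add: RS_def RF_def)
  note S = E.sem_post[OF t mid_spec(5)[OF assms] kk hl, unfolded eq RLe RPe]
  show "\<forall>k<C. \<forall>d<l. E.good (ys j) q k d --> (\<exists>i<\<Lambda>. cells (ss (Suc j)) RL ((j * C + k) * \<Lambda> + i) = d)"
    and "\<forall>z. z < j * C * \<Lambda> \<or> (j * C + C) * \<Lambda> <= z --> cells (ss (Suc j)) RL z = cells (ss j) RL z"
    and "cells (ss (Suc j)) RP = (%z. if j < b & M * M + j * (\<Lambda> ^ 4 * (M * M)) <= z & z < M * M + j * (\<Lambda> ^ 4 * (M * M)) + \<Lambda> ^ 4 * (M * M)
      then min (l ^ 4) (E.position (cells (ss (Suc j)) RL) j (z - (M * M + j * (\<Lambda> ^ 4 * (M * M))))) else PP j z)"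
    by (fact S)+
  show "\<forall>z. cells (ss (Suc j)) RL z < l" using S(3) assms(2) by (simp add: okay_def)
qed

lemma no_post:
  assumes "j < 2 * b" "\<not> has_post j"
  shows "cells (ss (Suc j)) RL = cells (ss j) RL" "cells (ss (Suc j)) RP = PP j"
  using post_eq[OF assms(1)] assms(2) frame_mid[OF assms(1), of RL] frame_pre[OF assms(1), of RL] frame_mid[OF assms(1), of RP]
  by (simp_all add: RS_def RF_def)

lemma position_less: "\<forall>z. L z < l ==> E.position L i z < l ^ 4"
  unfolding E.position_def by (rule digit_sum[THEN conjunct1]) simp

lemma okay_Suc:
  assumes "j < 2 * b" "okay j"
  shows "okay (Suc j)"
proof -
  have fr: "cells (ss (Suc j)) r = cells (ss j) r"
    if "r \<notin> {VA, RX, RP, RB, RG, RW, VS, VR, VO, VH, VC, VL, RL, RS j, RF j}" for r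
    using frame_post[OF assms(1), of r] frame_mid[OF assms(1), of r] frame_pre[OF assms(1), of r] that by simp
  have t: "E.table_ok (ss (Suc j))" "\<forall>a. cells (ss (Suc j)) RC a = 0"
    using fr[of RH] fr[of RC] assms(2) by (simp_all add: okay_def E.table_ok_def RS_def RF_def)
  have p: "printed (ss (Suc j)) = []" using chan_post[OF assms(1)] mid_spec(2)[OF assms] by simp
  have c: "length (chan (ss (Suc j))) = cl (Suc j)"
    using chan_post[OF assms(1)] mid_spec(1,3,4)[OF assms] assms(2) by (simp add: okay_def)
  have W: "\<forall>x. cells (ss (Suc j)) RW x < Q"
    using frame_post[OF assms(1), of RW] frame_mid[OF assms(1), of RW] pre_spec(7)[OF assms] by (simp add: RS_def RF_def)
  have L: "\<forall>z. cells (ss (Suc j)) RL z < l"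
    using post_spec(3)[OF assms] no_post(1)[OF assms(1)] assms(2) by (cases "has_post j") (simp_all add: okay_def)
  have P: "\<forall>z. cells (ss (Suc j)) RP z < l ^ 4"
    using post_spec(4)[OF assms] no_post(2)[OF assms(1)] pre_spec(8)[OF assms] position_less[OF L]
    by (cases "has_post j") (simp_all add: min_less_iff_disj)
  have X: "\<forall>a. cells (ss (Suc j)) RX a < \<sigma>"
    using frame_post[OF assms(1), of RX] mid_spec(6)[OF assms] RX_mid[of j] pre_spec(3)[OF assms] assms(1) \<sigma>0
    by (cases "j < b") simp_all
  have F: "\<forall>i\<ge>Suc j. i < 2 * b --> cells (ss (Suc j)) (RF i) = (%_. 0)"
    using fr assms by (auto simp: okay_def RF_def RS_def)
  show ?thesis unfolding okay_def using t p c W L P X F by blast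
qed

lemma okay: "j <= 2 * b ==> okay j"
  by (induction j) (auto intro: okay_0 okay_Suc)

lemmas okay' = okay[OF less_imp_le]

text \<open>Evaluating piece \<open>j\<close> writes only the block of \<open>RL\<close> that
  belongs to \<open>j\<close>. Hence the lists at the end can stand for those of any earlier
  time.\<close>

lemma lists_stable:
  assumes "i < j" "j <= 2 * b" "i * C * \<Lambda> <= z" "z < (i * C + C) * \<Lambda>"
  shows "cells (ss j) RL z = cells (ss (Suc i)) RL z"
  using assms(1,2)
proof (induction j)
  case (Suc j)
  show ?case
  proof (cases "i = j")
    case False
    then have ij: "i < j" "j < 2 * b" using Suc.prems by auto
    have "(i * C + C) <= j * C" using ij(1) by (metis Suc_leI mult_Suc add.commute mult_le_mono1)
    then have "(i * C + C) * \<Lambda> <= j * C * \<Lambda>" by (rule mult_le_mono1)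
    then have "z < j * C * \<Lambda>" using assms(4) by linarith
    then have "cells (ss (Suc j)) RL z = cells (ss j) RL z"
      using post_spec(2)[OF ij(2) okay'[OF ij(2)]] no_post(1)[OF ij(2)] by (cases "has_post j") auto
    then show ?thesis using Suc.IH ij by simp
  qed simp
qed simp

lemma listed:
  assumes "i < 2 * b" "has_post i" "k < C" "d < l" "E.good (ys i) q k d"
  shows "\<exists>j<\<Lambda>. cells (ss (2 * b)) RL ((i * C + k) * \<Lambda> + j) = d"
proof -
  obtain j where j: "j < \<Lambda>" "cells (ss (Suc i)) RL ((i * C + k) * \<Lambda> + j) = d"
    using post_spec(1)[OF assms(1) okay'[OF assms(1)] assms(2)] assms(3-5) by blast
  have "Suc (i * C + k) * \<Lambda> <= (i * C + C) * \<Lambda>" using assms(3) by (intro mult_le_mono1) simp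
  then have "(i * C + k) * \<Lambda> + j < (i * C + C) * \<Lambda>" using j(1) by simp
  moreover have "i * C * \<Lambda> <= (i * C + k) * \<Lambda> + j" by (simp add: add_mult_distrib)
  ultimately show ?thesis using lists_stable[of i "2 * b"] assms(1) j by auto
qed

lemma positions_stable:
  assumes "u < j" "j <= 2 * b" "u < b" "z < \<Lambda> ^ 4 * (M * M)"
  shows "cells (ss j) RP (M * M + u * (\<Lambda> ^ 4 * (M * M)) + z) = min (l ^ 4) (E.position (cells (ss (2 * b)) RL) u z)"
  using assms(1,2)
proof (induction j)
  case (Suc j)
  have j: "j < 2 * b" using Suc.prems by simp
  let ?a = "M * M + u * (\<Lambda> ^ 4 * (M * M)) + z"
  show ?case
  proof (cases "u = j")
    case True
    have hp: "has_post j" using True assms(3) by (simp add: has_post_def)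
    have "cells (ss (Suc j)) RP ?a = min (l ^ 4) (E.position (cells (ss (Suc u)) RL) u z)"
      using post_spec(4)[OF j okay'[OF j] hp] True assms(3,4) by simp
    also have "E.position (cells (ss (Suc u)) RL) u z = E.position (cells (ss (2 * b)) RL) u z"
      unfolding E.position_def
    proof (intro sum.cong refl arg_cong2[of _ _ _ _ times])
      fix i :: nat assume i: "i \<in> {..<4}"
      let ?x = "z div (M * M) div \<Lambda> ^ i mod \<Lambda>" and ?k = "4 * (z mod (M * M)) + i"
      have "0 < M * M" using assms(4) by (cases "M * M") auto
      then have "z mod (M * M) < M * M" by simp
      then have kC: "?k < C" using i by (simp add: C_def nf_def np_def)
      have x: "?x < \<Lambda>" using \<Lambda>0 by simp
      have "Suc (u * C + ?k) * \<Lambda> <= (u * C + C) * \<Lambda>" using kC by (intro mult_le_mono1) simp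
      then have 1: "(u * C + ?k) * \<Lambda> + ?x < (u * C + C) * \<Lambda>" using x by (simp add: algebra_simps)
      have 2: "u * C * \<Lambda> <= (u * C + ?k) * \<Lambda> + ?x" by (simp add: add_mult_distrib)
      show "cells (ss (Suc u)) RL ((u * C + ?k) * \<Lambda> + ?x) = cells (ss (2 * b)) RL ((u * C + ?k) * \<Lambda> + ?x)"
        by (rule lists_stable[symmetric, OF _ order_refl 2 1]) (use assms(3) in simp)
    qed
    finally show ?thesis .
  next
    case False
    then have uj: "u < j" using Suc.prems by simp
    have "Suc u * (\<Lambda> ^ 4 * (M * M)) <= j * (\<Lambda> ^ 4 * (M * M))" using uj by (intro mult_le_mono1) simp
    then have lt: "?a < M * M + j * (\<Lambda> ^ 4 * (M * M))" using assms(4) by simp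
    have "cells (ss (Suc j)) RP ?a = PP j ?a"
      using post_spec(4)[OF j okay'[OF j]] no_post(2)[OF j] lt by (cases "has_post j") auto
    also have "\<dots> = cells (ss j) RP ?a" using pre_spec(4)[OF j okay'[OF j]] by simp
    finally show ?thesis using Suc.IH uj j by simp
  qed
qed simp

lemma positions_of_run:
  assumes "u < j" "j < 2 * b" "u < b" "z < \<Lambda> ^ 4 * (M * M)"
  shows "PP j (M * M + u * (\<Lambda> ^ 4 * (M * M)) + z) = min (l ^ 4) (E.position (cells (ss (2 * b)) RL) u z)"
  using positions_stable[OF assms(1) less_imp_le[OF assms(2)] assms(3,4)] pre_spec(4)[OF assms(2) okay'[OF assms(2)]] by simp

lemma saved:
  assumes "u < j" "j <= 2 * b" "u < b" "z < M * M"
  shows "cells (ss j) RB (u * (M * M) + z) = PP u z"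
  using assms(1,2)
proof (induction j)
  case (Suc j)
  then have j: "j < 2 * b" by simp
  have e: "cells (ss (Suc j)) RB = cells (r1 j) RB"
    using frame_post[OF j, of RB] frame_mid[OF j, of RB] by (simp add: RS_def RF_def)
  show ?case
  proof (cases "u = j")
    case True
    then show ?thesis using e pre_spec(5)[OF j okay'[OF j]] assms by simp
  next
    case False
    then have uj: "u < j" using Suc.prems by simp
    have "Suc u * (M * M) <= j * (M * M)" using uj by (intro mult_le_mono1) simp
    then have "u * (M * M) + z < j * (M * M)" using assms(4) by simp
    then show ?thesis using e pre_spec(5)[OF j okay'[OF j]] Suc.IH uj j by simp
  qed
qed simp

lemma slot_step:
  assumes "Suc j < 2 * b" "k < M" "k < j * ls"
  shows "slot (XX (Suc j)) m k = slot (XX j) m k"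
proof -
  have j: "j < 2 * b" using assms(1) by simp
  have "slot (cells (ss (Suc j)) RX) m k = slot (XX j) m k"
  proof (cases "j < b")
    case True
    have "k * m + i < j * ls * m" if "i < m" for i
    proof -
      have "Suc k * m <= j * ls * m" using assms(3) by (intro mult_le_mono1) simp
      then show ?thesis using that by simp
    qed
    then have "slot (cells (r2 j) RX) m k = slot (XX j) m k"
      using mid_spec(6)[OF j okay'[OF j] True] by (intro slot_cong) (simp add: not_le[symmetric])
    then show ?thesis using frame_post[OF j, of RX] by simp
  next
    case False
    then show ?thesis using frame_post[OF j, of RX] RX_mid[of j] j by simp
  qed
  then show ?thesis using pre_spec(2)[OF assms(1) okay'[OF assms(1)] assms(2)] pre_spec(1)[OF j okay'[OF j] assms(2)] by simp
qed

text \<open>Slots below \<open>i * ls\<close> belong to runs before \<open>i\<close>; they are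
  repaired when piece \<open>i\<close> is prepared, later outputs go to other slots, and repairing a
  consistent candidate again does not change it.\<close>

lemma slots_stable:
  assumes "i <= j" "j < 2 * b" "k < M" "k < i * ls"
  shows "slot (XX j) m k = slot (XX i) m k"
  using assms(1,2)
proof (induction j)
  case (Suc j)
  show ?case
  proof (cases "i = Suc j")
    case False
    then have ij: "i <= j" using Suc.prems by simp
    then have "i * ls <= j * ls" by (rule mult_le_mono1)
    then have "k < j * ls" using assms(4) by linarith
    then show ?thesis using slot_step[of j k] Suc ij assms(3) by simp
  qed simp
qed simp

text \<open>Entry \<open>x\<close> of the list of run \<open>u\<close> lands in slot
  \<open>u * ls + x\<close>. A proper list is neither truncated nor changed by the reduction modulo
  \<sigma>, and consistency protects the entry from repairs.\<close>

lemma found: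
  assumes u: "u < b" "u < j" "j < 2 * b"
    and ts: "out (run u) = concat ts" "length ts <= ls" "set ts \<subseteq> transcripts \<sigma> m" "t \<in> set ts" and t: "consistent fn t"
  shows "\<exists>k<Suc u * ls. slot (XX j) m k = t"
proof -
  have u2: "u < 2 * b" "Suc u < 2 * b" using u by auto
  obtain x where x: "x < length ts" "t = ts ! x" using ts(4) by (auto simp: in_set_conv_nth)
  have lens: "\<forall>t\<in>set ts. length t = m" using ts(3) by (auto simp: transcripts_def)
  note C = concat_equal_lengths[OF lens x(1)]
  have lt: "length t = m" using lens ts(4) by simp
  let ?k = "u * ls + x"
  have len: "length (concat ts) <= ls * m"
  proof -
    have "length (concat ts) = length ts * m"
      using lens by (induction ts) (auto simp: algebra_simps)
    then show ?thesis using ts(2) by simp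
  qed
  have k: "?k < Suc u * ls" using x(1) ts(2) by simp
  then have kM: "?k < M" unfolding M_def using u(1) by (meson Suc_leI less_le_trans mult_le_mono1)
  have "slot (cells (r2 u) RX) m ?k = t"
  proof (rule nth_equalityI)
    fix i assume "i < length (slot (cells (r2 u) RX) m ?k)"
    then have i: "i < m" by simp
    have a: "?k * m + i = u * ls * m + (x * m + i)" by (simp add: algebra_simps)
    have xi: "x * m + i < length (concat ts)" using C(2) i by simp
    have ti: "concat ts ! (x * m + i) = t ! i"
      using arg_cong[OF C(1), of "%t. t ! i"] i x(2) C(2) by simp
    have "set t \<subseteq> {..<\<sigma>}" using ts(3,4) by (auto simp: transcripts_def)
    then have "t ! i < \<sigma>" using nth_mem[of i t] i lt by blast
    then have "cells (r2 u) RX (?k * m + i) = t ! i"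
      unfolding mid_spec(6)[OF u2(1) okay'[OF u2(1)] u(1)] a using xi len ti ts(1) by simp
    then show "slot (cells (r2 u) RX) m ?k ! i = t ! i" using i by (simp add: slot_nth)
  qed (simp add: lt)
  then have "slot (cells (ss (Suc u)) RX) m ?k = t" using frame_post[OF u2(1), of RX] by simp
  then have "slot (XX (Suc u)) m ?k = t" using pre_spec(2)[OF u2(2) okay'[OF u2(2)] kM] t by simp
  then have "slot (XX j) m ?k = t" using slots_stable[of "Suc u" j ?k] u kM k by simp
  then show ?thesis using k by blast
qed

lemma chan_stable:
  assumes "i < j" "j <= 2 * b" "r < length (part i)"
  shows "chan (ss j) ! (cl i + r) = part i ! r"
  using assms(1,2)
proof (induction j)
  case (Suc j)
  have j: "j < 2 * b" using Suc.prems by simp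
  have len: "length (chan (ss i)) = cl i" if "i <= 2 * b" for i using okay[OF that] by (simp add: okay_def)
  have ch: "chan (ss (Suc j)) = chan (ss j) @ part j" using chan_post[OF j] mid_spec(1)[OF j okay'[OF j]] by simp
  show ?case
  proof (cases "i = j")
    case True
    then show ?thesis using ch len[of j] j by (simp add: nth_append)
  next
    case False
    then have ij: "i < j" using Suc.prems by simp
    have mono: "cl (Suc i) <= cl j" using ij by (intro cl_mono) simp
    have "i < 2 * b" using ij j by simp
    then have "cl i + r < cl (Suc i)" using assms(3) mid_spec(3,4)[of i] okay' by auto
    then have "cl i + r < length (chan (ss j))" using mono len[of j] j by simp
    then show ?thesis using ch Suc.IH ij j by (simp add: nth_append)
  qed
qed simp

end

section \<open>Executions of the new programs\<close>

lemma polynomially_compose: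
  assumes "polynomially f" "polynomially g"
  shows "polynomially (%Z. f (g Z))"
proof -
  obtain c d where c: "\<And>Z. f Z <= (Z + 2) ^ c" and d: "\<And>Z. g Z <= (Z + 2) ^ d"
    using assms by (auto simp: polynomially_def)
  have "f (g Z) <= (Z + 2) ^ ((d + 2) * c)" for Z
  proof -
    have "(2::nat) ^ 1 <= (Z + 2) ^ Suc d" by (rule order_trans[OF power_mono power_increasing]) auto
    moreover have "(Z + 2) ^ d <= (Z + 2) ^ Suc d" by (rule power_increasing) auto
    moreover have "2 * (Z + 2) ^ Suc d <= (Z + 2) * (Z + 2) ^ Suc d" by (rule mult_le_mono1) simp
    ultimately have "g Z + 2 <= (Z + 2) ^ (d + 2)" using d[of Z] by simp
    then have "(g Z + 2) ^ c <= ((Z + 2) ^ (d + 2)) ^ c" by (rule power_mono) simp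
    then show ?thesis using c[of "g Z"] unfolding power_mult by linarith
  qed
  then show ?thesis unfolding polynomially_def by blast
qed

lemma polynomially_power: "polynomially f ==> polynomially (%Z. f Z ^ k)"
  by (induction k) (auto intro: polynomially_intros)

lemma polynomially_sum_list: "(\<And>x. x \<in> set xs ==> polynomially (F x)) ==> polynomially (%Z. sum_list (map (%x. F x Z) xs))"
  by (induction xs) (auto intro: polynomially_intros)

context coder
begin

definition depth_bound :: "bool => nat => program => item list => nat" where
  "depth_bound al q P xs = 29 + sum_list (map (%x. case x of Run c => depth c | Set j x => depth_expr x
     | Sim i => sum_list (map (%I. depth (simulation.trans al q Q ls \<sigma> i (RF i) (RS i) I)) P)) xs)"

text \<open>Registers 1, 2, 3 and 5 receive the padded length \<open>max n n0\<close>, the layout constants of the store and the bound for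
  \<open>find_length\<close>; cell 12 is scratch.\<close>

definition prologue :: "nat => instr list" where
  "prologue n0 = [Lit 12 n0, Sub 1 0 12, Add 1 1 12, Add 2 1 1, Lit 12 (2 * NR - 1), Mul 3 12 2, Lit 12 p, Mul 5 12 1]"

text \<open>The constant of the theorem is fixed before the scheme. Therefore the weights are summed
  for both parties, and 0 takes the place of the alphabet size in \<open>talk\<close> and
  \<open>listen\<close>, whose weights do not depend on it.\<close>

definition eff :: nat where
  "eff = weight find_length + weight table + weight answer + (len_expr (Var VE) + len_expr (pow_expr 4) + 4)
     + (\<Sum>i<b. weight (pre True i) + weight (pre False i) + weight (post i) + 300 + (len_expr (Var VH) + 4))
     + (\<Sum>i<b. weight (pre True (b + i)) + weight (pre False (b + i)) + weight (talk 0) + weight (listen 0 (b + i)) + weight (post (b + i)))"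

text \<open>The result of the program \<open>find_length\<close> is a witness, whatever oracle and
  channel are supplied.\<close>

lemma fits_exists:
  assumes "0 < m"
  shows "\<exists>l. fits m l"
proof -
  define st :: store where "st = \<lparr>cells = %_ _. 0, chan = [], printed = []\<rparr>"
  let ?e = "envr 0 m 0 (p * m) 0"
  have "fits m (cells (sem (%_. 0) (%_. 0) 7 find_length ?e st) VE 0)"
    unfolding fits_def using sem_find_length[of ?e m "%_. 0" "%_. 0" st] assms by simp
  then show ?thesis by blast
qed

text \<open>Makes the code table and the exhaustive list decoding, both quadratic in
  \<open>l\<close>, linear in \<open>m\<close>.\<close>

lemma fits_square:
  assumes "fits m l" "0 < m"
  shows "l * l <= p ^ 2 * m"
proof -
  have "(l * l) ^ 2 = l ^ 4" by (simp add: power2_eq_square power4_eq_xxxx mult.assoc)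
  also have "\<dots> <= p ^ 4 * m" using assms by (simp add: fits_def)
  also have "\<dots> <= p ^ 4 * (m * m)" using assms(2) by simp
  also have "\<dots> = (p ^ 2 * m) ^ 2" by (simp add: power2_eq_square power4_eq_xxxx algebra_simps)
  finally show ?thesis by (rule power2_le_imp_le) simp
qed

end

context builder
begin

lemma items_ok:
  assumes D: "depth_bound al q P all_items <= D"
  shows "list_all item_ok all_items"
proof -
  let ?d = "%x. case x of Run c => depth c | Set j x => depth_expr x
     | Sim i => sum_list (map (%I. depth (tr i I)) P)"
  have d: "29 + ?d x <= D" if "x \<in> set all_items" for x
  proof -
    have "?d x <= sum_list (map ?d all_items)" using that by (intro member_le_sum_list) auto
    then show ?thesis using D by (simp add: depth_bound_def)
  qed
  have run: "item_ok (Run c)" if "Run c \<in> set all_items" "wfc NR 7 c" "tame \<kappa> c" for c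
    using d[OF that(1)] that(2,3) by (simp add: item_ok_def)
  have set: "item_ok (Set j x)" if "Set j x \<in> set all_items" "3 < j" "j < 7" "wfe NR 7 x" for j x
    using d[OF that(1)] that(2-) by (simp add: item_ok_def)
  have sim: "item_ok (Sim i)" if "Sim i \<in> set all_items" "i < b" for i
  proof -
    have "depth (tr i I) <= sum_list (map (%I. depth (tr i I)) P)" if "I \<in> set P" for I
      using that by (intro member_le_sum_list) auto
    then show ?thesis using d[OF that(1)] that(2) by (force simp: item_ok_def)
  qed
  have "item_ok x" if x: "x \<in> set all_items" for x
  proof -
    have N: "VE < NR" "VH < NR" by (simp_all add: NR_def)
    consider "x \<in> set init_items" | i where "i < b" "x \<in> set (run_items i)" | i where "i < 2 * b" "x \<in> set (end_items i)" | "x = Run answer"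
      using x by (auto simp: all_items_def split: if_splits)
    then show ?thesis
    proof cases
      case 1
      then show ?thesis using x N by (auto simp: init_items_def intro!: run set wfc_coms tame_coms)
    next
      case 2
      then show ?thesis using x N by (auto simp: run_items_def intro!: run set sim wfc_coms tame_coms)
    next
      case 3
      have "x \<in> {Run (pre al i), Run (talk q), Run (listen q i), Run (post i)}"
        using 3(2) unfolding end_items_def by (cases al) auto
      then show ?thesis using x 3(1) by (auto intro!: run wfc_coms tame_coms)
    next
      case 4
      then show ?thesis using x by (auto intro!: run wfc_coms tame_coms)
    qed
  qed
  then show ?thesis by (simp add: list_all_iff)
qed

lemma polynomially_item_peak: "polynomially (%Z. item_peak Z x)"
proof (cases x)
  case (Sim i)
  have "polynomially (%Z. case I of Jz a l => peak D (Cell (RS i) (Const a)) Z | _ => 0)" for I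
    by (cases I) (simp_all add: polynomially_const polynomially_peak del: peak.simps)
  then show ?thesis unfolding item_peak_def Sim
    by (simp del: peak.simps) (intro polynomially_sum_list polynomially_add polynomially_peak_com)
qed (simp_all add: item_peak_def polynomially_peak polynomially_peak_com)

end

context party_run
begin

lemma prologue_run:
  assumes m: "m = n - n0 + n0" and B: "V0 <= B"
  defines "cf == run f w (prologue n0) (initial n)"
  shows "represents D NR 7 (envr n m 0 (p * m) 0) st0 cf" "pc cf = 8" "run_below f w B (prologue n0) (initial n)"
proof -
  have pm: "p * m <= V0"
  proof -
    have "p ^ 1 <= p ^ 4" using p1 by (intro power_increasing) auto
    then have "p * m <= p ^ 4 * m" by (intro mult_le_mono1) simp
    then show ?thesis using V0(7) by linarith
  qed
  have NR1: "1 <= 2 * NR - 1" by (simp add: NR_def)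
  have le: "n <= B" "n0 <= B" "m <= B" "2 * m <= B" "(2 * NR - 1) * (2 * m) <= B" "p * m <= B" "p <= B" "2 * NR - 1 <= B"
  proof -
    show 1: "(2 * NR - 1) * (2 * m) <= B" using V0(8) B by linarith
    have "1 * (2 * m) <= (2 * NR - 1) * (2 * m)" using NR1 by (rule mult_le_mono1)
    then show 2: "2 * m <= B" using 1 by linarith
    show pB: "p * m <= B" using pm B by linarith
    have "p * 1 <= p * m" using nm by (intro mult_le_mono2) simp
    then show "p <= B" using pB by linarith
    have "(2 * NR - 1) * 1 <= (2 * NR - 1) * (2 * m)" using nm by (intro mult_le_mono2) simp
    then show "2 * NR - 1 <= B" using 1 by linarith
    show "n <= B" "n0 <= B" "m <= B" using 2 nm m by linarith+
  qed
  have mem: "mem cf = (%a. if a < 7 then envr n m 0 (p * m) 0 a else if a = 12 then p else 0)"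
    unfolding cf_def prologue_def using m
    by (auto simp: assign_def initial_def fun_eq_iff envr_def)
  have co: "comm cf = []" "out cf = []" unfolding cf_def prologue_def by (simp_all add: assign_def initial_def)
  show "pc cf = 8" unfolding cf_def prologue_def by (simp add: assign_def initial_def)
  have z: "mem cf (loc D NR m k a) = 0" for k a
  proof -
    have "17 <= loc D NR m k a" using loc_ge[of D NR m k a] D0 by linarith
    then show ?thesis by (simp add: mem)
  qed
  show "represents D NR 7 (envr n m 0 (p * m) 0) st0 cf"
  proof -
    have "\<forall>j<7. mem cf j = envr n m 0 (p * m) 0 j" by (simp add: mem)
    then show ?thesis using nm z co by (simp add: represents_def regs_ok_def holds_regs_def holds_cells_def st0_def)
  qed
  show "run_below f w B (prologue n0) (initial n)"
  proof -
    have "(2 * NR - 1) * (m + m) <= B" "m + m <= B" "n - n0 <= B" using le by (simp_all only: mult_2[of m])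
    then show ?thesis unfolding prologue_def using le by (auto simp: below_def assign_def initial_def m[symmetric])
  qed
qed

lemma execution:
  assumes m: "m = n - n0 + n0" and D: "depth_bound al q P all_items <= D" and b0: "0 < b"
    and B: "V0 + t_all <= Zm" "\<forall>x\<in>set all_items. item_peak Zm x <= B" "Zm <= B"
  defines "pr == prologue n0 @ items_code 8 all_items"
  shows "\<exists>u cf' e s. u <= 8 + t_all & reaches pr f w B (initial n) u cf' & pc cf' = length pr &
    comm cf' = chan s & out cf' = printed s & Done e s"
proof -
  define cf where "cf = run f w (prologue n0) (initial n)"
  have V0B: "V0 <= B" using B by linarith
  note R = prologue_run[OF m V0B, folded cf_def]
  note ok = items_ok[OF D]
  have len: "length (prologue n0) = 8" by (simp add: prologue_def)
  have at0: "code_at pr (pc (initial n)) (prologue n0)"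
    using code_at_self[of "[]" "prologue n0" "items_code 8 all_items"] by (simp add: pr_def initial_def)
  have at1: "code_at pr (pc cf) (items_code (pc cf) all_items)"
    using code_at_self[of "prologue n0" "items_code 8 all_items" "[]"] R(2) len by (simp add: pr_def)
  have r1: "reaches pr f w B (initial n) 8 cf"
    using reaches_run[OF at0 _ R(3)] unfolding cf_def len by (simp add: prologue_def)
  have pm: "p * m <= V0"
  proof -
    have "p ^ 1 <= p ^ 4" using p1 by (intro power_increasing) auto
    then have "p * m <= p ^ 4 * m" by (intro mult_le_mono1) simp
    then show ?thesis using V0(7) by linarith
  qed
  have "1 * (2 * m) <= (2 * NR - 1) * (2 * m)" by (rule mult_le_mono1) (simp add: NR_def)
  then have "n <= V0" "m <= V0" "2 * m <= V0" using V0(8) nm by linarith+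
  then have v: "values_le V0 7 (envr n m 0 (p * m) 0) st0"
    using pm V0(8) by (auto simp: values_le_def st0_def envr_def)
  have bl: "below B cf" using r1 by (auto simp: reaches_def)
  obtain u cf' e s where u: "u <= t_all" "reaches pr f w B cf u cf'" "pc cf' = pc cf + items_len all_items"
    "represents D NR 7 e s cf'" "Done e s"
    using does_all[OF b0, unfolded does_def, rule_format, OF ok _ B(1,3) v at1 R(1) bl] B(2) by blast
  have "reaches pr f w B (initial n) (8 + u) cf'" by (rule reaches_trans[OF r1 u(2)])
  moreover have "pc cf' = length pr" using u(3) R(2) len length_items_code[OF ok] by (simp add: pr_def)
  ultimately show ?thesis using u by (intro exI[of _ "8 + u"] exI[of _ cf'] exI[of _ e] exI[of _ s]) (auto simp: represents_def)
qed

lemma t_all_le: "t_all <= eff * (W + Tm + 1)"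
proof -
  define U where "U = W + Tm + 1"
  have wq: "weight (talk q) = weight (talk 0)" "weight (listen q i) = weight (listen 0 i)" for i
    by (simp_all add: talk_def listen_def)
  have pr: "weight (pre al i) <= weight (pre True i) + weight (pre False i)" for i by (cases al) auto
  have A: "x * W <= x * U" "x * Tm <= x * U" "x <= x * U" for x by (simp_all add: U_def algebra_simps)
  have init: "t_init <= (weight find_length + weight table + (len_expr (Var VE) + len_expr (pow_expr 4) + 4)) * U"
    unfolding t_init_def add_mult_distrib using A(1)[of "weight find_length"] A(1)[of "weight table"]
      A(3)[of "len_expr (Var VE)"] A(3)[of "len_expr (pow_expr 4)"] A(3)[of 4] by linarith
  have run: "t_run i <= (weight (pre True i) + weight (pre False i) + weight (post i) + 300 + (len_expr (Var VH) + 4)) * U" for i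
    unfolding t_run_def add_mult_distrib using mult_le_mono1[OF pr[of i], of W] A(1)[of "weight (pre True i)"] A(1)[of "weight (pre False i)"]
      A(1)[of "weight (post i)"] A(2)[of 300] A(3)[of "len_expr (Var VH)"] A(3)[of 4] unfolding add_mult_distrib by linarith
  have en: "t_end i <= (weight (pre True i) + weight (pre False i) + weight (talk 0) + weight (listen 0 i) + weight (post i)) * U" for i
    unfolding t_end_def wq add_mult_distrib using mult_le_mono1[OF pr[of i], of W] A(1)[of "weight (pre True i)"] A(1)[of "weight (pre False i)"]
      A(1)[of "weight (talk 0)"] A(1)[of "weight (listen 0 i)"] A(1)[of "weight (post i)"] unfolding add_mult_distrib by linarith
  have "(\<Sum>i<b. t_run i) <= (\<Sum>i<b. weight (pre True i) + weight (pre False i) + weight (post i) + 300 + (len_expr (Var VH) + 4)) * U"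
    unfolding sum_distrib_right by (intro sum_mono run)
  moreover have "(\<Sum>i<b. t_end (b + i)) <= (\<Sum>i<b. weight (pre True (b + i)) + weight (pre False (b + i)) + weight (talk 0)
      + weight (listen 0 (b + i)) + weight (post (b + i))) * U"
    unfolding sum_distrib_right by (intro sum_mono en)
  ultimately show ?thesis
    unfolding t_all_def eff_def U_def[symmetric] using init A(1)[of "weight answer"] unfolding add_mult_distrib by linarith
qed

end

context party_history
begin

lemma pieces_final:
  assumes "i < 2 * b" "has_post i"
  shows "E.piece_ok (ss (2 * b)) i (ys i) q"
proof -
  have "cells (ss j) (RF i) = cells (r2 i) (RF i)" if "i < j" "j <= 2 * b" for j
    using that
  proof (induction j)
    case (Suc j)
    then have j: "j < 2 * b" by simp
    have 1: "cells (ss (Suc j)) (RF i) = cells (r2 j) (RF i)" using frame_post[OF j, of "RF i"] by (simp add: RF_def)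
    show ?case
    proof (cases "i = j")
      case False
      then have "cells (r2 j) (RF i) = cells (ss j) (RF i)"
        using frame_mid[OF j, of "RF i"] frame_pre[OF j, of "RF i"] assms(1) by (simp add: RF_def RS_def)
      then show ?thesis using 1 Suc False by simp
    qed (use 1 in simp)
  qed simp
  then have "cells (ss (2 * b)) (RF i) = cells (r2 i) (RF i)" using assms(1) by simp
  then show ?thesis using mid_spec(5)[OF assms(1) okay'[OF assms(1)] assms(2)] E.piece_ok_cong by blast
qed

lemma final_store:
  shows "cells (ss (2 * b)) RX = XX (2 * b - 1)"
    and "z < M * M ==> cells (ss (2 * b)) RP z = first_diff m (slot (cells (ss (2 * b)) RX) m (z div M)) (slot (cells (ss (2 * b)) RX) m (z mod M))"
    and "E.table_ok (ss (2 * b))" "\<forall>a. cells (ss (2 * b)) RC a = 0" "\<forall>z. cells (ss (2 * b)) RL z < l" "printed (ss (2 * b)) = []"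
    and "length (chan (ss (2 * b))) = cl (2 * b)"
proof -
  let ?j = "2 * b - 1"
  have j: "?j < 2 * b" "Suc ?j = 2 * b" "b <= ?j" using b0 by linarith+
  show X: "cells (ss (2 * b)) RX = XX ?j" using frame_post[OF j(1), of RX] RX_mid[OF j(3,1)] j(2) by simp
  show "cells (ss (2 * b)) RP z = first_diff m (slot (cells (ss (2 * b)) RX) m (z div M)) (slot (cells (ss (2 * b)) RX) m (z mod M))"
    if z: "z < M * M"
  proof -
    have "cells (ss (Suc ?j)) RP z = PP ?j z"
      using post_spec(4)[OF j(1) okay'[OF j(1)]] no_post(2)[OF j(1)] j(3) by (cases "has_post ?j") auto
    then show ?thesis using pre_spec(4)[OF j(1) okay'[OF j(1)]] z X j(2) by simp
  qed
  show "E.table_ok (ss (2 * b))" "\<forall>a. cells (ss (2 * b)) RC a = 0" "\<forall>z. cells (ss (2 * b)) RL z < l" "printed (ss (2 * b)) = []"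
    "length (chan (ss (2 * b))) = cl (2 * b)"
    using okay[OF order_refl] by (simp_all add: okay_def)
qed

lemma answer_spec:
  assumes "\<not> al" "0 < M"
  shows "\<exists>R kb. (\<forall>i<2 * b. E.judged (ss (2 * b)) i (\<Lambda> ^ C) (ys i) q R) & kb < M &
    (\<forall>k<M. (\<Sum>i<2 * b. R (i * M + k)) <= (\<Sum>i<2 * b. R (i * M + kb))) &
    printed (sem f w 7 answer eh (ss (2 * b))) = take n (slot (XX (2 * b - 1)) m kb) &
    chan (sem f w 7 answer eh (ss (2 * b))) = chan (ss (2 * b))"
proof -
  let ?st = "ss (2 * b)"
  have ok: "E.piece_ok ?st i (ys i) q" if "i < 2 * b" for i
    by (rule pieces_final[OF that]) (use assms(1) in \<open>unfold has_post_def, simp\<close>)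
  have P: "\<forall>z<M * M. cells ?st RP z = first_diff m (slot (cells ?st RX) m (z div M)) (slot (cells ?st RX) m (z mod M))"
    by (intro allI impI) (rule final_store(2))
  show ?thesis
    using E.sem_answer[OF final_store(3) ok final_store(5) P final_store(4) assms(2)]
    unfolding final_store(1,6) envr_simps append_Nil .
qed

end

section \<open>The new scheme\<close>

lemma card_Suc_split: "card {k. k < Suc n & A k} = of_bool (A 0) + card {k. k < n & A (Suc k)}"
proof -
  have "{k. k < Suc n & A k} = (if A 0 then {0} else {}) \<union> Suc ` {k. k < n & A (Suc k)}"
    by (auto simp: image_iff less_Suc_eq_0_disj)
  moreover have "card (Suc ` {k. k < n & A (Suc k)}) = card {k. k < n & A (Suc k)}" by (simp add: card_image)
  moreover have "card ({0} \<union> Suc ` {k. k < n & A (Suc k)}) = card {0::nat} + card (Suc ` {k. k < n & A (Suc k)})"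
    by (rule card_Un_disjoint) auto
  ultimately show ?thesis by simp
qed

lemma card_blocks:
  fixes c :: "nat => nat"
  assumes "c 0 = 0" "\<And>j. c j <= c (Suc j)"
  shows "card {i. i < c k & G i} = (\<Sum>j<k. card {r. r < c (Suc j) - c j & G (c j + r)})"
proof (induction k)
  case (Suc k)
  let ?A = "{i. i < c k & G i}" and ?B = "{r. r < c (Suc k) - c k & G (c k + r)}"
  have "{i. i < c (Suc k) & G i} = ?A \<union> (+) (c k) ` ?B"
  proof (intro equalityI subsetI)
    fix i assume i: "i \<in> {i. i < c (Suc k) & G i}"
    show "i \<in> ?A \<union> (+) (c k) ` ?B"
    proof (cases "i < c k")
      case False
      then have "i = c k + (i - c k)" "i - c k < c (Suc k) - c k" using i by auto
      then show ?thesis using i by (metis (mono_tags, lifting) UnI2 image_eqI mem_Collect_eq)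
    qed (use i in simp)
  qed (use assms(2)[of k] in auto)
  moreover have "card (?A \<union> (+) (c k) ` ?B) = card ?A + card ((+) (c k) ` ?B)" by (rule card_Un_disjoint) auto
  moreover have "card ((+) (c k) ` ?B) = card ?B" by (simp add: card_image)
  ultimately show ?case using Suc by simp
qed (simp add: assms(1))

lemma block_exists:
  fixes c :: "nat => nat"
  assumes "c 0 = 0" "i < c k"
  shows "\<exists>j<k. \<exists>r<c (Suc j) - c j. i = c j + r"
  using assms(2)
proof (induction k)
  case (Suc k)
  show ?case
  proof (cases "i < c k")
    case True
    then show ?thesis using Suc.IH less_Suc_eq by blast
  next
    case False
    then show ?thesis using Suc.prems by (intro exI[of _ k] conjI exI[of _ "i - c k"]) auto
  qed
qed (simp add: assms(1))

lemma sent_Cons: "sent (x # xs) = (if x = None then 0 else 1) + sent xs"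
  by (simp add: sent_def)

lemma encode_nth: "r < length xs ==> encode q l W k xs ! r = map_option (%v. v + q * W ((k + sent (take r xs)) mod l)) (xs ! r)"
proof (induction xs arbitrary: k r)
  case (Cons x xs)
  then show ?case by (cases r) (auto simp: sent_Cons sent_def[of "[]"] split: option.splits)
qed simp

text \<open>Exactly one party transmits in each round, so the \<open>k\<close>-th symbol received on
  one side is the \<open>k\<close>-th sent on the other. If it arrives intact, then its quotient by
  \<open>q\<close> is the code symbol; hence wrong code symbols are at most as frequent as
  corruptions.\<close>

lemma transmission_errors:
  assumes "list_all2 (%x z. x = None \<longleftrightarrow> z ~= None) xs zs" "\<forall>v. Some v \<in> set xs --> v < q"
  shows "card {k. k < length (rcvd w c zs) & rcvd w c zs ! k div q ~= W ((k0 + k) mod l)}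
    <= card {r. r < length xs & xs ! r ~= None & encode q l W k0 xs ! r ~= Some (w (c + r))}"
  using assms
proof (induction xs zs arbitrary: c k0 rule: list_all2_induct)
  case (Cons x xs z zs)
  show ?case
  proof (cases x)
    case None
    then obtain y where "z = Some y" using Cons by auto
    then show ?thesis using None Cons.IH[of "Suc c" k0] Cons.prems by (simp add: card_Suc_split)
  next
    case (Some v)
    then have z: "z = None" "v < q" using Cons by auto
    have "(v + q * W (k0 mod l)) div q = W (k0 mod l)" using z(2) by simp
    then have "of_bool (w c div q ~= W (k0 mod l)) <= (of_bool (v + q * W (k0 mod l) ~= w c) :: nat)" by auto
    then show ?thesis using Some z Cons.IH[of "Suc c" "Suc k0"] Cons.prems by (simp add: card_Suc_split)
  qed
qed simp

context coder
begin

text \<open>The estimate \<open>q < 2 ^ q\<close> turns the assumption into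
  \<open>m \<le> q * N + s\<close>. If \<open>N \<le> 2 * l\<close>, then \<open>m\<close> is at
  most linear in \<open>l\<close>, whereas \<open>l ^ 4\<close> is at most \<open>p ^ 4 * m\<close>;
  so \<open>l\<close> is bounded by a constant, and \<open>m < l ^ 4\<close> is below the
  threshold.\<close>

lemma enough_rounds:
  assumes "2 ^ m <= q ^ N * s" "fits m l" "(p ^ 4 * (2 * q + s)) ^ 4 <= m"
  shows "l <= N div 2"
proof (rule ccontr)
  assume "\<not> l <= N div 2"
  then have Nl: "N <= 2 * l" by linarith
  have l1: "1 <= l" using assms(2) by (cases l) (auto simp: fits_def)
  have "q ^ N * s <= (2 ^ q) ^ N * 2 ^ s" by (intro mult_le_mono power_mono) (auto intro: less_imp_le less_exp)
  then have "(2::nat) ^ m <= 2 ^ (q * N + s)" using assms(1) by (simp add: power_add power_mult)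
  then have "m <= q * N + s" by simp
  also have "\<dots> <= q * (2 * l) + s * l" using Nl l1 by (intro add_mono mult_le_mono2) simp_all
  also have "\<dots> = (2 * q + s) * l" by (simp add: algebra_simps)
  finally have "p ^ 4 * m <= p ^ 4 * ((2 * q + s) * l)" by (rule mult_le_mono2)
  moreover have "l ^ 4 <= p ^ 4 * m" using assms(2) by (simp add: fits_def)
  ultimately have "l ^ 4 <= p ^ 4 * ((2 * q + s) * l)" by linarith
  moreover have "l ^ 4 = l ^ 3 * l" by (simp add: power3_eq_cube power4_eq_xxxx)
  ultimately have "l ^ 3 * l <= p ^ 4 * (2 * q + s) * l" by (simp only: mult.assoc)
  then have "l ^ 3 <= p ^ 4 * (2 * q + s)" using l1 mult_le_cancel2[of "l ^ 3" l "p ^ 4 * (2 * q + s)"] by linarith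
  moreover have "l ^ 1 <= l ^ 3" using l1 by (intro power_increasing) auto
  ultimately have "l <= p ^ 4 * (2 * q + s)" by simp
  then have "l ^ 4 <= (p ^ 4 * (2 * q + s)) ^ 4" by (rule power_mono) simp
  then show False using assms(2,3) unfolding fits_def by linarith
qed

end

section \<open>The scheme constructed from a given one\<close>

locale reduction = coder b ls \<sigma> g p for b ls \<sigma> g p :: nat +
  fixes S :: scheme and T :: "nat => nat" and \<epsilon> :: real and n0 c0 :: nat
  assumes S: "nonadaptive_scheme \<sigma> S" "balanced S" "list_decoding \<sigma> S ls (1 / 2 - \<epsilon>)"
    and halt: "\<And>n \<Pi> w. 1 <= n ==> \<Pi> \<in> protocols \<sigma> ==> w \<in> words S ==>
      \<exists>tA tB. halts_by S \<Pi> n w Alice tA & halts_by S \<Pi> n w Bob tB & tA + tB <= T n"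
    and space: "\<And>n \<Pi> w P t a. 1 <= n ==> \<Pi> \<in> protocols \<sigma> ==> w \<in> words S ==> mem (state S \<Pi> n w P t) a <= (n + T n + 2) ^ c0"
    and qpos: "0 < alphabet S" and \<sigma>2: "2 <= \<sigma>" and ls0: "0 < ls"
    and eps: "0 < \<epsilon>" "\<epsilon> <= 1 / 6" "2 / \<epsilon> <= real g" "3 / \<epsilon> <= real b"
    and n0: "1 <= n0" "\<sigma> <= n0" "\<And>m l. n0 <= m ==> fits m l ==> l <= rounds S m div 2"
    and Tl: "\<And>n. 1 <= n ==> n <= T n" "\<And>n. 1 <= n ==> rounds S n <= T n"
begin

abbreviation "q == alphabet S"
abbreviation "items P == builder.all_items b ls g p q (P = Alice)"
definition DD :: "party => nat" where "DD P = depth_bound (P = Alice) q (prog S P) (items P)"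
definition pgm :: "party => program" where
  "pgm P = prologue n0 @ builder.items_code b ls \<sigma> g p q (DD P) (P = Alice) (prog S P) 8 (items P)"
definition K1 :: nat where "K1 = 2 * (8 + eff * (p ^ 2 + 4))"
text \<open>Balance gives \<open>2 * h\<close> rounds per run, so Alice's final \<open>b\<close>
  pieces of \<open>h\<close> rounds bring the total to \<open>3 * b * h\<close>. An error rate just
  below one third thus means just below \<open>b * h\<close> corruptions.\<close>

definition S' :: scheme where
  "S' = \<lparr>prog = pgm, alphabet = q * Q, rounds = %n. b * rounds S (max n n0) + b * (rounds S (max n n0) div 2),
     turn = %n r. if r < b * rounds S (max n n0) then turn S (max n n0) (r mod rounds S (max n n0)) else Alice\<rparr>"
text \<open>\<open>VV\<close> bounds constants, registers and all values of the simulated machine in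
  terms of the time \<open>y\<close> of the given scheme; \<open>ZZ\<close> adds the growth of at
  most one per step, and \<open>BB\<close> the intermediate results of the compiled code.\<close>

definition VV :: "nat => nat" where
  "VV y = \<kappa> + \<sigma> + q * Q + 2 + (ls + p ^ 4 + (2 * NR - 1) * 2 + 1) * y + (2 * y + 2) ^ c0"
definition ZZ :: "nat => nat" where "ZZ y = VV y + K1 * y"
definition BB :: "party => nat => nat" where
  "BB P y = ZZ y + sum_list (map (builder.item_peak b ls \<sigma> g p q (DD P) (P = Alice) (prog S P) (ZZ y)) (items P))"

lemma b0: "0 < b" using eps by (cases b) (auto simp: divide_le_0_iff)

lemma M0: "0 < M" using b0 ls0 by (simp add: M_def)

lemma DD17: "17 <= DD P" by (simp add: DD_def depth_bound_def)

lemma builder: "builder \<sigma> g p q (DD P)"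
  by unfold_locales (use qpos \<sigma>2 DD17 in auto)

lemma polynomially_BB: "polynomially (BB P)"
proof -
  interpret U: builder b ls \<sigma> g p q "DD P" "P = Alice" "prog S P" by (rule builder)
  have VV: "polynomially VV" unfolding VV_def by (intro polynomially_intros polynomially_power)
  then have ZZ: "polynomially ZZ" unfolding ZZ_def by (intro polynomially_intros)
  have "polynomially (%y. sum_list (map (%x. U.item_peak (ZZ y) x) (items P)))"
    by (rule polynomially_sum_list) (rule polynomially_compose[OF U.polynomially_item_peak ZZ])
  then show ?thesis unfolding BB_def by (intro polynomially_add ZZ)
qed

end

locale reduced_run = reduction b ls \<sigma> g p S T \<epsilon> n0 c0 for b ls \<sigma> g p S T \<epsilon> n0 c0 +
  fixes \<Pi> :: protocol and n :: nat and w :: "nat => nat"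
  assumes n1: "1 <= n" and \<Pi>: "\<Pi> \<in> protocols \<sigma>" and w: "w \<in> words S'"
begin

definition m where "m = max n n0"
definition N where "N = rounds S m"
definition h where "h = N div 2"
definition l where "l = (SOME l. fits m l)"
definition \<Pi>p where "\<Pi>p = pad_protocol n \<Pi>"
definition tm :: "party => (nat => nat) => nat" where "tm P v = (LEAST t. halts_by S \<Pi>p m v P t)"
definition W where "W = p ^ 2 * m + h + 1"
abbreviation "al P == P = Alice"
abbreviation "orc P == oracle_of \<Pi> n P"
abbreviation "vv j == (%k. w (j * N + k) mod q)"

lemma m1: "1 <= m" "n <= m" "n0 <= m" using n1 by (auto simp: m_def)

lemma fit: "fits m l"
  unfolding l_def by (rule someI_ex[of "fits m"], rule fits_exists) (use m1 in simp)

lemma \<Pi>p: "\<Pi>p \<in> protocols \<sigma>" unfolding \<Pi>p_def using pad_protocol_in[OF \<Pi>] \<sigma>2 by simp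

lemma wq: "w i < q * Q" using w by (simp add: words_def S'_def)

lemma po: "pad_oracle (al P) n m (orc P) = oracle_of \<Pi>p m P"
  unfolding \<Pi>p_def by (rule pad_oracle_eq[OF m1(2)])

lemma vw: "(\<forall>k. v k < q) ==> v \<in> words S" by (simp add: words_def)

lemma oracle_le: "Rs \<in> protocols \<sigma> ==> oracle_of Rs k P x <= \<sigma>"
  by (auto simp: oracle_of_def protocols_def Suc_le_eq)

lemma N2: "N = 2 * h" "card {i. i < N & turn S m i = P} = h" and h0: "0 < h"
proof -
  let ?A = "{i. i < N & turn S m i = Alice}" and ?B = "{i. i < N & turn S m i = Bob}"
  have eq: "card ?A = card ?B" using S(2) m1(1) by (simp add: balanced_def N_def)
  have "?A \<union> ?B = {..<N}" using party.exhaust by auto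
  moreover have "card (?A \<union> ?B) = card ?A + card ?B" by (rule card_Un_disjoint) auto
  ultimately have NN: "N = 2 * card ?A" using eq by simp
  then have hA: "h = card ?A" by (simp add: h_def)
  show "N = 2 * h" unfolding hA by (rule NN)
  show "card {i. i < N & turn S m i = P} = h" unfolding hA using eq by (cases P) simp_all
  have "0 < N" unfolding N_def by (rule nonadaptiveD(1)[OF S(1) m1(1) \<Pi>p, of "%_. 0"]) (use qpos in \<open>simp add: words_def\<close>)
  then show "0 < h" unfolding hA using NN by linarith
qed

lemma final_tm: "final S \<Pi>p m v P = (step (prog S P) (pad_oracle (al P) n m (orc P)) v ^^ tm P v) (initial m)"
  unfolding po final_def tm_def state_def ..

lemma tm:
  assumes "\<forall>k. v k < q"
  shows "halts_by S \<Pi>p m v P (tm P v)" "tm P v <= T m"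
proof -
  obtain tA tB where t: "halts_by S \<Pi>p m v Alice tA" "halts_by S \<Pi>p m v Bob tB" "tA + tB <= T m"
    using halt[OF m1(1) \<Pi>p vw[OF assms]] by blast
  then have "\<exists>t\<le>T m. halts_by S \<Pi>p m v P t" by (cases P) (force intro: exI[of _ tA] exI[of _ tB])+
  then obtain t where "t <= T m" "halts_by S \<Pi>p m v P t" by blast
  then show "halts_by S \<Pi>p m v P (tm P v)" "tm P v <= T m" unfolding tm_def using LeastI[of "halts_by S \<Pi>p m v P" t] Least_le[of "halts_by S \<Pi>p m v P" t] by linarith+
qed

lemma sent_final:
  assumes "\<forall>k. v k < q"
  shows "sent (comm (final S \<Pi>p m v P)) = h" "length (comm (final S \<Pi>p m v P)) = N"
proof -
  note D = nonadaptiveD[OF S(1) m1(1) \<Pi>p vw[OF assms], folded N_def]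
  show len: "length (comm (final S \<Pi>p m v P)) = N" by (rule D(3))
  have "comm (final S \<Pi>p m v P) ! i ~= None \<longleftrightarrow> turn S m i = P" if "i < N" for i
    using D(4)[OF that, of P] D(5)[OF that, of P] by force
  then have "{i. i < N & comm (final S \<Pi>p m v P) ! i ~= None} = {i. i < N & turn S m i = P}" by blast
  then show "sent (comm (final S \<Pi>p m v P)) = h" using N2(2) len by (simp add: sent_def length_filter_conv_card)
qed

lemma W_le: "W + T m + 1 <= (p ^ 2 + 4) * T m"
proof -
  have "h <= T m" "1 <= T m" "m <= T m" using Tl[OF m1(1)] m1(1) N2(1) by (simp_all add: N_def h_def)
  moreover have "p ^ 2 * m <= p ^ 2 * T m" using \<open>m <= T m\<close> by (rule mult_le_mono2)
  ultimately show ?thesis unfolding W_def add_mult_distrib by linarith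
qed

lemma party_run: "party_run b ls \<sigma> g p q (DD P) (al P) (prog S P) (orc P) w n m l h N (T m) (VV (T m)) W (tm P)"
proof -
  let ?y = "T m" and ?V = "VV (T m)"
  have my: "m <= ?y" using Tl m1 by simp
  have lin: "ls * m <= ?V" "p ^ 4 * m <= ?V" "(2 * NR - 1) * (2 * m) <= ?V"
  proof -
    have "(ls + p ^ 4 + (2 * NR - 1) * 2 + 1) * ?y <= ?V" by (simp add: VV_def)
    then have 1: "ls * ?y + p ^ 4 * ?y + (2 * NR - 1) * (2 * ?y) <= ?V" by (simp only: add_mult_distrib mult.assoc)
    have "ls * m <= ls * ?y" "p ^ 4 * m <= p ^ 4 * ?y" "(2 * NR - 1) * (2 * m) <= (2 * NR - 1) * (2 * ?y)"
      using my by (simp_all only: mult_le_mono2 mult_le_mono)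
    then show "ls * m <= ?V" "p ^ 4 * m <= ?V" "(2 * NR - 1) * (2 * m) <= ?V" using 1 by linarith+
  qed
  have ty: "?y < ?V" by (simp add: VV_def)
  have mem: "(m + ?y + 2) ^ c0 <= ?V"
  proof -
    have "(m + ?y + 2) ^ c0 <= (2 * ?y + 2) ^ c0" using my by (intro power_mono) auto
    then show ?thesis by (simp add: VV_def)
  qed
  have st: "(step (prog S P) (pad_oracle (al P) n m (orc P)) v ^^ u) (initial m) = state S \<Pi>p m v P u" for v u
    unfolding po state_def ..
  have f\<sigma>: "\<sigma> <= ?V" by (simp add: VV_def)
  have fV: "orc P x <= ?V" for x using oracle_le[OF \<Pi>, of n P x] f\<sigma> by linarith
  have wV: "w i <= ?V" for i using wq[of i] by (simp add: VV_def)
  have kV: "\<kappa> <= ?V" "1 <= ?V" by (simp_all add: VV_def)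
  have Ws: "1 <= W" "m <= W" "l * l <= W" "h <= W"
  proof -
    show "1 <= W" "h <= W" by (simp_all add: W_def)
    show "l * l <= W" using fits_square[OF fit] m1(1) by (simp add: W_def)
    have "1 * m <= p ^ 2 * m" using p1 by (intro mult_le_mono1) simp
    then show "m <= W" unfolding W_def by linarith
  qed
  have a1: "tm P v <= ?y" if "\<forall>k. v k < q" for v using tm(2)[OF that] .
  have a2: "halted (prog S P) ((step (prog S P) (pad_oracle (al P) n m (orc P)) v ^^ tm P v) (initial m))" if "\<forall>k. v k < q" for v
    using tm(1)[OF that] unfolding st halts_by_def .
  have a3: "below ?V ((step (prog S P) (pad_oracle (al P) n m (orc P)) v ^^ u) (initial m))" if "\<forall>k. v k < q" for v u
    unfolding st below_def using space[OF m1(1) \<Pi>p vw[OF that]] mem le_trans by blast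
  have a4: "length (comm ((step (prog S P) (pad_oracle (al P) n m (orc P)) v ^^ u) (initial m))) < ?V" if v: "\<forall>k. v k < q" for v u
  proof (cases "u <= tm P v")
    case True
    then show ?thesis unfolding st using length_comm_state(1)[of S \<Pi>p m v P u] a1[OF v] ty by linarith
  next
    case False
    then have "(step (prog S P) (pad_oracle (al P) n m (orc P)) v ^^ u) (initial m) = state S \<Pi>p m v P (tm P v)"
      using halted_mono[OF a2[OF v], of u] unfolding st by simp
    then show ?thesis using length_comm_state(1)[of S \<Pi>p m v P "tm P v"] a1[OF v] ty by simp
  qed
  have a5: "sent (comm ((step (prog S P) (pad_oracle (al P) n m (orc P)) v ^^ tm P v) (initial m))) = h"
    "length (comm ((step (prog S P) (pad_oracle (al P) n m (orc P)) v ^^ tm P v) (initial m))) = N" if "\<forall>k. v k < q" for v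
    using sent_final[OF that, of P] unfolding final_tm .
  have n0': "0 < n" using n1 by simp
  show ?thesis
    by (rule party_run.intro[OF builder], unfold_locales)
      (fact n0' m1 fit kV fV wV lin f\<sigma> Ws a1 a2 a3 a4 a5)+
qed

lemma execution:
  "\<exists>u ss r1 r2. party_history b ls \<sigma> g p q (DD P) (al P) (prog S P) (orc P) w n m l h N (T m) (VV (T m)) W (tm P) ss r1 r2 &
     u <= 8 + eff * (W + T m + 1) & halts_by S' \<Pi> n w P u & (\<forall>t a. mem (state S' \<Pi> n w P t) a <= BB P (T m)) &
     comm (final S' \<Pi> n w P) = chan (ss (2 * b)) &
     (\<not> al P --> out (final S' \<Pi> n w P) = printed (sem (orc P) w 7 answer (envr n m l (l ^ 4) h) (ss (2 * b))))"
proof -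
  interpret R: party_run b ls \<sigma> g p q "DD P" "al P" "prog S P" "orc P" w n m l h N "T m" "VV (T m)" "BB P (T m)" "ZZ (T m)" W "tm P"
    by (rule party_run)
  have mn: "m = n - n0 + n0" by (simp add: m_def max_def)
  have "R.t_all <= eff * (W + T m + 1)" by (rule R.t_all_le)
  also have "\<dots> <= eff * ((p ^ 2 + 4) * T m)" using W_le by (rule mult_le_mono2)
  also have "\<dots> <= K1 * T m" by (simp add: K1_def algebra_simps)
  finally have Z: "VV (T m) + R.t_all <= ZZ (T m)" by (simp add: ZZ_def)
  have pk: "\<forall>x\<in>set (items P). R.item_peak (ZZ (T m)) x <= BB P (T m)"
    unfolding BB_def using member_le_sum_list[of _ "map (R.item_peak (ZZ (T m))) (items P)"] by (auto intro: trans_le_add2)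
  obtain u cf e s where u: "u <= 8 + R.t_all" "reaches (pgm P) (orc P) w (BB P (T m)) (initial n) u cf" "pc cf = length (pgm P)"
    "comm cf = chan s" "out cf = printed s" "R.Done e s"
    using R.execution[OF mn _ b0 Z pk] unfolding DD_def pgm_def[symmetric, unfolded DD_def] BB_def ZZ_def by auto
  have prS: "prog S' P = pgm P" by (simp add: S'_def)
  have st: "state S' \<Pi> n w P u = cf" using u(2) by (simp add: state_def prS reaches_def)
  have ht: "halts_by S' \<Pi> n w P u" unfolding halts_by_def st prS using u(3) by (simp add: halted_def)
  have fin: "final S' \<Pi> n w P = cf" using final_eq[OF ht] st by simp
  have mem: "mem (state S' \<Pi> n w P t) a <= BB P (T m)" for t a
  proof (cases "t <= u")
    case True
    then show ?thesis using u(2) by (simp add: reaches_def below_def state_def prS)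
  next
    case False
    then have "state S' \<Pi> n w P t = state S' \<Pi> n w P u"
      using halted_mono[OF ht[unfolded halts_by_def state_def], of t] unfolding state_def by simp
    then show ?thesis using u(2) by (auto simp: reaches_def below_def state_def prS)
  qed
  obtain ss r1 r2 where H: "R.history (2 * b) ss r1 r2" "s = (if al P then ss (2 * b) else sem (orc P) w 7 answer R.eh (ss (2 * b)))"
    using u(6) unfolding R.Done_def by blast
  have ph: "party_history b ls \<sigma> g p q (DD P) (al P) (prog S P) (orc P) w n m l h N (T m) (VV (T m)) W (tm P) ss r1 r2"
  proof (rule party_history.intro[OF party_run], rule party_history_axioms.intro)
    show "l <= h" using n0(3)[OF m1(3) fit] by (simp add: h_def N_def)
    show "\<And>x. pad_oracle (al P) n m (orc P) x <= \<sigma>" unfolding po by (rule oracle_le[OF \<Pi>p])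
    show "\<sigma> <= m" using n0(2) m1(3) by linarith
  qed (fact H(1) h0 wq b0 N2(1))+
  interpret H: party_history b ls \<sigma> g p q "DD P" "al P" "prog S P" "orc P" w n m l h N "T m" "VV (T m)" "BB P (T m)" "ZZ (T m)" W "tm P" ss r1 r2
    by (rule ph)
  have ch: "chan s = chan (ss (2 * b))"
  proof (cases "al P")
    case False
    then show ?thesis using H.answer_spec[OF False M0] unfolding H(2) if_not_P[OF False] by blast
  qed (simp add: H(2))
  have ou: "\<not> al P --> out cf = printed (sem (orc P) w 7 answer R.eh (ss (2 * b)))" using u(5) unfolding H(2) by (simp add: if_not_P)
  have ub: "u <= 8 + eff * (W + T m + 1)" using u(1) R.t_all_le by linarith
  show ?thesis using ph ub ht mem u(4) ch ou unfolding fin by (intro exI[of _ u] exI[of _ ss] exI[of _ r1] exI[of _ r2] conjI) simp_all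
qed

end

context party_history
begin

lemma final_part:
  assumes "j < 2 * b" "r < cl (Suc j) - cl j"
  shows "chan (ss (2 * b)) ! (cl j + r) = part j ! r"
  by (rule chan_stable) (use assms mid_spec(3)[OF assms(1) okay'[OF assms(1)]] in auto)

end

section \<open>Corruptions of the new scheme, piece by piece\<close>

context reduced_run
begin

abbreviation "hist P == party_history b ls \<sigma> g p q (DD P) (al P) (prog S P) (orc P) w n m l h N (T m) (VV (T m)) W (tm P)"
abbreviation "sc P j == comm (final S \<Pi>p m (vv j) P)"
abbreviation "sc' P == comm (final S' \<Pi> n w P)"

definition ck :: "nat => nat" where "ck j = (if j <= b then j * N else b * N + (j - b) * h)"

lemma ck_0: "ck 0 = 0" by (simp add: ck_def)

lemma ck_Suc: "ck (Suc j) = ck j + (if j < b then N else h)"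
  by (cases j b rule: linorder_cases) (auto simp: ck_def Suc_diff_le)

lemma rounds': "rounds S' n = ck (2 * b)"
  using b0 by (simp add: S'_def ck_def N_def m_def h_def)

lemma vvq: "\<forall>k. vv j k < q" using qpos by simp

lemma turn_run: "j < b ==> r < N ==> turn S' n (ck j + r) = turn S m r"
proof -
  assume a: "j < b" "r < N"
  then have "Suc j * N <= b * N" by (intro mult_le_mono1) simp
  then have "j * N + r < b * N" using a by simp
  then show ?thesis using a by (simp add: S'_def ck_def flip: N_def m_def)
qed

lemma turn_end: "b <= j ==> turn S' n (ck j + r) = Alice"
  by (cases "j = b") (auto simp: S'_def ck_def simp flip: N_def m_def)

lemma sc_Some: "r < N ==> turn S m r = P ==> \<exists>v<q. sc P j ! r = Some v"
  and sc_None: "r < N ==> turn S m r ~= P ==> sc P j ! r = None"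
  using nonadaptiveD(4,5)[OF S(1) m1(1) \<Pi>p vw[OF vvq], folded N_def] by blast+

lemma comm_run:
  assumes H: "hist P ss r1 r2" and c: "sc' P = chan (ss (2 * b))" and j: "j < b" "r < N"
  shows "sc' P ! (ck j + r) = encode q l (cells (r1 j) RW) 0 (sc P j) ! r"
proof -
  interpret H: party_history b ls \<sigma> g p q "DD P" "al P" "prog S P" "orc P" w n m l h N "T m" "VV (T m)" 0 0 W "tm P" ss r1 r2
    by (rule H)
  have cl: "H.cl = ck" by (simp add: H.cl_def ck_def fun_eq_iff)
  have run: "H.run j = final S \<Pi>p m (vv j) P" unfolding H.run_def H.fin_def final_tm ..
  have "sc' P ! (ck j + r) = H.part j ! r" unfolding c cl[symmetric] by (rule H.final_part) (use j in \<open>auto simp: H.cl_Suc\<close>)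
  then show ?thesis using j by (simp add: H.part_def run)
qed

lemma comm_end:
  assumes H: "hist P ss r1 r2" and c: "sc' P = chan (ss (2 * b))" and j: "b <= j" "j < 2 * b" "r < h"
  shows "sc' P ! (ck j + r) = (if al P then Some (q * cells (r1 j) RW (r mod l)) else None)"
proof -
  interpret H: party_history b ls \<sigma> g p q "DD P" "al P" "prog S P" "orc P" w n m l h N "T m" "VV (T m)" 0 0 W "tm P" ss r1 r2
    by (rule H)
  have cl: "H.cl = ck" by (simp add: H.cl_def ck_def fun_eq_iff)
  have "sc' P ! (ck j + r) = H.part j ! r" unfolding c cl[symmetric] by (rule H.final_part) (use j in \<open>auto simp: H.cl_Suc\<close>)
  then show ?thesis using j by (simp add: H.part_def)
qed

lemma history_exists:
  obtains ss r1 r2 where "hist P ss r1 r2" "sc' P = chan (ss (2 * b))"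
    "\<not> al P --> out (final S' \<Pi> n w P) = printed (sem (orc P) w 7 answer (envr n m l (l ^ 4) h) (ss (2 * b)))"
  using execution[of P] by blast

lemma RW_less:
  assumes "hist P ss r1 r2" "j < 2 * b"
  shows "cells (r1 j) RW x < Q"
proof -
  interpret H: party_history b ls \<sigma> g p q "DD P" "al P" "prog S P" "orc P" w n m l h N "T m" "VV (T m)" 0 0 W "tm P" ss r1 r2
    by (rule assms(1))
  show ?thesis by (rule H.pre_spec(7)[OF assms(2) H.okay'[OF assms(2)]])
qed

lemma communication:
  shows "length (sc' P) = rounds S' n"
    and "i < rounds S' n ==> if turn S' n i = P then \<exists>v<alphabet S'. sc' P ! i = Some v else sc' P ! i = None"
proof -
  obtain ss r1 r2 where H: "hist P ss r1 r2" "sc' P = chan (ss (2 * b))" by (rule history_exists)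
  interpret H: party_history b ls \<sigma> g p q "DD P" "al P" "prog S P" "orc P" w n m l h N "T m" "VV (T m)" 0 0 W "tm P" ss r1 r2
    by (rule H(1))
  have cl: "H.cl = ck" by (simp add: H.cl_def ck_def fun_eq_iff)
  show "length (sc' P) = rounds S' n" using H(2) H.final_store(7) by (simp add: rounds' cl)
  assume "i < rounds S' n"
  then obtain j r where j: "j < 2 * b" "r < ck (Suc j) - ck j" "i = ck j + r"
    using block_exists[of ck i "2 * b", OF ck_0] unfolding rounds' by blast
  have small: "v + q * cells (r1 j) RW x < q * Q" if "v < q" for v x
  proof -
    have "q * Suc (cells (r1 j) RW x) <= q * Q" using RW_less[OF H(1) j(1), of x] by (intro mult_le_mono2) simp
    then show ?thesis using that by simp
  qed
  show "if turn S' n i = P then \<exists>v<alphabet S'. sc' P ! i = Some v else sc' P ! i = None"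
  proof (cases "j < b")
    case True
    then have r: "r < N" using j by (simp add: ck_Suc)
    have e: "sc' P ! i = map_option (%v. v + q * cells (r1 j) RW ((0 + sent (take r (sc P j))) mod l)) (sc P j ! r)"
      unfolding j(3) comm_run[OF H True r] by (rule encode_nth) (use sent_final(2)[OF vvq] r in simp)
    show ?thesis
    proof (cases "turn S m r = P")
      case t: True
      obtain v where v: "v < q" "sc P j ! r = Some v" using sc_Some[OF r t] by blast
      have al: "alphabet S' = q * Q" by (simp add: S'_def)
      show ?thesis using e v small[OF v(1)] t turn_run[OF True r] j(3) unfolding al by simp
    next
      case False
      then show ?thesis using e sc_None[OF r False] turn_run[OF True r] j(3) by simp
    qed
  next
    case False
    then have r: "r < h" "b <= j" using j by (simp_all add: ck_Suc)
    have al: "alphabet S' = q * Q" by (simp add: S'_def)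
    show ?thesis using comm_end[OF H r(2) j(1) r(1)] turn_end[OF r(2), of r] small[OF qpos, of "r mod l"] j(3) unfolding al
      by (cases P) simp_all
  qed
qed

definition bad :: "nat => bool" where "bad i \<longleftrightarrow> sc' (turn S' n i) ! i ~= Some (w i)"
definition cc :: "nat => nat" where "cc j = card {r. r < ck (Suc j) - ck j & bad (ck j + r)}"

lemma corruptions_cc: "corruptions S' \<Pi> n w = (\<Sum>j<2 * b. cc j)"
  unfolding corruptions_def bad_def[symmetric] rounds' cc_def by (rule card_blocks[of ck, OF ck_0]) (simp add: ck_Suc)

text \<open>A round of the new scheme that is not corrupted delivers a symbol whose remainder modulo
  \<open>q\<close> is the symbol of the given scheme. So the word seen by the simulated parties
  contains at most as many corruptions as the piece.\<close>

lemma run_corruptions: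
  assumes "j < b"
  shows "corruptions S \<Pi>p m (vv j) <= cc j"
  unfolding corruptions_def cc_def N_def[symmetric]
proof (rule card_mono)
  show "{i. i < N & sc (turn S m i) j ! i ~= Some (vv j i)} \<subseteq> {r. r < ck (Suc j) - ck j & bad (ck j + r)}"
  proof
    fix r assume "r \<in> {i. i < N & sc (turn S m i) j ! i ~= Some (vv j i)}"
    then have r: "r < N" "sc (turn S m r) j ! r ~= Some (vv j r)" by auto
    let ?P = "turn S m r"
    obtain ss r1 r2 where H: "hist ?P ss r1 r2" "sc' ?P = chan (ss (2 * b))" by (rule history_exists)
    obtain v where v: "v < q" "sc ?P j ! r = Some v" using sc_Some[OF r(1) refl] by blast
    have "sc' ?P ! (ck j + r) = map_option (%v. v + q * cells (r1 j) RW ((0 + sent (take r (sc ?P j))) mod l)) (sc ?P j ! r)"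
      unfolding comm_run[OF H assms r(1)] by (rule encode_nth) (use sent_final(2)[OF vvq] r in simp)
    then have e: "sc' ?P ! (ck j + r) = Some (v + q * cells (r1 j) RW ((0 + sent (take r (sc ?P j))) mod l))" using v(2) by simp
    have "sc' ?P ! (ck j + r) ~= Some (w (ck j + r))"
    proof
      assume "sc' ?P ! (ck j + r) = Some (w (ck j + r))"
      then have "w (j * N + r) = v + q * cells (r1 j) RW ((0 + sent (take r (sc ?P j))) mod l)" using e assms by (simp add: ck_def)
      then have "w (j * N + r) mod q = v mod q" by (simp only: mod_mult_self2)
      then show False using r(2) v by simp
    qed
    then show "r \<in> {r. r < ck (Suc j) - ck j & bad (ck j + r)}"
      using r(1) assms turn_run[OF assms r(1)] by (simp add: bad_def ck_Suc)
  qed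
qed simp

text \<open>The simulated parties transmit in complementary rounds, so
  \<open>transmission_errors\<close> applies to either direction. Each wrong code symbol spoils the
  combined symbol and counts among the corruptions of the piece.\<close>

lemma code_errors:
  assumes H: "hist P ss r1 r2" "sc' P = chan (ss (2 * b))" and j: "j < b" and P': "P' ~= P"
  shows "card {k. k < h & rcvd w (j * N) (sc P' j) ! k div q ~= cells (r1 j) RW (k mod l)} <= cc j"
proof -
  let ?W = "cells (r1 j) RW"
  have len: "length (sc P j) = N" "length (sc P' j) = N" using sent_final(2)[OF vvq] by simp_all
  have lr: "length (rcvd w (j * N) (sc P' j)) = h"
    using length_rcvd[of w "j * N" "sc P' j"] sent_final[OF vvq, of j P'] N2(1) by linarith
  have tn: "(turn S m r ~= P) = (turn S m r = P')" for r using P' by (cases "turn S m r"; cases P; cases P') auto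
  have t1: "list_all2 (%x z. x = None \<longleftrightarrow> z ~= None) (sc P j) (sc P' j)"
  proof (rule list_all2_all_nthI)
    fix r assume "r < length (sc P j)"
    then have r: "r < N" using len by simp
    show "(sc P j ! r = None) = (sc P' j ! r ~= None)"
    proof (cases "turn S m r = P")
      case True
      then have "turn S m r ~= P'" using P' by simp
      then show ?thesis using sc_Some[OF r True] sc_None[OF r, of P'] by auto
    next
      case False
      then have "turn S m r = P'" using tn by simp
      then show ?thesis using sc_Some[OF r, of P'] sc_None[OF r False] by auto
    qed
  qed (simp add: len)
  have t2: "\<forall>v. Some v \<in> set (sc P j) --> v < q"
  proof (intro allI impI)
    fix v assume "Some v \<in> set (sc P j)"
    then obtain r where r: "r < N" "sc P j ! r = Some v" using len by (auto simp: in_set_conv_nth)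
    then have "turn S m r = P" using sc_None[OF r(1), of P j] by fastforce
    then show "v < q" using sc_Some[OF r(1), of P j] r(2) by auto
  qed
  have "card {k. k < h & rcvd w (j * N) (sc P' j) ! k div q ~= ?W ((0 + k) mod l)}
    <= card {r. r < N & sc P j ! r ~= None & encode q l ?W 0 (sc P j) ! r ~= Some (w (j * N + r))}"
    using transmission_errors[OF t1 t2, where w = w and c = "j * N" and W = ?W and ?k0.0 = 0 and l = l] unfolding lr len(1) .
  also have "\<dots> <= cc j"
    unfolding cc_def
  proof (rule card_mono)
    show "{r. r < N & sc P j ! r ~= None & encode q l ?W 0 (sc P j) ! r ~= Some (w (j * N + r))}
      \<subseteq> {r. r < ck (Suc j) - ck j & bad (ck j + r)}"
    proof
      fix r assume "r \<in> {r. r < N & sc P j ! r ~= None & encode q l ?W 0 (sc P j) ! r ~= Some (w (j * N + r))}"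
      then have r: "r < N" "sc P j ! r ~= None" "encode q l ?W 0 (sc P j) ! r ~= Some (w (j * N + r))" by auto
      have "turn S m r = P" using sc_None[OF r(1), of P j] r(2) by blast
      then have "bad (ck j + r)" using comm_run[OF H j r(1)] turn_run[OF j r(1)] r(3) j unfolding bad_def by (simp add: ck_def)
      then show "r \<in> {r. r < ck (Suc j) - ck j & bad (ck j + r)}" using r(1) j by (simp add: ck_Suc)
    qed
  qed simp
  finally show ?thesis by simp
qed

lemma final_errors:
  assumes H: "hist Alice ss r1 r2" "sc' Alice = chan (ss (2 * b))" and j: "b <= j" "j < 2 * b"
  shows "card {k. k < h & w (ck j + k) div q ~= cells (r1 j) RW (k mod l)} <= cc j"
  unfolding cc_def
proof (rule card_mono)
  show "{k. k < h & w (ck j + k) div q ~= cells (r1 j) RW (k mod l)} \<subseteq> {r. r < ck (Suc j) - ck j & bad (ck j + r)}"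
  proof
    fix k assume "k \<in> {k. k < h & w (ck j + k) div q ~= cells (r1 j) RW (k mod l)}"
    then have k: "k < h" "w (ck j + k) div q ~= cells (r1 j) RW (k mod l)" by auto
    have "q * cells (r1 j) RW (k mod l) ~= w (ck j + k)" using k(2) qpos by (metis nonzero_mult_div_cancel_left neq0_conv)
    then have "bad (ck j + k)" unfolding bad_def using comm_end[OF H j k(1)] turn_end[OF j(1), of k] by simp
    then show "k \<in> {r. r < ck (Suc j) - ck j & bad (ck j + r)}" using k(1) j by (simp add: ck_Suc)
  qed
qed simp

lemma listed_transcript:
  assumes "u < b" "real (cc u) <= (1 - 2 * \<epsilon>) * h"
  obtains ts where "out (final S \<Pi>p m (vv u) P) = concat ts" "length ts <= ls" "set ts \<subseteq> transcripts \<sigma> m" "transcript \<Pi>p m \<in> set ts"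
proof -
  have "real (corruptions S \<Pi>p m (vv u)) <= cc u" using run_corruptions[OF assms(1)] by simp
  also have "\<dots> <= (1 / 2 - \<epsilon>) * rounds S m" using assms(2) N2(1) unfolding N_def by (simp add: algebra_simps)
  finally show thesis using list_decodingD[OF S(3) m1(1) \<Pi>p vw[OF vvq]] that by blast
qed

text \<open>The recorded histories of Alice and Bob under the same word satisfy the assumptions of
  \<open>duel\<close>, so the elected slot holds the padded transcript, and its first
  \<open>n\<close> symbols are the transcript.\<close>

theorem decodes:
  assumes few: "real (corruptions S' \<Pi> n w) <= (1 / 3 - 2 * \<epsilon>) * real (rounds S' n)"
  shows "out (final S' \<Pi> n w Bob) = transcript \<Pi> n"
proof -
  obtain sA a1 a2 where HA: "hist Alice sA a1 a2" "sc' Alice = chan (sA (2 * b))" by (rule history_exists)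
  obtain sB b1 b2 where HB: "hist Bob sB b1 b2" "sc' Bob = chan (sB (2 * b))"
    and ou: "\<not> al Bob --> out (final S' \<Pi> n w Bob) = printed (sem (orc Bob) w 7 answer (envr n m l (l ^ 4) h) (sB (2 * b)))"
    by (rule history_exists[where P = Bob])
  interpret A: party_history b ls \<sigma> g p q "DD Alice" "al Alice" "prog S Alice" "orc Alice" w n m l h N "T m" "VV (T m)" 0 0 W "tm Alice" sA a1 a2
    by (rule HA)
  interpret B: party_history b ls \<sigma> g p q "DD Bob" "al Bob" "prog S Bob" "orc Bob" w n m l h N "T m" "VV (T m)" 0 0 W "tm Bob" sB b1 b2
    by (rule HB)
  have nB: "\<not> al Bob" by simp
  obtain R kb where R: "\<forall>i<2 * b. B.E.judged (sB (2 * b)) i (\<Lambda> ^ C) (B.ys i) q R" "kb < M"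
    "\<forall>k<M. (\<Sum>i<2 * b. R (i * M + k)) <= (\<Sum>i<2 * b. R (i * M + kb))"
    "printed (sem (orc Bob) w 7 answer B.eh (sB (2 * b))) = take n (slot (cells (b1 (2 * b - 1)) RX) m kb)"
    using B.answer_spec[OF nB M0] by blast
  obtain kk where kk: "l = p ^ kk" by (rule A.lp)
  have runA: "A.run j = final S \<Pi>p m (vv j) Alice" for j unfolding A.run_def A.fin_def final_tm ..
  have runB: "B.run j = final S \<Pi>p m (vv j) Bob" for j unfolding B.run_def B.fin_def final_tm ..
  have clB: "B.cl = ck" by (simp add: B.cl_def ck_def fun_eq_iff)
  have okA: "A.okay j" if "j < 2 * b" for j using A.okay' that .
  have okB: "B.okay j" if "j < 2 * b" for j using B.okay' that .
  have postB: "B.has_post i" for i unfolding B.has_post_def using nB by blast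
  have postA: "A.has_post i" if "i < b" for i unfolding A.has_post_def using that by blast
  define XA where "XA j = cells (a1 j) RX" for j
  define XB where "XB j = cells (b1 j) RX" for j
  define PA where "PA j = cells (a1 j) RP" for j
  define PB where "PB j = cells (b1 j) RP" for j
  define LA where "LA = cells (sA (2 * b)) RL"
  define ya where "ya = A.ys"
  define yb where "yb = B.ys"
  define st where "st = sB (2 * b)"
  note defs = XA_def PA_def XB_def PB_def LA_def ya_def yb_def st_def
  have csA: "{r. r < h & ys ! r div q ~= csym p C (%k. A.E.field (PA i) (XA i) (k div 4) div l ^ (k mod 4) mod l) (r mod l)}
    = {k. k < h & ys ! k div q ~= cells (a1 i) RW (k mod l)}" if "i < 2 * b" for i ys
    using A.pre_spec(6)[OF that okA[OF that]] A.l0 unfolding defs by (metis (no_types, lifting) mod_less_divisor)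
  have csB: "{r. r < h & ys ! r div q ~= csym p C (%k. B.E.field (PB i) (XB i) (k div 4) div l ^ (k mod 4) mod l) (r mod l)}
    = {k. k < h & ys ! k div q ~= cells (b1 i) RW (k mod l)}" if "i < 2 * b" for i ys
    using B.pre_spec(6)[OF that okB[OF that]] B.l0 unfolding defs by (metis (no_types, lifting) mod_less_divisor)
  have D: "duel b ls \<sigma> g p B.eh m l h \<Pi>p XA XB PA PB LA ya yb st R cc q kk \<epsilon>"
  proof (rule duel.intro[OF B.E.coder_exec_axioms], rule duel_axioms.intro)
    show "consistent (oracle_of \<Pi>p m Alice) (slot (XA j) m k)" if "j < 2 * b" "k < M" for j k
      using A.pre_spec(1)[OF that(1) okA[OF that(1)] that(2)] unfolding defs po .
    show "consistent (oracle_of \<Pi>p m Bob) (slot (XB j) m k)" if "j < 2 * b" "k < M" for j k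
      using B.pre_spec(1)[OF that(1) okB[OF that(1)] that(2)] unfolding defs po .
    show "XA j a < \<sigma>" if "j < 2 * b" for j a using A.pre_spec(3)[OF that okA[OF that]] unfolding defs .
    show "XB j a < \<sigma>" if "j < 2 * b" for j a using B.pre_spec(3)[OF that okB[OF that]] unfolding defs .
    show "slot (XB j) m k = slot (XB i) m k" if "i <= j" "j < 2 * b" "k < M" "k < i * ls" for i j k
      using B.slots_stable[OF that] unfolding defs .
    show "\<exists>k<Suc u * ls. slot (XA j) m k = transcript \<Pi>p m"
      if u: "u < b" "real (cc u) <= (1 - 2 * \<epsilon>) * h" "u < j" "j < 2 * b" for u j
    proof -
      obtain ts where ts: "out (A.run u) = concat ts" "length ts <= ls" "set ts \<subseteq> transcripts \<sigma> m" "transcript \<Pi>p m \<in> set ts"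
        unfolding runA by (rule listed_transcript[OF u(1,2)])
      show ?thesis using A.found[OF u(1,3,4) ts, unfolded po, OF transcript_consistent] unfolding defs .
    qed
    show "\<exists>k<Suc u * ls. slot (XB j) m k = transcript \<Pi>p m"
      if u: "u < b" "real (cc u) <= (1 - 2 * \<epsilon>) * h" "u < j" "j < 2 * b" for u j
    proof -
      obtain ts where ts: "out (B.run u) = concat ts" "length ts <= ls" "set ts \<subseteq> transcripts \<sigma> m" "transcript \<Pi>p m \<in> set ts"
        unfolding runB by (rule listed_transcript[OF u(1,2)])
      show ?thesis using B.found[OF u(1,3,4) ts, unfolded po, OF transcript_consistent] unfolding defs .
    qed
    show "PA j z = first_diff m (slot (XA j) m (z div M)) (slot (XA j) m (z mod M))" if "j < 2 * b" "z < M * M" for j z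
      using A.pre_spec(4)[OF that(1) okA[OF that(1)]] that(2) unfolding defs by simp
    show "PB j z = first_diff m (slot (XB j) m (z div M)) (slot (XB j) m (z mod M))" if "j < 2 * b" "z < M * M" for j z
      using B.pre_spec(4)[OF that(1) okB[OF that(1)]] that(2) unfolding defs by simp
    show "PA j (M * M + u * (\<Lambda> ^ 4 * (M * M)) + z) = min (l ^ 4) (B.E.position LA u z)"
      if "u < j" "j < 2 * b" "u < b" "z < \<Lambda> ^ 4 * (M * M)" for u j z
      using A.positions_of_run[OF that] unfolding defs .
    show "PA j z < l ^ 4" if "j < 2 * b" for j z using A.pre_spec(8)[OF that okA[OF that]] unfolding defs .
    show "PB j z < l ^ 4" if "j < 2 * b" for j z using B.pre_spec(8)[OF that okB[OF that]] unfolding defs .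
    show "\<exists>j<\<Lambda>. LA ((u * C + k) * \<Lambda> + j) = d" if "u < b" "k < C" "d < l" "B.E.good (ya u) q k d" for u k d
      using A.listed[OF _ postA[OF that(1)] that(2,3) that(4)[unfolded ya_def]] that(1) unfolding defs by simp
    show "\<exists>j<\<Lambda>. cells st RL ((u * C + k) * \<Lambda> + j) = d" if "u < 2 * b" "k < C" "d < l" "B.E.good (yb u) q k d" for u k d
      using B.listed[OF that(1) postB that(2,3) that(4)[unfolded yb_def]] unfolding defs .
    show "cells st RL z < l" for z using B.final_store(5) unfolding defs by blast
    show "cells st RB (j * (M * M) + z) = PB j z" if "j < b" "z < M * M" for j z
      using B.saved[of j "2 * b" z] that unfolding defs by simp
    show "cells st RX = XB (2 * b - 1)" using B.final_store(1) unfolding defs .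
    show "B.E.judged st i (\<Lambda> ^ C) (yb i) q R" if "i < 2 * b" for i using R(1) that unfolding defs by blast
    show "card {r. r < h & yb i ! r div q ~= csym p C (%k. B.E.field (PA i) (XA i) (k div 4) div l ^ (k mod 4) mod l) (r mod l)} <= cc i"
      if i: "i < 2 * b" for i
    proof (cases "i < b")
      case True
      have "yb i = rcvd w (i * N) (sc Bob i)" unfolding yb_def B.ys_def runB using True by simp
      then show ?thesis unfolding csA[OF i] using code_errors[OF HA True, of Bob] by simp
    next
      case False
      have y: "yb i ! k = w (ck i + k)" if "k < h" for k unfolding yb_def B.ys_def clB using False that by simp
      have "{k. k < h & yb i ! k div q ~= cells (a1 i) RW (k mod l)} = {k. k < h & w (ck i + k) div q ~= cells (a1 i) RW (k mod l)}"
        using y by auto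
      then show ?thesis unfolding csA[OF i] using final_errors[OF HA _ i] False by simp
    qed
    show "card {r. r < h & ya i ! r div q ~= csym p C (%k. B.E.field (PB i) (XB i) (k div 4) div l ^ (k mod 4) mod l) (r mod l)} <= cc i"
      if i: "i < b" for i
    proof -
      have i2: "i < 2 * b" using i by simp
      have "ya i = rcvd w (i * N) (sc Alice i)" unfolding ya_def A.ys_def runA using i by simp
      then show ?thesis unfolding csB[OF i2] using code_errors[OF HB i, of Alice] by simp
    qed
    \<comment> \<open>With \<open>3 * b * h\<close> rounds the error rate amounts to
      \<open>b * h - 6 *\<close> \<epsilon>\<open>* b * h\<close> corruptions, the budget assumed in
      \<open>duel\<close>.\<close>
    have "(\<Sum>i<2 * b. real (cc i)) <= (1 / 3 - 2 * \<epsilon>) * real (rounds S' n)"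
      using few unfolding corruptions_cc by simp
    also have "real (rounds S' n) = 3 * (real b * real h)" unfolding rounds' ck_def using b0 N2(1) by simp
    finally show "(\<Sum>i<2 * b. real (cc i)) <= b * h - 6 * \<epsilon> * b * h" by (simp add: algebra_simps)
  qed (fact A.\<sigma>m A.m4 kk h0 A.hl(2) b0 eps)+
  interpret D: duel b ls \<sigma> g p "al Bob" "orc Bob" w B.eh m l h \<Pi>p XA XB PA PB LA ya yb st R cc q kk \<epsilon>
    by (rule D)
  have "slot (XB (2 * b - 1)) m kb = transcript \<Pi>p m" by (rule D.elected_is_transcript[OF R(2)]) (use R(3) in blast)
  then have "out (final S' \<Pi> n w Bob) = take n (transcript \<Pi>p m)" using ou[rule_format, OF nB] R(4) unfolding XB_def by simp
  also have "\<dots> = transcript \<Pi> n" unfolding transcript_props(2)[OF m1(2)] \<Pi>p_def by (rule transcript_pad) simp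
  finally show ?thesis .
qed

lemma time_bound:
  "\<exists>tA tB. halts_by S' \<Pi> n w Alice tA & halts_by S' \<Pi> n w Bob tB & tA + tB <= K1 * T m"
proof -
  obtain tA where A: "halts_by S' \<Pi> n w Alice tA" "tA <= 8 + eff * (W + T m + 1)" using execution[of Alice] by blast
  obtain tB where B: "halts_by S' \<Pi> n w Bob tB" "tB <= 8 + eff * (W + T m + 1)" using execution[of Bob] by blast
  have *: "tA + tB <= 2 * (z + y)" if "tA <= 8 + x" "tB <= 8 + x" "x <= y" "8 <= z" for x y z
  proof -
    have "tA <= z + y" "tB <= z + y" using that by simp_all
    then have "tA + tB <= (z + y) + (z + y)" by (rule add_mono)
    then show ?thesis by (simp only: mult_2)
  qed
  have "eff * (W + T m + 1) <= eff * ((p ^ 2 + 4) * T m)" using W_le by (rule mult_le_mono2)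
  moreover have "8 <= 8 * T m" using Tl(1)[OF m1(1)] m1(1) by simp
  ultimately have "tA + tB <= 2 * (8 * T m + eff * ((p ^ 2 + 4) * T m))" by (rule *[OF A(2) B(2)])
  also have "\<dots> = K1 * T m" by (simp add: K1_def algebra_simps)
  finally show ?thesis using A(1) B(1) by blast
qed

end

context reduction
begin

lemma reduced_run: "1 <= n ==> \<Pi> \<in> protocols \<sigma> ==> w \<in> words S' ==> reduced_run b ls \<sigma> g p S T \<epsilon> n0 c0 \<Pi> n w"
  by unfold_locales

lemma nonadaptive_S': "nonadaptive_scheme \<sigma> S'"
  unfolding nonadaptive_scheme_def
proof (intro allI impI conjI ballI)
  fix n :: nat assume n: "1 <= n"
  have "0 < rounds S (max n n0)"
    by (rule nonadaptiveD(1)[OF S(1), of _ "\<lparr>speaker = %_. Alice, next_symbol = %_. 0\<rparr>" "%_. 0"])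
      (use n qpos \<sigma>2 in \<open>auto simp: protocols_def words_def\<close>)
  then show "0 < rounds S' n" using b0 by (simp add: S'_def)
  fix \<Pi> w P assume a: "\<Pi> \<in> protocols \<sigma>" "w \<in> words S'"
  interpret R: reduced_run b ls \<sigma> g p S T \<epsilon> n0 c0 \<Pi> n w by (rule reduced_run[OF n a])
  show "\<exists>t. halts_by S' \<Pi> n w P t" using R.execution[of P] by blast
  show "length (comm (final S' \<Pi> n w P)) = rounds S' n" by (rule R.communication(1))
  show "if turn S' n i = P then \<exists>v<alphabet S'. comm (final S' \<Pi> n w P) ! i = Some v else comm (final S' \<Pi> n w P) ! i = None"
    if "i < rounds S' n" for i using R.communication(2)[OF that] .
qed

lemma unique_S': "one_sided_unique_decoding \<sigma> S' (1 / 3 - 2 * \<epsilon>)"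
  unfolding one_sided_unique_decoding_def
  by (intro exI[of _ Bob] allI impI ballI) (rule reduced_run.decodes[OF reduced_run])

lemma runs_S': "runs_in \<sigma> S' (%n. K1 * T (max n n0))"
proof -
  obtain cA where cA: "\<And>y. BB Alice y <= (y + 2) ^ cA" using polynomially_BB[of Alice] unfolding polynomially_def by blast
  obtain cB where cB: "\<And>y. BB Bob y <= (y + 2) ^ cB" using polynomially_BB[of Bob] unfolding polynomially_def by blast
  define c where "c = cA + cB"
  have K1: "1 <= K1" by (simp add: K1_def)
  have B: "BB P (T k) <= (n + K1 * T k + 2) ^ c" for P n k
  proof -
    have "BB P (T k) <= (T k + 2) ^ c"
    proof (cases P)
      case Alice
      have "(T k + 2) ^ cA <= (T k + 2) ^ c" by (rule power_increasing) (auto simp: c_def)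
      then show ?thesis using cA[of "T k"] unfolding Alice by linarith
    next
      case Bob
      have "(T k + 2) ^ cB <= (T k + 2) ^ c" by (rule power_increasing) (auto simp: c_def)
      then show ?thesis using cB[of "T k"] unfolding Bob by linarith
    qed
    moreover have "T k + 2 <= n + K1 * T k + 2" using mult_le_mono1[OF K1, of "T k"] by linarith
    then have "(T k + 2) ^ c <= (n + K1 * T k + 2) ^ c" by (rule power_mono) simp
    ultimately show ?thesis by (rule le_trans)
  qed
  show ?thesis
    unfolding runs_in_def
  proof (rule exI[of _ c], intro allI impI ballI conjI)
    fix n :: nat and \<Pi> w assume a: "1 <= n" "\<Pi> \<in> protocols \<sigma>" "w \<in> words S'"
    interpret R: reduced_run b ls \<sigma> g p S T \<epsilon> n0 c0 \<Pi> n w by (rule reduced_run[OF a])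
    show "\<exists>tA tB. halts_by S' \<Pi> n w Alice tA & halts_by S' \<Pi> n w Bob tB & tA + tB <= K1 * T (max n n0)"
      using R.time_bound unfolding R.m_def .
    fix P t c'
    have "mem (state S' \<Pi> n w P t) c' <= BB P (T (max n n0))" using R.execution[of P] unfolding R.m_def by blast
    then show "mem (state S' \<Pi> n w P t) c' <= (n + K1 * T (max n n0) + 2) ^ c" using B le_trans by blast
  qed
qed

end

text \<open>In two degenerate cases the given scheme itself serves: for
  \<epsilon>\<open>> 1 / 6\<close> the tolerated error rate is negative, and an empty alphabet
  leaves no words. In all other cases the parameters \<open>g\<close>, \<open>b\<close> and
  \<open>p\<close> are chosen without looking at the scheme, so that one constant works for all
  schemes.\<close>

theorem theorem7:
  fixes \<epsilon> :: real and s \<sigma> :: nat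
  assumes "\<epsilon> > 0" and "\<sigma> \<ge> 2"
  shows "\<exists>K. \<forall>S T.
           nonadaptive_scheme \<sigma> S \<and> balanced S \<and>
           list_decoding \<sigma> S s (1/2 - \<epsilon>) \<and> runs_in \<sigma> S T \<longrightarrow>
           (\<exists>S' T'.
              nonadaptive_scheme \<sigma> S' \<and>
              one_sided_unique_decoding \<sigma> S' (1/3 - 2 * \<epsilon>) \<and> runs_in \<sigma> S' T' \<and>
              same_up_to K (alphabet S') (alphabet S) \<and>
              (\<forall>\<^sub>F n in sequentially.
                 same_up_to K (rounds S' n) (rounds S n) \<and>
                 same_up_to K (T' n) (T n)))"
proof (cases "\<epsilon> <= 1 / 6")
  case False
  have "one_sided_unique_decoding \<sigma> S (1 / 3 - 2 * \<epsilon>)" if S: "nonadaptive_scheme \<sigma> S" for S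
    unfolding one_sided_unique_decoding_def
  proof (intro exI[of _ Alice] allI impI ballI)
    fix n \<Pi> w assume a: "1 <= n" "\<Pi> \<in> protocols \<sigma>" "w \<in> words S"
      "real (corruptions S \<Pi> n w) <= (1 / 3 - 2 * \<epsilon>) * real (rounds S n)"
    have "(1 / 3 - 2 * \<epsilon>) * real (rounds S n) < 0"
      using False nonadaptiveD(1)[OF S a(1-3)] by (intro mult_neg_pos) auto
    then show "out (final S \<Pi> n w Alice) = transcript \<Pi> n" using a(4) by linarith
  qed
  note one = this
  show ?thesis
  proof (intro exI[of _ 1] allI impI)
    fix S T assume a: "nonadaptive_scheme \<sigma> S & balanced S & list_decoding \<sigma> S s (1/2 - \<epsilon>) & runs_in \<sigma> S T"
    show "\<exists>S' T'. nonadaptive_scheme \<sigma> S' & one_sided_unique_decoding \<sigma> S' (1/3 - 2 * \<epsilon>) & runs_in \<sigma> S' T' &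
      same_up_to 1 (alphabet S') (alphabet S) &
      (\<forall>\<^sub>F n in sequentially. same_up_to 1 (rounds S' n) (rounds S n) & same_up_to 1 (T' n) (T n))"
      using a one[of S] by (intro exI[of _ S] exI[of _ T]) (simp add: same_up_to_def)
  qed
next
  case True
  \<comment> \<open>This threshold makes a piece with fewer than \<open>h / g\<close> correct code
    symbols cost at most an \<epsilon> fraction of \<open>h\<close> in the accounting;
    \<open>b\<close> is so large that the two runs without reliable credit do not matter.\<close>
  define g where "g = nat \<lceil>2 / \<epsilon>\<rceil>"
  define b where "b = nat \<lceil>3 / \<epsilon>\<rceil>"
  have hg: "2 / \<epsilon> <= real g" unfolding g_def by (rule real_nat_ceiling_ge)
  have hb: "3 / \<epsilon> <= real b" unfolding b_def by (rule real_nat_ceiling_ge)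
  have "0 < 2 / \<epsilon>" "0 < 3 / \<epsilon>" using assms(1) by simp_all
  then have gb: "0 < g" "0 < b" using hg hb by linarith+
  obtain p where p: "prime p" "8 * g * g < p" using bigger_prime by blast
  interpret coder b s \<sigma> g p by unfold_locales (use p gb in auto)
  \<comment> \<open>The summands serve the time, the alphabet and the number of rounds, in this
    order.\<close>
  define K where "K = 2 * (8 + eff * (p ^ 2 + 4)) + Q + 2 * b"
  have "\<exists>S' T'. nonadaptive_scheme \<sigma> S' & one_sided_unique_decoding \<sigma> S' (1/3 - 2 * \<epsilon>) & runs_in \<sigma> S' T' &
      same_up_to K (alphabet S') (alphabet S) &
      (\<forall>\<^sub>F n in sequentially. same_up_to K (rounds S' n) (rounds S n) & same_up_to K (T' n) (T n))"
    if S: "nonadaptive_scheme \<sigma> S" "balanced S" "list_decoding \<sigma> S s (1/2 - \<epsilon>)" and T: "runs_in \<sigma> S T" for S T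
  proof (cases "alphabet S = 0")
    case True
    have "one_sided_unique_decoding \<sigma> S (1 / 3 - 2 * \<epsilon>)"
      using True by (simp add: one_sided_unique_decoding_def words_def)
    moreover have "1 * x <= K * x" for x by (rule mult_le_mono1) (simp add: K_def)
    ultimately show ?thesis using S T by (intro exI[of _ S] exI[of _ T]) (auto simp: same_up_to_def)
  next
    case False
    then have q: "0 < alphabet S" by simp
    have \<rho>: "0 <= 1 / 2 - \<epsilon>" using \<open>\<epsilon> <= 1 / 6\<close> by simp
    have lb: "\<sigma> ^ n <= alphabet S ^ rounds S n * s" if "1 <= n" for n
      by (rule rounds_lower_bound[OF S(1,3) \<rho> that q]) (use assms(2) in simp)
    have s0: "0 < s" using lb[of 1] assms(2) by (cases s) auto
    obtain c0 where c0: "\<And>n \<Pi> w. 1 <= n ==> \<Pi> \<in> protocols \<sigma> ==> w \<in> words S ==>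
        (\<exists>tA tB. halts_by S \<Pi> n w Alice tA & halts_by S \<Pi> n w Bob tB & tA + tB <= T n) &
        (\<forall>P t a. mem (state S \<Pi> n w P t) a <= (n + T n + 2) ^ c0)"
      using T unfolding runs_in_def by blast
    \<comment> \<open>The first summand is the threshold of \<open>enough_rounds\<close>;
      \<sigma>\<open>\<le> m\<close> lets the symbols of candidates fit into four digits. The
      threshold may depend on the scheme because rounds and time are compared only
      eventually.\<close>
    define n0 where "n0 = (p ^ 4 * (2 * alphabet S + s)) ^ 4 + \<sigma> + 1"
    have tl: "n <= T n" "rounds S n <= T n" if "1 <= n" for n
      using time_lower_bound[OF S(1,3) \<rho> T that q] assms(2) by simp_all
    have c1: "\<exists>tA tB. halts_by S \<Pi> n w Alice tA & halts_by S \<Pi> n w Bob tB & tA + tB <= T n"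
      and c2: "mem (state S \<Pi> n w P t) a <= (n + T n + 2) ^ c0"
      if "1 <= n" "\<Pi> \<in> protocols \<sigma>" "w \<in> words S" for n \<Pi> w P t a
      using c0[OF that] by blast+
    have n1: "1 <= n0" "\<sigma> <= n0" by (simp_all add: n0_def)
    interpret R: reduction b s \<sigma> g p S T \<epsilon> n0 c0
    proof unfold_locales
      show "l <= rounds S m div 2" if "n0 <= m" "fits m l" for m l
      proof (rule enough_rounds[OF _ that(2)])
        have "1 <= m" using that(1) by (simp add: n0_def)
        have "2 ^ m <= \<sigma> ^ m" using assms(2) by (intro power_mono) auto
        then show "2 ^ m <= alphabet S ^ rounds S m * s" using lb[OF \<open>1 <= m\<close>] by linarith
        show "(p ^ 4 * (2 * alphabet S + s)) ^ 4 <= m" using that(1) by (simp add: n0_def)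
      qed
    qed (fact S q assms True s0 hg hb c1 c2 n1 tl)+
    have Q1: "1 <= Q" using Q0 by simp
    have "alphabet R.S' = alphabet S * Q" by (simp add: R.S'_def)
    moreover have "alphabet S * Q <= K * alphabet S"
      unfolding mult.commute[of K] by (rule mult_le_mono2) (simp add: K_def)
    moreover have "alphabet S <= K * (alphabet S * Q)"
    proof -
      have "1 * (alphabet S * 1) <= K * (alphabet S * Q)" using Q1 by (intro mult_le_mono mult_le_mono2) (auto simp: K_def)
      then show ?thesis by simp
    qed
    ultimately have alph: "same_up_to K (alphabet R.S') (alphabet S)" by (simp add: same_up_to_def)
    have "same_up_to K (rounds R.S' n) (rounds S n) & same_up_to K (R.K1 * T (max n n0)) (T n)" if n: "n0 <= n" for n
    proof -
      have mx: "max n n0 = n" using n by simp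
      let ?N = "rounds S n"
      have r: "rounds R.S' n = b * ?N + b * (?N div 2)" by (simp add: R.S'_def mx)
      have "b * (?N div 2) <= b * ?N" by (rule mult_le_mono2) simp
      then have "rounds R.S' n <= (2 * b) * ?N" unfolding r by simp
      also have "\<dots> <= K * ?N" by (rule mult_le_mono1) (simp add: K_def)
      finally have 1: "rounds R.S' n <= K * ?N" .
      have "1 * (1 * ?N) <= K * (b * ?N)" using gb by (intro mult_le_mono) (auto simp: K_def)
      also have "\<dots> <= K * rounds R.S' n" unfolding r by (rule mult_le_mono2) simp
      finally have 2: "?N <= K * rounds R.S' n" by simp
      have 3: "R.K1 * T n <= K * T n" by (rule mult_le_mono1) (simp add: K_def R.K1_def)
      have "1 * (1 * T n) <= K * (R.K1 * T n)" by (intro mult_le_mono) (auto simp: K_def R.K1_def)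
      then show ?thesis using 1 2 3 by (simp add: same_up_to_def mx)
    qed
    then have "\<forall>\<^sub>F n in sequentially. same_up_to K (rounds R.S' n) (rounds S n) & same_up_to K (R.K1 * T (max n n0)) (T n)"
      by (rule eventually_sequentiallyI)
    then show ?thesis using R.nonadaptive_S' R.unique_S' R.runs_S' alph by blast
  qed
  then show ?thesis by blast
qed

end
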